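(* Let $d\ge4$ and let $(\mathcal{V}_t)_{t\in[0,1]}$ be the diffusion in $\mathbb{R}^d$ satisfying $d\mathcal{V}_t=2\Lambda(\mathcal{V}_t)dt+\sqrt2\,\Sigma(\mathcal{V}_t)dB_t$, with $B$ a $d$-dimensional Brownian motion and with $\mathcal{V}_0$ distributed with probability density $g_0\gamma$. Then the Fokker–Planck equation associated with this SDE is the linear Landau equation, i.e. $f_t=\mathrm{Law}(\mathcal{V}_t)$ is a weak solution of $$\partial_tf_t=\nabla\cdot\big(D(V)(\nabla f_t+V f_t)\big),\qquad f_0=g_0\gamma,$$ where $$D(V)=\frac{\pi}{(2\pi)^d}\int_{\mathbb{R}^d}(k\otimes k)\,|\hat\Phi(k)|^2\int_{\mathbb{R}^d}\gamma(v+V)\,\delta_{k\cdot v}\,dv\,dk .$$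
   Context: $\gamma(v)=(2\pi)^{-d/2}e^{-|v|^2/2}$; $(a\otimes b)_{i,j}=a_ib_j$; $\mathcal{B}(0,R)$ is the ball of radius $R$ centered at $0$. $\Phi\in C^3_c(\mathbb{R}^d,\mathbb{R})$ is even, not identically zero, with support in $\mathcal{B}(0,R)$, $R>0$. $g_0$ is bounded continuous with bounded continuous derivatives and $g_0\gamma$ is a probability density. The Fourier transform is $\hat\Phi(k)=\int_{\mathbb{R}^d}e^{-ik\cdot x}\Phi(x)dx$, and $\delta_{k\cdot v}$ is the Dirac mass at $0$ evaluated at $k\cdot v$, i.e. for $k\neq0$, $\int\gamma(v+V)\delta_{k\cdot v}dv=\frac1{|k|}\int_{k^\perp}\gamma(w+V)dw$ with $(d-1)$-dimensional Lebesgue measure on the hyperplane $k^\perp$. The coefficients of the SDE are $$\Lambda(V)=-\int_{\mathcal{B}(0,R)}dx\int_{\mathbb{R}^d}dv\,\gamma(v+V)\,\mathrm{Hess}\,\Phi(x)\int_{-\infty}^0\int_{-\infty}^s\nabla\Phi(x+uv)\,du\,ds,$$ and $\Sigma(V)$ is the symmetric positive definite square root of the symmetric positive definite matrix $$\int_{\mathcal{B}(0,R)}dx\int_{\mathbb{R}^d}dv\,\gamma(v+V)\,\nabla\Phi(x)\otimes\int_{-\infty}^0\nabla\Phi(x+sv)\,ds$$ (which is the matrix also denoted $D(V)$ in the paper). *)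

theory Defs
  imports "HOL-Probability.Probability"
begin

subsection \<open>Differential calculus on \<open>real ^ 'n\<close>\<close>

definition partial :: "'n \<Rightarrow> (real ^ 'n \<Rightarrow> real) \<Rightarrow> real ^ 'n \<Rightarrow> real" where
  "partial i f x = frechet_derivative f (at x) (axis i 1)"

definition grad :: "(real ^ 'n \<Rightarrow> real) \<Rightarrow> real ^ 'n \<Rightarrow> real ^ 'n" where
  "grad f x = (\<chi> i. partial i f x)"

definition Hess :: "(real ^ 'n \<Rightarrow> real) \<Rightarrow> real ^ 'n \<Rightarrow> real ^ 'n ^ 'n" where
  "Hess f x = (\<chi> i j. partial i (partial j f) x)"

definition divergence :: "(real ^ 'n \<Rightarrow> real ^ 'n) \<Rightarrow> real ^ 'n \<Rightarrow> real" where
  "divergence F x = (\<Sum>i\<in>UNIV. partial i (\<lambda>y. F y $ i) x)"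

primrec C_k :: "nat \<Rightarrow> (real ^ 'n \<Rightarrow> real) \<Rightarrow> bool" where
  "C_k 0 f \<longleftrightarrow> continuous_on UNIV f"
| "C_k (Suc k) f \<longleftrightarrow> (\<forall>x. f differentiable (at x)) \<and> (\<forall>i. C_k k (partial i f))"

text \<open>Smooth functions with compact support.\<close>

definition test_function :: "(real ^ 'n \<Rightarrow> real) \<Rightarrow> bool" where
  "test_function \<phi> \<longleftrightarrow> (\<forall>k. C_k k \<phi>) \<and> compact (closure {x. \<phi> x \<noteq> 0})"


subsection \<open>Matrices\<close>

definition outer :: "real ^ 'n \<Rightarrow> real ^ 'n \<Rightarrow> real ^ 'n ^ 'n" where
  "outer a b = (\<chi> i j. a $ i * b $ j)"

definition sym_pos_def :: "real ^ 'n ^ 'n \<Rightarrow> bool" where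
  "sym_pos_def A \<longleftrightarrow> transpose A = A \<and> (\<forall>x. x \<noteq> 0 \<longrightarrow> 0 < x \<bullet> (A *v x))"

definition spd_sqrt :: "real ^ 'n ^ 'n \<Rightarrow> real ^ 'n ^ 'n" where
  "spd_sqrt A = (THE S. sym_pos_def S \<and> S ** S = A)"


subsection \<open>Coefficients of the stochastic differential equation\<close>

definition gauss :: "real ^ 'n \<Rightarrow> real" where
  "gauss v = (2 * pi) powr (- real CARD('n) / 2) * exp (- (norm v)\<^sup>2 / 2)"

definition Lambda :: "(real ^ 'n \<Rightarrow> real) \<Rightarrow> real \<Rightarrow> real ^ 'n \<Rightarrow> real ^ 'n" where
  "Lambda \<Phi> R V =
     - (LBINT x:cball 0 R. LBINT v. gauss (v + V) *\<^sub>R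
          (Hess \<Phi> x *v (LBINT s:{..0}. LBINT u:{..s}. grad \<Phi> (x + u *\<^sub>R v))))"

definition diffusion_matrix :: "(real ^ 'n \<Rightarrow> real) \<Rightarrow> real \<Rightarrow> real ^ 'n \<Rightarrow> real ^ 'n ^ 'n" where
  "diffusion_matrix \<Phi> R V =
     (LBINT x:cball 0 R. LBINT v. gauss (v + V) *\<^sub>R
          outer (grad \<Phi> x) (LBINT s:{..0}. grad \<Phi> (x + s *\<^sub>R v)))"

definition Sigma_coeff :: "(real ^ 'n \<Rightarrow> real) \<Rightarrow> real \<Rightarrow> real ^ 'n \<Rightarrow> real ^ 'n ^ 'n" where
  "Sigma_coeff \<Phi> R V = spd_sqrt (diffusion_matrix \<Phi> R V)"


subsection \<open>Diffusion matrix of the linear Landau equation\<close>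

definition fourier :: "(real ^ 'n \<Rightarrow> real) \<Rightarrow> real ^ 'n \<Rightarrow> complex" where
  "fourier \<Phi> k = (LBINT x. exp (- (\<i> * complex_of_real (k \<bullet> x))) * complex_of_real (\<Phi> x))"

text \<open>Lebesgue measure of dimension \<open>dim S\<close> on a linear subspace \<open>S\<close>: the construction of
  \<^const>\<open>lborel\<close>, with an orthonormal basis of \<open>S\<close> in place of \<^const>\<open>Basis\<close>. The result does
  not depend on the basis.\<close>

definition subspace_lborel :: "'a::euclidean_space set \<Rightarrow> 'a measure" where
  "subspace_lborel S =
     (let B = (SOME B. B \<subseteq> S \<and> span B = S \<and> pairwise orthogonal B \<and> (\<forall>b\<in>B. norm b = 1))
      in distr (\<Pi>\<^sub>M b\<in>B. lborel) borel (\<lambda>c. \<Sum>b\<in>B. c b *\<^sub>R b))"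

text \<open>The integral of \<open>h v\<close> against the Dirac mass at \<open>0\<close> evaluated at \<open>k \<bullet> v\<close>; the value at
  \<open>k = 0\<close> is \<open>0\<close>, which does not matter as it is only used under an integral over \<open>k\<close>.\<close>

definition integral_dirac :: "'a::euclidean_space \<Rightarrow> ('a \<Rightarrow> real) \<Rightarrow> real" where
  "integral_dirac k h = 1 / norm k * (LINT w|subspace_lborel {w. k \<bullet> w = 0}. h w)"

definition landau_matrix :: "(real ^ 'n \<Rightarrow> real) \<Rightarrow> real ^ 'n \<Rightarrow> real ^ 'n ^ 'n" where
  "landau_matrix \<Phi> V = (pi / (2 * pi) ^ CARD('n)) *\<^sub>R
     (LBINT k. ((cmod (fourier \<Phi> k))\<^sup>2 * integral_dirac k (\<lambda>v. gauss (v + V))) *\<^sub>R outer k k)"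


subsection \<open>Brownian motion and Ito integral\<close>

text \<open>The time interval is \<open>[0, 1]\<close>; the values of processes and filtrations at other times are
  irrelevant. No usual conditions are imposed on the filtration.\<close>

definition adapted :: "(real \<Rightarrow> 'w measure) \<Rightarrow> (real \<Rightarrow> 'w \<Rightarrow> 'b::topological_space) \<Rightarrow> bool" where
  "adapted F X \<longleftrightarrow> (\<forall>t\<in>{0..1}. X t \<in> borel_measurable (F t))"

definition continuous_paths :: "'w measure \<Rightarrow> (real \<Rightarrow> 'w \<Rightarrow> 'b::topological_space) \<Rightarrow> bool" where
  "continuous_paths M X \<longleftrightarrow> (\<forall>\<omega>\<in>space M. continuous_on {0..1} (\<lambda>t. X t \<omega>))"

definition brownian_motion ::
    "'w measure \<Rightarrow> (real \<Rightarrow> 'w measure) \<Rightarrow> (real \<Rightarrow> 'w \<Rightarrow> real ^ 'n) \<Rightarrow> bool" where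
  "brownian_motion M F B \<longleftrightarrow>
     adapted F B \<and> continuous_paths M B \<and> (AE \<omega> in M. B 0 \<omega> = 0) \<and>
     (\<forall>s t. 0 \<le> s \<and> s < t \<and> t \<le> 1 \<longrightarrow>
        prob_space.indep_set M (sets (F s))
          (sets (vimage_algebra (space M) (\<lambda>\<omega>. B t \<omega> - B s \<omega>) borel)) \<and>
        distributed M lborel (\<lambda>\<omega>. B t \<omega> - B s \<omega>)
          (\<lambda>x. ennreal ((2 * pi * (t - s)) powr (- real CARD('n) / 2)
                        * exp (- (norm x)\<^sup>2 / (2 * (t - s))))))"

text \<open>A simple process on \<open>[0, T]\<close> is given by times \<open>0 = \<tau> 0 \<le> \<dots> \<le> \<tau> m = T\<close> and, for each
  \<open>i < m\<close>, a bounded random matrix \<open>A i\<close>, known at time \<open>\<tau> i\<close>, which is its value on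
  \<open>(\<tau> i, \<tau> (i + 1)]\<close>.\<close>

definition simple_process ::
    "'w measure \<Rightarrow> (real \<Rightarrow> 'w measure) \<Rightarrow> real \<Rightarrow> nat \<Rightarrow> (nat \<Rightarrow> real) \<Rightarrow>
     (nat \<Rightarrow> 'w \<Rightarrow> real ^ 'n ^ 'n) \<Rightarrow> bool" where
  "simple_process M F T m \<tau> A \<longleftrightarrow>
     \<tau> 0 = 0 \<and> \<tau> m = T \<and> (\<forall>i<m. \<tau> i \<le> \<tau> (Suc i)) \<and>
     (\<forall>i<m. A i \<in> borel_measurable (F (\<tau> i)) \<and> bounded (A i ` space M))"

definition simple_value ::
    "nat \<Rightarrow> (nat \<Rightarrow> real) \<Rightarrow> (nat \<Rightarrow> 'w \<Rightarrow> real ^ 'n ^ 'n) \<Rightarrow> real \<Rightarrow> 'w \<Rightarrow> real ^ 'n ^ 'n" where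
  "simple_value m \<tau> A s \<omega> = (\<Sum>i<m. indicator {\<tau> i<..\<tau> (Suc i)} s *\<^sub>R A i \<omega>)"

definition simple_integral ::
    "(real \<Rightarrow> 'w \<Rightarrow> real ^ 'n) \<Rightarrow> nat \<Rightarrow> (nat \<Rightarrow> real) \<Rightarrow> (nat \<Rightarrow> 'w \<Rightarrow> real ^ 'n ^ 'n) \<Rightarrow>
     'w \<Rightarrow> real ^ 'n" where
  "simple_integral B m \<tau> A \<omega> = (\<Sum>i<m. A i \<omega> *v (B (\<tau> (Suc i)) \<omega> - B (\<tau> i) \<omega>))"

definition progressive ::
    "(real \<Rightarrow> 'w measure) \<Rightarrow> real \<Rightarrow> (real \<Rightarrow> 'w \<Rightarrow> 'b::topological_space) \<Rightarrow> bool" where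
  "progressive F T H \<longleftrightarrow> (\<forall>t\<in>{0..T}.
     (\<lambda>(s, \<omega>). H s \<omega>) \<in> borel_measurable (restrict_space borel {0..t} \<Otimes>\<^sub>M F t))"

definition tends_to_0_in_prob :: "'w measure \<Rightarrow> (nat \<Rightarrow> 'w \<Rightarrow> ennreal) \<Rightarrow> bool" where
  "tends_to_0_in_prob M X \<longleftrightarrow>
     (\<forall>\<epsilon>>0. (\<lambda>n. measure M {\<omega> \<in> space M. ennreal \<epsilon> < X n \<omega>}) \<longlonglongrightarrow> 0)"

text \<open>\<open>I\<close> is a version of the integral of \<open>H\<close> against \<open>dB\<close> over \<open>[0, T]\<close>: the limit in
  probability of the integrals of simple processes \<open>H\<^sub>n\<close> such that the integral of
  \<open>\<bar>H\<^sub>n - H\<bar>\<^sup>2\<close> over \<open>[0, T]\<close> tends to \<open>0\<close> in probability. Such processes exist exactly when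
  \<open>\<bar>H\<bar>\<^sup>2\<close> is almost surely integrable, and \<open>I\<close> is unique up to a null set. The norm on matrices
  is the Frobenius norm.\<close>

definition ito_integral ::
    "'w measure \<Rightarrow> (real \<Rightarrow> 'w measure) \<Rightarrow> (real \<Rightarrow> 'w \<Rightarrow> real ^ 'n) \<Rightarrow> real \<Rightarrow>
     (real \<Rightarrow> 'w \<Rightarrow> real ^ 'n ^ 'n) \<Rightarrow> ('w \<Rightarrow> real ^ 'n) \<Rightarrow> bool" where
  "ito_integral M F B T H I \<longleftrightarrow>
     progressive F T H \<and> I \<in> borel_measurable M \<and>
     (\<exists>m \<tau> A. (\<forall>n. simple_process M F T (m n) (\<tau> n) (A n)) \<and>
        tends_to_0_in_prob M (\<lambda>n \<omega>. \<integral>\<^sup>+s\<in>{0..T}.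
          ennreal ((norm (simple_value (m n) (\<tau> n) (A n) s \<omega> - H s \<omega>))\<^sup>2) \<partial>lborel) \<and>
        tends_to_0_in_prob M (\<lambda>n \<omega>.
          ennreal (norm (simple_integral B (m n) (\<tau> n) (A n) \<omega> - I \<omega>))))"

text \<open>\<open>X\<close> solves \<open>dX = b(X) dt + \<sigma>(X) dB\<close> on \<open>[0, 1]\<close>.\<close>

definition sde_solution ::
    "'w measure \<Rightarrow> (real \<Rightarrow> 'w measure) \<Rightarrow> (real \<Rightarrow> 'w \<Rightarrow> real ^ 'n) \<Rightarrow>
     (real ^ 'n \<Rightarrow> real ^ 'n) \<Rightarrow> (real ^ 'n \<Rightarrow> real ^ 'n ^ 'n) \<Rightarrow> (real \<Rightarrow> 'w \<Rightarrow> real ^ 'n) \<Rightarrow> bool"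
  where
  "sde_solution M F B b \<sigma> X \<longleftrightarrow>
     adapted F X \<and> continuous_paths M X \<and>
     (AE \<omega> in M. set_integrable lborel {0..1} (\<lambda>s. b (X s \<omega>))) \<and>
     (\<forall>t\<in>{0..1}. \<exists>I. ito_integral M F B t (\<lambda>s \<omega>. \<sigma> (X s \<omega>)) I \<and>
        (AE \<omega> in M. X t \<omega> = X 0 \<omega> + (LBINT s:{0..t}. b (X s \<omega>)) + I \<omega>))"


subsection \<open>Fokker--Planck and linear Landau equations\<close>

text \<open>Right-hand side of the Fokker--Planck equation of \<open>dX = b(X) dt + \<sigma>(X) dB\<close>.\<close>

definition fokker_planck_rhs ::
    "(real ^ 'n \<Rightarrow> real ^ 'n) \<Rightarrow> (real ^ 'n \<Rightarrow> real ^ 'n ^ 'n) \<Rightarrow> (real ^ 'n \<Rightarrow> real) \<Rightarrow>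
     real ^ 'n \<Rightarrow> real" where
  "fokker_planck_rhs b \<sigma> f V =
     1 / 2 * (\<Sum>i\<in>UNIV. \<Sum>j\<in>UNIV.
        partial i (partial j (\<lambda>W. (\<sigma> W ** transpose (\<sigma> W)) $ i $ j * f W)) V)
     - divergence (\<lambda>W. f W *\<^sub>R b W) V"

definition landau_rhs ::
    "(real ^ 'n \<Rightarrow> real ^ 'n ^ 'n) \<Rightarrow> (real ^ 'n \<Rightarrow> real) \<Rightarrow> real ^ 'n \<Rightarrow> real" where
  "landau_rhs D f V = divergence (\<lambda>W. D W *v (grad f W + f W *\<^sub>R W)) V"

text \<open>The formal adjoint of \<^const>\<open>landau_rhs\<close>: all derivatives falling on \<open>f\<close> are moved to the
  test function by integration by parts, without using symmetry of \<open>D\<close>.\<close>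

definition landau_adjoint ::
    "(real ^ 'n \<Rightarrow> real ^ 'n ^ 'n) \<Rightarrow> (real ^ 'n \<Rightarrow> real) \<Rightarrow> real ^ 'n \<Rightarrow> real" where
  "landau_adjoint D \<phi> V =
     divergence (\<lambda>W. transpose (D W) *v grad \<phi> W) V - (D V *v V) \<bullet> grad \<phi> V"

text \<open>Weak (measure-valued) solutions on \<open>[0, 1]\<close>. The \<open>C\<^sup>1\<close> requirement on \<open>D\<close> gives meaning to
  the adjoint.\<close>

definition landau_weak_solution ::
    "(real ^ 'n \<Rightarrow> real ^ 'n ^ 'n) \<Rightarrow> (real ^ 'n) measure \<Rightarrow> (real \<Rightarrow> (real ^ 'n) measure) \<Rightarrow> bool"
  where
  "landau_weak_solution D f0 f \<longleftrightarrow>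
     (\<forall>i j. C_k 1 (\<lambda>V. D V $ i $ j)) \<and>
     (\<forall>t\<in>{0..1}. prob_space (f t) \<and> sets (f t) = sets borel) \<and>
     f 0 = f0 \<and>
     (\<forall>\<phi>. test_function \<phi> \<longrightarrow>
        (\<forall>t\<in>{0..1}. integrable (f t) (landau_adjoint D \<phi>)) \<and>
        set_integrable lborel {0..1} (\<lambda>s. LINT V|f s. landau_adjoint D \<phi> V) \<and>
        (\<forall>t\<in>{0..1}. (LINT V|f t. \<phi> V) =
           (LINT V|f0. \<phi> V) + (LBINT s:{0..t}. LINT V|f s. landau_adjoint D \<phi> V)))"

end

theory Submission imports Defs
begin

text \<open>The statement combines two facts that do not depend on each other: an identification of
  the coefficients of the diffusion, and Ito's formula in expectation.

\<^bold>\<open>Coefficients.\<close> The integrals that define the coefficients are correlations of derivatives of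
  the potential along free flights \<open>x + s v\<close>, averaged over the velocity. For a fixed flight
  time \<open>s\<close> the average over \<open>v\<close> is a convolution with a Gaussian of width \<open>\<bar>s\<bar>\<close>, so in Fourier
  variables it is a multiplication by \<open>exp (- s\<^sup>2 \<bar>k\<bar>\<^sup>2 / 2)\<close>, and \<open>V\<close> only shows in the phase
  \<open>s (k \<bullet> V)\<close> (\<open>smoothed_autocorrelation\<close>). Integrating over \<open>s \<le> 0\<close> leaves
  \<open>exp (- (n \<bullet> V)\<^sup>2 / 2)\<close> with \<open>n = k / \<bar>k\<bar>\<close>, which is also what the Gaussian mass of the
  hyperplane orthogonal to \<open>k\<close> amounts to (\<open>integral_dirac_gauss\<close>). Hence the matrix of the
  stochastic equation and that of the Landau equation are one and the same superposition \<open>D\<close> of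
  functions of \<open>n \<bullet> V\<close>, with weight \<open>\<bar>k\<bar>\<close> times the power spectrum of the potential
  (\<open>diffusion_matrix_eq\<close>, \<open>landau_matrix_eq\<close>). The same computation with the weight \<open>s\<close> gives
  \<open>Lambda_eq\<close>: \<open>\<Lambda>(V) = - D(V) V\<close>. Differentiating the Gaussian profile gives \<open>div D = - D(V) V\<close>
  as well (\<open>divergence_D\<close>), and smoothness of every order. All exchanges of integrals rest on
  the fact that a particle of velocity \<open>v\<close> stays in a ball of radius \<open>R\<close> for a time at most
  \<open>2 R / \<bar>v\<bar>\<close>, together with the integrability of \<open>\<bar>v\<bar>\<close> to the power \<open>-2\<close> against Gaussians in
  dimension at least four. From \<open>\<Sigma> \<Sigma> = D\<close>, \<open>\<Lambda> = div D\<close> and \<open>\<Lambda>(V) = - D(V) V\<close> the equality of the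
  Fokker-Planck and Landau operators, and that of their adjoints, is the product rule
  (\<open>fokker_planck_landau\<close>, \<open>landau_adjoint_eq\<close>).

\<^bold>\<open>Ito's formula.\<close> Only expectations of bounded quantities occur. While the noise coefficient is
  frozen, Taylor's formula shows that \<open>E \<phi> (Y v)\<close> minus the time integral of the expected
  generator changes by at most a multiple of \<open>(v - u) powr (3/2)\<close> over \<open>[u, v]\<close>, hence not at
  all (\<open>ito_step\<close>). Summation gives the formula for simple integrands. The coefficients being
  bounded, the simple processes that define the stochastic integral can be truncated; they then
  converge in mean square (\<open>bounded_approximation\<close>), the isometry transfers this to the
  integrals up to each intermediate time (\<open>cut_integral_compare\<close>), and dominated convergence
  yields \<open>ito_formula\<close> for the solution.\<close>

section \<open>Partial derivatives and supports\<close>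

lemma partial_eqI: "(f has_derivative f') (at x) \<Longrightarrow> partial i f x = f' (axis i 1)"
  using frechet_derivative_at[of f f' x] by (simp add: partial_def)

lemma has_derivative_partials:
  fixes f :: "real ^ 'n \<Rightarrow> real"
  assumes "f differentiable (at x)"
  shows "(f has_derivative (\<lambda>h. \<Sum>i\<in>UNIV. h $ i * partial i f x)) (at x)"
proof -
  let ?D = "frechet_derivative f (at x)"
  have D: "(f has_derivative ?D) (at x)" using assms frechet_derivative_works by blast
  interpret bounded_linear ?D by (rule has_derivative_bounded_linear[OF D])
  have "?D h = (\<Sum>i\<in>UNIV. h $ i * partial i f x)" for h
  proof -
    have "?D h = ?D (\<Sum>i\<in>UNIV. h $ i *\<^sub>R axis i 1)"
      using basis_expansion[of h] by (simp add: scalar_mult_eq_scaleR)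
    also have "\<dots> = (\<Sum>i\<in>UNIV. h $ i * partial i f x)"
      by (simp add: sum scaleR partial_def)
    finally show ?thesis .
  qed
  then have "?D = (\<lambda>h. \<Sum>i\<in>UNIV. h $ i * partial i f x)" by (rule ext)
  with D show ?thesis by (simp only:)
qed

lemma partial_const [simp]: "partial i (\<lambda>x. c) = (\<lambda>x. 0)"
  by (simp add: partial_def fun_eq_iff frechet_derivative_const)

lemma partial_mult:
  assumes "f differentiable (at x)" "g differentiable (at x)"
  shows "partial i (\<lambda>y. f y * g y) x = partial i f x * g x + f x * partial i g x"
proof -
  have "((\<lambda>y. f y * g y) has_derivative
     (\<lambda>h. f x * (frechet_derivative g (at x) h) + frechet_derivative f (at x) h * g x)) (at x)"
    using assms by (intro has_derivative_mult) (auto simp: frechet_derivative_works)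
  from partial_eqI[OF this] show ?thesis by (simp add: partial_def)
qed

lemma partial_diff:
  assumes "f differentiable (at x)" "g differentiable (at x)"
  shows "partial i (\<lambda>y. f y - g y) x = partial i f x - partial i g x"
proof -
  have "((\<lambda>y. f y - g y) has_derivative
     (\<lambda>h. frechet_derivative f (at x) h - frechet_derivative g (at x) h)) (at x)"
    using assms by (intro has_derivative_diff) (auto simp: frechet_derivative_works)
  from partial_eqI[OF this] show ?thesis by (simp add: partial_def)
qed

lemma partial_sum:
  assumes "\<And>j. j \<in> S \<Longrightarrow> f j differentiable (at x)"
  shows "partial i (\<lambda>y. \<Sum>j\<in>S. f j y) x = (\<Sum>j\<in>S. partial i (f j) x)"
proof -
  have "((\<lambda>y. \<Sum>j\<in>S. f j y) has_derivative
     (\<lambda>h. \<Sum>j\<in>S. frechet_derivative (f j) (at x) h)) (at x)"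
    using assms by (intro has_derivative_sum) (auto simp: frechet_derivative_works)
  from partial_eqI[OF this] show ?thesis by (simp add: partial_def)
qed

lemma partial_cmult:
  assumes "f differentiable (at x)"
  shows "partial i (\<lambda>y. c * f y) x = c * partial i f x"
  using partial_mult[of "\<lambda>_. c" x f i] assms by simp

lemma C_k_continuous: "C_k k f \<Longrightarrow> continuous_on UNIV f"
proof (cases k)
  case (Suc m)
  assume "C_k k f" with Suc have "\<forall>x. f differentiable (at x)" by simp
  then show ?thesis
    by (simp add: continuous_on_eq_continuous_at differentiable_imp_continuous_within)
qed simp

lemma C_k_Suc_mono: "C_k (Suc k) f \<Longrightarrow> C_k k f"
proof (induction k arbitrary: f)
  case 0 then show ?case using C_k_continuous by fastforce
next
  case (Suc k) then show ?case by (metis C_k.simps(2))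
qed

lemma partial_zero_outside:
  assumes "x \<notin> closure {x. f x \<noteq> 0}"
  shows "partial i f x = 0"
proof -
  have "((\<lambda>x. 0 :: real) has_derivative (\<lambda>h. 0)) (at x)" by simp
  moreover have "open (- closure {x. f x \<noteq> 0})" by (rule open_Compl[OF closed_closure])
  moreover have "x \<in> - closure {x. f x \<noteq> 0}" using assms by simp
  moreover have "0 = f y" if "y \<in> - closure {x. f x \<noteq> 0}" for y
    using that closure_subset[of "{x. f x \<noteq> 0}"] by auto
  ultimately have "(f has_derivative (\<lambda>h. 0)) (at x)"
    by (rule has_derivative_transform_within_open)
  from partial_eqI[OF this] show ?thesis .
qed

lemma closure_support_partial:
  "closure {x. partial i f x \<noteq> 0} \<subseteq> closure {x. f x \<noteq> 0}"
  by (rule closure_minimal) (use partial_zero_outside in auto)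

lemma bounded_of_compact_support:
  fixes f :: "'a::euclidean_space \<Rightarrow> real"
  assumes "continuous_on UNIV f" "compact (closure {x. f x \<noteq> 0})"
  shows "\<exists>C\<ge>0. \<forall>x. \<bar>f x\<bar> \<le> C"
proof -
  have "bounded (f ` closure {x. f x \<noteq> 0})"
    using assms continuous_on_subset by (intro compact_imp_bounded compact_continuous_image) blast+
  then obtain C where C: "\<And>x. x \<in> closure {x. f x \<noteq> 0} \<Longrightarrow> \<bar>f x\<bar> \<le> C"
    unfolding bounded_iff by auto
  have "\<bar>f x\<bar> \<le> max C 0" for x
    using C[of x] closure_subset[of "{x. f x \<noteq> 0}"] by (cases "f x = 0") auto
  then show ?thesis by (intro exI[of _ "max C 0"]) auto
qed

section \<open>Gaussian integrals\<close>

lemma orthonormal_sum_inner: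
  fixes B :: "'a::euclidean_space set"
  assumes "finite B" "pairwise orthogonal B" "\<forall>b\<in>B. norm b = 1" "b \<in> B"
  shows "(\<Sum>b'\<in>B. c b' *\<^sub>R b') \<bullet> b = c b"
proof -
  have "(\<Sum>b'\<in>B. c b' *\<^sub>R b') \<bullet> b = (\<Sum>b'\<in>B. c b' * (b' \<bullet> b))"
    by (simp add: inner_sum_left)
  also have "\<dots> = (\<Sum>b'\<in>B. if b' = b then c b else 0)"
    using assms by (intro sum.cong) (auto simp: pairwise_def orthogonal_def norm_eq_1)
  finally show ?thesis using assms by simp
qed

text \<open>The change of variables behind the Gaussian integrals. It is stated for an arbitrary
  orthonormal family because Lebesgue measure on a hyperplane is built from one; the standard
  basis gives Lebesgue measure on the whole space.\<close>

lemma orthonormal_lborel_prod: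
  fixes B :: "'a::euclidean_space set"
    and f :: "'a \<Rightarrow> real \<Rightarrow> 'b::{real_normed_field,banach,second_countable_topology}"
  assumes B: "finite B" "pairwise orthogonal B" "\<forall>b\<in>B. norm b = 1"
    and f: "\<And>b. b \<in> B \<Longrightarrow> integrable lborel (f b)"
  shows "integrable (distr (\<Pi>\<^sub>M b\<in>B. lborel) borel (\<lambda>c. \<Sum>b\<in>B. c b *\<^sub>R b)) (\<lambda>x. \<Prod>b\<in>B. f b (x \<bullet> b))"
        (is "integrable ?D ?f")
    and "(\<integral>x. (\<Prod>b\<in>B. f b (x \<bullet> b)) \<partial>distr (\<Pi>\<^sub>M b\<in>B. lborel) borel (\<lambda>c. \<Sum>b\<in>B. c b *\<^sub>R b))
          = (\<Prod>b\<in>B. \<integral>x. f b x \<partial>lborel)"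
proof -
  interpret product_sigma_finite "\<lambda>_::'a. lborel :: real measure" ..
  have [measurable]: "b \<in> B \<Longrightarrow> f b \<in> borel_measurable borel" for b using f[of b] by auto
  have [measurable]: "(\<lambda>c. \<Sum>b\<in>B. c b *\<^sub>R b) \<in> (\<Pi>\<^sub>M b\<in>B. lborel) \<rightarrow>\<^sub>M borel" by measurable
  have [measurable]: "?f \<in> borel_measurable borel"
    by (intro borel_measurable_prod) measurable
  have eq: "(\<Prod>b\<in>B. f b ((\<Sum>b\<in>B. c b *\<^sub>R b) \<bullet> b)) = (\<Prod>b\<in>B. f b (c b))" for c
    by (intro prod.cong refl arg_cong[of _ _ "f _"] orthonormal_sum_inner B)
  show "integrable ?D ?f"
    by (subst integrable_distr_eq) (simp_all add: eq product_integrable_prod B f)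
  show "integral\<^sup>L ?D ?f = (\<Prod>b\<in>B. \<integral>x. f b x \<partial>lborel)"
    by (subst integral_distr) (simp_all add: eq product_integral_prod B f)
qed

lemma lborel_integral_prod:
  fixes f :: "'a::euclidean_space \<Rightarrow> real \<Rightarrow> 'b::{real_normed_field,banach,second_countable_topology}"
  assumes f: "\<And>b. b \<in> Basis \<Longrightarrow> integrable lborel (f b)"
  shows "integrable lborel (\<lambda>x::'a. \<Prod>b\<in>Basis. f b (x \<bullet> b))"
    and "(\<integral>x. (\<Prod>b\<in>Basis. f b (x \<bullet> b)) \<partial>(lborel :: 'a measure)) = (\<Prod>b\<in>Basis. \<integral>x. f b x \<partial>lborel)"
proof -
  have B: "pairwise orthogonal (Basis::'a set)" "\<forall>b\<in>Basis. norm (b::'a) = 1"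
    by (auto simp: pairwise_def orthogonal_def inner_Basis)
  show "integrable lborel (\<lambda>x::'a. \<Prod>b\<in>Basis. f b (x \<bullet> b))"
    and "(\<integral>x. (\<Prod>b\<in>Basis. f b (x \<bullet> b)) \<partial>(lborel :: 'a measure)) = (\<Prod>b\<in>Basis. \<integral>x. f b x \<partial>lborel)"
    using orthonormal_lborel_prod[OF finite_Basis B f] by (simp_all add: lborel_eq[symmetric])
qed

lemma gaussian_char:
  shows "integrable lborel (\<lambda>x. complex_of_real (exp (- x\<^sup>2 / 2)) * iexp (t * x))"
    and "(LBINT x. complex_of_real (exp (- x\<^sup>2 / 2)) * iexp (t * x))
         = complex_of_real (sqrt (2 * pi) * exp (- t\<^sup>2 / 2))"
proof -
  have i: "integrable lborel (\<lambda>x. exp (- x\<^sup>2 / 2) :: real)"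
  proof -
    have "(\<lambda>x::real. exp (- x\<^sup>2 / 2)) = (\<lambda>x. sqrt (2*pi) * std_normal_density x)"
      by (simp add: std_normal_density_def fun_eq_iff)
    then show ?thesis by simp
  qed
  show int: "integrable lborel (\<lambda>x. complex_of_real (exp (- x\<^sup>2 / 2)) * iexp (t * x))"
    by (rule Bochner_Integration.integrable_bound[OF i]) (auto simp: norm_mult)
  have "complex_of_real (exp (- (t^2) / 2)) = (CLINT x|std_normal_distribution. iexp (t * x))"
    using char_std_normal_distribution by (simp add: char_def fun_eq_iff)
  also have "\<dots> = (LBINT x. std_normal_density x *\<^sub>R iexp (t * x))"
    by (subst integral_density) (auto simp: normal_density_nonneg)
  also have "\<dots> = (LBINT x. (1 / sqrt (2*pi)) *\<^sub>R (complex_of_real (exp (- x\<^sup>2 / 2)) * iexp (t * x)))"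
    by (intro Bochner_Integration.integral_cong)
       (simp_all add: std_normal_density_def scaleR_conv_of_real)
  also have "\<dots> = (1 / sqrt (2*pi)) *\<^sub>R (LBINT x. (complex_of_real (exp (- x\<^sup>2 / 2)) * iexp (t * x)))"
    using int by (subst integral_scaleR_right) auto
  finally show "(LBINT x. complex_of_real (exp (- x\<^sup>2 / 2)) * iexp (t * x))
         = complex_of_real (sqrt (2 * pi) * exp (- t\<^sup>2 / 2))"
    by (simp add: scaleR_conv_of_real field_simps)
qed

lemma gaussian_cos:
  shows "integrable lborel (\<lambda>x. exp (- x\<^sup>2 / 2) * cos (t * x) :: real)"
    and "(LBINT x. exp (- x\<^sup>2 / 2) * cos (t * x)) = sqrt (2 * pi) * exp (- t\<^sup>2 / 2)"
proof -
  have Re: "Re (complex_of_real (exp (- x\<^sup>2 / 2)) * iexp (t * x)) = exp (- x\<^sup>2 / 2) * cos (t * x)" for x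
    by (simp add: Re_exp)
  show "integrable lborel (\<lambda>x. exp (- x\<^sup>2 / 2) * cos (t * x) :: real)"
    using integrable_Re[OF gaussian_char(1)[of t]] by (simp only: Re)
  show "(LBINT x. exp (- x\<^sup>2 / 2) * cos (t * x)) = sqrt (2 * pi) * exp (- t\<^sup>2 / 2)"
    using integral_Re[OF gaussian_char(1)[of t]] unfolding gaussian_char(2) Re by simp
qed

lemma gaussian_cos_nd:
  fixes z :: "'a::euclidean_space"
  shows "integrable lborel (\<lambda>x::'a. exp (- (norm x)\<^sup>2 / 2) * cos (x \<bullet> z))"
    and "(\<integral>x. exp (- (norm x)\<^sup>2 / 2) * cos (x \<bullet> z) \<partial>(lborel :: 'a measure))
          = sqrt (2 * pi) ^ DIM('a) * exp (- (norm z)\<^sup>2 / 2)"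
proof -
  let ?f = "\<lambda>b x. complex_of_real (exp (- x\<^sup>2 / 2)) * iexp ((z \<bullet> b) * x)"
  have n2: "(norm x)\<^sup>2 = (\<Sum>b\<in>Basis. (x \<bullet> b)\<^sup>2)" for x :: 'a
    unfolding dot_square_norm[symmetric] by (subst euclidean_inner) (simp add: power2_eq_square)
  have sq: "exp (- (norm x)\<^sup>2 / 2) = (\<Prod>b\<in>Basis. exp (- (x \<bullet> b)\<^sup>2 / 2))" for x :: 'a
    by (simp add: n2 exp_sum[symmetric] sum_negf sum_divide_distrib)
  have prod: "(\<Prod>b\<in>Basis. ?f b (x \<bullet> b)) = complex_of_real (exp (- (norm x)\<^sup>2 / 2)) * iexp (x \<bullet> z)" for x :: 'a
    unfolding sq prod.distrib of_real_prod
    by (simp add: exp_sum[symmetric] sum_distrib_left[symmetric] euclidean_inner[of x z] mult.commute)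
  have Re: "Re (complex_of_real (exp (- (norm x)\<^sup>2 / 2)) * iexp (x \<bullet> z)) = exp (- (norm x)\<^sup>2 / 2) * cos (x \<bullet> z)" for x :: 'a
    by (simp add: Re_exp)
  have int: "integrable lborel (\<lambda>x::'a. complex_of_real (exp (- (norm x)\<^sup>2 / 2)) * iexp (x \<bullet> z))"
    using lborel_integral_prod(1)[where 'a='a and f="?f", OF gaussian_char(1)] by (simp only: prod)
  show "integrable lborel (\<lambda>x::'a. exp (- (norm x)\<^sup>2 / 2) * cos (x \<bullet> z))"
    using integrable_Re[OF int] by (simp only: Re)
  have "(\<integral>x. complex_of_real (exp (- (norm x)\<^sup>2 / 2)) * iexp (x \<bullet> z) \<partial>(lborel :: 'a measure)) = (\<Prod>b\<in>Basis. complex_of_real (sqrt (2 * pi) * exp (- (z \<bullet> b)\<^sup>2 / 2)))"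
    using lborel_integral_prod(2)[where 'a='a and f="?f", OF gaussian_char(1)] by (simp only: prod gaussian_char(2))
  also have "\<dots> = complex_of_real (sqrt (2 * pi) ^ DIM('a) * exp (- (norm z)\<^sup>2 / 2))"
    unfolding sq by (simp add: prod.distrib)
  finally show "(\<integral>x. exp (- (norm x)\<^sup>2 / 2) * cos (x \<bullet> z) \<partial>(lborel :: 'a measure))
          = sqrt (2 * pi) ^ DIM('a) * exp (- (norm z)\<^sup>2 / 2)"
    using integral_Re[OF int] by (simp only: Re Re_complex_of_real)
qed

lemma gaussian_nd:
  shows "integrable lborel (\<lambda>x::'a::euclidean_space. exp (- (norm x)\<^sup>2 / 2))"
    and "(\<integral>x. exp (- (norm x)\<^sup>2 / 2) \<partial>(lborel :: 'a::euclidean_space measure)) = sqrt (2 * pi) ^ DIM('a)"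
  using gaussian_cos_nd[of "0::'a"] by simp_all

lemma gauss_eq: "gauss (v::real^'n) = exp (- (norm v)\<^sup>2 / 2) / sqrt (2 * pi) ^ CARD('n)"
proof -
  have "(2 * pi) powr (- real CARD('n) / 2) = ((2*pi) powr (1/2)) powr (- real CARD('n))"
    by (simp add: powr_powr)
  also have "\<dots> = 1 / sqrt (2 * pi) ^ CARD('n)"
    by (simp add: powr_half_sqrt powr_minus powr_realpow inverse_eq_divide)
  finally show ?thesis by (simp add: gauss_def)
qed

lemma gauss_pos: "gauss v > 0" unfolding gauss_eq by simp

lemma continuous_gauss: "continuous_on UNIV gauss"
  unfolding gauss_eq[abs_def] by (intro continuous_intros) auto

lemma gauss_measurable [measurable]: "gauss \<in> borel_measurable borel"
  by (rule borel_measurable_continuous_onI[OF continuous_gauss])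

text \<open>This representation of the velocity density is what brings the wave number \<open>k\<close> into the
  coefficients.\<close>

lemma gauss_cos_transform:
  "gauss (z::real^'n) = (1 / (2 * pi) ^ CARD('n)) * (\<integral>x. exp (- (norm x)\<^sup>2 / 2) * cos (x \<bullet> z) \<partial>(lborel :: (real^'n) measure))"
proof -
  define c :: real where "c = sqrt (2 * pi) ^ CARD('n)"
  have "(2 * pi) ^ CARD('n) = (sqrt (2 * pi) * sqrt (2 * pi)) ^ CARD('n)" by simp
  also have "\<dots> = c * c" unfolding c_def by (rule power_mult_distrib)
  finally have 2: "(2 * pi) ^ CARD('n) = c * c" .
  have "c \<noteq> 0" by (simp add: c_def)
  then have "e / c = 1 / (c * c) * (c * e)" for e by simp
  then show ?thesis unfolding gaussian_cos_nd(2) gauss_eq 2 by (simp add: c_def[symmetric])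
qed

lemma integrable_gauss: "integrable lborel (gauss :: real^'n \<Rightarrow> real)"
  unfolding gauss_eq[abs_def] by (intro integrable_divide gaussian_nd)

lemma integral_gauss: "(LBINT x. gauss (x::real^'n)) = 1"
  unfolding gauss_eq[abs_def] using gaussian_nd(2)[where 'a="real^'n"] by simp

lemma gaussian_shift: "(LBINT x. exp (- (x + a)\<^sup>2 / 2)) = sqrt (2 * pi :: real)"
    "integrable lborel (\<lambda>x::real. exp (- (x + a)\<^sup>2 / 2))"
proof -
  have "(LBINT x. exp (- x\<^sup>2 / 2)) = sqrt (2*pi)" using gaussian_cos(2)[of 0] by simp
  then show "(LBINT x. exp (- (x + a)\<^sup>2 / 2)) = sqrt (2 * pi :: real)"
    using lborel_integral_real_affine[of 1 "\<lambda>x. exp (- x\<^sup>2 / 2) :: real" a] by (simp add: add.commute)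
  show "integrable lborel (\<lambda>x::real. exp (- (x + a)\<^sup>2 / 2))"
    using lborel_integrable_real_affine_iff[of 1 "\<lambda>x. exp (- x\<^sup>2 / 2) :: real" a] gaussian_cos(1)[of 0]
    by (simp add: add.commute)
qed

text \<open>Adding the unit normal \<open>sgn k\<close> to the chosen basis of the hyperplane gives an orthonormal
  basis of the whole space. Along the normal the argument of the Gaussian is \<open>sgn k \<bullet> V\<close>, and
  the other directions contribute normalised one-dimensional integrals.\<close>

lemma integral_dirac_gauss:
  fixes k V :: "real^'n"
  assumes k: "k \<noteq> 0"
  shows "integral_dirac k (\<lambda>v. gauss (v + V)) = exp (- (sgn k \<bullet> V)\<^sup>2 / 2) / (sqrt (2 * pi) * norm k)"
proof -
  let ?S = "{w. k \<bullet> w = 0}"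
  define P where "P B \<longleftrightarrow> B \<subseteq> ?S \<and> span B = ?S \<and> pairwise orthogonal B \<and> (\<forall>b\<in>B. norm b = 1)" for B
  define B where "B = (SOME B. P B)"
  have "\<exists>B. P B"
    using orthonormal_basis_subspace[OF subspace_hyperplane[of k]] unfolding P_def by metis
  then have "P B" unfolding B_def by (rule someI_ex)
  then have BS: "B \<subseteq> ?S" "span B = ?S" and B: "pairwise orthogonal B" "\<forall>b\<in>B. norm b = 1"
    unfolding P_def by auto
  have "0 \<notin> B" using B by force
  then have ind: "independent B" using B pairwise_orthogonal_independent by blast
  then have fin: "finite B" by (rule independent_imp_finite)
  have card: "card B = CARD('n) - 1"
    using dim_hyperplane[OF k] dim_span_eq_card_independent[OF ind] BS(2) by simp
  let ?n = "sgn k"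
  have n: "norm ?n = 1" "?n \<notin> B" using k BS by (auto simp: norm_sgn sgn_div_norm)
  have nB: "b \<in> B \<Longrightarrow> ?n \<bullet> b = 0" for b using BS k by (auto simp: sgn_div_norm)
  let ?B = "insert ?n B"
  have "pairwise orthogonal ?B" using B nB
    by (auto simp: pairwise_insert orthogonal_def inner_commute)
  moreover have "0 \<notin> ?B" using \<open>0 \<notin> B\<close> k by (auto simp: sgn_zero_iff)
  ultimately have ind': "independent ?B" by (rule pairwise_orthogonal_independent)
  have card': "card ?B = CARD('n)" using fin n card by simp
  have span: "x \<in> span ?B" for x
    using card_ge_dim_independent[OF subset_UNIV ind'] card' by (auto simp: dim_UNIV)
  \<comment> \<open>Pythagoras, for the basis of the hyperplane completed by the normal\<close>
  have norm2: "(norm x)\<^sup>2 = (\<Sum>b\<in>B. (x \<bullet> b)\<^sup>2) + (x \<bullet> ?n)\<^sup>2" for x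
  proof -
    obtain c where c: "x = (\<Sum>b\<in>?B. c b *\<^sub>R b)"
      using span[of x] span_finite[of ?B] fin by auto
    have on: "finite ?B" "pairwise orthogonal ?B" "\<forall>b\<in>?B. norm b = 1"
      using fin \<open>pairwise orthogonal ?B\<close> B n by auto
    have "(norm x)\<^sup>2 = (\<Sum>b\<in>?B. c b *\<^sub>R b) \<bullet> x" using c by (simp add: dot_square_norm)
    also have "\<dots> = (\<Sum>b\<in>?B. c b * (x \<bullet> b))"
      unfolding inner_sum_left inner_scaleR_left by (simp only: inner_commute[of x])
    also have "\<dots> = (\<Sum>b\<in>?B. (x \<bullet> b)\<^sup>2)"
      using orthonormal_sum_inner[OF on, of _ c] c by (intro sum.cong) (auto simp: power2_eq_square)
    finally show ?thesis using fin n by simp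
  qed
  have sub: "subspace_lborel ?S = distr (\<Pi>\<^sub>M b\<in>B. lborel) borel (\<lambda>c. \<Sum>b\<in>B. c b *\<^sub>R b)" (is "_ = ?D")
    unfolding subspace_lborel_def Let_def B_def P_def ..
  have "(LINT w|?D. gauss (w + V)) =
     (LINT w|?D. (exp (- (?n \<bullet> V)\<^sup>2 / 2) / sqrt (2 * pi) ^ CARD('n)) * (\<Prod>b\<in>B. exp (- (w \<bullet> b + V \<bullet> b)\<^sup>2 / 2)))"
    (is "_ = (LINT w|_. ?h w)")
  proof -
    have "(LINT w|?D. gauss (w + V)) = (LINT c|(\<Pi>\<^sub>M b\<in>B. lborel). gauss ((\<Sum>b\<in>B. c b *\<^sub>R b) + V))"
      by (intro integral_distr) measurable
    also have "\<dots> = (LINT c|(\<Pi>\<^sub>M b\<in>B. lborel). ?h (\<Sum>b\<in>B. c b *\<^sub>R b))"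
    proof (intro Bochner_Integration.integral_cong refl)
      fix c
      let ?x = "\<Sum>b\<in>B. c b *\<^sub>R b"
      have "?x \<bullet> ?n = 0" using nB unfolding inner_commute[of _ "?n"] by (simp add: inner_sum_right)
      then have "(norm (?x + V))\<^sup>2 = (\<Sum>b\<in>B. (?x \<bullet> b + V \<bullet> b)\<^sup>2) + (?n \<bullet> V)\<^sup>2"
        by (simp add: norm2 inner_add_left inner_commute[of V "?n"])
      then show "gauss (?x + V) = ?h ?x"
        unfolding gauss_eq
        by (simp add: exp_sum[symmetric] fin sum_negf sum_divide_distrib[symmetric] exp_add[symmetric] add_divide_distrib diff_divide_distrib)
    qed
    also have "\<dots> = (LINT w|?D. ?h w)"
      by (intro integral_distr[symmetric]) measurable
    finally show ?thesis .
  qed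
  also have "\<dots> = (exp (- (?n \<bullet> V)\<^sup>2 / 2) / sqrt (2 * pi) ^ CARD('n)) * sqrt (2 * pi) ^ (CARD('n) - 1)"
    using orthonormal_lborel_prod(2)[OF fin B gaussian_shift(2), of "\<lambda>b. V \<bullet> b"]
    unfolding gaussian_shift(1) integral_mult_right_zero by (simp only: prod_constant card)
  also have "\<dots> = exp (- (?n \<bullet> V)\<^sup>2 / 2) / sqrt (2 * pi)"
    by (cases "CARD('n)") auto
  finally show ?thesis unfolding integral_dirac_def sub by simp
qed

section \<open>Gaussian averages of correlations in Fourier variables\<close>

lemma borel_measurable_vec_nth [measurable (raw)]:
  fixes f :: "'a \<Rightarrow> 'b::topological_space ^ 'n"
  assumes "f \<in> borel_measurable M" shows "(\<lambda>x. f x $ i) \<in> borel_measurable M"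
  by (rule measurable_compose[OF assms borel_measurable_continuous_onI]) (intro continuous_intros)

text \<open>The real part and, up to sign, the imaginary part of the Fourier transform. With these two
  all integrands stay real.\<close>

definition cosT :: "('a::euclidean_space \<Rightarrow> real) \<Rightarrow> 'a \<Rightarrow> real" where
  "cosT f k = (LBINT x. f x * cos (k \<bullet> x))"

definition sinT :: "('a::euclidean_space \<Rightarrow> real) \<Rightarrow> 'a \<Rightarrow> real" where
  "sinT f k = (LBINT x. f x * sin (k \<bullet> x))"

text \<open>The class to which the potential and its first two derivatives belong.\<close>

definition cont_supp :: "real \<Rightarrow> ('a::euclidean_space \<Rightarrow> real) \<Rightarrow> bool" where
  "cont_supp R f \<longleftrightarrow> continuous_on UNIV f \<and> (\<forall>x. R < norm x \<longrightarrow> f x = 0)"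

lemma cont_supp_measurable: "cont_supp R f \<Longrightarrow> f \<in> borel_measurable borel"
  unfolding cont_supp_def by (intro borel_measurable_continuous_onI) simp

lemma cont_supp_integrable:
  assumes "cont_supp R f" shows "integrable lborel f"
proof -
  have "integrable lborel (\<lambda>x. indicator (cball 0 R) x *\<^sub>R f x)"
    using assms continuous_on_subset[of UNIV f] unfolding cont_supp_def
    by (intro borel_integrable_compact) auto
  also have "(\<lambda>x. indicator (cball 0 R) x *\<^sub>R f x) = f"
    using assms by (auto simp: cont_supp_def indicator_def fun_eq_iff not_le)
  finally show ?thesis .
qed

lemma cont_supp_bounded:
  assumes "cont_supp R f" shows "\<exists>C\<ge>0. \<forall>x. \<bar>f x\<bar> \<le> C"
proof (rule bounded_of_compact_support)
  show "continuous_on UNIV f" using assms by (simp add: cont_supp_def)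
  have "closure {x. f x \<noteq> 0} \<subseteq> cball 0 R"
    using assms by (intro closure_minimal) (auto simp: cont_supp_def not_le[symmetric])
  then show "compact (closure {x. f x \<noteq> 0})"
    by (meson bounded_cball bounded_subset closed_closure compact_eq_bounded_closed)
qed

lemma integrable_lborel_prod:
  fixes f :: "'a::euclidean_space \<Rightarrow> real" and g :: "'b::euclidean_space \<Rightarrow> real"
  assumes f: "integrable lborel f" and g: "integrable lborel g"
  shows "integrable (lborel \<Otimes>\<^sub>M lborel) (\<lambda>(x, y). f x * g y)"
proof (rule lborel_pair.Fubini_integrable)
  have [measurable]: "f \<in> borel_measurable borel" "g \<in> borel_measurable borel" using f g by auto
  show "(\<lambda>(x, y). f x * g y) \<in> borel_measurable (lborel \<Otimes>\<^sub>M lborel)" by measurable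
  show "integrable lborel (\<lambda>x. LBINT y. norm (case (x, y) of (x, y) \<Rightarrow> f x * g y))"
    using f g by (simp add: abs_mult)
  show "AE x in lborel. integrable lborel (\<lambda>y. case (x, y) of (x, y) \<Rightarrow> f x * g y)"
    using g by simp
qed

lemma integral_lborel_affine:
  fixes f :: "'a::euclidean_space \<Rightarrow> real"
  assumes [measurable]: "f \<in> borel_measurable borel" and c: "c \<noteq> 0"
  shows "(LBINT x. f x) = \<bar>c\<bar> ^ DIM('a) * (LBINT x. f (t + c *\<^sub>R x))"
proof -
  have "(LBINT x. f x) = (\<integral>x. f x \<partial>density (distr lborel borel (\<lambda>x. t + c *\<^sub>R x)) (\<lambda>_. ennreal (\<bar>c\<bar> ^ DIM('a))))"
    using lborel_affine[OF c, of t] by (simp add: ennreal_power[symmetric])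
  also have "\<dots> = (\<integral>x. \<bar>c\<bar> ^ DIM('a) *\<^sub>R f x \<partial>distr lborel borel (\<lambda>x. t + c *\<^sub>R x))"
    by (intro integral_density) auto
  also have "\<dots> = \<bar>c\<bar> ^ DIM('a) * (LBINT x. f (t + c *\<^sub>R x))"
    by (subst integral_distr) auto
  finally show ?thesis .
qed

lemma cosT_sinT_bound:
  assumes f: "integrable lborel f"
  shows "\<bar>cosT f k\<bar> \<le> (LBINT x. \<bar>f x\<bar>)" "\<bar>sinT f k\<bar> \<le> (LBINT x. \<bar>f x\<bar>)"
    and "integrable lborel (\<lambda>x. f x * cos (k \<bullet> x))" "integrable lborel (\<lambda>x. f x * sin (k \<bullet> x))"
proof -
  have [measurable]: "f \<in> borel_measurable borel" using f by auto
  have b: "\<bar>f x * cos (k \<bullet> x)\<bar> \<le> \<bar>f x\<bar>" "\<bar>f x * sin (k \<bullet> x)\<bar> \<le> \<bar>f x\<bar>" for x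
    using mult_left_mono[of "\<bar>cos (k \<bullet> x)\<bar>" 1 "\<bar>f x\<bar>"] mult_left_mono[of "\<bar>sin (k \<bullet> x)\<bar>" 1 "\<bar>f x\<bar>"]
    by (auto simp: abs_mult)
  show i: "integrable lborel (\<lambda>x. f x * cos (k \<bullet> x))" "integrable lborel (\<lambda>x. f x * sin (k \<bullet> x))"
    using b by (auto intro!: Bochner_Integration.integrable_bound[OF f])
  show "\<bar>cosT f k\<bar> \<le> (LBINT x. \<bar>f x\<bar>)"
    unfolding cosT_def using i f b
    by (intro order_trans[OF integral_abs_bound] integral_mono integrable_abs) auto
  show "\<bar>sinT f k\<bar> \<le> (LBINT x. \<bar>f x\<bar>)"
    unfolding sinT_def using i f b
    by (intro order_trans[OF integral_abs_bound] integral_mono integrable_abs) auto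
qed

lemma cosT_sinT_measurable:
  assumes [measurable]: "f \<in> borel_measurable borel"
  shows "cosT f \<in> borel_measurable borel" "sinT f \<in> borel_measurable borel"
  unfolding cosT_def[abs_def] sinT_def[abs_def] by measurable

text \<open>Rescaling \<open>k\<close> by \<open>s\<close> in \<open>gauss_cos_transform\<close>.\<close>

lemma gauss_scaled:
  fixes w V :: "real^'n"
  assumes s: "s \<noteq> 0"
  shows "(LBINT k. exp (- s\<^sup>2 * (norm k)\<^sup>2 / 2) * cos (k \<bullet> w + s * (k \<bullet> V)))
     = (2 * pi) ^ CARD('n) * \<bar>1 / s\<bar> ^ CARD('n) * gauss ((1 / s) *\<^sub>R w + V)"
proof -
  have "(LBINT x. exp (- (norm x)\<^sup>2 / 2) * cos (x \<bullet> ((1 / s) *\<^sub>R w + V)))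
     = \<bar>s\<bar> ^ DIM(real^'n) * (LBINT k. exp (- (norm (0 + s *\<^sub>R k))\<^sup>2 / 2) * cos ((0 + s *\<^sub>R k) \<bullet> ((1 / s) *\<^sub>R w + V)))"
    by (intro integral_lborel_affine s) measurable
  also have "(LBINT k. exp (- (norm (0 + s *\<^sub>R k))\<^sup>2 / 2) * cos ((0 + s *\<^sub>R k) \<bullet> ((1 / s) *\<^sub>R w + V)))
     = (LBINT k. exp (- s\<^sup>2 * (norm k)\<^sup>2 / 2) * cos (k \<bullet> w + s * (k \<bullet> V)))"
    using s by (simp add: power_mult_distrib inner_add_right)
  finally show ?thesis using s
    by (simp add: gauss_cos_transform power_divide divide_simps)
qed

text \<open>The addition theorems separate \<open>x\<close> from \<open>y\<close>; the two parts integrate them out one after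
  the other.\<close>

lemma cos_shift_integral:
  fixes f g :: "'a::euclidean_space \<Rightarrow> real"
  assumes f: "integrable lborel f" and g: "integrable lborel g"
  shows "(LBINT y. g y * cos (k \<bullet> (y - x) + \<theta>))
      = cos \<theta> * (cosT g k * cos (k \<bullet> x) + sinT g k * sin (k \<bullet> x))
        - sin \<theta> * (sinT g k * cos (k \<bullet> x) - cosT g k * sin (k \<bullet> x))"
    and "(LBINT x. f x * (cos \<theta> * (cosT g k * cos (k \<bullet> x) + sinT g k * sin (k \<bullet> x))
        - sin \<theta> * (sinT g k * cos (k \<bullet> x) - cosT g k * sin (k \<bullet> x))))
      = cos \<theta> * (cosT f k * cosT g k + sinT f k * sinT g k)
        - sin \<theta> * (sinT g k * cosT f k - cosT g k * sinT f k)"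
proof -
  have c: "cos (k \<bullet> (y - x) + \<theta>) = (cos \<theta> * cos (k \<bullet> x) + sin \<theta> * sin (k \<bullet> x)) * cos (k \<bullet> y)
       + (cos \<theta> * sin (k \<bullet> x) - sin \<theta> * cos (k \<bullet> x)) * sin (k \<bullet> y)" for y
    unfolding inner_diff_right cos_add cos_diff sin_diff by (simp add: algebra_simps)
  have "(LBINT y. g y * cos (k \<bullet> (y - x) + \<theta>)) =
     (LBINT y. (cos \<theta> * cos (k \<bullet> x) + sin \<theta> * sin (k \<bullet> x)) * (g y * cos (k \<bullet> y))
       + (cos \<theta> * sin (k \<bullet> x) - sin \<theta> * cos (k \<bullet> x)) * (g y * sin (k \<bullet> y)))"
    unfolding c by (intro Bochner_Integration.integral_cong) (simp_all add: algebra_simps)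
  also have "\<dots> = (cos \<theta> * cos (k \<bullet> x) + sin \<theta> * sin (k \<bullet> x)) * cosT g k
       + (cos \<theta> * sin (k \<bullet> x) - sin \<theta> * cos (k \<bullet> x)) * sinT g k"
    unfolding cosT_def sinT_def using cosT_sinT_bound[OF g] by simp
  finally show "(LBINT y. g y * cos (k \<bullet> (y - x) + \<theta>)) = (cos \<theta> * (cosT g k * cos (k \<bullet> x) + sinT g k * sin (k \<bullet> x))
        - sin \<theta> * (sinT g k * cos (k \<bullet> x) - cosT g k * sin (k \<bullet> x)))"
    by (simp add: algebra_simps)
  have "(LBINT x. f x * (cos \<theta> * (cosT g k * cos (k \<bullet> x) + sinT g k * sin (k \<bullet> x))
        - sin \<theta> * (sinT g k * cos (k \<bullet> x) - cosT g k * sin (k \<bullet> x)))) = (LBINT x. (cos \<theta> * cosT g k - sin \<theta> * sinT g k) * (f x * cos (k \<bullet> x))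
       + (cos \<theta> * sinT g k + sin \<theta> * cosT g k) * (f x * sin (k \<bullet> x)))"
    by (intro Bochner_Integration.integral_cong) (simp_all add: algebra_simps)
  also have "\<dots> = (cos \<theta> * cosT g k - sin \<theta> * sinT g k) * cosT f k
       + (cos \<theta> * sinT g k + sin \<theta> * cosT g k) * sinT f k"
    unfolding cosT_def[of f] sinT_def[of f] using cosT_sinT_bound[OF f] by simp
  finally show "(LBINT x. f x * (cos \<theta> * (cosT g k * cos (k \<bullet> x) + sinT g k * sin (k \<bullet> x))
        - sin \<theta> * (sinT g k * cos (k \<bullet> x) - cosT g k * sin (k \<bullet> x))))
      = cos \<theta> * (cosT f k * cosT g k + sinT f k * sinT g k)
        - sin \<theta> * (sinT g k * cosT f k - cosT g k * sinT f k)"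
    by (simp add: algebra_simps)
qed

lemma integrable_scaled_gaussian:
  fixes s :: real
  assumes "s \<noteq> 0"
  shows "integrable lborel (\<lambda>k::'a::euclidean_space. exp (- s\<^sup>2 * (norm k)\<^sup>2 / 2))"
proof -
  have "integrable (density (distr lborel borel (\<lambda>x::'a. 0 + s *\<^sub>R x)) (\<lambda>_. ennreal (\<bar>s\<bar> ^ DIM('a)))) (\<lambda>x. exp (- (norm x)\<^sup>2 / 2))"
    using lborel_affine[OF assms, of "0::'a"] gaussian_nd(1)[where 'a='a] by (simp add: ennreal_power[symmetric])
  then have "integrable lborel (\<lambda>x::'a. \<bar>s\<bar> ^ DIM('a) * exp (- (norm (0 + s *\<^sub>R x))\<^sup>2 / 2))"
    by (subst (asm) integrable_density) (auto simp: integrable_distr_eq)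
  then show ?thesis using assms by (simp add: power_mult_distrib)
qed

lemma fubini_swap:
  fixes F :: "'a::euclidean_space \<Rightarrow> 'b::euclidean_space \<Rightarrow> real"
  assumes "(\<lambda>(x, y). F x y) \<in> borel_measurable (lborel \<Otimes>\<^sub>M lborel)"
    and "integrable lborel f" "integrable lborel g" "\<And>x y. \<bar>F x y\<bar> \<le> f x * g y"
  shows "(LBINT x. (LBINT y. F x y)) = (LBINT y. (LBINT x. F x y))"
proof (rule lborel_pair.Fubini_integral[symmetric])
  show "integrable (lborel \<Otimes>\<^sub>M lborel) (\<lambda>(x, y). F x y)"
    by (rule Bochner_Integration.integrable_bound[OF integrable_lborel_prod[OF assms(2,3)] assms(1)])
       (use order_trans[OF assms(4) abs_ge_self] in auto)
qed

lemma integrable_gauss_shift: "integrable lborel (\<lambda>v::real^'n. gauss (v + V))"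
proof -
  have "integrable (density (distr lborel borel (\<lambda>x. V + 1 *\<^sub>R x)) (\<lambda>_. ennreal (\<bar>1\<bar> ^ DIM(real^'n)))) (gauss :: real^'n \<Rightarrow> real)"
    using lborel_affine[of 1 V] integrable_gauss by (simp add: density_1)
  then show ?thesis
    by (subst (asm) integrable_density) (auto simp: integrable_distr_eq add.commute)
qed

text \<open>Parseval's identity for a correlation that has been smoothed by the Gaussian. The
  substitution \<open>y = x + s v\<close> turns the average over \<open>v\<close> into a convolution, whose Gaussian
  factor is then expanded by \<open>gauss_scaled\<close>. That factor also makes the integrals over \<open>k\<close>
  converge absolutely.\<close>

lemma smoothed_autocorrelation:
  fixes f g :: "real^'n \<Rightarrow> real"
  assumes f: "cont_supp R f" and g: "cont_supp R g" and s: "s \<noteq> 0"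
  shows "(LBINT v. gauss (v + V) * (LBINT x. f x * g (x + s *\<^sub>R v))) =
     1 / (2 * pi) ^ CARD('n) * (LBINT k. exp (- s\<^sup>2 * (norm k)\<^sup>2 / 2) *
         (cos (s * (k \<bullet> V)) * (cosT f k * cosT g k + sinT f k * sinT g k)
        - sin (s * (k \<bullet> V)) * (sinT g k * cosT f k - cosT g k * sinT f k)))"
proof -
  note [measurable] = cont_supp_measurable[OF f] cont_supp_measurable[OF g]
    cosT_sinT_measurable[OF cont_supp_measurable[OF f]] cosT_sinT_measurable[OF cont_supp_measurable[OF g]]
  have fi: "integrable lborel f" and gi: "integrable lborel g"
    using f g cont_supp_integrable by auto
  obtain C where C: "C \<ge> 0" "\<And>x. \<bar>g x\<bar> \<le> C" using cont_supp_bounded[OF g] by auto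
  define E where "E k = exp (- s\<^sup>2 * (norm k)\<^sup>2 / 2)" for k :: "real^'n"
  have E: "integrable lborel E" "\<And>k. E k \<ge> 0"
    using integrable_scaled_gaussian[OF s, where 'a="real^'n"] unfolding E_def by auto
  have [measurable]: "E \<in> borel_measurable borel" using E by auto
  define G where "G k x = (cos (s * (k \<bullet> V)) * (cosT g k * cos (k \<bullet> x) + sinT g k * sin (k \<bullet> x))
        - sin (s * (k \<bullet> V)) * (sinT g k * cos (k \<bullet> x) - cosT g k * sin (k \<bullet> x)))" for k x
  have G: "(LBINT y. g y * cos (k \<bullet> (y - x) + s * (k \<bullet> V))) = G k x" for k x
    unfolding G_def by (rule cos_shift_integral[OF fi gi])
  have Gb: "\<bar>G k x\<bar> \<le> (LBINT y. \<bar>g y\<bar>)" for k x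
    unfolding G[symmetric]
    by (intro order_trans[OF integral_abs_bound] integral_mono integrable_abs gi
        Bochner_Integration.integrable_bound[OF gi])
       (auto simp: abs_mult mult_left_le)
  have "(LBINT v. gauss (v + V) * (LBINT x. f x * g (x + s *\<^sub>R v))) =
     (LBINT v. (LBINT x. gauss (v + V) * (f x * g (x + s *\<^sub>R v))))"
    by simp
  also have "\<dots> = (LBINT x. (LBINT v. gauss (v + V) * (f x * g (x + s *\<^sub>R v))))"
  proof (rule fubini_swap[where f="\<lambda>v. gauss (v + V)" and g="\<lambda>x. \<bar>f x\<bar> * C"])
    show "integrable lborel (\<lambda>x. \<bar>f x\<bar> * C)" using fi by auto
    show "\<bar>gauss (v + V) * (f x * g (x + s *\<^sub>R v))\<bar> \<le> gauss (v + V) * (\<bar>f x\<bar> * C)" for v x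
      using C gauss_pos[of "v + V"] by (auto simp: abs_mult intro!: mult_left_mono)
  qed (use integrable_gauss_shift in auto)
  also have "\<dots> = (LBINT x. (LBINT y. 1 / (2 * pi) ^ CARD('n) * (f x * (LBINT k. g y * (E k * cos (k \<bullet> (y - x) + s * (k \<bullet> V)))))))"
  proof (rule Bochner_Integration.integral_cong[OF refl])
    fix x
    have "(LBINT v. gauss (v + V) * (f x * g (x + s *\<^sub>R v))) =
       \<bar>1 / s\<bar> ^ DIM(real^'n) * (LBINT y. gauss ((- (1 / s) *\<^sub>R x + (1 / s) *\<^sub>R y) + V) * (f x * g (x + s *\<^sub>R (- (1 / s) *\<^sub>R x + (1 / s) *\<^sub>R y))))"
      using s by (intro integral_lborel_affine) auto
    also have "\<dots> = (LBINT y. 1 / (2 * pi) ^ CARD('n) * (f x * (g y * ((2 * pi) ^ CARD('n) * \<bar>1 / s\<bar> ^ CARD('n) * gauss ((1 / s) *\<^sub>R (y - x) + V)))))"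
      using s by (simp add: algebra_simps flip: integral_mult_right_zero)
    finally show "(LBINT v. gauss (v + V) * (f x * g (x + s *\<^sub>R v))) =
      (LBINT y. 1 / (2 * pi) ^ CARD('n) * (f x * (LBINT k. g y * (E k * cos (k \<bullet> (y - x) + s * (k \<bullet> V))))))"
      by (simp only: gauss_scaled[OF s, symmetric] E_def[symmetric] integral_mult_right_zero)
  qed
  also have "\<dots> = 1 / (2 * pi) ^ CARD('n) * (LBINT x. f x * (LBINT y. (LBINT k. g y * (E k * cos (k \<bullet> (y - x) + s * (k \<bullet> V))))))"
    by simp
  also have "(LBINT x. f x * (LBINT y. (LBINT k. g y * (E k * cos (k \<bullet> (y - x) + s * (k \<bullet> V))))))
     = (LBINT x. f x * (LBINT k. E k * G k x))"
  proof (rule Bochner_Integration.integral_cong[OF refl], rule arg_cong[of _ _ "(*) _"])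
    fix x
    have "(LBINT y. (LBINT k. g y * (E k * cos (k \<bullet> (y - x) + s * (k \<bullet> V)))))
       = (LBINT k. (LBINT y. g y * (E k * cos (k \<bullet> (y - x) + s * (k \<bullet> V)))))"
    proof (rule fubini_swap[where f="\<lambda>y. \<bar>g y\<bar>" and g=E])
      show "\<bar>g y * (E k * cos (k \<bullet> (y - x) + s * (k \<bullet> V)))\<bar> \<le> \<bar>g y\<bar> * E k" for y k
        using E(2)[of k] by (auto simp: abs_mult mult_left_le intro!: mult_left_mono)
    qed (use gi E in auto)
    also have "\<dots> = (LBINT k. (LBINT y. E k * (g y * cos (k \<bullet> (y - x) + s * (k \<bullet> V)))))"
      by (simp add: mult_ac)
    also have "\<dots> = (LBINT k. E k * G k x)" by (simp add: G)
    finally show "(LBINT y. (LBINT k. g y * (E k * cos (k \<bullet> (y - x) + s * (k \<bullet> V)))))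
       = (LBINT k. E k * G k x)" .
  qed
  also have "\<dots> = (LBINT x. (LBINT k. f x * (E k * G k x)))" by simp
  also have "\<dots> = (LBINT k. (LBINT x. f x * (E k * G k x)))"
  proof (rule fubini_swap[where f="\<lambda>x. \<bar>f x\<bar>" and g="\<lambda>k. E k * (LBINT y. \<bar>g y\<bar>)"])
    show "(\<lambda>(x, k). f x * (E k * G k x)) \<in> borel_measurable (lborel \<Otimes>\<^sub>M lborel)"
      unfolding G_def by measurable
    show "integrable lborel (\<lambda>k. E k * (LBINT y. \<bar>g y\<bar>))" using E by simp
    show "\<bar>f x * (E k * G k x)\<bar> \<le> \<bar>f x\<bar> * (E k * (LBINT y. \<bar>g y\<bar>))" for x k
      using E(2)[of k] Gb[of k x] by (auto simp: abs_mult intro!: mult_left_mono)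
  qed (use fi in auto)
  also have "\<dots> = (LBINT k. E k * (LBINT x. f x * G k x))"
    by (simp add: mult.left_commute[of _ "E _"])
  finally show ?thesis
    unfolding G_def cos_shift_integral(2)[OF fi gi] E_def .
qed

section \<open>Fourier transforms of derivatives\<close>

lemma cont_supp_partial:
  fixes h :: "real^'n \<Rightarrow> real"
  assumes "cont_supp R h" "continuous_on UNIV (partial j h)"
  shows "cont_supp R (partial j h)"
  unfolding cont_supp_def
proof (intro conjI allI impI)
  fix x :: "real^'n" assume x: "R < norm x"
  have "closure {x. h x \<noteq> 0} \<subseteq> cball 0 R"
    using assms by (intro closure_minimal) (auto simp: cont_supp_def not_le[symmetric])
  then show "partial j h x = 0" using x by (intro partial_zero_outside) auto
qed fact

text \<open>By translation invariance \<open>h (x + e) - h x\<close> has integral zero, and it is the integral of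
  the derivative over a segment; exchange the two integrations.\<close>

lemma integral_partial_eq_0:
  fixes h :: "real^'n \<Rightarrow> real"
  assumes h: "cont_supp R h" "\<And>x. h differentiable (at x)" and c: "continuous_on UNIV (partial j h)"
  shows "(LBINT x. partial j h x) = 0"
proof -
  let ?e = "axis j 1 :: real^'n"
  have p: "cont_supp R (partial j h)" by (rule cont_supp_partial[OF h(1) c])
  note [measurable] = cont_supp_measurable[OF h(1)] cont_supp_measurable[OF p]
  have hi: "integrable lborel h" and pi: "integrable lborel (partial j h)"
    using h(1) p cont_supp_integrable by auto
  have shift: "(LBINT x. f (x + t)) = (LBINT x. f x)"
    if [measurable]: "f \<in> borel_measurable borel" for f :: "real^'n \<Rightarrow> real" and t
    using integral_lborel_affine[of f 1 t] by (simp add: add.commute)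
  obtain C where C: "C \<ge> 0" "\<And>x. \<bar>partial j h x\<bar> \<le> C" using cont_supp_bounded[OF p] by auto
  have D: "((\<lambda>s. h (x + s *\<^sub>R ?e)) has_real_derivative partial j h (x + s *\<^sub>R ?e)) (at s)" for x s
  proof -
    have "((\<lambda>s. h (x + s *\<^sub>R ?e)) has_derivative (\<lambda>t. frechet_derivative h (at (x + s *\<^sub>R ?e)) (t *\<^sub>R ?e))) (at s)"
      by (rule has_derivative_compose[of "\<lambda>s. x + s *\<^sub>R ?e" "\<lambda>t. t *\<^sub>R ?e", OF _ frechet_derivative_works[THEN iffD1, OF h(2)]])
         (auto intro!: derivative_eq_intros)
    moreover have "frechet_derivative h (at (x + s *\<^sub>R ?e)) (t *\<^sub>R ?e) = t * partial j h (x + s *\<^sub>R ?e)" for t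
      using linear_frechet_derivative[OF h(2)] by (simp add: linear_scale partial_def)
    ultimately show ?thesis by (simp add: has_field_derivative_def mult_commute_abs)
  qed
  have cont: "isCont (\<lambda>s. partial j h (x + s *\<^sub>R ?e)) u" for x u
  proof -
    have "continuous_on UNIV (\<lambda>s. partial j h (x + s *\<^sub>R ?e))"
      by (rule continuous_on_compose2[OF c]) (auto intro!: continuous_intros)
    then show ?thesis by (simp add: continuous_on_eq_continuous_at)
  qed
  have ftc: "(LBINT s. indicator {0..1} s * partial j h (x + s *\<^sub>R ?e)) = h (x + ?e) - h x" for x
    using integral_FTC_Icc_real[OF zero_le_one D cont, of x] by (simp add: mult.commute)
  have pij: "integrable lborel (\<lambda>x. h (x + ?e))"
  proof (rule cont_supp_integrable[of "R + 1"], unfold cont_supp_def, intro conjI allI impI)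
    show "continuous_on UNIV (\<lambda>x. h (x + ?e))"
      using h(1) unfolding cont_supp_def
      by (intro continuous_on_compose2[of UNIV h UNIV "\<lambda>x. x + ?e"] continuous_intros) auto
    fix x :: "real^'n" assume "R + 1 < norm x"
    moreover have "norm x \<le> norm (x + ?e) + norm ?e"
      using norm_triangle_ineq4[of "x + ?e" ?e] by simp
    ultimately have "R < norm (x + ?e)" by simp
    then show "h (x + ?e) = 0" using h(1) unfolding cont_supp_def by blast
  qed
  have "0 = (LBINT x. h (x + ?e) - h x)"
    using hi pij by (simp add: shift)
  also have "\<dots> = (LBINT x. (LBINT s. indicator {0..1} s * partial j h (x + s *\<^sub>R ?e)))"
    by (simp add: ftc)
  also have "\<dots> = (LBINT s. (LBINT x. indicator {0..1} s * partial j h (x + s *\<^sub>R ?e)))"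
  proof (rule fubini_swap[where f="\<lambda>x. C * indicator (cball 0 (R + 1)) x" and g="indicator {0..1}"])
    show "integrable lborel (\<lambda>x::real^'n. C * indicator (cball 0 (R + 1)) x)"
      by (intro integrable_mult_right integrable_real_indicator emeasure_lborel_cball_finite) simp
    show "integrable lborel (indicator {0..1} :: real \<Rightarrow> real)" by auto
    fix x :: "real^'n" and s :: real
    show "\<bar>indicator {0..1} s * partial j h (x + s *\<^sub>R ?e)\<bar> \<le> C * indicator (cball 0 (R + 1)) x * indicator {0..1} s"
    proof (cases "s \<in> {0..1} \<and> x \<notin> cball 0 (R + 1)")
      case True
      have "norm x \<le> norm (x + s *\<^sub>R ?e) + norm (s *\<^sub>R ?e)"
        using norm_triangle_ineq4[of "x + s *\<^sub>R ?e" "s *\<^sub>R ?e"] by simp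
      then have "partial j h (x + s *\<^sub>R ?e) = 0" using True p by (auto simp: cont_supp_def)
      then show ?thesis using C by simp
    qed (use C in \<open>auto simp: indicator_def\<close>)
  qed measurable
  also have "\<dots> = (LBINT s. indicator {0..1::real} s * (LBINT x. partial j h x))"
    by (simp add: shift)
  also have "\<dots> = (LBINT x. partial j h x)" by simp
  finally show ?thesis by simp
qed

lemma trig_transform_partial:
  fixes h :: "real^'n \<Rightarrow> real"
  assumes h: "cont_supp R h" "\<And>x. h differentiable (at x)" and c: "continuous_on UNIV (partial j h)"
  shows "cosT (partial j h) k = k $ j * sinT h k" "sinT (partial j h) k = - (k $ j) * cosT h k"
proof -
  have p: "cont_supp R (partial j h)" by (rule cont_supp_partial[OF h(1) c])
  have pi: "integrable lborel (partial j h)" and hi: "integrable lborel h"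
    using h(1) p cont_supp_integrable by auto
  have ch: "continuous_on UNIV h" using h(1) by (simp add: cont_supp_def)
  have Dc: "((\<lambda>y. cos (k \<bullet> y)) has_derivative (\<lambda>t. - (k \<bullet> t) * sin (k \<bullet> x))) (at x)"
   and Ds: "((\<lambda>y. sin (k \<bullet> y)) has_derivative (\<lambda>t. (k \<bullet> t) * cos (k \<bullet> x))) (at x)" for x
    by (auto intro!: derivative_eq_intros)
  have pc: "partial j (\<lambda>y. h y * cos (k \<bullet> y)) = (\<lambda>x. partial j h x * cos (k \<bullet> x) - k $ j * (h x * sin (k \<bullet> x)))"
    using h(2) Dc by (intro ext) (subst partial_mult, auto simp: differentiable_def partial_eqI[OF Dc] inner_axis)
  have ps: "partial j (\<lambda>y. h y * sin (k \<bullet> y)) = (\<lambda>x. partial j h x * sin (k \<bullet> x) + k $ j * (h x * cos (k \<bullet> x)))"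
    using h(2) Ds by (intro ext) (subst partial_mult, auto simp: differentiable_def partial_eqI[OF Ds] inner_axis)
  have "(LBINT x. partial j (\<lambda>y. h y * cos (k \<bullet> y)) x) = 0"
  proof (rule integral_partial_eq_0)
    show "cont_supp R (\<lambda>y. h y * cos (k \<bullet> y))"
      using h(1) by (auto simp: cont_supp_def intro!: continuous_intros)
    show "(\<lambda>y. h y * cos (k \<bullet> y)) differentiable at x" for x
      using h(2) Dc by (intro differentiable_mult) (auto simp: differentiable_def)
    show "continuous_on UNIV (partial j (\<lambda>y. h y * cos (k \<bullet> y)))"
      unfolding pc using c ch by (auto intro!: continuous_intros)
  qed
  then show "cosT (partial j h) k = k $ j * sinT h k"
    unfolding pc using cosT_sinT_bound[OF pi] cosT_sinT_bound[OF hi] by (simp add: cosT_def sinT_def)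
  have "(LBINT x. partial j (\<lambda>y. h y * sin (k \<bullet> y)) x) = 0"
  proof (rule integral_partial_eq_0)
    show "cont_supp R (\<lambda>y. h y * sin (k \<bullet> y))"
      using h(1) by (auto simp: cont_supp_def intro!: continuous_intros)
    show "(\<lambda>y. h y * sin (k \<bullet> y)) differentiable at x" for x
      using h(2) Ds by (intro differentiable_mult) (auto simp: differentiable_def)
    show "continuous_on UNIV (partial j (\<lambda>y. h y * sin (k \<bullet> y)))"
      unfolding ps using c ch by (auto intro!: continuous_intros)
  qed
  then show "sinT (partial j h) k = - (k $ j) * cosT h k"
    unfolding ps using cosT_sinT_bound[OF pi] cosT_sinT_bound[OF hi] by (simp add: cosT_def sinT_def)
qed

lemma cmod_fourier:
  fixes h :: "real^'n \<Rightarrow> real"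
  assumes h: "integrable lborel h"
  shows "(cmod (fourier h k))\<^sup>2 = (cosT h k)\<^sup>2 + (sinT h k)\<^sup>2"
proof -
  have [measurable]: "h \<in> borel_measurable borel" using h by auto
  let ?F = "\<lambda>x. exp (- (\<i> * complex_of_real (k \<bullet> x))) * complex_of_real (h x)"
  have i: "integrable lborel ?F"
    by (rule Bochner_Integration.integrable_bound[OF h]) (auto simp: norm_mult)
  have "Re (fourier h k) = cosT h k"
    unfolding fourier_def cosT_def by (subst integral_Re[OF i, symmetric]) (simp add: Re_exp mult.commute)
  moreover have "Im (fourier h k) = - sinT h k"
    unfolding fourier_def sinT_def by (subst integral_Im[OF i, symmetric]) (simp add: Im_exp mult.commute)
  ultimately show ?thesis by (simp add: cmod_power2)
qed

section \<open>Gaussian integrals over a half-line\<close>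

lemma integral_even_half:
  fixes f :: "real \<Rightarrow> real"
  assumes f: "integrable lborel f" and even: "\<And>x. f (- x) = f x"
  shows "integrable lborel (\<lambda>x. indicator {..0} x * f x)"
    and "(LBINT x. indicator {..0} x * f x) = (LBINT x. f x) / 2"
proof -
  have i: "integrable lborel (\<lambda>x. indicator A x * f x)" if "A \<in> sets borel" for A
    using integrable_mult_indicator[of A lborel f] f that by simp
  show "integrable lborel (\<lambda>x. indicator {..0} x * f x)" by (rule i) simp
  have "(LBINT x. f x) = (LBINT x. indicator {..0} x * f x + indicator {0<..} x * f x)"
    by (intro Bochner_Integration.integral_cong) (auto simp: indicator_def)
  also have "\<dots> = (LBINT x. indicator {..0} x * f x) + (LBINT x. indicator {0<..} x * f x)"
    by (intro Bochner_Integration.integral_add i) auto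
  also have "(LBINT x. indicator {0<..} x * f x) = (LBINT x. indicator {0<..} (0 + (-1) * x) * f (0 + (-1) * x))"
    using lborel_integral_real_affine[of "-1" "\<lambda>x. indicator {0<..} x * f x" 0] by simp
  also have "\<dots> = (LBINT x. indicator {..0} x * f x)"
  proof (rule integral_cong_AE)
    have [measurable]: "f \<in> borel_measurable borel" using f by auto
    show "(\<lambda>x. indicator {0<..} (0 + (-1) * x) * f (0 + (-1) * x)) \<in> borel_measurable lborel" by measurable
    show "(\<lambda>x. indicator {..0} x * f x) \<in> borel_measurable lborel" by measurable
    show "AE x in lborel. indicator {0<..} (0 + (-1) * x) * f (0 + (-1) * x) = indicator {..0} x * f x"
      by (rule AE_mp[OF AE_lborel_singleton[of "0::real"]], rule AE_I2) (auto simp: indicator_def even)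
  qed
  finally show "(LBINT x. indicator {..0} x * f x) = (LBINT x. f x) / 2" by simp
qed

lemma gaussian_cos_scaled:
  fixes a \<theta> :: real
  assumes a: "a > 0"
  shows "integrable lborel (\<lambda>s. exp (- s\<^sup>2 * a\<^sup>2 / 2) * cos (s * \<theta>))"
    and "(LBINT s. exp (- s\<^sup>2 * a\<^sup>2 / 2) * cos (s * \<theta>)) = sqrt (2 * pi) / a * exp (- (\<theta> / a)\<^sup>2 / 2)"
proof -
  let ?f = "\<lambda>x. exp (- x\<^sup>2 / 2) * cos ((\<theta> / a) * x) :: real"
  have e: "?f (0 + a * s) = exp (- s\<^sup>2 * a\<^sup>2 / 2) * cos (s * \<theta>)" for s
    using a by (simp add: power_mult_distrib mult_ac)
  show "integrable lborel (\<lambda>s. exp (- s\<^sup>2 * a\<^sup>2 / 2) * cos (s * \<theta>))"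
    using lborel_integrable_real_affine[OF gaussian_cos(1)[of "\<theta> / a"], of a 0] a unfolding e by simp
  show "(LBINT s. exp (- s\<^sup>2 * a\<^sup>2 / 2) * cos (s * \<theta>)) = sqrt (2 * pi) / a * exp (- (\<theta> / a)\<^sup>2 / 2)"
    using lborel_integral_real_affine[of a ?f 0] a gaussian_cos(2)[of "\<theta> / a"] unfolding e by (simp add: field_simps)
qed

lemma half_gaussian_cos:
  fixes a \<theta> :: real
  assumes a: "a > 0"
  shows "integrable lborel (\<lambda>s. indicator {..0} s * (exp (- s\<^sup>2 * a\<^sup>2 / 2) * cos (s * \<theta>)))"
    and "(LBINT s. indicator {..0} s * (exp (- s\<^sup>2 * a\<^sup>2 / 2) * cos (s * \<theta>)))
      = sqrt (2 * pi) / (2 * a) * exp (- (\<theta> / a)\<^sup>2 / 2)"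
  using integral_even_half[OF gaussian_cos_scaled(1)[OF a, of \<theta>]] gaussian_cos_scaled(2)[OF a, of \<theta>] by simp_all

lemma gaussian_abs_scaled:
  fixes a :: real
  assumes a: "a > 0"
  shows "integrable lborel (\<lambda>s. \<bar>s\<bar> * exp (- s\<^sup>2 * a\<^sup>2 / 2))"
proof -
  let ?f = "\<lambda>x. \<bar>x\<bar> * exp (- x\<^sup>2 / 2) :: real"
  have "integrable lborel (\<lambda>x. sqrt (2 * pi) * (std_normal_density x * \<bar>x\<bar>^1))"
    by (intro integrable_mult_right integrable_std_normal_moment_abs)
  then have i: "integrable lborel ?f" by (simp add: std_normal_density_def mult.commute)
  have e: "?f (0 + a * s) = a * (\<bar>s\<bar> * exp (- s\<^sup>2 * a\<^sup>2 / 2))" for s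
    using a by (simp add: power_mult_distrib abs_mult mult_ac)
  have "integrable lborel (\<lambda>s. a * (\<bar>s\<bar> * exp (- s\<^sup>2 * a\<^sup>2 / 2)))"
    using lborel_integrable_real_affine[OF i, of a 0] a unfolding e by simp
  then have "integrable lborel (\<lambda>s. (1 / a) * (a * (\<bar>s\<bar> * exp (- s\<^sup>2 * a\<^sup>2 / 2))))"
    by (rule integrable_mult_right)
  then show ?thesis using a by simp
qed

lemma tendsto_gaussian_0:
  fixes a :: real
  assumes a: "a > 0"
  shows "((\<lambda>s. exp (- s\<^sup>2 * a\<^sup>2 / 2)) \<longlongrightarrow> 0) at_top" "((\<lambda>s. exp (- s\<^sup>2 * a\<^sup>2 / 2)) \<longlongrightarrow> 0) at_bot"
proof -
  have e: "exp (- s\<^sup>2 * a\<^sup>2 / 2) = exp ((- (a\<^sup>2 / 2)) * s\<^sup>2)" for s by simp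
  have n: "- (a\<^sup>2 / 2) < 0" using a by simp
  have "filterlim (\<lambda>s::real. s\<^sup>2) at_top at_top" by (intro filterlim_pow_at_top filterlim_ident) simp
  from filterlim_tendsto_neg_mult_at_bot[OF tendsto_const n this]
  show "((\<lambda>s. exp (- s\<^sup>2 * a\<^sup>2 / 2)) \<longlongrightarrow> 0) at_top"
    unfolding e by (rule filterlim_compose[OF exp_at_bot])
  have "filterlim (\<lambda>s::real. s\<^sup>2) at_top at_bot" by (intro filterlim_pow_at_bot_even filterlim_ident) simp_all
  from filterlim_tendsto_neg_mult_at_bot[OF tendsto_const n this]
  show "((\<lambda>s. exp (- s\<^sup>2 * a\<^sup>2 / 2)) \<longlongrightarrow> 0) at_bot"
    unfolding e by (rule filterlim_compose[OF exp_at_bot])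
qed

text \<open>Integration by parts over the whole line, where the boundary terms vanish, reduces this to
  the cosine integral; the integrand is even.\<close>

lemma half_gaussian_sin:
  fixes a \<theta> :: real
  assumes a: "a > 0"
  shows "integrable lborel (\<lambda>s. indicator {..0} s * (exp (- s\<^sup>2 * a\<^sup>2 / 2) * (s * sin (s * \<theta>))))"
    and "(LBINT s. indicator {..0} s * (exp (- s\<^sup>2 * a\<^sup>2 / 2) * (s * sin (s * \<theta>))))
      = \<theta> / a\<^sup>2 * (sqrt (2 * pi) / (2 * a) * exp (- (\<theta> / a)\<^sup>2 / 2))"
proof -
  let ?E = "\<lambda>s. exp (- s\<^sup>2 * a\<^sup>2 / 2)"
  let ?f = "\<lambda>s. ?E s * (s * sin (s * \<theta>))"
  let ?F = "\<lambda>s. - (1 / a\<^sup>2) * (?E s * sin (s * \<theta>))"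
  have fi: "integrable lborel ?f"
    by (rule Bochner_Integration.integrable_bound[OF gaussian_abs_scaled[OF a]])
       (auto simp: abs_mult mult_left_le intro!: AE_I2)
  have ci: "integrable lborel (\<lambda>s. \<theta> / a\<^sup>2 * (?E s * cos (s * \<theta>)))"
    by (intro integrable_mult_right gaussian_cos_scaled a)
  have lim: "(?F \<longlongrightarrow> 0) G" if "(?E \<longlongrightarrow> 0) G" for G
  proof -
    have "((\<lambda>s. ?E s * sin (s * \<theta>)) \<longlongrightarrow> 0) G"
      by (rule Lim_null_comparison[OF _ that]) (auto simp: abs_mult mult_left_le)
    from tendsto_mult_right[OF this, of "- (1 / a\<^sup>2)"] show ?thesis by simp
  qed
  have "(LBINT s=-\<infinity>..\<infinity>. (?f s - \<theta> / a\<^sup>2 * (?E s * cos (s * \<theta>)))) = 0 - 0"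
  proof (rule interval_integral_FTC_integrable[where F="?F"])
    show "(?F has_vector_derivative (?f s - \<theta> / a\<^sup>2 * (?E s * cos (s * \<theta>)))) (at s)" for s
      unfolding has_real_derivative_iff_has_vector_derivative[symmetric] using a
      by (auto intro!: derivative_eq_intros simp: field_simps power2_eq_square)
    show "isCont (\<lambda>s. ?f s - \<theta> / a\<^sup>2 * (?E s * cos (s * \<theta>))) s" for s using a by (auto intro!: continuous_intros)
    show "set_integrable lborel (einterval (-\<infinity>) \<infinity>) (\<lambda>s. ?f s - \<theta> / a\<^sup>2 * (?E s * cos (s * \<theta>)))"
      using Bochner_Integration.integrable_diff[OF fi ci] by (simp add: set_integrable_def)
    show "((?F \<circ> real_of_ereal) \<longlongrightarrow> 0) (at_right (-\<infinity>))" "((?F \<circ> real_of_ereal) \<longlongrightarrow> 0) (at_left \<infinity>)"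
      unfolding ereal_tendsto_simps using lim[OF tendsto_gaussian_0(1)[OF a]] lim[OF tendsto_gaussian_0(2)[OF a]] by simp_all
  qed simp
  then have "(LBINT s. ?f s - \<theta> / a\<^sup>2 * (?E s * cos (s * \<theta>))) = 0"
    by (simp add: interval_lebesgue_integral_def set_lebesgue_integral_def)
  then have "(LBINT s. ?f s) = (LBINT s. \<theta> / a\<^sup>2 * (?E s * cos (s * \<theta>)))"
    using Bochner_Integration.integral_diff[OF fi ci] by linarith
  also have "\<dots> = \<theta> / a\<^sup>2 * (sqrt (2 * pi) / a * exp (- (\<theta> / a)\<^sup>2 / 2))"
    using gaussian_cos_scaled(2)[OF a, of \<theta>] by (simp only: integral_mult_right_zero)
  finally show "(LBINT s. indicator {..0} s * ?f s)
      = \<theta> / a\<^sup>2 * (sqrt (2 * pi) / (2 * a) * exp (- (\<theta> / a)\<^sup>2 / 2))"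
    using integral_even_half(2)[OF fi] by simp
  show "integrable lborel (\<lambda>s. indicator {..0} s * ?f s)"
    by (rule integral_even_half(1)[OF fi]) simp
qed

section \<open>Superpositions of Gaussian ridge functions\<close>

text \<open>The effect of differentiation on the polynomial factor of \<open>p x * exp (- x\<^sup>2 / 2)\<close>. Up to
  sign, its iterates on the constant \<open>1\<close> are the Hermite polynomials.\<close>

definition hermite_step :: "real poly \<Rightarrow> real poly" where
  "hermite_step p = pderiv p - [:0, 1:] * p"

definition ridge :: "real poly \<Rightarrow> real \<Rightarrow> real" where
  "ridge p x = poly p x * exp (- x\<^sup>2 / 2)"

lemma ridge_deriv: "(ridge p has_real_derivative ridge (hermite_step p) x) (at x)"
  unfolding ridge_def[abs_def] hermite_step_def
  by (auto intro!: derivative_eq_intros simp: algebra_simps)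

lemma ridge_bounded: "\<exists>C\<ge>0. \<forall>x. \<bar>ridge p x\<bar> \<le> C"
proof -
  have m: "\<bar>x ^ i\<bar> * exp (- x\<^sup>2 / 2) \<le> fact i * 2 ^ i" for i and x :: real
  proof -
    have "\<bar>x\<bar> ^ i \<le> 2 ^ i * (fact i * exp (x\<^sup>2 / 2))"
    proof (cases "\<bar>x\<bar> \<le> 1")
      case True
      have "\<bar>x\<bar> ^ i \<le> 1" using True by (intro power_le_one) auto
      also have "1 \<le> 2 ^ i * (fact i * exp (x\<^sup>2 / 2) :: real)"
      proof -
        have "1 * (1 * 1) \<le> 2 ^ i * (fact i * exp (x\<^sup>2 / 2) :: real)"
          by (intro mult_mono) (auto simp: fact_ge_1)
        then show ?thesis by simp
      qed
      finally show ?thesis .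
    next
      case False
      then have "\<bar>x\<bar> ^ 1 \<le> \<bar>x\<bar> ^ 2" by (intro power_increasing) auto
      then have "\<bar>x\<bar> ^ i \<le> (x\<^sup>2) ^ i" by (intro power_mono) auto
      also have "\<dots> = 2 ^ i * (x\<^sup>2 / 2) ^ i" by (simp add: power_divide)
      also have "(x\<^sup>2 / 2) ^ i \<le> fact i * exp (x\<^sup>2 / 2)"
      proof -
        have "(x\<^sup>2 / 2) ^ i /\<^sub>R fact i \<le> exp (x\<^sup>2 / 2)"
          unfolding exp_def using sum_le_suminf[OF summable_exp_generic[of "x\<^sup>2 / 2"], of "{i}"] by simp
        then show ?thesis by (simp add: field_simps)
      qed
      finally show ?thesis by simp
    qed
    then have "\<bar>x\<bar> ^ i * exp (- x\<^sup>2 / 2) \<le> 2 ^ i * (fact i * exp (x\<^sup>2 / 2)) * exp (- x\<^sup>2 / 2)"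
      by (intro mult_right_mono) auto
    also have "\<dots> = fact i * 2 ^ i" by (simp add: mult.assoc exp_add[symmetric])
    finally show ?thesis by (simp add: power_abs)
  qed
  define C where "C = (\<Sum>i\<le>degree p. \<bar>coeff p i\<bar> * (fact i * 2 ^ i))"
  have "\<bar>ridge p x\<bar> \<le> C" for x
  proof -
    have "\<bar>ridge p x\<bar> = \<bar>\<Sum>i\<le>degree p. coeff p i * (x ^ i * exp (- x\<^sup>2 / 2))\<bar>"
      by (simp add: ridge_def poly_altdef sum_distrib_right mult.assoc)
    also have "\<dots> \<le> (\<Sum>i\<le>degree p. \<bar>coeff p i * (x ^ i * exp (- x\<^sup>2 / 2))\<bar>)" by (rule sum_abs)
    also have "\<dots> \<le> C"
      unfolding C_def using m by (intro sum_mono) (simp add: abs_mult mult_left_mono)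
    finally show ?thesis .
  qed
  moreover have "C \<ge> 0" unfolding C_def by (intro sum_nonneg) auto
  ultimately show ?thesis by blast
qed

lemma ridge_measurable [measurable]: "ridge p \<in> borel_measurable borel"
  by (intro borel_measurable_continuous_onI continuous_at_imp_continuous_on ballI DERIV_isCont[OF ridge_deriv])

lemma ridge_measurable_compose [measurable (raw)]:
  "f \<in> borel_measurable M \<Longrightarrow> (\<lambda>x. ridge p (f x)) \<in> borel_measurable M"
  by (rule measurable_compose[OF _ ridge_measurable])

definition ridge_mix :: "('k::euclidean_space \<Rightarrow> real) \<Rightarrow> ('k \<Rightarrow> real^'n) \<Rightarrow> real poly \<Rightarrow> real^'n \<Rightarrow> real" where
  "ridge_mix m n p V = (LBINT k. m k * ridge p (n k \<bullet> V))"

lemma ridge_mix_integrable: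
  fixes n :: "'k::euclidean_space \<Rightarrow> real^'n"
  assumes m: "integrable lborel m" and [measurable]: "n \<in> borel_measurable borel"
  shows "integrable lborel (\<lambda>k. m k * ridge p (n k \<bullet> V))"
proof -
  obtain C where C: "C \<ge> 0" "\<And>x. \<bar>ridge p x\<bar> \<le> C" using ridge_bounded by blast
  have [measurable]: "m \<in> borel_measurable borel" using m by auto
  have "integrable lborel (\<lambda>k. m k * C)" using m by simp
  then show ?thesis
    by (rule Bochner_Integration.integrable_bound) (use C in \<open>auto simp: abs_mult intro!: AE_I2 mult_left_mono\<close>)
qed

lemma ridge_mix_bounded:
  assumes m: "integrable lborel m" and [measurable]: "n \<in> borel_measurable borel"
  shows "\<exists>C\<ge>0. \<forall>V. \<bar>ridge_mix m n p V\<bar> \<le> C"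
proof -
  obtain C where C: "C \<ge> 0" "\<And>x. \<bar>ridge p x\<bar> \<le> C" using ridge_bounded by blast
  have [measurable]: "m \<in> borel_measurable borel" using m by auto
  have "\<bar>ridge_mix m n p V\<bar> \<le> (LBINT k. \<bar>m k\<bar> * C)" for V
    unfolding ridge_mix_def using m ridge_mix_integrable[OF m, of n p V] C
    by (intro order_trans[OF integral_abs_bound] integral_mono integrable_abs) (auto simp: abs_mult intro!: mult_left_mono)
  moreover have "0 \<le> (LBINT k. \<bar>m k\<bar> * C)" using C by (intro integral_nonneg_AE) auto
  ultimately show ?thesis by blast
qed

lemma integrable_mult_unit_component:
  fixes n :: "'k::euclidean_space \<Rightarrow> real^'n"
  assumes m: "integrable lborel m" and [measurable]: "n \<in> borel_measurable borel" and n1: "\<And>k. norm (n k) \<le> 1"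
  shows "integrable lborel (\<lambda>k. m k * n k $ i)"
proof (rule Bochner_Integration.integrable_bound[OF m])
  have [measurable]: "m \<in> borel_measurable borel" using m by auto
  show "(\<lambda>k. m k * n k $ i) \<in> borel_measurable lborel" by measurable
  have "\<bar>n k $ i\<bar> \<le> 1" for k using component_le_norm_cart[of "n k" i] n1[of k] by simp
  then show "AE k in lborel. norm (m k * n k $ i) \<le> norm (m k)" by (auto simp: abs_mult mult_left_le)
qed

lemma quadratic_remainder:
  fixes q q1 q2 :: "real \<Rightarrow> real"
  assumes q: "\<And>x. (q has_real_derivative q1 x) (at x)" "\<And>x. (q1 has_real_derivative q2 x) (at x)"
    and C: "\<And>x. \<bar>q2 x\<bar> \<le> C"
  shows "\<bar>q (a + h) - q a - q1 a * h\<bar> \<le> C * h\<^sup>2"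
proof -
  have l: "\<bar>q1 y - q1 x\<bar> \<le> C * \<bar>y - x\<bar>" for x y
    using field_differentiable_bound[of UNIV q1 q2 C x y] q(2) C by (simp add: has_field_derivative_at_within abs_minus_commute)
  have D: "((\<lambda>t. q (a + t) - q1 a * t) has_real_derivative (q1 (a + t) - q1 a)) (at t within S)" for t S
  proof -
    have "((\<lambda>t. q (a + t)) has_real_derivative q1 (a + t) * 1) (at t)"
      by (rule DERIV_chain2[OF q(1)]) (auto intro!: derivative_eq_intros)
    then have "((\<lambda>t. q (a + t) - q1 a * t) has_real_derivative q1 (a + t) * 1 - q1 a * 1) (at t)"
      by (intro DERIV_diff DERIV_cmult DERIV_ident)
    then show ?thesis by (simp add: has_field_derivative_at_within)
  qed
  have "norm ((q (a + h) - q1 a * h) - (q (a + 0) - q1 a * 0)) \<le> (C * \<bar>h\<bar>) * norm (h - 0)"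
  proof (rule field_differentiable_bound[OF _ D])
    show "convex (closed_segment 0 h)" by simp
    fix t assume "t \<in> closed_segment 0 h"
    then have "\<bar>t\<bar> \<le> \<bar>h\<bar>" by (auto simp: closed_segment_eq_real_ivl split: if_splits)
    moreover have "0 \<le> C" using C[of 0] by linarith
    ultimately show "norm (q1 (a + t) - q1 a) \<le> C * \<bar>h\<bar>"
      using l[of a "a + t"] mult_left_mono[of "\<bar>t\<bar>" "\<bar>h\<bar>" C] by simp
  qed auto
  then show ?thesis by (simp add: power2_eq_square mult.assoc abs_mult[symmetric])
qed

text \<open>The second derivative of a ridge function is bounded and the directions have norm at most
  one, so the first-order Taylor remainder is bounded uniformly in \<open>k\<close> and can be integrated
  against the weight.\<close>

lemma ridge_mix_has_derivative:
  fixes n :: "'k::euclidean_space \<Rightarrow> real^'n"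
  assumes m: "integrable lborel m" and n[measurable]: "n \<in> borel_measurable borel" and n1: "\<And>k. norm (n k) \<le> 1"
  shows "(ridge_mix m n p has_derivative (\<lambda>h. \<Sum>i\<in>UNIV. h $ i * ridge_mix (\<lambda>k. m k * n k $ i) n (hermite_step p) V)) (at V)"
proof -
  let ?p1 = "hermite_step p" let ?p2 = "hermite_step (hermite_step p)"
  have [measurable]: "m \<in> borel_measurable borel" using m by auto
  obtain C where C: "C \<ge> 0" "\<And>x. \<bar>ridge ?p2 x\<bar> \<le> C" using ridge_bounded by blast
  let ?D = "\<lambda>h. \<Sum>i\<in>UNIV. h $ i * ridge_mix (\<lambda>k. m k * n k $ i) n ?p1 V"
  define K where "K = (LBINT k. \<bar>m k\<bar> * C)"
  have K: "K \<ge> 0" unfolding K_def using C by (intro integral_nonneg_AE) auto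
  have D: "?D h = (LBINT k. m k * (ridge ?p1 (n k \<bullet> V) * (n k \<bullet> h)))"
     and Di: "integrable lborel (\<lambda>k. m k * (ridge ?p1 (n k \<bullet> V) * (n k \<bullet> h)))" for h
  proof -
    have i: "integrable lborel (\<lambda>k. h $ i * (m k * n k $ i * ridge ?p1 (n k \<bullet> V)))" for i
      by (intro integrable_mult_right ridge_mix_integrable integrable_mult_unit_component m n n1)
    have e: "(\<Sum>i\<in>UNIV. h $ i * (m k * n k $ i * ridge ?p1 (n k \<bullet> V))) = m k * (ridge ?p1 (n k \<bullet> V) * (n k \<bullet> h))" for k
      by (simp add: inner_vec_def[of "n k" h] sum_distrib_left mult_ac)
    show "?D h = (LBINT k. m k * (ridge ?p1 (n k \<bullet> V) * (n k \<bullet> h)))"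
      unfolding e[symmetric] ridge_mix_def using i by (subst Bochner_Integration.integral_sum) auto
    show "integrable lborel (\<lambda>k. m k * (ridge ?p1 (n k \<bullet> V) * (n k \<bullet> h)))"
      unfolding e[symmetric] using i by (intro Bochner_Integration.integrable_sum)
  qed
  have rem: "\<bar>ridge_mix m n p (V + h) - ridge_mix m n p V - ?D h\<bar> \<le> K * (norm h)\<^sup>2" for h
  proof -
    let ?r = "\<lambda>k. m k * ridge p (n k \<bullet> (V + h)) - m k * ridge p (n k \<bullet> V) - m k * (ridge ?p1 (n k \<bullet> V) * (n k \<bullet> h))"
    have ri: "integrable lborel ?r"
      by (intro Bochner_Integration.integrable_diff ridge_mix_integrable Di m n)
    have "ridge_mix m n p (V + h) - ridge_mix m n p V - ?D h = (LBINT k. ?r k)"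
      unfolding D unfolding ridge_mix_def using ridge_mix_integrable[OF m n] Di by simp
    also have "\<bar>\<dots>\<bar> \<le> (LBINT k. (\<bar>m k\<bar> * C) * (norm h)\<^sup>2)"
    proof (rule order_trans[OF integral_abs_bound], rule integral_mono)
      fix k
      have "\<bar>ridge p (n k \<bullet> V + n k \<bullet> h) - ridge p (n k \<bullet> V) - ridge ?p1 (n k \<bullet> V) * (n k \<bullet> h)\<bar> \<le> C * (n k \<bullet> h)\<^sup>2"
        by (rule quadratic_remainder[OF ridge_deriv ridge_deriv C(2)])
      also have "\<dots> \<le> C * (norm h)\<^sup>2"
      proof -
        have "\<bar>n k \<bullet> h\<bar> \<le> norm (n k) * norm h" by (rule Cauchy_Schwarz_ineq2)
        also have "\<dots> \<le> norm h" using n1[of k] by (simp add: mult_left_le_one_le)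
        finally have "(n k \<bullet> h)\<^sup>2 \<le> (norm h)\<^sup>2" using power_mono[of "\<bar>n k \<bullet> h\<bar>" "norm h" 2] by simp
        then show ?thesis using C by (intro mult_left_mono)
      qed
      finally have "\<bar>m k\<bar> * \<bar>ridge p (n k \<bullet> V + n k \<bullet> h) - ridge p (n k \<bullet> V) - ridge ?p1 (n k \<bullet> V) * (n k \<bullet> h)\<bar> \<le> \<bar>m k\<bar> * (C * (norm h)\<^sup>2)"
        by (intro mult_left_mono) auto
      then show "\<bar>?r k\<bar> \<le> (\<bar>m k\<bar> * C) * (norm h)\<^sup>2"
        by (simp add: abs_mult[symmetric] inner_add_right right_diff_distrib mult.assoc)
    qed (use ri m in auto)
    also have "\<dots> = K * (norm h)\<^sup>2" by (simp add: K_def)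
    finally show ?thesis .
  qed
  have bl: "bounded_linear ?D"
    by (intro linear_conv_bounded_linear[THEN iffD1] linearI)
       (simp_all add: distrib_right sum.distrib sum_distrib_left mult.assoc)
  show ?thesis
    unfolding has_derivative_at
  proof (intro conjI bl)
    show "(\<lambda>h. norm (ridge_mix m n p (V + h) - ridge_mix m n p V - ?D h) / norm h) \<midarrow>0\<rightarrow> 0"
    proof (rule Lim_null_comparison)
      show "\<forall>\<^sub>F h in at 0. norm (norm (ridge_mix m n p (V + h) - ridge_mix m n p V - ?D h) / norm h) \<le> K * norm h"
      proof (rule eventually_at_topological[THEN iffD2], intro exI[of _ UNIV] conjI allI impI ballI)
        fix h :: "real^'n" assume "h \<noteq> 0"
        then show "norm (norm (ridge_mix m n p (V + h) - ridge_mix m n p V - ?D h) / norm h) \<le> K * norm h"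
          using rem[of h] by (simp add: divide_le_eq power2_eq_square mult.assoc)
      qed auto
      show "(\<lambda>h. K * norm h) \<midarrow>0\<rightarrow> 0" by (auto intro!: tendsto_eq_intros)
    qed
  qed
qed

lemma ridge_mix_differentiable:
  fixes n :: "'k::euclidean_space \<Rightarrow> real^'n"
  assumes "integrable lborel m" "n \<in> borel_measurable borel" "\<And>k. norm (n k) \<le> 1"
  shows "ridge_mix m n p differentiable (at V)"
  using ridge_mix_has_derivative[OF assms] differentiable_def by blast

lemma partial_ridge_mix:
  fixes n :: "'k::euclidean_space \<Rightarrow> real^'n"
  assumes "integrable lborel m" "n \<in> borel_measurable borel" "\<And>k. norm (n k) \<le> 1"
  shows "partial i (ridge_mix m n p) = ridge_mix (\<lambda>k. m k * n k $ i) n (hermite_step p)"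
proof
  fix V
  have "partial i (ridge_mix m n p) V = (\<Sum>j\<in>UNIV. axis i 1 $ j * ridge_mix (\<lambda>k. m k * n k $ j) n (hermite_step p) V)"
    by (rule partial_eqI[OF ridge_mix_has_derivative[OF assms]])
  also have "\<dots> = (\<Sum>j\<in>UNIV. if j = i then ridge_mix (\<lambda>k. m k * n k $ i) n (hermite_step p) V else 0)"
    by (intro sum.cong) (auto simp: axis_def)
  finally show "partial i (ridge_mix m n p) V = ridge_mix (\<lambda>k. m k * n k $ i) n (hermite_step p) V" by simp
qed

text \<open>A derivative of a superposition is again a superposition: the weight is multiplied by a
  component of the direction, which keeps it integrable, and the polynomial changes. So
  integrability of the weight alone gives smoothness of all orders.\<close>

lemma C_k_ridge_mix:
  fixes n :: "'k::euclidean_space \<Rightarrow> real^'n"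
  assumes "integrable lborel m" "n \<in> borel_measurable borel" "\<And>k. norm (n k) \<le> 1"
  shows "C_k l (ridge_mix m n p)"
  using assms
proof (induction l arbitrary: m p)
  case 0
  then show ?case
    using ridge_mix_differentiable[of m n p] by (simp add: continuous_on_eq_continuous_at differentiable_imp_continuous_within)
next
  case (Suc l)
  then show ?case
    using ridge_mix_differentiable[of m n p] by (simp add: partial_ridge_mix integrable_mult_unit_component)
qed

section \<open>Square roots of positive definite matrices\<close>

lemma symmetric_inner:
  assumes "transpose A = A" shows "x \<bullet> (A *v y) = (A *v x) \<bullet> (y :: real^'n)"
  using assms by (metis dot_lmul_matrix vector_transpose_matrix)

lemma quadratic_nonneg_linear_zero:
  fixes a c :: real
  assumes "\<And>t. 0 \<le> 2 * t * a + t\<^sup>2 * c"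
  shows "a = 0"
proof (rule ccontr)
  assume a: "a \<noteq> 0"
  define m where "m = \<bar>c\<bar> + 1"
  have m: "m > 0" "c < m" by (auto simp: m_def)
  have "0 \<le> 2 * (- a / m) * a + (- a / m)\<^sup>2 * c" by (rule assms)
  also have "\<dots> = (a\<^sup>2 / m) * (c / m - 2)" using m by (simp add: field_simps power2_eq_square)
  also have "\<dots> < 0" using a m by (intro mult_pos_neg) (auto simp: field_simps)
  finally show False by simp
qed

text \<open>Partial eigenbases, which are enlarged until they span.\<close>

definition eigen_orthonormal :: "real^'n^'n \<Rightarrow> (real^'n) set \<Rightarrow> bool" where
  "eigen_orthonormal A B \<longleftrightarrow> pairwise orthogonal B \<and> (\<forall>b\<in>B. norm b = 1 \<and> (\<exists>c. A *v b = c *\<^sub>R b))"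

lemma eigen_orthonormal_independent: "eigen_orthonormal A B \<Longrightarrow> independent B"
  unfolding eigen_orthonormal_def by (intro pairwise_orthogonal_independent) force+

text \<open>The orthogonal complement \<open>W\<close> of \<open>B\<close> is invariant under \<open>A\<close>. A maximiser \<open>u\<close> of the
  quadratic form on its unit sphere is an eigenvector, since the first variation in the
  direction \<open>l u - A u\<close> vanishes.\<close>

lemma eigen_orthonormal_extend:
  fixes A :: "real^'n^'n"
  assumes A: "transpose A = A" and B: "eigen_orthonormal A B" and sp: "span B \<noteq> UNIV"
  shows "\<exists>u. u \<notin> B \<and> eigen_orthonormal A (insert u B)"
proof -
  define W where "W = {x. \<forall>b\<in>B. b \<bullet> x = 0}"
  define S where "S = W \<inter> sphere 0 1"
  have W: "subspace W" unfolding W_def subspace_def by (auto simp: inner_add_right)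
  have AW: "A *v x \<in> W" if "x \<in> W" for x
  proof -
    have "b \<bullet> (A *v x) = 0" if "b \<in> B" for b
    proof -
      obtain c where "A *v b = c *\<^sub>R b" using B \<open>b \<in> B\<close> unfolding eigen_orthonormal_def by auto
      then show ?thesis using \<open>x \<in> W\<close> \<open>b \<in> B\<close> by (simp add: symmetric_inner[OF A] W_def)
    qed
    then show ?thesis by (simp add: W_def)
  qed
  have "dim B < DIM(real^'n)"
    using sp dim_subset_UNIV[of B] dim_eq_full[of B] by linarith
  then obtain z where z: "z \<noteq> 0" "\<And>y. y \<in> span B \<Longrightarrow> orthogonal z y"
    using orthogonal_to_subspace_exists[of B] by (metis dim_span)
  then have "sgn z \<in> S"
    by (auto simp: S_def W_def norm_sgn sgn_div_norm orthogonal_def inner_commute span_base)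
  moreover have "closed W"
    using W closed_subspace by blast
  then have "compact S" unfolding S_def by (intro closed_Int_compact) auto
  moreover have "continuous_on S (\<lambda>x. x \<bullet> (A *v x))"
    by (intro continuous_intros linear_continuous_on) (simp add: linear_linear matrix_vector_mul_linear)
  ultimately obtain u where u: "u \<in> S" "\<And>y. y \<in> S \<Longrightarrow> y \<bullet> (A *v y) \<le> u \<bullet> (A *v u)"
    using continuous_attains_sup[of S] by blast
  define l where "l = u \<bullet> (A *v u)"
  have u1: "norm u = 1" "u \<in> W" using u by (auto simp: S_def)
  have le: "y \<bullet> (A *v y) \<le> l * (norm y)\<^sup>2" if "y \<in> W" for y
  proof (cases "y = 0")
    case False
    have "sgn y \<in> S" using that False W by (auto simp: S_def norm_sgn sgn_div_norm subspace_scale)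
    then have "sgn y \<bullet> (A *v sgn y) \<le> l" using u by (simp add: l_def)
    then show ?thesis using False
      by (simp add: sgn_div_norm matrix_vector_mult_scaleR power2_eq_square field_simps)
  qed simp
  define w where "w = l *\<^sub>R u - A *v u"
  have w: "w \<in> W" unfolding w_def using u1 AW W by (simp add: subspace_diff subspace_scale)
  have "l * (u \<bullet> w) - w \<bullet> (A *v u) = 0"
  proof (rule quadratic_nonneg_linear_zero)
    fix t
    have "u + t *\<^sub>R w \<in> W" using u1 w W by (simp add: subspace_add subspace_scale)
    from le[OF this] have le': "(u + t *\<^sub>R w) \<bullet> (A *v (u + t *\<^sub>R w)) \<le> l * ((u + t *\<^sub>R w) \<bullet> (u + t *\<^sub>R w))"
      by (simp add: dot_square_norm)
    have uw: "u \<bullet> (A *v w) = w \<bullet> (A *v u)"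
      using symmetric_inner[OF A, of u w] by (simp add: inner_commute)
    have e1: "(u + t *\<^sub>R w) \<bullet> (A *v (u + t *\<^sub>R w)) = l + 2 * t * (w \<bullet> (A *v u)) + t\<^sup>2 * (w \<bullet> (A *v w))"
      unfolding matrix_vector_right_distrib matrix_vector_mult_scaleR inner_add_left inner_add_right
        inner_scaleR_left inner_scaleR_right uw l_def[symmetric]
      by (simp add: power2_eq_square algebra_simps)
    have e2: "(u + t *\<^sub>R w) \<bullet> (u + t *\<^sub>R w) = 1 + 2 * t * (u \<bullet> w) + t\<^sup>2 * (w \<bullet> w)"
      using u1 unfolding inner_add_left inner_add_right inner_scaleR_left inner_scaleR_right inner_commute[of w u]
      by (simp add: power2_eq_square dot_square_norm algebra_simps)
    show "0 \<le> 2 * t * (l * (u \<bullet> w) - w \<bullet> (A *v u)) + t\<^sup>2 * (l * (w \<bullet> w) - w \<bullet> (A *v w))"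
      using le'[unfolded e1 e2] by (simp add: algebra_simps)
  qed
  moreover have "w \<bullet> w = l * (u \<bullet> w) - w \<bullet> (A *v u)"
    by (subst (2) w_def) (simp add: inner_diff_right inner_commute[of w u])
  ultimately have "w \<bullet> w = 0" by simp
  then have eig: "A *v u = l *\<^sub>R u" by (simp add: w_def)
  have "u \<notin> B"
  proof
    assume "u \<in> B"
    then have "u \<bullet> u = 0" using u1 by (simp add: W_def)
    then show False using u1 by simp
  qed
  moreover have "eigen_orthonormal A (insert u B)"
    using B u1 eig unfolding eigen_orthonormal_def W_def
    by (auto simp: pairwise_insert orthogonal_def inner_commute)
  ultimately show ?thesis by blast
qed

lemma symmetric_eigenbasis:
  fixes A :: "real^'n^'n"
  assumes A: "transpose A = A"
  shows "\<exists>B. eigen_orthonormal A B \<and> span B = UNIV"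
proof -
  have "\<exists>B. eigen_orthonormal A B \<and> (\<forall>C. eigen_orthonormal A C \<longrightarrow> card C \<le> card B)"
  proof -
    have "eigen_orthonormal A {}" by (simp add: eigen_orthonormal_def)
    moreover have "\<forall>C. eigen_orthonormal A C \<longrightarrow> card C < Suc DIM(real^'n)"
      using independent_bound[OF eigen_orthonormal_independent, of A] unfolding less_Suc_eq_le by blast
    ultimately show ?thesis
      by (rule Lattices_Big.ex_has_greatest_nat[where P="eigen_orthonormal A" and f=card and k="{}" and b="Suc DIM(real^'n)"])
  qed
  then obtain B where B: "eigen_orthonormal A B" "\<And>C. eigen_orthonormal A C \<Longrightarrow> card C \<le> card B" by blast
  have fin: "finite B" by (rule independent_imp_finite[OF eigen_orthonormal_independent[OF B(1)]])
  have "span B = UNIV"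
  proof (rule ccontr)
    assume "span B \<noteq> UNIV"
    then obtain u where u: "u \<notin> B" "eigen_orthonormal A (insert u B)"
      using eigen_orthonormal_extend[OF A B(1)] by blast
    then show False using B(2)[OF u(2)] fin by simp
  qed
  with B show ?thesis by blast
qed

lemma outer_mult_vec: "outer a b *v x = (b \<bullet> x) *\<^sub>R a"
  by (simp add: outer_def matrix_vector_mult_def vec_eq_iff inner_vec_def sum_distrib_left sum_distrib_right mult_ac)

lemma sum_matrix_mult_vec: "(\<Sum>b\<in>B. M b) *v x = (\<Sum>b\<in>B. M b *v (x :: real^'n))"
  by (induction B rule: infinite_finite_induct) (auto simp: matrix_vector_mult_add_rdistrib)

lemma matrix_eq_on_span:
  fixes A C :: "real^'n^'n"
  assumes "span B = UNIV" "\<And>b. b \<in> B \<Longrightarrow> A *v b = C *v b"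
  shows "A = C"
proof -
  have "A *v x = C *v x" for x
    using linear_eq_on_span[of "(*v) A" "(*v) C" B x] assms by (simp add: matrix_vector_mul_linear)
  then show ?thesis by (simp add: matrix_eq)
qed

text \<open>Existence: take square roots of the eigenvalues. Uniqueness: if \<open>T\<close> is another root and
  \<open>b\<close> an eigenvector for \<open>l\<close>, then \<open>w = T b - sqrt l b\<close> satisfies \<open>T w = - sqrt l w\<close>, so
  positivity of \<open>T\<close> forces \<open>w = 0\<close>.\<close>

theorem spd_sqrt_works:
  fixes A :: "real^'n^'n"
  assumes A: "sym_pos_def A"
  shows "sym_pos_def (spd_sqrt A)" and "spd_sqrt A ** spd_sqrt A = A"
proof -
  have sym: "transpose A = A" using A by (simp add: sym_pos_def_def)
  obtain B where B: "eigen_orthonormal A B" "span B = UNIV" using symmetric_eigenbasis[OF sym] by blast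
  have fin: "finite B" by (rule independent_imp_finite[OF eigen_orthonormal_independent[OF B(1)]])
  define l where "l b = (SOME c. A *v b = c *\<^sub>R b)" for b
  have l: "A *v b = l b *\<^sub>R b" if "b \<in> B" for b
    using B(1) that unfolding eigen_orthonormal_def l_def by (auto intro: someI_ex)
  have nb: "b \<bullet> b = 1" if "b \<in> B" for b
    using B(1) that unfolding eigen_orthonormal_def by (simp add: dot_square_norm)
  have ob: "b \<bullet> b' = (if b' = b then 1 else 0)" if "b \<in> B" "b' \<in> B" for b b'
    using B(1) that nb unfolding eigen_orthonormal_def pairwise_def orthogonal_def by auto
  have lpos: "l b > 0" if "b \<in> B" for b
  proof -
    have "b \<noteq> 0" using nb[OF that] by auto
    then have "0 < b \<bullet> (A *v b)" using A by (simp add: sym_pos_def_def)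
    then show ?thesis using l nb that by simp
  qed
  define S where "S = (\<Sum>b\<in>B. sqrt (l b) *\<^sub>R outer b b)"
  have Sx: "S *v x = (\<Sum>b\<in>B. (sqrt (l b) * (b \<bullet> x)) *\<^sub>R b)" for x
    unfolding S_def sum_matrix_mult_vec
    by (intro sum.cong refl) (simp add: outer_mult_vec flip: scaleR_matrix_vector_assoc)
  have Sb: "S *v b = sqrt (l b) *\<^sub>R b" if "b \<in> B" for b
  proof -
    have "S *v b = (\<Sum>b'\<in>B. if b' = b then sqrt (l b) *\<^sub>R b else 0)"
      unfolding Sx using that ob by (intro sum.cong) auto
    then show ?thesis using that fin by simp
  qed
  have Spd: "sym_pos_def S"
    unfolding sym_pos_def_def
  proof (intro conjI allI impI)
    show "transpose S = S"
      by (simp add: S_def transpose_def vec_eq_iff outer_def mult_ac)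
    fix x :: "real^'n" assume "x \<noteq> 0"
    have "\<exists>b\<in>B. b \<bullet> x \<noteq> 0"
    proof (rule ccontr)
      assume "\<not> ?thesis"
      then have "\<And>b. b \<in> B \<Longrightarrow> orthogonal x b" by (simp add: orthogonal_def inner_commute)
      then have "orthogonal x x" using orthogonal_to_span[of x B x] B(2) by auto
      then show False using \<open>x \<noteq> 0\<close> by (simp add: orthogonal_self)
    qed
    then obtain b0 where b0: "b0 \<in> B" "b0 \<bullet> x \<noteq> 0" by blast
    have "x \<bullet> (S *v x) = (\<Sum>b\<in>B. sqrt (l b) * (b \<bullet> x)\<^sup>2)"
      unfolding Sx by (simp add: inner_sum_right inner_commute[of x] power2_eq_square mult_ac)
    also have "\<dots> > 0"
      using b0 lpos by (intro sum_pos2[OF fin b0(1)]) (auto simp: less_imp_le)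
    finally show "0 < x \<bullet> (S *v x)" .
  qed
  have SS: "S ** S = A"
  proof (rule matrix_eq_on_span[OF B(2)])
    fix b assume b: "b \<in> B"
    show "(S ** S) *v b = A *v b"
      using lpos[OF b] by (simp add: matrix_vector_mul_assoc[symmetric] Sb[OF b] l[OF b] matrix_vector_mult_scaleR)
  qed
  have uniq: "T = S" if T: "sym_pos_def T" "T ** T = A" for T
  proof (rule matrix_eq_on_span[OF B(2)])
    fix b assume b: "b \<in> B"
    define w where "w = T *v b - sqrt (l b) *\<^sub>R b"
    have "T *v (T *v b) = l b *\<^sub>R b" using T(2) l[OF b] by (simp add: matrix_vector_mul_assoc)
    then have "T *v w = - sqrt (l b) *\<^sub>R w"
      using lpos[OF b] by (simp add: w_def matrix_vector_mult_diff_distrib matrix_vector_mult_scaleR scaleR_diff_right)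
    then have "w \<bullet> (T *v w) = - sqrt (l b) * (w \<bullet> w)" by simp
    also have "\<dots> \<le> 0" using lpos[OF b] by simp
    finally have "\<not> 0 < w \<bullet> (T *v w)" by simp
    then have "w = 0" using T(1) unfolding sym_pos_def_def by blast
    then show "T *v b = S *v b" by (simp add: w_def Sb[OF b])
  qed
  have "spd_sqrt A = S"
    unfolding spd_sqrt_def
  proof (rule the_equality)
    show "sym_pos_def S \<and> S ** S = A" using Spd SS by (rule conjI)
    show "T = S" if "sym_pos_def T \<and> T ** T = A" for T
      using that by (elim conjE) (rule uniq)
  qed
  then show "sym_pos_def (spd_sqrt A)" "spd_sqrt A ** spd_sqrt A = A" using Spd SS by simp_all
qed

section \<open>Absolute convergence of the flight integrals\<close>

lemma integral_scaled_gaussian: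
  fixes s :: real
  assumes "s \<noteq> 0"
  shows "(\<integral>k. exp (- s\<^sup>2 * (norm k)\<^sup>2 / 2) \<partial>(lborel :: 'a::euclidean_space measure)) = sqrt (2 * pi) ^ DIM('a) / \<bar>s\<bar> ^ DIM('a)"
proof -
  have "sqrt (2 * pi) ^ DIM('a) = (\<integral>x. exp (- (norm x)\<^sup>2 / 2) \<partial>(lborel :: 'a measure))"
    by (rule gaussian_nd(2)[symmetric])
  also have "\<dots> = \<bar>s\<bar> ^ DIM('a) * (\<integral>x. exp (- (norm (0 + s *\<^sub>R x))\<^sup>2 / 2) \<partial>(lborel :: 'a measure))"
    by (rule integral_lborel_affine[OF _ assms]) measurable
  finally show ?thesis using assms by (simp add: power_mult_distrib)
qed

text \<open>Write \<open>1 / \<bar>v\<bar>\<^sup>2\<close> as the integral of \<open>exp (- r \<bar>v\<bar>\<^sup>2)\<close> over \<open>r \<ge> 0\<close>. By Tonelli's theorem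
  the integral over \<open>v\<close> comes first and is a multiple of \<open>r + 1/4\<close> to the power \<open>- d / 2\<close>, which
  for \<open>d \<ge> 4\<close> is at most a multiple of the power \<open>-2\<close>.\<close>

lemma integrable_inverse_square_gaussian:
  assumes d: "DIM('a) \<ge> 4"
  shows "integrable lborel (\<lambda>v::'a::euclidean_space. exp (- (norm v)\<^sup>2 / 4) / (norm v)\<^sup>2)"
proof (rule integrableI_bounded)
  let ?d = "DIM('a)"
  define c where "c = sqrt (2 * pi) ^ ?d * sqrt 2 ^ (?d - 4)"
  have c: "c \<ge> 0" by (simp add: c_def)
  have r: "(\<integral>\<^sup>+r. ennreal (exp (- r * a)) * indicator {0..} r \<partial>lborel) = ennreal (1 / a)" if "a > 0" for a :: real
  proof -
    have "filterlim (\<lambda>r. (- a) * r) at_bot at_top"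
      by (rule filterlim_tendsto_neg_mult_at_bot[OF tendsto_const _ filterlim_ident]) (use that in simp)
    then have "((\<lambda>r. exp ((- a) * r)) \<longlongrightarrow> 0) at_top" by (rule filterlim_compose[OF exp_at_bot])
    from tendsto_mult_right[OF this, of "- (1 / a)"]
    have "((\<lambda>r. - exp (- r * a) / a) \<longlongrightarrow> 0) at_top" by (simp add: mult.commute)
    then have "(\<integral>\<^sup>+r. ennreal (exp (- r * a)) * indicator {0..} r \<partial>lborel) = ennreal (0 - (- exp (- 0 * a) / a))"
      using that by (intro nn_integral_FTC_atLeast) (auto intro!: derivative_eq_intros)
    then show ?thesis by simp
  qed
  have "(\<integral>\<^sup>+v. norm (exp (- (norm (v::'a))\<^sup>2 / 4) / (norm v)\<^sup>2) \<partial>lborel)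
      = (\<integral>\<^sup>+v. (\<integral>\<^sup>+r. ennreal (exp (- (r + 1 / 4) * (norm (v::'a))\<^sup>2)) * indicator {0..} r \<partial>lborel) \<partial>lborel)"
  proof (rule nn_integral_cong_AE)
    have *: "(\<integral>\<^sup>+r. ennreal (exp (- (r + 1 / 4) * (norm v)\<^sup>2)) * indicator {0..} r \<partial>lborel)
        = ennreal (norm (exp (- (norm v)\<^sup>2 / 4) / (norm v)\<^sup>2))" if "v \<noteq> 0" for v :: 'a
    proof -
      have e: "exp (- (r + 1 / 4) * (norm v)\<^sup>2) = exp (- (norm v)\<^sup>2 / 4) * exp (- r * (norm v)\<^sup>2)" for r
        by (simp add: exp_add[symmetric] algebra_simps)
      have "(\<integral>\<^sup>+r. ennreal (exp (- (r + 1 / 4) * (norm v)\<^sup>2)) * indicator {0..} r \<partial>lborel)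
         = ennreal (exp (- (norm v)\<^sup>2 / 4)) * ennreal (1 / (norm v)\<^sup>2)"
        unfolding e using that by (subst r[symmetric]) (auto simp: ennreal_mult' mult.assoc intro!: nn_integral_cmult)
      then show ?thesis by (simp add: ennreal_mult'[symmetric])
    qed
    show "AE v::'a in lborel. ennreal (norm (exp (- (norm v)\<^sup>2 / 4) / (norm v)\<^sup>2)) = (\<integral>\<^sup>+r. ennreal (exp (- (r + 1 / 4) * (norm v)\<^sup>2)) * indicator {0..} r \<partial>lborel)"
      by (rule AE_mp[OF AE_lborel_singleton[of "0::'a"]], rule AE_I2, rule impI, rule *[symmetric])
  qed
  also have "\<dots> = (\<integral>\<^sup>+r. (\<integral>\<^sup>+v. ennreal (exp (- (r + 1 / 4) * (norm (v::'a))\<^sup>2)) * indicator {0..} r \<partial>lborel) \<partial>lborel)"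
    by (rule lborel_pair.Fubini') measurable
  also have "\<dots> \<le> (\<integral>\<^sup>+r. ennreal (c / (2 * r + 1 / 2)\<^sup>2) * indicator {0..} r \<partial>lborel)"
  proof (rule nn_integral_mono)
    fix r :: real
    show "(\<integral>\<^sup>+v. ennreal (exp (- (r + 1 / 4) * (norm (v::'a))\<^sup>2)) * indicator {0..} r \<partial>lborel) \<le> ennreal (c / (2 * r + 1 / 2)\<^sup>2) * indicator {0..} r"
    proof (cases "r \<ge> 0")
      case True
      define s where "s = sqrt (2 * r + 1 / 2)"
      have s2: "s\<^sup>2 = 2 * r + 1 / 2" using True by (simp add: s_def)
      have s: "s > 0" "sqrt (1/2) \<le> s" using True by (auto simp: s_def)
      have e: "exp (- (r + 1 / 4) * (norm v)\<^sup>2) = exp (- s\<^sup>2 * (norm v)\<^sup>2 / 2)" for v :: 'a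
        unfolding s2 by (simp add: field_simps)
      have "(\<integral>\<^sup>+v. ennreal (exp (- (r + 1 / 4) * (norm (v::'a))\<^sup>2)) \<partial>lborel) = ennreal (sqrt (2 * pi) ^ ?d / s ^ ?d)"
      proof -
        have "(\<integral>\<^sup>+v. ennreal (exp (- s\<^sup>2 * (norm (v::'a))\<^sup>2 / 2)) \<partial>lborel) = ennreal (LBINT v. exp (- s\<^sup>2 * (norm (v::'a))\<^sup>2 / 2))"
          using s integrable_scaled_gaussian[of s, where 'a='a] by (intro nn_integral_eq_integral) auto
        then show ?thesis unfolding e using integral_scaled_gaussian[of s, where 'a='a] s by simp
      qed
      also have "sqrt (2 * pi) ^ ?d / s ^ ?d \<le> c / (2 * r + 1 / 2)\<^sup>2"
      proof -
        have "(1 / s) ^ (?d - 4) \<le> sqrt 2 ^ (?d - 4)"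
          using s by (intro power_mono) (auto simp: field_simps real_sqrt_divide)
        then have "sqrt (2 * pi) ^ ?d * ((1 / s) ^ (?d - 4) * (1 / s) ^ 4) \<le> sqrt (2 * pi) ^ ?d * (sqrt 2 ^ (?d - 4) * (1 / s) ^ 4)"
          using s by (intro mult_left_mono mult_right_mono) auto
        moreover have "(1 / s) ^ (?d - 4) * (1 / s) ^ 4 = 1 / s ^ ?d"
          using d by (simp add: power_add[symmetric] power_one_over)
        moreover have "s ^ 4 = (2 * r + 1 / 2)\<^sup>2"
          unfolding s2[symmetric] by (simp flip: power_mult)
        ultimately show ?thesis by (simp add: c_def power_one_over)
      qed
      finally show ?thesis using True by (simp add: ennreal_leI)
    qed simp
  qed
  also have "\<dots> = (\<integral>\<^sup>+r. ennreal (c / 4 * (inverse (r + 1 / 4))\<^sup>2) * indicator {0..} r \<partial>lborel)"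
  proof -
    have "c / (2 * r + 1 / 2)\<^sup>2 = c / 4 * (inverse (r + 1 / 4))\<^sup>2" for r
    proof -
      have e: "2 * r + 1 / 2 = 2 * (r + 1 / 4)" by simp
      show ?thesis unfolding e power_mult_distrib by (simp add: power_one_over inverse_eq_divide)
    qed
    then show ?thesis by (simp only:)
  qed
  also have "\<dots> = ennreal (0 - (- (c / 4) * inverse (0 + 1 / 4)))"
  proof (rule nn_integral_FTC_atLeast)
    have "filterlim (\<lambda>r::real. 1 / 4 + r) at_top at_top"
      by (intro filterlim_tendsto_add_at_top[OF tendsto_const] filterlim_ident)
    then have "filterlim (\<lambda>r::real. r + 1 / 4) at_top at_top" by (simp add: add.commute)
    then have "((\<lambda>r::real. inverse (r + 1 / 4)) \<longlongrightarrow> 0) at_top" by (rule tendsto_inverse_0_at_top)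
    from tendsto_mult_left[OF this, of "- (c / 4)"]
    show "((\<lambda>r. - (c / 4) * inverse (r + 1 / 4)) \<longlongrightarrow> 0) at_top" by (simp only: mult_zero_right)
    show "((\<lambda>r. - (c / 4) * inverse (r + 1 / 4)) has_real_derivative c / 4 * (inverse (r + 1 / 4))\<^sup>2) (at r)" if "0 \<le> r" for r
      using that by (auto intro!: derivative_eq_intros simp: power2_eq_square)
  qed (use c in auto)
  also have "\<dots> < \<infinity>" by simp
  finally show "(\<integral>\<^sup>+v. norm (exp (- (norm (v::'a))\<^sup>2 / 4) / (norm v)\<^sup>2) \<partial>lborel) < \<infinity>" .
qed measurable

text \<open>The shift is absorbed by a wider Gaussian.\<close>

lemma gauss_shift_bound:
  fixes v V :: "real^'n"
  shows "gauss (v + V) \<le> exp ((norm V)\<^sup>2 / 2) / sqrt (2 * pi) ^ CARD('n) * exp (- (norm v)\<^sup>2 / 4)"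
proof -
  have "(norm v)\<^sup>2 = (norm ((v + V) - V))\<^sup>2" by simp
  also have "\<dots> \<le> 2 * (norm (v + V))\<^sup>2 + 2 * (norm V)\<^sup>2"
  proof -
    have "norm ((v + V) - V) \<le> norm (v + V) + norm V" by (rule norm_triangle_ineq4)
    then have "(norm ((v + V) - V))\<^sup>2 \<le> (norm (v + V) + norm V)\<^sup>2" by (intro power_mono) auto
    also have "\<dots> \<le> 2 * (norm (v + V))\<^sup>2 + 2 * (norm V)\<^sup>2"
      using zero_le_power2[of "norm (v + V) - norm V"] by (simp add: power2_eq_square algebra_simps)
    finally show ?thesis .
  qed
  finally have "- (norm (v + V))\<^sup>2 / 2 \<le> (norm V)\<^sup>2 / 2 + - (norm v)\<^sup>2 / 4" by simp
  then have "exp (- (norm (v + V))\<^sup>2 / 2) \<le> exp ((norm V)\<^sup>2 / 2) * exp (- (norm v)\<^sup>2 / 4)"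
    by (simp only: exp_add[symmetric] exp_le_cancel_iff)
  then show ?thesis unfolding gauss_eq by (simp add: divide_right_mono)
qed

lemma integrable_gauss_inverse_square:
  assumes "CARD('n) \<ge> 4"
  shows "integrable lborel (\<lambda>v::real^'n. gauss (v + V) / (norm v)\<^sup>2)"
proof -
  let ?C = "exp ((norm V)\<^sup>2 / 2) / sqrt (2 * pi) ^ CARD('n)"
  have "integrable lborel (\<lambda>v::real^'n. exp (- (norm v)\<^sup>2 / 4) / (norm v)\<^sup>2)"
    using integrable_inverse_square_gaussian[where 'a="real^'n"] assms by simp
  then have i: "integrable lborel (\<lambda>v::real^'n. ?C * (exp (- (norm v)\<^sup>2 / 4) / (norm v)\<^sup>2))"
    by (rule integrable_mult_right)
  show ?thesis
  proof (rule Bochner_Integration.integrable_bound[OF i], measurable, intro AE_I2)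
    fix v :: "real^'n"
    have "gauss (v + V) / (norm v)\<^sup>2 \<le> (?C * exp (- (norm v)\<^sup>2 / 4)) / (norm v)\<^sup>2"
      by (intro divide_right_mono gauss_shift_bound) simp
    then show "norm (gauss (v + V) / (norm v)\<^sup>2) \<le> norm (?C * (exp (- (norm v)\<^sup>2 / 4) / (norm v)\<^sup>2))"
      using gauss_pos[of "v + V"] by (simp add: abs_mult)
  qed
qed

text \<open>The common majorant of the position-space integrals. If \<open>x\<close> and \<open>x + s v\<close> both lie in the
  ball of radius \<open>R\<close>, then \<open>\<bar>s\<bar> \<bar>v\<bar> \<le> 2 R\<close>; the factor \<open>1 + \<bar>s\<bar>\<close> dominates the weights \<open>1\<close> and
  \<open>s\<close> of the diffusion matrix and of the drift.\<close>

definition flight_kernel :: "real \<Rightarrow> real^'n \<Rightarrow> (real^'n) \<times> real \<Rightarrow> real" where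
  "flight_kernel R V = (\<lambda>(v, s). gauss (v + V) * ((1 + \<bar>s\<bar>) * indicator {s. \<bar>s\<bar> * norm v \<le> 2 * R} s))"

lemma flight_kernel_measurable [measurable]: "flight_kernel R V \<in> borel_measurable borel"
proof -
  have "flight_kernel R V \<in> borel_measurable (borel \<Otimes>\<^sub>M borel)"
    unfolding flight_kernel_def by measurable
  then show ?thesis by (simp add: borel_prod)
qed

text \<open>The integral over \<open>s\<close> extends over an interval of length \<open>4 R / \<bar>v\<bar>\<close>, hence is at most a
  multiple of \<open>1 + 1 / \<bar>v\<bar>\<^sup>2\<close>.\<close>

lemma flight_kernel_integrable:
  fixes V :: "real^'n"
  assumes d: "CARD('n) \<ge> 4" and R: "R > 0"
  shows "integrable lborel (flight_kernel R V)"
proof (rule integrableI_bounded)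
  have nn: "0 \<le> flight_kernel R V z" for z
    using gauss_pos[of "fst z + V"] by (auto simp: flight_kernel_def split: prod.split)
  have "(\<integral>\<^sup>+z. norm (flight_kernel R V z) \<partial>lborel) = (\<integral>\<^sup>+z. flight_kernel R V z \<partial>(lborel \<Otimes>\<^sub>M lborel))"
    using nn by (simp add: lborel_prod)
  also have "\<dots> = (\<integral>\<^sup>+v. (\<integral>\<^sup>+s. flight_kernel R V (v, s) \<partial>lborel) \<partial>lborel)"
    by (rule lborel.nn_integral_fst[symmetric]) (simp add: lborel_prod)
  also have "\<dots> \<le> (\<integral>\<^sup>+v. ennreal ((4 * R + 8 * R\<^sup>2) * (gauss (v + V) + gauss (v + V) / (norm v)\<^sup>2)) \<partial>lborel)"
  proof (rule nn_integral_mono_AE)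
    have *: "(\<integral>\<^sup>+s. flight_kernel R V (v, s) \<partial>lborel) \<le> ennreal ((4 * R + 8 * R\<^sup>2) * (gauss (v + V) + gauss (v + V) / (norm v)\<^sup>2))"
      if v: "v \<noteq> 0" for v :: "real^'n"
    proof -
      define T where "T = 2 * R / norm v"
      have T: "T \<ge> 0" using R by (simp add: T_def)
      have g: "gauss (v + V) \<ge> 0" using gauss_pos[of "v + V"] by simp
      have ge0: "0 \<le> gauss (v + V) * (1 + T)" using g T by simp
      have "(\<integral>\<^sup>+s. flight_kernel R V (v, s) \<partial>lborel) \<le> (\<integral>\<^sup>+s. ennreal (gauss (v + V) * (1 + T)) * indicator {-T..T} s \<partial>lborel)"
      proof (rule nn_integral_mono)
        fix s :: real
        have "\<bar>s\<bar> * norm v \<le> 2 * R \<longleftrightarrow> \<bar>s\<bar> \<le> T" using v by (simp add: T_def field_simps)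
        then show "ennreal (flight_kernel R V (v, s)) \<le> ennreal (gauss (v + V) * (1 + T)) * indicator {-T..T} s"
          using g by (auto simp: flight_kernel_def indicator_def intro!: ennreal_leI mult_left_mono)
      qed
      also have "\<dots> = ennreal (gauss (v + V) * (1 + T)) * ennreal (2 * T)"
        using T by (subst nn_integral_cmult_indicator) auto
      also have "\<dots> = ennreal (gauss (v + V) * (2 * T + 2 * T\<^sup>2))"
      proof -
        have "gauss (v + V) * (1 + T) * (2 * T) = gauss (v + V) * (2 * T + 2 * T\<^sup>2)"
          by (simp add: algebra_simps power2_eq_square)
        then show ?thesis by (simp only: ennreal_mult'[OF ge0, symmetric])
      qed
      also have "\<dots> \<le> ennreal ((4 * R + 8 * R\<^sup>2) * (gauss (v + V) + gauss (v + V) / (norm v)\<^sup>2))"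
      proof (rule ennreal_leI)
        define a where "a = 1 / norm v"
        have a0: "a \<ge> 0" by (simp add: a_def)
        have "0 \<le> (a - 1 / 2) * (a - 1 / 2)" by simp
        then have "a \<le> 1 + a\<^sup>2" by (simp add: power2_eq_square algebra_simps)
        with a0 have a: "a \<ge> 0" "a \<le> 1 + a\<^sup>2" by simp_all
        have "2 * T + 2 * T\<^sup>2 = 4 * R * a + 8 * R\<^sup>2 * a\<^sup>2"
          by (simp add: T_def a_def power_divide power_mult_distrib)
        also have "\<dots> \<le> 4 * R * (1 + a\<^sup>2) + 8 * R\<^sup>2 * (1 + a\<^sup>2)"
          using a R by (intro add_mono mult_left_mono) auto
        also have "\<dots> = (4 * R + 8 * R\<^sup>2) * (1 + a\<^sup>2)" by (simp add: algebra_simps)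
        finally have "gauss (v + V) * (2 * T + 2 * T\<^sup>2) \<le> gauss (v + V) * ((4 * R + 8 * R\<^sup>2) * (1 + a\<^sup>2))"
          using g by (intro mult_left_mono)
        then show "gauss (v + V) * (2 * T + 2 * T\<^sup>2) \<le> (4 * R + 8 * R\<^sup>2) * (gauss (v + V) + gauss (v + V) / (norm v)\<^sup>2)"
          by (simp add: a_def power_one_over algebra_simps)
      qed
      finally show ?thesis .
    qed
    show "AE v::real^'n in lborel. (\<integral>\<^sup>+s. flight_kernel R V (v, s) \<partial>lborel) \<le> ennreal ((4 * R + 8 * R\<^sup>2) * (gauss (v + V) + gauss (v + V) / (norm v)\<^sup>2))"
      by (rule AE_mp[OF AE_lborel_singleton[of "0::real^'n"]], rule AE_I2, rule impI, rule *)
  qed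
  also have "\<dots> < \<infinity>"
  proof -
    have "integrable lborel (\<lambda>v. (4 * R + 8 * R\<^sup>2) * (gauss (v + V) + gauss (v + V) / (norm v)\<^sup>2))"
      using integrable_gauss_shift[of V] integrable_gauss_inverse_square[OF d, of V] by (intro integrable_mult_right Bochner_Integration.integrable_add)
    then have "(\<integral>\<^sup>+v. ennreal (norm ((4 * R + 8 * R\<^sup>2) * (gauss (v + V) + gauss (v + V) / (norm v)\<^sup>2))) \<partial>lborel) < \<infinity>"
      by (simp only: integrable_iff_bounded)
    moreover have "(\<integral>\<^sup>+v. ennreal ((4 * R + 8 * R\<^sup>2) * (gauss (v + V) + gauss (v + V) / (norm v)\<^sup>2)) \<partial>lborel)
      \<le> (\<integral>\<^sup>+v. ennreal (norm ((4 * R + 8 * R\<^sup>2) * (gauss (v + V) + gauss (v + V) / (norm v)\<^sup>2))) \<partial>lborel)"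
      by (intro nn_integral_mono ennreal_leI) (simp only: real_norm_def abs_ge_self)
    ultimately show ?thesis by (rule order_le_less_trans[rotated])
  qed
  finally show "(\<integral>\<^sup>+z. norm (flight_kernel R V z) \<partial>lborel) < \<infinity>" .
qed simp

lemma integral_lborel_pair:
  fixes h :: "'a::euclidean_space \<times> 'b::euclidean_space \<Rightarrow> real"
  assumes "integrable lborel h"
  shows "integrable lborel (\<lambda>x. LBINT y. h (x, y))"
    and "integrable lborel (\<lambda>y. LBINT x. h (x, y))"
    and "(LBINT z. h z) = (LBINT x. (LBINT y. h (x, y)))"
    and "(LBINT z. h z) = (LBINT y. (LBINT x. h (x, y)))"
proof -
  have h: "integrable (lborel \<Otimes>\<^sub>M lborel) h" "integrable (lborel \<Otimes>\<^sub>M lborel) (\<lambda>(x, y). h (x, y))"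
    using assms by (simp_all add: lborel_prod)
  show "integrable lborel (\<lambda>x. LBINT y. h (x, y))" by (rule lborel_pair.integrable_fst'[OF h(1)])
  show "integrable lborel (\<lambda>y. LBINT x. h (x, y))" using lborel_pair.integrable_snd[OF h(2)] by simp
  show "(LBINT z. h z) = (LBINT x. (LBINT y. h (x, y)))"
    using lborel_pair.integral_fst'[OF h(1)] by (simp add: lborel_prod)
  show "(LBINT z. h z) = (LBINT y. (LBINT x. h (x, y)))"
    using lborel_pair.integral_snd[OF h(2)] by (simp add: lborel_prod)
qed

text \<open>Integrability for each fixed \<open>x\<close> and after each integration is part of the claim, because
  the coefficients are iterated integrals and the Bochner integral of a function that is not
  integrable is zero.\<close>

lemma position_fubini:
  fixes f g :: "real^'n \<Rightarrow> real" and V :: "real^'n"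
  assumes d: "CARD('n) \<ge> 4" and R: "R > 0"
    and f: "cont_supp R f" and g: "cont_supp R g"
    and p[measurable]: "p \<in> borel_measurable borel" and pb: "\<And>s. \<bar>p s\<bar> \<le> 1 + \<bar>s\<bar>"
  shows "integrable lborel (\<lambda>v. gauss (v + V) * (f x * (LBINT s. p s * g (x + s *\<^sub>R v))))"
    and "integrable lborel (\<lambda>x. LBINT v. gauss (v + V) * (f x * (LBINT s. p s * g (x + s *\<^sub>R v))))"
    and "(LBINT x. (LBINT v. gauss (v + V) * (f x * (LBINT s. p s * g (x + s *\<^sub>R v)))))
       = (LBINT s. p s * (LBINT v. gauss (v + V) * (LBINT x. f x * g (x + s *\<^sub>R v))))"
    and "integrable lborel (\<lambda>s. p s * (LBINT v. gauss (v + V) * (LBINT x. f x * g (x + s *\<^sub>R v))))"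
proof -
  note [measurable] = cont_supp_measurable[OF f] cont_supp_measurable[OF g]
  have fi: "integrable lborel f" by (rule cont_supp_integrable[OF f])
  obtain C where C: "C \<ge> 0" "\<And>x. \<bar>g x\<bar> \<le> C" using cont_supp_bounded[OF g] by auto
  define H where "H x z = gauss (fst z + V) * (f x * (p (snd z) * g (x + snd z *\<^sub>R fst z)))" for x z
  have Hb: "\<bar>H x z\<bar> \<le> \<bar>f x\<bar> * (C * flight_kernel R V z)" for x z
  proof -
    obtain v s where z: "z = (v, s)" by force
    show ?thesis
    proof (cases "f x = 0 \<or> g (x + s *\<^sub>R v) = 0")
      case True
      then have "H x z = 0" by (auto simp: H_def z)
      moreover have "0 \<le> flight_kernel R V z" using gauss_pos[of "v + V"] by (simp add: flight_kernel_def z)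
      ultimately show ?thesis using C by simp
    next
      case False
      then have "norm x \<le> R" "norm (x + s *\<^sub>R v) \<le> R" using f g unfolding cont_supp_def by (meson not_le)+
      moreover have "norm (s *\<^sub>R v) \<le> norm (x + s *\<^sub>R v) + norm x"
        using norm_triangle_ineq4[of "x + s *\<^sub>R v" x] by simp
      ultimately have "\<bar>s\<bar> * norm v \<le> 2 * R" by simp
      then have K: "flight_kernel R V z = gauss (v + V) * (1 + \<bar>s\<bar>)" by (simp add: flight_kernel_def z)
      have "\<bar>H x z\<bar> = gauss (v + V) * (\<bar>f x\<bar> * (\<bar>p s\<bar> * \<bar>g (x + s *\<^sub>R v)\<bar>))"
        using gauss_pos[of "v + V"] by (simp add: H_def z abs_mult)
      also have "\<dots> \<le> gauss (v + V) * (\<bar>f x\<bar> * ((1 + \<bar>s\<bar>) * C))"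
        using gauss_pos[of "v + V"] C pb[of s] by (intro mult_left_mono mult_mono) auto
      finally show ?thesis by (simp add: K mult_ac)
    qed
  qed
  have Hm[measurable]: "H x \<in> borel_measurable borel" for x
  proof -
    have "(\<lambda>z. H x z) \<in> borel_measurable (borel \<Otimes>\<^sub>M borel)"
      unfolding H_def by measurable
    then show ?thesis by (simp add: borel_prod)
  qed
  have Hm2: "(\<lambda>(x, z). H x z) \<in> borel_measurable (lborel \<Otimes>\<^sub>M lborel)"
  proof -
    have "(\<lambda>(x, z). H x z) \<in> borel_measurable (borel \<Otimes>\<^sub>M (borel \<Otimes>\<^sub>M borel))"
      unfolding H_def by measurable
    then show ?thesis by (simp add: borel_prod lborel_prod)
  qed
  have Ki: "integrable lborel (\<lambda>z. C * flight_kernel R V z)" using flight_kernel_integrable[OF d R] by simp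
  have Hi: "integrable lborel (H x)" for x
  proof (rule Bochner_Integration.integrable_bound[where f="\<lambda>z. \<bar>f x\<bar> * (C * flight_kernel R V z)"])
    show "AE z in lborel. norm (H x z) \<le> norm (\<bar>f x\<bar> * (C * flight_kernel R V z))"
      using order_trans[OF Hb abs_ge_self] by auto
  qed (use Ki in auto)
  have HI: "integrable (lborel \<Otimes>\<^sub>M lborel) (\<lambda>(x, z). H x z)"
    by (rule Bochner_Integration.integrable_bound[OF integrable_lborel_prod[OF integrable_abs[OF fi] Ki] Hm2])
       (use order_trans[OF Hb abs_ge_self] in auto)
  have in1: "(LBINT s. H x (v, s)) = gauss (v + V) * (f x * (LBINT s. p s * g (x + s *\<^sub>R v)))" for x v
    by (simp add: H_def)
  have in2: "(LBINT v. (LBINT x. H x (v, s))) = p s * (LBINT v. gauss (v + V) * (LBINT x. f x * g (x + s *\<^sub>R v)))" for s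
    by (simp add: H_def mult.left_commute[of _ "p s"])
  have fubx: "integrable lborel (\<lambda>z. LBINT x. H x z)"
    using lborel_pair.integrable_snd[OF HI] by simp
  show "integrable lborel (\<lambda>v. gauss (v + V) * (f x * (LBINT s. p s * g (x + s *\<^sub>R v))))"
    using integral_lborel_pair(1)[OF Hi] by (simp add: in1)
  have e: "(LBINT v. gauss (v + V) * (f x * (LBINT s. p s * g (x + s *\<^sub>R v)))) = (LBINT z. H x z)" for x
    using integral_lborel_pair(3)[OF Hi] by (simp add: in1)
  show "integrable lborel (\<lambda>x. LBINT v. gauss (v + V) * (f x * (LBINT s. p s * g (x + s *\<^sub>R v))))"
    unfolding e using lborel_pair.integrable_fst[OF HI] by simp
  show "(LBINT x. (LBINT v. gauss (v + V) * (f x * (LBINT s. p s * g (x + s *\<^sub>R v)))))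
       = (LBINT s. p s * (LBINT v. gauss (v + V) * (LBINT x. f x * g (x + s *\<^sub>R v))))"
    unfolding e in2[symmetric] integral_lborel_pair(4)[OF fubx, symmetric]
    by (rule lborel_pair.Fubini_integral[symmetric]) (use HI in simp)
  show "integrable lborel (\<lambda>s. p s * (LBINT v. gauss (v + V) * (LBINT x. f x * g (x + s *\<^sub>R v))))"
    using integral_lborel_pair(2)[OF fubx] by (simp add: in2)
qed

section \<open>Taylor expansion of test functions\<close>

lemma test_function_partial:
  assumes "test_function \<phi>" shows "test_function (partial i \<phi>)"
proof -
  have "C_k k (partial i \<phi>)" for k using assms C_k.simps(2)[of k \<phi>] unfolding test_function_def by blast
  moreover have "compact (closure {x. partial i \<phi> x \<noteq> 0})"
    using assms closure_support_partial[of i \<phi>] compact_Int_closed[of "closure {x. \<phi> x \<noteq> 0}" "closure {x. partial i \<phi> x \<noteq> 0}"]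
    unfolding test_function_def by (simp add: Int_absorb1)
  ultimately show ?thesis unfolding test_function_def by blast
qed

lemma test_function_facts:
  assumes "test_function \<phi>"
  shows "\<phi> differentiable (at x)" "continuous_on UNIV \<phi>" "\<exists>C\<ge>0. \<forall>x. \<bar>\<phi> x\<bar> \<le> C"
proof -
  have "C_k 1 \<phi>" "C_k 0 \<phi>" using assms unfolding test_function_def by blast+
  then show "\<phi> differentiable (at x)" and c: "continuous_on UNIV \<phi>" by simp_all
  show "\<exists>C\<ge>0. \<forall>x. \<bar>\<phi> x\<bar> \<le> C"
    using assms bounded_of_compact_support[OF c] unfolding test_function_def by blast
qed

lemma partial_line_derivative:
  fixes \<phi> :: "real^'n \<Rightarrow> real"
  assumes "\<And>y. \<phi> differentiable (at y)"
  shows "((\<lambda>t. \<phi> (x + t *\<^sub>R h)) has_real_derivative (\<Sum>i\<in>UNIV. h $ i * partial i \<phi> (x + t *\<^sub>R h))) (at t)"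
proof -
  have "((\<lambda>t. \<phi> (x + t *\<^sub>R h)) has_derivative (\<lambda>u. \<Sum>i\<in>UNIV. (u *\<^sub>R h) $ i * partial i \<phi> (x + t *\<^sub>R h))) (at t)"
    by (rule has_derivative_compose[of "\<lambda>t. x + t *\<^sub>R h" "\<lambda>u. u *\<^sub>R h", OF _ has_derivative_partials[OF assms]])
       (auto intro!: derivative_eq_intros)
  moreover have "(\<lambda>u. \<Sum>i\<in>UNIV. (u *\<^sub>R h) $ i * partial i \<phi> (x + t *\<^sub>R h)) = (*) (\<Sum>i\<in>UNIV. h $ i * partial i \<phi> (x + t *\<^sub>R h))"
    by (simp add: fun_eq_iff sum_distrib_left sum_distrib_right mult_ac)
  ultimately show ?thesis by (simp add: has_field_derivative_def)
qed

lemma test_function_lipschitz: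
  fixes \<phi> :: "real^'n \<Rightarrow> real"
  assumes \<phi>: "test_function \<phi>"
  shows "\<exists>L\<ge>0. \<forall>x y. \<bar>\<phi> y - \<phi> x\<bar> \<le> L * norm (y - x)"
proof -
  have "\<forall>i. \<exists>C\<ge>0. \<forall>x. \<bar>partial i \<phi> x\<bar> \<le> C"
    using test_function_facts(3)[OF test_function_partial[OF \<phi>]] by blast
  then obtain C where C: "\<And>i. C i \<ge> 0" "\<And>i x. \<bar>partial i \<phi> x\<bar> \<le> C i" by metis
  have "\<bar>\<phi> y - \<phi> x\<bar> \<le> (\<Sum>i\<in>UNIV. C i) * norm (y - x)" for x y
  proof -
    let ?h = "y - x"
    have "norm (\<phi> (x + 1 *\<^sub>R ?h) - \<phi> (x + 0 *\<^sub>R ?h)) \<le> ((\<Sum>i\<in>UNIV. C i) * norm ?h) * norm (1 - 0 :: real)"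
    proof (rule field_differentiable_bound[of UNIV])
      fix t :: real
      show "((\<lambda>t. \<phi> (x + t *\<^sub>R ?h)) has_real_derivative (\<Sum>i\<in>UNIV. ?h $ i * partial i \<phi> (x + t *\<^sub>R ?h))) (at t within UNIV)"
        using partial_line_derivative[OF test_function_facts(1)[OF \<phi>], of x ?h t] by simp
      have "norm (\<Sum>i\<in>UNIV. ?h $ i * partial i \<phi> (x + t *\<^sub>R ?h)) \<le> (\<Sum>i\<in>UNIV. norm ?h * C i)"
      proof (rule sum_norm_le)
        fix i
        show "norm (?h $ i * partial i \<phi> (x + t *\<^sub>R ?h)) \<le> norm ?h * C i"
          unfolding real_norm_def abs_mult using C(2)[of i] component_le_norm_cart[of ?h i] by (intro mult_mono) auto
      qed
      then show "norm (\<Sum>i\<in>UNIV. ?h $ i * partial i \<phi> (x + t *\<^sub>R ?h)) \<le> (\<Sum>i\<in>UNIV. C i) * norm ?h"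
        by (simp add: sum_distrib_right mult.commute)
    qed auto
    then show ?thesis by simp
  qed
  moreover have "(\<Sum>i\<in>UNIV. C i) \<ge> 0" using C by (intro sum_nonneg) auto
  ultimately show ?thesis by blast
qed

lemma third_order_remainder:
  fixes q :: "real \<Rightarrow> real"
  assumes q: "\<And>t. (q has_real_derivative q1 t) (at t)" "\<And>t. (q1 has_real_derivative q2 t) (at t)"
    and L: "\<And>t. 0 \<le> t \<Longrightarrow> t \<le> 1 \<Longrightarrow> \<bar>q2 t - q2 0\<bar> \<le> L"
  shows "\<bar>q 1 - q 0 - q1 0 - q2 0 / 2\<bar> \<le> L"
proof -
  have L0: "0 \<le> L" using L[of 0] by simp
  have a: "\<bar>q1 t - q1 0 - q2 0 * t\<bar> \<le> L" if t: "0 \<le> t" "t \<le> 1" for t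
  proof -
    have "norm ((q1 t - q2 0 * t) - (q1 0 - q2 0 * 0)) \<le> L * norm (t - 0)"
    proof (rule field_differentiable_bound[of "{0..1}" "\<lambda>t. q1 t - q2 0 * t" "\<lambda>t. q2 t - q2 0 * 1"])
      show "((\<lambda>t. q1 t - q2 0 * t) has_real_derivative q2 t - q2 0 * 1) (at t within {0..1})" for t
        by (rule has_field_derivative_at_within, intro DERIV_diff DERIV_cmult DERIV_ident q)
      show "norm (q2 z - q2 0 * 1) \<le> L" if "z \<in> {0..1}" for z using L[of z] that by simp
    qed (use t in simp_all)
    also have "\<dots> \<le> L" using L0 t by (simp add: mult_left_le)
    finally show ?thesis by simp
  qed
  have "norm ((q 1 - q1 0 * 1 - q2 0 * (1\<^sup>2 / 2)) - (q 0 - q1 0 * 0 - q2 0 * (0\<^sup>2 / 2))) \<le> L * norm (1 - 0 :: real)"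
  proof (rule field_differentiable_bound[of "{0..1}" "\<lambda>t. q t - q1 0 * t - q2 0 * (t\<^sup>2 / 2)" "\<lambda>t. q1 t - q1 0 * 1 - q2 0 * t"])
    fix t :: real
    have sq: "((\<lambda>t::real. t\<^sup>2 / 2) has_real_derivative t) (at t)" by (auto intro!: derivative_eq_intros)
    show "((\<lambda>t. q t - q1 0 * t - q2 0 * (t\<^sup>2 / 2)) has_real_derivative q1 t - q1 0 * 1 - q2 0 * t) (at t within {0..1})"
      by (rule has_field_derivative_at_within, intro DERIV_diff DERIV_cmult DERIV_ident q sq)
    show "norm (q1 z - q1 0 * 1 - q2 0 * z) \<le> L" if "z \<in> {0..1}" for z using a[of z] that by simp
  qed simp_all
  then show ?thesis by simp
qed

definition hess_form :: "(real^'n \<Rightarrow> real) \<Rightarrow> real^'n \<Rightarrow> real^'n \<Rightarrow> real" where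
  "hess_form \<phi> x h = (\<Sum>i\<in>UNIV. \<Sum>j\<in>UNIV. h $ i * h $ j * partial i (partial j \<phi>) x)"

lemma test_function_taylor:
  fixes \<phi> :: "real^'n \<Rightarrow> real"
  assumes \<phi>: "test_function \<phi>"
  shows "\<exists>C\<ge>0. \<forall>x h. \<bar>\<phi> (x + h) - \<phi> x - grad \<phi> x \<bullet> h - hess_form \<phi> x h / 2\<bar> \<le> C * norm h ^ 3"
proof -
  have "\<forall>i j. \<exists>L\<ge>0. \<forall>x y. \<bar>partial i (partial j \<phi>) y - partial i (partial j \<phi>) x\<bar> \<le> L * norm (y - x)"
    using test_function_lipschitz[OF test_function_partial[OF test_function_partial[OF \<phi>]]] by blast
  then obtain L where L: "\<And>i j. L i j \<ge> 0" "\<And>i j x y. \<bar>partial i (partial j \<phi>) y - partial i (partial j \<phi>) x\<bar> \<le> L i j * norm (y - x)" by metis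
  define C where "C = (\<Sum>i\<in>UNIV. \<Sum>j\<in>UNIV. L i j)"
  have "\<bar>\<phi> (x + h) - \<phi> x - grad \<phi> x \<bullet> h - hess_form \<phi> x h / 2\<bar> \<le> C * norm h ^ 3" for x h
  proof -
    let ?q = "\<lambda>t. \<phi> (x + t *\<^sub>R h)"
    let ?q1 = "\<lambda>t. \<Sum>j\<in>UNIV. h $ j * partial j \<phi> (x + t *\<^sub>R h)"
    let ?q2 = "\<lambda>t. \<Sum>j\<in>UNIV. h $ j * (\<Sum>i\<in>UNIV. h $ i * partial i (partial j \<phi>) (x + t *\<^sub>R h))"
    have q2: "?q2 t = hess_form \<phi> (x + t *\<^sub>R h) h" for t
      unfolding hess_form_def by (subst sum.swap) (simp add: sum_distrib_left mult_ac)
    have "\<bar>?q 1 - ?q 0 - ?q1 0 - ?q2 0 / 2\<bar> \<le> C * norm h ^ 3"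
    proof (rule third_order_remainder)
      show "(?q has_real_derivative ?q1 t) (at t)" for t
        by (rule partial_line_derivative[OF test_function_facts(1)[OF \<phi>]])
      show "(?q1 has_real_derivative ?q2 t) (at t)" for t
        by (intro DERIV_sum DERIV_cmult partial_line_derivative test_function_facts test_function_partial \<phi>)
      fix t :: real assume t: "0 \<le> t" "t \<le> 1"
      have "\<bar>?q2 t - ?q2 0\<bar> = \<bar>\<Sum>i\<in>UNIV. \<Sum>j\<in>UNIV. h $ i * h $ j * (partial i (partial j \<phi>) (x + t *\<^sub>R h) - partial i (partial j \<phi>) x)\<bar>"
        unfolding q2 hess_form_def by (simp add: sum_subtractf right_diff_distrib)
      also have "\<dots> \<le> (\<Sum>i\<in>UNIV. \<Sum>j\<in>UNIV. \<bar>h $ i * h $ j * (partial i (partial j \<phi>) (x + t *\<^sub>R h) - partial i (partial j \<phi>) x)\<bar>)"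
        by (intro order_trans[OF sum_abs] sum_mono sum_abs)
      also have "\<dots> \<le> (\<Sum>i\<in>UNIV. \<Sum>j\<in>UNIV. L i j * norm h ^ 3)"
      proof (intro sum_mono)
        fix i j
        have "\<bar>partial i (partial j \<phi>) (x + t *\<^sub>R h) - partial i (partial j \<phi>) x\<bar> \<le> L i j * norm (t *\<^sub>R h)"
          using L(2)[of i j "x + t *\<^sub>R h" x] by simp
        also have "\<dots> \<le> L i j * norm h" using t L(1)[of i j] by (intro mult_left_mono) (auto simp: mult_left_le_one_le)
        finally have "\<bar>h $ i\<bar> * \<bar>h $ j\<bar> * \<bar>partial i (partial j \<phi>) (x + t *\<^sub>R h) - partial i (partial j \<phi>) x\<bar> \<le> norm h * norm h * (L i j * norm h)"
          using component_le_norm_cart[of h] by (intro mult_mono) auto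
        then show "\<bar>h $ i * h $ j * (partial i (partial j \<phi>) (x + t *\<^sub>R h) - partial i (partial j \<phi>) x)\<bar> \<le> L i j * norm h ^ 3"
          by (simp add: abs_mult power3_eq_cube mult_ac)
      qed
      also have "\<dots> = C * norm h ^ 3" by (simp add: C_def sum_distrib_right)
      finally show "\<bar>?q2 t - ?q2 0\<bar> \<le> C * norm h ^ 3" .
    qed
    moreover have "?q1 0 = grad \<phi> x \<bullet> h" by (simp add: grad_def inner_vec_def mult.commute)
    ultimately show ?thesis unfolding q2 by simp
  qed
  moreover have "C \<ge> 0" unfolding C_def using L by (intro sum_nonneg) auto
  ultimately show ?thesis by blast
qed

text \<open>The hypothesis makes the derivative zero everywhere.\<close>

lemma constant_if_superlinear_modulus:
  fixes G :: "real \<Rightarrow> real"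
  assumes ab: "a \<le> b" and G: "\<And>u v. a \<le> u \<Longrightarrow> u \<le> v \<Longrightarrow> v \<le> b \<Longrightarrow> \<bar>G v - G u\<bar> \<le> C * ((v - u) * sqrt (v - u))"
  shows "G b = G a"
proof (rule has_field_derivative_zero_constant[of "{a..b}" G, THEN exE])
  show "convex {a..b}" by simp
  fix x assume x: "x \<in> {a..b}"
  show "(G has_real_derivative 0) (at x within {a..b})"
    unfolding has_field_derivative_iff
  proof (rule Lim_null_comparison)
    show "\<forall>\<^sub>F y in at x within {a..b}. norm ((G y - G x) / (y - x)) \<le> \<bar>C\<bar> * sqrt \<bar>y - x\<bar>"
      unfolding eventually_at_filter
    proof (intro always_eventually allI impI)
      fix y assume y: "y \<noteq> x" "y \<in> {a..b}"
      have "\<bar>G y - G x\<bar> \<le> C * (\<bar>y - x\<bar> * sqrt \<bar>y - x\<bar>)"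
      proof (cases "x \<le> y")
        case True then show ?thesis using G[of x y] x y by simp
      next
        case False
        then have "\<bar>y - x\<bar> = x - y" by simp
        then show ?thesis using G[of y x] x y False by (simp add: abs_minus_commute[of "G y"])
      qed
      also have "\<dots> \<le> \<bar>C\<bar> * (\<bar>y - x\<bar> * sqrt \<bar>y - x\<bar>)" by (intro mult_right_mono) auto
      finally show "norm ((G y - G x) / (y - x)) \<le> \<bar>C\<bar> * sqrt \<bar>y - x\<bar>"
        using y by (simp add: divide_le_eq mult_ac)
    qed
    have "((\<lambda>y. \<bar>C\<bar> * sqrt \<bar>y - x\<bar>) \<longlongrightarrow> \<bar>C\<bar> * sqrt \<bar>x - x\<bar>) (at x within {a..b})"
      by (intro tendsto_intros)
    then show "((\<lambda>y. \<bar>C\<bar> * sqrt \<bar>y - x\<bar>) \<longlongrightarrow> 0) (at x within {a..b})" by simp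
  qed
next
  fix c assume "\<forall>x\<in>{a..b}. G x = c"
  then show "G b = G a" using ab by simp
qed

section \<open>Moments of the Gaussian density\<close>

lemma gauss_prod:
  fixes y :: "real^'n"
  shows "gauss y = (\<Prod>b\<in>Basis. std_normal_density (y \<bullet> b))"
proof -
  have n2: "(norm y)\<^sup>2 = (\<Sum>b\<in>Basis. (y \<bullet> b)\<^sup>2)"
    unfolding dot_square_norm[symmetric] by (subst euclidean_inner) (simp add: power2_eq_square)
  have "(\<Prod>b\<in>Basis. std_normal_density (y \<bullet> b)) = (\<Prod>b\<in>(Basis::(real^'n) set). 1 / sqrt (2 * pi)) * (\<Prod>b\<in>Basis. exp (- (y \<bullet> b)\<^sup>2 / 2))"
    unfolding std_normal_density_def prod.distrib ..
  also have "(\<Prod>b\<in>Basis. exp (- (y \<bullet> b)\<^sup>2 / 2)) = exp (- (norm y)\<^sup>2 / 2)"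
    unfolding n2 by (simp add: exp_sum[symmetric] sum_negf sum_divide_distrib)
  finally show ?thesis by (simp add: gauss_eq power_one_over)
qed

lemma gauss_monomial:
  fixes m :: "real^'n \<Rightarrow> nat"
  shows "integrable lborel (\<lambda>y::real^'n. gauss y * (\<Prod>b\<in>Basis. (y \<bullet> b) ^ m b))"
    and "(LBINT y. gauss y * (\<Prod>b\<in>Basis. (y \<bullet> b) ^ m b)) = (\<Prod>b\<in>Basis. \<integral>x. std_normal_density x * x ^ m b \<partial>lborel)"
proof -
  have e: "gauss y * (\<Prod>b\<in>Basis. (y \<bullet> b) ^ m b) = (\<Prod>b\<in>Basis. std_normal_density (y \<bullet> b) * (y \<bullet> b) ^ m b)" for y
    unfolding gauss_prod prod.distrib ..
  show "integrable lborel (\<lambda>y::real^'n. gauss y * (\<Prod>b\<in>Basis. (y \<bullet> b) ^ m b))"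
    unfolding e by (intro lborel_integral_prod integrable_std_normal_moment)
  show "(LBINT y. gauss y * (\<Prod>b\<in>Basis. (y \<bullet> b) ^ m b)) = (\<Prod>b\<in>Basis. \<integral>x. std_normal_density x * x ^ m b \<partial>lborel)"
    unfolding e by (intro lborel_integral_prod integrable_std_normal_moment)
qed

lemma std_moment_1: "(LBINT x. std_normal_density x * x ^ 1) = 0"
  using integral_std_normal_moment_odd[of 0] by simp

lemma std_moment_2: "(LBINT x. std_normal_density x * x ^ 2) = 1"
  using integral_std_normal_moment_even[of 1] by simp

lemma prod_Basis_single:
  fixes y :: "real^'n"
  shows "(\<Prod>b\<in>Basis. (y \<bullet> b) ^ (if b = axis i 1 then 1 else 0)) = y $ i"
proof -
  have "(\<Prod>b\<in>Basis. (y \<bullet> b) ^ (if b = axis i 1 then 1 else 0)) = (\<Prod>b\<in>(Basis :: (real^'n) set). if b = axis i 1 then y $ i else 1)"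
    by (intro prod.cong) (auto simp: inner_axis)
  then show ?thesis by (simp add: axis_in_Basis_iff)
qed

lemma gauss_mean:
  shows "integrable lborel (\<lambda>y::real^'n. gauss y * y $ i)" "(LBINT y. gauss y * (y::real^'n) $ i) = 0"
proof -
  let ?m = "\<lambda>b::real^'n. if b = axis i 1 then 1 else 0 :: nat"
  show "integrable lborel (\<lambda>y::real^'n. gauss y * y $ i)"
    using gauss_monomial(1)[of ?m] unfolding prod_Basis_single .
  have "(LBINT y. gauss y * (y::real^'n) $ i) = (\<Prod>b\<in>(Basis::(real^'n) set). \<integral>x. std_normal_density x * x ^ ?m b \<partial>lborel)"
    using gauss_monomial(2)[of ?m] unfolding prod_Basis_single .
  also have "\<dots> = 0"
    using std_moment_1 by (intro prod_zero bexI[of _ "axis i 1"]) (auto simp: axis_in_Basis_iff)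
  finally show "(LBINT y. gauss y * (y::real^'n) $ i) = 0" .
qed

lemma gauss_covariance:
  shows "integrable lborel (\<lambda>y::real^'n. gauss y * (y $ i * y $ j))"
    and "(LBINT y. gauss y * ((y::real^'n) $ i * y $ j)) = (if i = j then 1 else 0)"
proof -
  let ?m = "\<lambda>b::real^'n. (if b = axis i 1 then 1 else 0) + (if b = axis j 1 then 1 else 0) :: nat"
  have e: "(\<Prod>b\<in>Basis. (y \<bullet> b) ^ ?m b) = y $ i * y $ j" for y :: "real^'n"
    unfolding power_add prod.distrib prod_Basis_single ..
  show "integrable lborel (\<lambda>y::real^'n. gauss y * (y $ i * y $ j))"
    using gauss_monomial(1)[of ?m] unfolding e .
  have i: "(LBINT y. gauss y * ((y::real^'n) $ i * y $ j)) = (\<Prod>b\<in>(Basis::(real^'n) set). \<integral>x. std_normal_density x * x ^ ?m b \<partial>lborel)"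
    using gauss_monomial(2)[of ?m] unfolding e .
  show "(LBINT y. gauss y * ((y::real^'n) $ i * y $ j)) = (if i = j then 1 else 0)"
  proof (cases "i = j")
    case True
    have "(\<Prod>b\<in>(Basis::(real^'n) set). \<integral>x. std_normal_density x * x ^ ?m b \<partial>lborel) = (\<Prod>b\<in>(Basis::(real^'n) set). 1)"
      using True std_moment_2 by (intro prod.cong) (auto simp: numeral_2_eq_2)
    then show ?thesis using True i by simp
  next
    case False
    have "(\<Prod>b\<in>(Basis::(real^'n) set). \<integral>x. std_normal_density x * x ^ ?m b \<partial>lborel) = 0"
      using std_moment_1 False by (intro prod_zero bexI[of _ "axis i 1"]) (auto simp: axis_in_Basis_iff axis_eq_axis)
    then show ?thesis using False i by simp
  qed
qed

lemma gauss_third_moment: "integrable lborel (\<lambda>y::real^'n. gauss y * norm y ^ 3)"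
proof -
  have i: "integrable lborel (\<lambda>y::real^'n. 33 / sqrt (2 * pi) ^ CARD('n) * exp (- (sqrt (1/2))\<^sup>2 * (norm y)\<^sup>2 / 2))"
    by (intro integrable_mult_right integrable_scaled_gaussian) simp
  show ?thesis
  proof (rule Bochner_Integration.integrable_bound[OF i], measurable, rule AE_I2)
    fix y :: "real^'n"
    define r where "r = norm y"
    have r: "r \<ge> 0" by (simp add: r_def)
    have "(r\<^sup>2 / 4) ^ 2 /\<^sub>R fact 2 \<le> exp (r\<^sup>2 / 4)"
      unfolding exp_def using sum_le_suminf[OF summable_exp_generic[of "r\<^sup>2 / 4"], of "{2}"] by simp
    then have 4: "r ^ 4 \<le> 32 * exp (r\<^sup>2 / 4)"
      by (simp add: power_divide fact_2 power_mult[symmetric])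
    have "r ^ 3 \<le> 1 + r ^ 4"
    proof (cases "r \<le> 1")
      case True
      then have "r ^ 3 \<le> 1" using r by (simp add: power_le_one)
      then show ?thesis using r zero_le_power[of r 4] by linarith
    next
      case False
      then have "r ^ 3 \<le> r ^ 4" by (intro power_increasing) auto
      then show ?thesis by simp
    qed
    moreover have "1 \<le> exp (r\<^sup>2 / 4)" by simp
    ultimately have "r ^ 3 \<le> 33 * exp (r\<^sup>2 / 4)" using 4 by linarith
    then have "exp (- r\<^sup>2 / 2) * r ^ 3 \<le> exp (- r\<^sup>2 / 2) * (33 * exp (r\<^sup>2 / 4))" by (intro mult_left_mono) auto
    also have "\<dots> = 33 * exp (- r\<^sup>2 / 4)" by (simp add: exp_add[symmetric])
    also have "- r\<^sup>2 / 4 = - (sqrt (1/2))\<^sup>2 * r\<^sup>2 / 2" by simp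
    finally have "exp (- r\<^sup>2 / 2) * r ^ 3 / sqrt (2 * pi) ^ CARD('n) \<le> 33 * exp (- (sqrt (1/2))\<^sup>2 * r\<^sup>2 / 2) / sqrt (2 * pi) ^ CARD('n)"
      by (intro divide_right_mono) auto
    then show "norm (gauss y * norm y ^ 3) \<le> norm (33 / sqrt (2 * pi) ^ CARD('n) * exp (- (sqrt (1/2))\<^sup>2 * (norm y)\<^sup>2 / 2))"
      using r by (simp add: gauss_eq r_def[symmetric] abs_mult)
  qed
qed

section \<open>Integrals of vectors and matrices\<close>

lemma integral_vec:
  fixes f :: "'a \<Rightarrow> 'b::euclidean_space ^ 'n"
  assumes f: "\<And>i. integrable M (\<lambda>x. f x $ i)"
  shows "integrable M f" "(\<integral>x. f x \<partial>M) $ i = (\<integral>x. f x $ i \<partial>M)"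
proof -
  have ax: "bounded_linear (axis j :: 'b \<Rightarrow> 'b ^ 'n)" for j
    by (intro linear_conv_bounded_linear[THEN iffD1] linearI) (simp_all add: vec_eq_iff axis_def)
  have e: "f x = (\<Sum>j\<in>UNIV. axis j (f x $ j))" for x
    by (simp add: vec_eq_iff axis_def)
  show i: "integrable M f"
    by (subst e[abs_def]) (intro Bochner_Integration.integrable_sum integrable_bounded_linear[OF ax] f)
  show "(\<integral>x. f x \<partial>M) $ i = (\<integral>x. f x $ i \<partial>M)"
    by (rule integral_bounded_linear[OF bounded_linear_vec_nth i, symmetric])
qed

text \<open>The components agree with \<open>g\<close> only almost everywhere in the applications: for the velocity
  \<open>v = 0\<close> the flight integral need not converge.\<close>

lemma integral_vec_AE:
  fixes f :: "'a \<Rightarrow> real ^ 'n"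
  assumes f: "f \<in> borel_measurable M" and g: "\<And>i. integrable M (g i)"
    and e: "\<And>i. AE x in M. f x $ i = g i x"
  shows "integrable M f" "(\<integral>x. f x \<partial>M) $ i = (\<integral>x. g i x \<partial>M)"
proof -
  note [measurable] = f
  have [measurable]: "g i \<in> borel_measurable M" for i using g by auto
  have i: "integrable M (\<lambda>x. f x $ i)" for i
    by (rule integrable_cong_AE_imp[OF g]) (use e in \<open>auto simp: eq_commute\<close>)
  show "integrable M f" by (rule integral_vec[OF i])
  show "(\<integral>x. f x \<partial>M) $ i = (\<integral>x. g i x \<partial>M)"
    unfolding integral_vec(2)[OF i] by (rule integral_cong_AE) (use e in auto)
qed

section \<open>Integrals along a line\<close>

lemma line_bound:
  fixes g :: "'a::euclidean_space \<Rightarrow> real"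
  assumes g: "cont_supp R g" and v: "v \<noteq> 0" and nz: "g (x + s *\<^sub>R v) \<noteq> 0"
  shows "\<bar>s\<bar> \<le> (R + norm x) / norm v"
proof -
  have "norm (x + s *\<^sub>R v) \<le> R" using g nz unfolding cont_supp_def by (meson not_le)
  moreover have "norm (s *\<^sub>R v) \<le> norm (x + s *\<^sub>R v) + norm x"
    using norm_triangle_ineq4[of "x + s *\<^sub>R v" x] by simp
  ultimately show ?thesis using v by (simp add: pos_le_divide_eq)
qed

lemma integrable_line:
  fixes g :: "'a::euclidean_space \<Rightarrow> real"
  assumes g: "cont_supp R g" and v: "v \<noteq> 0"
    and p[measurable]: "p \<in> borel_measurable borel" and pb: "\<And>s. \<bar>p s\<bar> \<le> 1 + \<bar>s\<bar>"
  shows "integrable lborel (\<lambda>s. p s * g (x + s *\<^sub>R v))"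
proof -
  note [measurable] = cont_supp_measurable[OF g]
  obtain C where C: "C \<ge> 0" "\<And>x. \<bar>g x\<bar> \<le> C" using cont_supp_bounded[OF g] by auto
  define T where "T = (R + norm x) / norm v"
  have i: "integrable lborel (\<lambda>s. ((1 + T) * C) * indicator {-T..T} s)"
    by (intro integrable_mult_right integrable_real_indicator) (auto simp: emeasure_lborel_Icc_eq)
  show ?thesis
  proof (rule Bochner_Integration.integrable_bound[OF i], measurable, rule AE_I2)
    fix s
    show "norm (p s * g (x + s *\<^sub>R v)) \<le> norm ((1 + T) * C * indicator {-T..T} s)"
    proof (cases "g (x + s *\<^sub>R v) = 0")
      case False
      then have s: "\<bar>s\<bar> \<le> T" unfolding T_def by (rule line_bound[OF g v])
      then have "\<bar>p s\<bar> * \<bar>g (x + s *\<^sub>R v)\<bar> \<le> (1 + T) * C"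
        using pb[of s] C by (intro mult_mono) auto
      moreover have "0 \<le> (1 + T) * C" using s C by simp
      moreover have i1: "indicator {-T..T} s = (1::real)" using s by (auto simp: indicator_def)
      ultimately show ?thesis unfolding i1 by (simp add: abs_mult[of "p s"])
    qed simp
  qed
qed

text \<open>After exchanging the integrals, \<open>s\<close> ranges over \<open>[u, 0]\<close>, which has length \<open>- u\<close>.\<close>

lemma double_line_integral:
  fixes g :: "'a::euclidean_space \<Rightarrow> real"
  assumes g: "cont_supp R g" and v: "v \<noteq> 0"
  shows "integrable lborel (\<lambda>s. indicator {..0} s * (LBINT u. indicator {..s} u * g (x + u *\<^sub>R v)))"
    and "(LBINT s. indicator {..0} s * (LBINT u. indicator {..s} u * g (x + u *\<^sub>R v)))
       = (LBINT u. (- u * indicator {..0} u) * g (x + u *\<^sub>R v))"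
proof -
  note [measurable] = cont_supp_measurable[OF g]
  obtain C where C: "C \<ge> 0" "\<And>x. \<bar>g x\<bar> \<le> C" using cont_supp_bounded[OF g] by auto
  define T where "T = (R + norm x) / norm v"
  let ?F = "\<lambda>s u. (if u \<le> s \<and> s \<le> 0 then 1 else 0) * g (x + u *\<^sub>R v)"
  have i: "integrable lborel (indicator {-T..T} :: real \<Rightarrow> real)" "integrable lborel (\<lambda>u. C * indicator {-T..T} u)"
    by (auto simp: emeasure_lborel_Icc_eq intro!: integrable_real_indicator)
  have b: "\<bar>?F s u\<bar> \<le> indicator {-T..T} s * (C * indicator {-T..T} u)" for s u
  proof (cases "?F s u = 0")
    case True
    then have "\<bar>?F s u\<bar> = 0" by (simp only: abs_zero)
    moreover have "0 \<le> indicator {-T..T} s * (C * indicator {-T..T} u)" using C by simp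
    ultimately show ?thesis by linarith
  next
    case False
    then have "g (x + u *\<^sub>R v) \<noteq> 0" and us: "u \<le> s" "s \<le> 0" by (auto split: if_splits)
    then have "\<bar>u\<bar> \<le> T" unfolding T_def by (intro line_bound[OF g v])
    then show ?thesis using us C by (simp add: indicator_def)
  qed
  have m: "(\<lambda>(s, u). ?F s u) \<in> borel_measurable (lborel \<Otimes>\<^sub>M lborel)" by measurable
  have F: "(LBINT u. ?F s u) = indicator {..0} s * (LBINT u. indicator {..s} u * g (x + u *\<^sub>R v))" for s
    by (cases "s \<le> 0") (auto simp: indicator_def of_bool_def intro!: Bochner_Integration.integral_cong)
  have "integrable (lborel \<Otimes>\<^sub>M lborel) (\<lambda>(s, u). ?F s u)"
    by (rule Bochner_Integration.integrable_bound[OF integrable_lborel_prod[OF i] m])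
       (use order_trans[OF b abs_ge_self] in auto)
  from lborel_pair.integrable_fst[OF this]
  show "integrable lborel (\<lambda>s. indicator {..0} s * (LBINT u. indicator {..s} u * g (x + u *\<^sub>R v)))"
    by (simp only: F)
  have inner: "(LBINT s. ?F s u) = (- u * indicator {..0} u) * g (x + u *\<^sub>R v)" for u
  proof -
    have "(\<lambda>s. (if u \<le> s \<and> s \<le> 0 then 1 else 0) :: real) = indicator {u..0}" by (auto simp: indicator_def)
    then have "(LBINT s. (if u \<le> s \<and> s \<le> 0 then 1 else 0)) = - u * indicator {..0} u"
      by (simp add: indicator_def)
    then show ?thesis by simp
  qed
  have "(LBINT s. (LBINT u. ?F s u)) = (LBINT u. (LBINT s. ?F s u))"
    by (rule fubini_swap[OF m i b])
  also have "\<dots> = (LBINT u. (- u * indicator {..0} u) * g (x + u *\<^sub>R v))"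
    by (simp only: inner)
  finally show "(LBINT s. indicator {..0} s * (LBINT u. indicator {..s} u * g (x + u *\<^sub>R v)))
       = (LBINT u. (- u * indicator {..0} u) * g (x + u *\<^sub>R v))" by (simp only: F)
qed

section \<open>The coefficients in Fourier variables\<close>

lemma sgn_nth: "sgn k $ i = k $ i / norm (k :: real^'n)"
  by (simp add: sgn_div_norm inverse_eq_divide)

lemma sgn_inner: "sgn k \<bullet> V = (k \<bullet> V) / norm (k :: real^'n)"
  by (simp add: sgn_div_norm inverse_eq_divide)

locale landau_potential =
  fixes \<Phi> :: "real^'n \<Rightarrow> real" and R :: real
  assumes dim4: "CARD('n) \<ge> 4" and R: "R > 0" and C3: "C_k 3 \<Phi>"
    and supp: "closure {x. \<Phi> x \<noteq> 0} \<subseteq> cball 0 R" and nz: "\<exists>x. \<Phi> x \<noteq> 0"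
begin

lemma potential_smooth:
  shows "\<Phi> differentiable (at x)" "partial j \<Phi> differentiable (at x)"
    and "continuous_on UNIV (partial j \<Phi>)" "continuous_on UNIV (partial i (partial j \<Phi>))"
  using C3 C_k_continuous[of 1] C_k_continuous[of 2 "partial j \<Phi>"] C_k_continuous[of 1 "partial i (partial j \<Phi>)"] by (auto simp: numeral_3_eq_3 numeral_2_eq_2)

lemma supp_potential: "cont_supp R \<Phi>"
  using C_k_continuous[OF C3] supp closure_subset[of "{x. \<Phi> x \<noteq> 0}"]
  by (force simp: cont_supp_def)

lemma supp_gradient: "cont_supp R (partial j \<Phi>)" by (rule cont_supp_partial[OF supp_potential potential_smooth(3)])

lemma supp_hessian: "cont_supp R (partial i (partial j \<Phi>))" by (rule cont_supp_partial[OF supp_gradient potential_smooth(4)])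

lemmas potential_measurable [measurable] = supp_potential[THEN cont_supp_measurable] supp_gradient[THEN cont_supp_measurable] supp_hessian[THEN cont_supp_measurable]

lemma grad_measurable [measurable]: "grad \<Phi> \<in> borel_measurable borel"
  unfolding grad_def[abs_def]
  by (intro borel_measurable_continuous_onI continuous_on_vec_lambda potential_smooth)

lemma Hess_measurable [measurable]: "Hess \<Phi> \<in> borel_measurable borel"
  unfolding Hess_def[abs_def]
  by (intro borel_measurable_continuous_onI continuous_on_vec_lambda potential_smooth)

text \<open>The power spectrum of the potential.\<close>

definition "P k = (cosT \<Phi> k)\<^sup>2 + (sinT \<Phi> k)\<^sup>2"

text \<open>The weight with which the direction \<open>sgn k\<close> enters the coefficients.\<close>

definition "W k = norm k * P k"

lemma P_nonneg: "P k \<ge> 0" by (simp add: P_def)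

lemma transform_measurable [measurable]: "cosT \<Phi> \<in> borel_measurable borel" "sinT \<Phi> \<in> borel_measurable borel"
  by (rule cosT_sinT_measurable[OF cont_supp_measurable[OF supp_potential]])+

lemma P_measurable [measurable]: "P \<in> borel_measurable borel"
  unfolding P_def[abs_def] by measurable

lemma W_measurable [measurable]: "W \<in> borel_measurable borel"
  unfolding W_def[abs_def] by measurable

lemma fourier_P: "(cmod (fourier \<Phi> k))\<^sup>2 = P k"
  unfolding P_def by (rule cmod_fourier[OF cont_supp_integrable[OF supp_potential]])

lemma gradient_transform: "cosT (partial i \<Phi>) k = k $ i * sinT \<Phi> k" "sinT (partial i \<Phi>) k = - (k $ i) * cosT \<Phi> k"
  by (rule trig_transform_partial[OF supp_potential potential_smooth(1) potential_smooth(3)])+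

lemma hessian_transform: "cosT (partial i (partial j \<Phi>)) k = - (k $ i * k $ j * cosT \<Phi> k)"
  "sinT (partial i (partial j \<Phi>)) k = - (k $ i * k $ j * sinT \<Phi> k)"
  using trig_transform_partial[OF supp_gradient potential_smooth(2) potential_smooth(4)] by (simp_all add: gradient_transform)

abbreviation E :: "real \<Rightarrow> real^'n \<Rightarrow> real" where "E s k \<equiv> exp (- s\<^sup>2 * (norm k)\<^sup>2 / 2)"

lemma gradient_correlation:
  assumes "s \<noteq> 0"
  shows "(LBINT v. gauss (v + V) * (LBINT x. partial i \<Phi> x * partial j \<Phi> (x + s *\<^sub>R v)))
    = 1 / (2 * pi) ^ CARD('n) * (LBINT k. E s k * (cos (s * (k \<bullet> V)) * (k $ i * k $ j * P k)))"
  unfolding smoothed_autocorrelation[OF supp_gradient supp_gradient assms] gradient_transform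
  by (intro arg_cong2[of _ _ _ _ "(*)"] refl Bochner_Integration.integral_cong) (simp add: P_def power2_eq_square algebra_simps)

lemma hessian_correlation:
  assumes "s \<noteq> 0"
  shows "(LBINT v. gauss (v + V) * (LBINT x. partial i (partial j \<Phi>) x * partial j \<Phi> (x + s *\<^sub>R v)))
    = 1 / (2 * pi) ^ CARD('n) * (LBINT k. E s k * (- sin (s * (k \<bullet> V)) * (k $ i * (k $ j)\<^sup>2 * P k)))"
  unfolding smoothed_autocorrelation[OF supp_hessian supp_gradient assms] gradient_transform hessian_transform
  by (intro arg_cong2[of _ _ _ _ "(*)"] refl Bochner_Integration.integral_cong) (simp add: P_def power2_eq_square algebra_simps)

lemma norm2_P: "(norm k)\<^sup>2 * P k = (\<Sum>i\<in>UNIV. k $ i * k $ i * P k)"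
  unfolding dot_square_norm[symmetric] inner_vec_def by (simp add: sum_distrib_right)

text \<open>By \<open>gradient_transform\<close>, \<open>(k $ i)\<^sup>2 * P k\<close> is the power spectrum of the integrable function
  \<open>partial i \<Phi>\<close>.\<close>

lemma norm2_P_bounded: "\<exists>C. \<forall>k. (norm k)\<^sup>2 * P k \<le> C"
proof -
  define m where "m i = (LBINT x. \<bar>partial i \<Phi> x\<bar>)" for i
  have "k $ i * k $ i * P k \<le> (m i)\<^sup>2 + (m i)\<^sup>2" for i k
  proof -
    have b: "\<bar>cosT (partial i \<Phi>) k\<bar> \<le> m i" "\<bar>sinT (partial i \<Phi>) k\<bar> \<le> m i"
      unfolding m_def by (rule cosT_sinT_bound[OF cont_supp_integrable[OF supp_gradient]])+
    have "k $ i * k $ i * P k = \<bar>cosT (partial i \<Phi>) k\<bar>\<^sup>2 + \<bar>sinT (partial i \<Phi>) k\<bar>\<^sup>2"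
      by (simp add: gradient_transform P_def power2_eq_square algebra_simps)
    also have "\<dots> \<le> (m i)\<^sup>2 + (m i)\<^sup>2" using b by (intro add_mono power_mono) auto
    finally show ?thesis .
  qed
  then have "(norm k)\<^sup>2 * P k \<le> (\<Sum>i\<in>UNIV. (m i)\<^sup>2 + (m i)\<^sup>2)" for k
    unfolding norm2_P by (intro sum_mono)
  then show ?thesis by blast
qed

lemma E_P_integrable:
  assumes "s \<noteq> 0"
  shows "integrable lborel (\<lambda>k. E s k * ((norm k)\<^sup>2 * P k))"
proof -
  obtain C where C: "\<And>k. (norm k)\<^sup>2 * P k \<le> C" using norm2_P_bounded by blast
  have "integrable lborel (\<lambda>k::real^'n. E s k * C)" using integrable_scaled_gaussian[OF assms, where 'a="real^'n"] by simp
  then show ?thesis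
  proof (rule Bochner_Integration.integrable_bound, measurable, intro AE_I2)
    fix k :: "real^'n"
    have "\<bar>(norm k)\<^sup>2 * P k\<bar> \<le> \<bar>C\<bar>" using C[of k] P_nonneg[of k] by (simp add: abs_mult)
    then show "norm (E s k * ((norm k)\<^sup>2 * P k)) \<le> norm (E s k * C)"
      by (simp add: abs_mult mult_left_mono)
  qed
qed

text \<open>Majorant, in the variables \<open>s\<close> and \<open>k\<close>, of the entries of the diffusion matrix.\<close>

definition "A s k = indicator {..0} s * (E s k * ((norm k)\<^sup>2 * P k))"

lemma A_nonneg: "A s k \<ge> 0" using P_nonneg[of k] by (simp add: A_def)

lemma A_measurable [measurable]: "(\<lambda>(s, k). A s k) \<in> borel_measurable (borel \<Otimes>\<^sub>M borel)"
  unfolding A_def by measurable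

text \<open>At \<open>V = 0\<close> the trace of the correlations of the gradient has the nonnegative spectral
  density \<open>A\<close>, up to a constant, and its time integral is finite by \<open>position_fubini\<close>. So the
  bound comes from position space.\<close>

lemma A_finite: "(\<integral>\<^sup>+s. (\<integral>\<^sup>+k. ennreal (A s k) \<partial>lborel) \<partial>lborel) < \<infinity>"
proof -
  let ?J = "\<lambda>i s. (LBINT v. gauss (v + 0) * (LBINT x. partial i \<Phi> x * partial i \<Phi> (x + s *\<^sub>R v)))"
  let ?h = "\<lambda>s. (2 * pi) ^ CARD('n) * (\<Sum>i\<in>UNIV. indicator {..0} s * ?J i s)"
  have h: "integrable lborel ?h"
    by (intro integrable_mult_right Bochner_Integration.integrable_sum position_fubini(4)[OF dim4 R supp_gradient supp_gradient])
       (auto simp: indicator_def)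
  have *: "(\<integral>\<^sup>+k. ennreal (A s k) \<partial>lborel) \<le> ennreal \<bar>?h s\<bar>" if s: "s \<noteq> 0" for s
  proof (cases "s \<le> 0")
    case True
    have i: "integrable lborel (\<lambda>k. E s k * (k $ i * k $ i * P k))" for i
    proof (rule Bochner_Integration.integrable_bound[OF E_P_integrable[OF s]], measurable, intro AE_I2)
      fix k :: "real^'n"
      have "k $ i * k $ i \<le> (norm k)\<^sup>2"
        using component_le_norm_cart[of k i] abs_le_square_iff[of "k $ i" "norm k"] by (simp add: power2_eq_square)
      then have "k $ i * k $ i * P k \<le> (norm k)\<^sup>2 * P k" using P_nonneg by (rule mult_right_mono)
      then show "norm (E s k * (k $ i * k $ i * P k)) \<le> norm (E s k * ((norm k)\<^sup>2 * P k))"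
        using P_nonneg[of k] by (simp add: abs_mult)
    qed
    have "(\<integral>\<^sup>+k. ennreal (A s k) \<partial>lborel) = (\<integral>\<^sup>+k. ennreal (E s k * ((norm k)\<^sup>2 * P k)) \<partial>lborel)"
      using True by (simp add: A_def)
    also have "\<dots> = ennreal (LBINT k. E s k * ((norm k)\<^sup>2 * P k))"
      using P_nonneg by (intro nn_integral_eq_integral E_P_integrable s) auto
    also have "(LBINT k. E s k * ((norm k)\<^sup>2 * P k)) = (\<Sum>i\<in>UNIV. \<integral>k. E s k * (k $ i * k $ i * P k) \<partial>lborel)"
      unfolding norm2_P sum_distrib_left using i by (rule Bochner_Integration.integral_sum)
    also have "\<dots> = ?h s"
      unfolding gradient_correlation[OF s] using True by (simp add: sum_distrib_left)
    finally show ?thesis by (simp add: ennreal_leI)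
  qed (simp add: A_def)
  have "(\<integral>\<^sup>+s. (\<integral>\<^sup>+k. ennreal (A s k) \<partial>lborel) \<partial>lborel) \<le> (\<integral>\<^sup>+s. ennreal \<bar>?h s\<bar> \<partial>lborel)"
    by (intro nn_integral_mono_AE, rule AE_mp[OF AE_lborel_singleton[of 0]], rule AE_I2, rule impI, rule *)
  also have "\<dots> < \<infinity>" using h unfolding integrable_iff_bounded real_norm_def by (rule conjunct2)
  finally show ?thesis .
qed

lemma A_integrable: "integrable (lborel \<Otimes>\<^sub>M lborel) (\<lambda>(s, k). A s k)"
proof (rule integrableI_bounded)
  have "(\<integral>\<^sup>+z. ennreal (norm (case z of (s, k) \<Rightarrow> A s k)) \<partial>(lborel \<Otimes>\<^sub>M lborel))
      = (\<integral>\<^sup>+s. (\<integral>\<^sup>+k. ennreal (norm (A s k)) \<partial>lborel) \<partial>lborel)"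
    by (subst lborel.nn_integral_fst[symmetric]) auto
  then show "(\<integral>\<^sup>+z. ennreal (norm (case z of (s, k) \<Rightarrow> A s k)) \<partial>(lborel \<Otimes>\<^sub>M lborel)) < \<infinity>"
    using A_finite A_nonneg by simp
qed measurable

text \<open>The integral of \<open>A s k\<close> over \<open>s\<close> is a multiple of \<open>W k\<close>.\<close>

lemma W_integrable: "integrable lborel W"
proof -
  let ?c = "sqrt (2 * pi) / 2"
  have *: "(\<integral>\<^sup>+s. ennreal (A s k) \<partial>lborel) = ennreal (?c * W k)" for k
  proof (cases "k = 0")
    case False
    then have k: "norm k > 0" by simp
    have A: "A s k = ((norm k)\<^sup>2 * P k) * (indicator {..0} s * (exp (- s\<^sup>2 * (norm k)\<^sup>2 / 2) * cos (s * 0)))" for s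
      by (simp add: A_def)
    have i: "integrable lborel (\<lambda>s. A s k)"
      unfolding A by (intro integrable_mult_right half_gaussian_cos k)
    have "(\<integral>\<^sup>+s. ennreal (A s k) \<partial>lborel) = ennreal (LBINT s. A s k)"
      using A_nonneg by (intro nn_integral_eq_integral i) auto
    also have "(LBINT s. A s k) = ((norm k)\<^sup>2 * P k) * (sqrt (2 * pi) / (2 * norm k))"
      unfolding A integral_mult_right_zero half_gaussian_cos(2)[OF k] by simp
    also have "\<dots> = ?c * W k" using k by (simp add: W_def power2_eq_square)
    finally show ?thesis .
  qed (simp add: A_def W_def)
  have "(\<integral>\<^sup>+k. ennreal (?c * W k) \<partial>lborel) = (\<integral>\<^sup>+s. (\<integral>\<^sup>+k. ennreal (A s k) \<partial>lborel) \<partial>lborel)"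
    unfolding *[symmetric] by (rule lborel_pair.Fubini') measurable
  then have "(\<integral>\<^sup>+k. ennreal (?c * W k) \<partial>lborel) < \<infinity>" using A_finite by simp
  then have "integrable lborel (\<lambda>k. ?c * W k)"
    using P_nonneg by (intro integrableI_nonneg) (auto simp: W_def)
  then have "integrable lborel (\<lambda>k. (1 / ?c) * (?c * W k))" by (rule integrable_mult_right)
  then show ?thesis by simp
qed

text \<open>Majorant for the drift, which has one more factor \<open>s\<close> and one more factor \<open>k\<close>. By scaling
  its integral over \<open>s\<close> is again a multiple of \<open>W k\<close>.\<close>

definition "A2 s k = \<bar>s\<bar> * E s k * (norm k ^ 3 * P k)"

lemma A2_nonneg: "A2 s k \<ge> 0" using P_nonneg[of k] by (simp add: A2_def)

lemma A2_integrable: "integrable (lborel \<Otimes>\<^sub>M lborel) (\<lambda>(s, k). A2 s k)"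
proof (rule integrableI_bounded)
  have [measurable]: "(\<lambda>(s, k). A2 s k) \<in> borel_measurable (borel \<Otimes>\<^sub>M borel)"
    unfolding A2_def by measurable
  show "(\<lambda>(s, k). A2 s k) \<in> borel_measurable (lborel \<Otimes>\<^sub>M lborel)" by measurable
  define M1 where "M1 = (\<integral>x. \<bar>x\<bar> * exp (- x\<^sup>2 / 2) \<partial>(lborel :: real measure))"
  have *: "(\<integral>\<^sup>+s. ennreal (A2 s k) \<partial>lborel) = ennreal (M1 * W k)" for k
  proof (cases "k = 0")
    case False
    then have k: "norm k > 0" by simp
    have A: "A2 s k = (norm k ^ 3 * P k) * (\<bar>s\<bar> * exp (- s\<^sup>2 * (norm k)\<^sup>2 / 2))" for s
      by (simp add: A2_def)
    have i: "integrable lborel (\<lambda>s. A2 s k)"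
      unfolding A by (intro integrable_mult_right gaussian_abs_scaled k)
    have "M1 = norm k * (LBINT s. norm k * (\<bar>s\<bar> * exp (- s\<^sup>2 * (norm k)\<^sup>2 / 2)))"
      unfolding M1_def using k
      by (subst lborel_integral_real_affine[of "norm k" _ 0]) (simp_all add: abs_mult power_mult_distrib mult_ac)
    then have M1: "(LBINT s. \<bar>s\<bar> * exp (- s\<^sup>2 * (norm k)\<^sup>2 / 2)) = M1 / (norm k)\<^sup>2"
      unfolding integral_mult_right_zero using k by (simp add: power2_eq_square)
    have "(\<integral>\<^sup>+s. ennreal (A2 s k) \<partial>lborel) = ennreal (LBINT s. A2 s k)"
      using A2_nonneg by (intro nn_integral_eq_integral i) auto
    also have "(LBINT s. A2 s k) = (norm k ^ 3 * P k) * (M1 / (norm k)\<^sup>2)"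
      unfolding A integral_mult_right_zero M1 ..
    also have "\<dots> = M1 * W k" using k by (simp add: W_def power2_eq_square power3_eq_cube)
    finally show ?thesis .
  qed (simp add: A2_def W_def)
  have "(\<integral>\<^sup>+z. ennreal (norm (case z of (s, k) \<Rightarrow> A2 s k)) \<partial>(lborel \<Otimes>\<^sub>M lborel))
      = (\<integral>\<^sup>+s. (\<integral>\<^sup>+k. ennreal (A2 s k) \<partial>lborel) \<partial>lborel)"
    using A2_nonneg by (subst lborel.nn_integral_fst[symmetric]) auto
  also have "\<dots> = (\<integral>\<^sup>+k. (\<integral>\<^sup>+s. ennreal (A2 s k) \<partial>lborel) \<partial>lborel)"
    by (rule lborel_pair.Fubini'[symmetric]) measurable
  also have "\<dots> = (\<integral>\<^sup>+k. ennreal (M1 * W k) \<partial>lborel)" unfolding * ..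
  also have "\<dots> \<le> (\<integral>\<^sup>+k. ennreal (norm (M1 * W k)) \<partial>lborel)" by (intro nn_integral_mono ennreal_leI) simp
  also have "\<dots> < \<infinity>" using integrable_mult_right[OF W_integrable, of M1] unfolding integrable_iff_bounded by (rule conjunct2)
  finally show "(\<integral>\<^sup>+z. ennreal (norm (case z of (s, k) \<Rightarrow> A2 s k)) \<partial>(lborel \<Otimes>\<^sub>M lborel)) < \<infinity>" .
qed

definition "c\<^sub>0 = sqrt (2 * pi) / (2 * (2 * pi) ^ CARD('n))"

text \<open>The common value of the two matrices, with the direction of \<open>k\<close> separated from its
  length.\<close>

definition D :: "real^'n \<Rightarrow> real^'n^'n" where
  "D V = (\<chi> i j. c\<^sub>0 * ridge_mix (\<lambda>k. W k * sgn k $ i * sgn k $ j) sgn 1 V)"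

lemma component_le: "\<bar>k $ i * k $ j\<bar> \<le> (norm (k::real^'n))\<^sup>2"
  unfolding abs_mult power2_eq_square using component_le_norm_cart[of k] by (intro mult_mono) auto

text \<open>By \<open>gradient_correlation\<close> the integrand is known in Fourier variables for \<open>s \<noteq> 0\<close>; the
  majorant \<open>A\<close> allows to integrate over \<open>s\<close> first.\<close>

lemma position_integral_D:
  "(LBINT s. indicator {..0} s * (LBINT v. gauss (v + V) * (LBINT x. partial i \<Phi> x * partial j \<Phi> (x + s *\<^sub>R v))))
   = D V $ i $ j" (is "(LBINT s. _ s * ?J s) = _")
proof -
  let ?c = "1 / (2 * pi) ^ CARD('n)"
  let ?F = "\<lambda>s k. indicator {..0} s * (E s k * (cos (s * (k \<bullet> V)) * (k $ i * k $ j * P k)))"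
  have m: "(\<lambda>(s, k). ?F s k) \<in> borel_measurable (lborel \<Otimes>\<^sub>M lborel)" by measurable
  have Fb: "\<bar>?F s k\<bar> \<le> A s k" for s k
  proof -
    have "\<bar>cos (s * (k \<bullet> V))\<bar> * \<bar>k $ i * k $ j\<bar> \<le> 1 * (norm k)\<^sup>2"
      by (intro mult_mono component_le) auto
    then have "(\<bar>cos (s * (k \<bullet> V))\<bar> * \<bar>k $ i * k $ j\<bar>) * P k \<le> (norm k)\<^sup>2 * P k"
      using P_nonneg by (intro mult_right_mono) auto
    then have "E s k * (\<bar>cos (s * (k \<bullet> V))\<bar> * \<bar>k $ i * k $ j\<bar> * P k) \<le> E s k * ((norm k)\<^sup>2 * P k)"
      by (intro mult_left_mono) auto
    then have "indicator {..0} s * (E s k * (\<bar>cos (s * (k \<bullet> V))\<bar> * \<bar>k $ i * k $ j\<bar> * P k)) \<le> A s k"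
      unfolding A_def by (intro mult_left_mono) auto
    then show ?thesis using P_nonneg[of k] by (simp add: abs_mult mult_ac)
  qed
  have Fi: "integrable (lborel \<Otimes>\<^sub>M lborel) (\<lambda>(s, k). ?F s k)"
    by (rule Bochner_Integration.integrable_bound[OF A_integrable m]) (use order_trans[OF Fb abs_ge_self] in auto)
  have inner: "(LBINT s. ?F s k) = sqrt (2 * pi) / 2 * ((W k * sgn k $ i * sgn k $ j) * ridge 1 (sgn k \<bullet> V))" for k
  proof (cases "k = 0")
    case False
    then have k: "norm k > 0" by simp
    have "(LBINT s. ?F s k) = (LBINT s. (k $ i * k $ j * P k) * (indicator {..0} s * (exp (- s\<^sup>2 * (norm k)\<^sup>2 / 2) * cos (s * (k \<bullet> V)))))"
      by (simp add: mult_ac)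
    also have "\<dots> = (k $ i * k $ j * P k) * (sqrt (2 * pi) / (2 * norm k) * exp (- (k \<bullet> V / norm k)\<^sup>2 / 2))"
      unfolding integral_mult_right_zero half_gaussian_cos(2)[OF k] ..
    finally show ?thesis using k by (simp add: ridge_def W_def sgn_nth sgn_inner)
  qed (simp add: W_def)
  have "(LBINT s. indicator {..0} s * ?J s) = (LBINT s. ?c * (LBINT k. ?F s k))"
  proof (rule integral_cong_AE)
    show "AE s in lborel. indicator {..0} s * ?J s = ?c * (LBINT k. ?F s k)"
      by (rule AE_mp[OF AE_lborel_singleton[of 0]], rule AE_I2) (simp add: gradient_correlation)
  qed measurable
  also have "\<dots> = ?c * (LBINT k. (LBINT s. ?F s k))"
    unfolding integral_mult_right_zero using lborel_pair.Fubini_integral[OF Fi] by simp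
  also have "\<dots> = ?c * (LBINT k. sqrt (2 * pi) / 2 * ((W k * sgn k $ i * sgn k $ j) * ridge 1 (sgn k \<bullet> V)))"
    by (simp only: inner)
  finally show ?thesis unfolding integral_mult_right_zero by (simp add: D_def ridge_mix_def c\<^sub>0_def)
qed

lemma unit_mult: "integrable lborel m \<Longrightarrow> integrable lborel (\<lambda>k. m k * sgn k $ i)" for m :: "real^'n \<Rightarrow> real"
  by (rule integrable_mult_unit_component) (auto simp: norm_sgn)

lemma D_weight_integrable: "integrable lborel (\<lambda>k. W k * sgn k $ i * sgn k $ j)"
  by (intro unit_mult W_integrable)

lemma ridge_integrable: "integrable lborel m \<Longrightarrow> integrable lborel (\<lambda>k. m k * ridge p (sgn k \<bullet> V))" for m :: "real^'n \<Rightarrow> real"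
  by (rule ridge_mix_integrable) auto

text \<open>Contracting with \<open>V\<close> turns the factor \<open>sgn k $ j\<close> into \<open>sgn k \<bullet> V\<close>, hence the constant
  polynomial into \<open>x\<close>.\<close>

lemma D_mult_V: "(D V *v V) $ i = c\<^sub>0 * ridge_mix (\<lambda>k. W k * sgn k $ i) sgn [:0, 1:] V"
proof -
  have "(D V *v V) $ i = c\<^sub>0 * (\<Sum>j\<in>UNIV. (LBINT k. V $ j * ((W k * sgn k $ i * sgn k $ j) * ridge 1 (sgn k \<bullet> V))))"
    by (simp add: matrix_vector_mult_def D_def ridge_mix_def sum_distrib_left mult_ac flip: integral_mult_right_zero)
  also have "(\<Sum>j\<in>UNIV. (LBINT k. V $ j * ((W k * sgn k $ i * sgn k $ j) * ridge 1 (sgn k \<bullet> V))))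
    = (LBINT k. (\<Sum>j\<in>UNIV. V $ j * ((W k * sgn k $ i * sgn k $ j) * ridge 1 (sgn k \<bullet> V))))"
    by (intro Bochner_Integration.integral_sum[symmetric] integrable_mult_right ridge_integrable D_weight_integrable)
  also have "\<dots> = ridge_mix (\<lambda>k. W k * sgn k $ i) sgn [:0, 1:] V"
    unfolding ridge_mix_def
  proof (intro Bochner_Integration.integral_cong refl)
    fix k :: "real^'n"
    have "(\<Sum>j\<in>UNIV. V $ j * ((W k * sgn k $ i * sgn k $ j) * ridge 1 (sgn k \<bullet> V)))
      = W k * sgn k $ i * ridge 1 (sgn k \<bullet> V) * (\<Sum>j\<in>UNIV. sgn k $ j * V $ j)"
      by (simp add: sum_distrib_left mult_ac)
    also have "\<dots> = W k * sgn k $ i * ridge [:0, 1:] (sgn k \<bullet> V)"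
      by (simp add: ridge_def inner_vec_def)
    finally show "(\<Sum>j\<in>UNIV. V $ j * ((W k * sgn k $ i * sgn k $ j) * ridge 1 (sgn k \<bullet> V))) = W k * sgn k $ i * ridge [:0, 1:] (sgn k \<bullet> V)" .
  qed
  finally show ?thesis .
qed

text \<open>As for \<open>position_integral_D\<close>. The three derivatives give \<open>k $ i * (\<bar>k\<bar>\<^sup>2 * P k)\<close> after
  summation over \<open>j\<close>, and the integral of \<open>s sin (s (k \<bullet> V))\<close> gives the factor
  \<open>(k \<bullet> V) / \<bar>k\<bar>\<^sup>2\<close>.\<close>

lemma position_integral_Lambda:
  "(\<Sum>j\<in>UNIV. (LBINT s. (- s * indicator {..0} s) * (LBINT v. gauss (v + V) * (LBINT x. partial i (partial j \<Phi>) x * partial j \<Phi> (x + s *\<^sub>R v)))))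
   = (D V *v V) $ i"
proof -
  let ?J = "\<lambda>j s. (LBINT v. gauss (v + V) * (LBINT x. partial i (partial j \<Phi>) x * partial j \<Phi> (x + s *\<^sub>R v)))"
  let ?c = "1 / (2 * pi) ^ CARD('n)"
  let ?G = "\<lambda>j k. (k $ i * (k $ j)\<^sup>2 * P k) * ((k \<bullet> V) / (norm k)\<^sup>2 * (sqrt (2 * pi) / (2 * norm k) * exp (- (k \<bullet> V / norm k)\<^sup>2 / 2)))"
  have *: "integrable lborel (?G j)" "(LBINT s. (- s * indicator {..0} s) * ?J j s) = ?c * (LBINT k. ?G j k)" for j
  proof -
    let ?F = "\<lambda>s k. indicator {..0} s * (E s k * (s * sin (s * (k \<bullet> V)) * (k $ i * (k $ j)\<^sup>2 * P k)))"
    have m: "(\<lambda>(s, k). ?F s k) \<in> borel_measurable (lborel \<Otimes>\<^sub>M lborel)" by measurable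
    have Fb: "\<bar>?F s k\<bar> \<le> A2 s k" for s k
    proof -
      have "(k $ j)\<^sup>2 \<le> (norm k)\<^sup>2" using component_le[of k j j] by (simp add: power2_eq_square)
      then have b: "\<bar>k $ i\<bar> * (k $ j)\<^sup>2 \<le> norm k * (norm k)\<^sup>2"
        using component_le_norm_cart[of k i] by (intro mult_mono) auto
      have "\<bar>sin (s * (k \<bullet> V))\<bar> * (\<bar>k $ i\<bar> * (k $ j)\<^sup>2) \<le> 1 * (norm k * (norm k)\<^sup>2)"
        by (rule mult_mono) (use b in auto)
      then have "(\<bar>sin (s * (k \<bullet> V))\<bar> * (\<bar>k $ i\<bar> * (k $ j)\<^sup>2)) * P k \<le> (1 * (norm k * (norm k)\<^sup>2)) * P k"
        using P_nonneg by (intro mult_right_mono) auto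
      also have "1 * (norm k * (norm k)\<^sup>2) = norm k ^ 3" by (simp add: power2_eq_square power3_eq_cube)
      finally have "(\<bar>sin (s * (k \<bullet> V))\<bar> * (\<bar>k $ i\<bar> * (k $ j)\<^sup>2)) * P k \<le> norm k ^ 3 * P k" .
      then have "(\<bar>s\<bar> * E s k) * ((\<bar>sin (s * (k \<bullet> V))\<bar> * (\<bar>k $ i\<bar> * (k $ j)\<^sup>2)) * P k) \<le> (\<bar>s\<bar> * E s k) * (norm k ^ 3 * P k)"
        by (intro mult_left_mono) auto
      moreover have "\<bar>?F s k\<bar> \<le> (\<bar>s\<bar> * E s k) * ((\<bar>sin (s * (k \<bullet> V))\<bar> * (\<bar>k $ i\<bar> * (k $ j)\<^sup>2)) * P k)"
        using P_nonneg[of k] by (cases "s \<le> 0") (simp_all add: abs_mult mult_ac)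
      ultimately show ?thesis unfolding A2_def by linarith
    qed
    have Fi: "integrable (lborel \<Otimes>\<^sub>M lborel) (\<lambda>(s, k). ?F s k)"
      by (rule Bochner_Integration.integrable_bound[OF A2_integrable m]) (use order_trans[OF Fb abs_ge_self] in auto)
    have G: "(LBINT s. ?F s k) = ?G j k" for k
    proof (cases "k = 0")
      case False
      then have k: "norm k > 0" by simp
      have "(LBINT s. ?F s k) = (LBINT s. (k $ i * (k $ j)\<^sup>2 * P k) * (indicator {..0} s * (exp (- s\<^sup>2 * (norm k)\<^sup>2 / 2) * (s * sin (s * (k \<bullet> V))))))"
        by (simp add: mult_ac)
      then show ?thesis unfolding integral_mult_right_zero half_gaussian_sin(2)[OF k] .
    qed simp
    show "integrable lborel (?G j)" using lborel_pair.integrable_snd[OF Fi] by (simp only: G)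
    have "(LBINT s. (- s * indicator {..0} s) * ?J j s) = (LBINT s. ?c * (LBINT k. ?F s k))"
    proof (rule integral_cong_AE)
      have ae: "(- s * indicator {..0} s) * ?J j s = ?c * (LBINT k. ?F s k)" if "s \<noteq> 0" for s
      proof -
        have "(- s * indicator {..0} s) * ?J j s = ?c * (LBINT k. (- s * indicator {..0} s) * (E s k * (- sin (s * (k \<bullet> V)) * (k $ i * (k $ j)\<^sup>2 * P k))))"
          unfolding hessian_correlation[OF that] integral_mult_right_zero by simp
        also have "\<dots> = ?c * (LBINT k. ?F s k)" by (simp add: mult_ac)
        finally show ?thesis .
      qed
      show "AE s in lborel. (- s * indicator {..0} s) * ?J j s = ?c * (LBINT k. ?F s k)"
        by (rule AE_mp[OF AE_lborel_singleton[of 0]], rule AE_I2, rule impI, rule ae)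
    qed measurable
    also have "\<dots> = ?c * (LBINT k. ?G j k)"
    proof -
      have "(LBINT s. (LBINT k. ?F s k)) = (LBINT k. (LBINT s. ?F s k))"
        by (rule lborel_pair.Fubini_integral[OF Fi, symmetric])
      also have "\<dots> = (LBINT k. ?G j k)" by (simp only: G)
      finally show ?thesis unfolding integral_mult_right_zero[of _ ?c] by (simp only:)
    qed
    finally show "(LBINT s. (- s * indicator {..0} s) * ?J j s) = ?c * (LBINT k. ?G j k)" .
  qed
  have inner: "(\<Sum>j\<in>UNIV. ?G j k) = sqrt (2 * pi) / 2 * (W k * sgn k $ i * ridge [:0, 1:] (sgn k \<bullet> V))" for k
  proof (cases "k = 0")
    case False
    then have k: "norm k \<noteq> 0" by simp
    have gen: "(\<Sum>j\<in>UNIV. (x * f j * p) * z) = x * (\<Sum>j\<in>UNIV. f j) * p * z" for x p z :: real and f :: "'n \<Rightarrow> real"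
      by (simp add: sum_distrib_left sum_distrib_right)
    have "(\<Sum>j\<in>UNIV. ?G j k) = k $ i * (\<Sum>j\<in>UNIV. (k $ j)\<^sup>2) * P k * ((k \<bullet> V) / (norm k)\<^sup>2 * (sqrt (2 * pi) / (2 * norm k) * exp (- (k \<bullet> V / norm k)\<^sup>2 / 2)))"
      by (rule gen)
    also have "(\<Sum>j\<in>UNIV. (k $ j)\<^sup>2) = (norm k)\<^sup>2"
      unfolding dot_square_norm[symmetric] inner_vec_def by (simp add: power2_eq_square)
    also have "k $ i * (norm k)\<^sup>2 * P k * ((k \<bullet> V) / (norm k)\<^sup>2 * (sqrt (2 * pi) / (2 * norm k) * exp (- (k \<bullet> V / norm k)\<^sup>2 / 2)))
      = sqrt (2 * pi) / 2 * (W k * sgn k $ i * ridge [:0, 1:] (sgn k \<bullet> V))"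
    proof -
      have r: "ridge [:0, 1:] (sgn k \<bullet> V) = (k \<bullet> V) / norm k * exp (- (k \<bullet> V / norm k)\<^sup>2 / 2)"
        by (simp add: ridge_def sgn_inner)
      have "W k * sgn k $ i = k $ i * P k" using k by (simp add: W_def sgn_nth)
      then show ?thesis unfolding r using k by simp
    qed
    finally show ?thesis .
  qed (simp add: W_def)
  have "(\<Sum>j\<in>UNIV. (LBINT s. (- s * indicator {..0} s) * ?J j s)) = ?c * (LBINT k. (\<Sum>j\<in>UNIV. ?G j k))"
    unfolding *(2) sum_distrib_left[symmetric] by (subst Bochner_Integration.integral_sum) (use *(1) in auto)
  also have "\<dots> = ?c * (LBINT k. sqrt (2 * pi) / 2 * (W k * sgn k $ i * ridge [:0, 1:] (sgn k \<bullet> V)))"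
    by (simp only: inner)
  finally show ?thesis unfolding D_mult_V integral_mult_right_zero by (simp add: ridge_mix_def c\<^sub>0_def)
qed

section \<open>The coefficients of the diffusion are those of the Landau equation\<close>

lemma abs_indicator_le: "\<bar>indicator {..0::real} s\<bar> \<le> 1 + \<bar>s\<bar>" "\<bar>- s * indicator {..0::real} s\<bar> \<le> 1 + \<bar>s\<bar>"
  by (auto simp: indicator_def)

lemma outside_zero: "x \<notin> cball 0 R \<Longrightarrow> partial i \<Phi> x = 0" "x \<notin> cball 0 R \<Longrightarrow> partial i (partial j \<Phi>) x = 0"
  using supp_gradient[of i] supp_hessian[of i j] by (auto simp: cont_supp_def)

lemma diffusion_matrix_eq: "diffusion_matrix \<Phi> R V = D V"
proof -
  define I where "I v x = (LBINT s. indicator {..0} s *\<^sub>R grad \<Phi> (x + s *\<^sub>R v))" for v x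
  define h where "h i j x v = gauss (v + V) * (partial i \<Phi> x * (LBINT s. indicator {..0} s * partial j \<Phi> (x + s *\<^sub>R v)))" for i j x v
  have I: "I v x $ j = (LBINT s. indicator {..0} s * partial j \<Phi> (x + s *\<^sub>R v))" if "v \<noteq> 0" for v x j
  proof -
    have "(\<lambda>s. (indicator {..0} s *\<^sub>R grad \<Phi> (x + s *\<^sub>R v)) $ l) = (\<lambda>s. indicator {..0} s * partial l \<Phi> (x + s *\<^sub>R v))" for l
      by (simp add: grad_def)
    then show ?thesis
      using integral_vec(2)[of lborel "\<lambda>s. indicator {..0} s *\<^sub>R grad \<Phi> (x + s *\<^sub>R v)" j] integrable_line[OF supp_gradient that _ abs_indicator_le(1)]
      unfolding I_def by simp
  qed
  have Im[measurable]: "(\<lambda>v. I v x) \<in> borel_measurable borel" for x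
    unfolding I_def by measurable
  have hi: "integrable lborel (h i j x)" and hI: "integrable lborel (\<lambda>x. LBINT v. h i j x v)" for i j x
    unfolding h_def by (intro position_fubini[OF dim4 R supp_gradient supp_gradient] abs_indicator_le; simp)+
  have row: "integrable lborel (\<lambda>v. (gauss (v + V) *\<^sub>R outer (grad \<Phi> x) (I v x)) $ i)"
    and entry: "(LBINT v. (gauss (v + V) *\<^sub>R outer (grad \<Phi> x) (I v x)) $ i) $ j = (LBINT v. h i j x v)" for x i j
  proof -
    have m: "(\<lambda>v. (gauss (v + V) *\<^sub>R outer (grad \<Phi> x) (I v x)) $ i) \<in> borel_measurable lborel"
    proof -
      have "(\<lambda>v. (gauss (v + V) *\<^sub>R outer (grad \<Phi> x) (I v x)) $ i) = (\<lambda>v. (gauss (v + V) * grad \<Phi> x $ i) *\<^sub>R I v x)"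
        by (simp add: outer_def vec_eq_iff fun_eq_iff)
      then show ?thesis by simp
    qed
    have ae: "AE v in lborel. (gauss (v + V) *\<^sub>R outer (grad \<Phi> x) (I v x)) $ i $ j = h i j x v" for j
      by (rule AE_mp[OF AE_lborel_singleton[of 0]], rule AE_I2) (simp add: outer_def I h_def grad_def)
    show "integrable lborel (\<lambda>v. (gauss (v + V) *\<^sub>R outer (grad \<Phi> x) (I v x)) $ i)"
      and "(LBINT v. (gauss (v + V) *\<^sub>R outer (grad \<Phi> x) (I v x)) $ i) $ j = (LBINT v. h i j x v)"
      using integral_vec_AE[OF m, of "\<lambda>j. h i j x"] hi ae by blast+
  qed
  have inner: "(LBINT v. gauss (v + V) *\<^sub>R outer (grad \<Phi> x) (I v x)) $ i $ j = (LBINT v. h i j x v)" for x i j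
    using integral_vec(2)[of lborel "\<lambda>v. gauss (v + V) *\<^sub>R outer (grad \<Phi> x) (I v x)" i, OF row] entry[of x i j] by (simp only:)
  let ?O = "\<lambda>x. indicator (cball 0 R) x *\<^sub>R (LBINT v. gauss (v + V) *\<^sub>R outer (grad \<Phi> x) (I v x))"
  have O: "?O x $ i $ j = (LBINT v. h i j x v)" for x i j
    using inner[of x i j] outside_zero(1)[of x i] by (cases "x \<in> cball 0 R") (auto simp: h_def)
  have Orow: "integrable lborel (\<lambda>x. ?O x $ i)" "(LBINT x. ?O x $ i) $ j = (LBINT x. (LBINT v. h i j x v))" for i j
    using integral_vec[of lborel "\<lambda>x. ?O x $ i"] hI unfolding O by blast+
  have "(LBINT x. ?O x) $ i $ j = D V $ i $ j" for i j
  proof -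
    have "(LBINT x. ?O x) $ i $ j = (LBINT x. (LBINT v. h i j x v))"
      using integral_vec(2)[of lborel ?O i, OF Orow(1)] Orow(2)[of i j] by (simp only:)
    also have "\<dots> = (LBINT s. indicator {..0} s * (LBINT v. gauss (v + V) * (LBINT x. partial i \<Phi> x * partial j \<Phi> (x + s *\<^sub>R v))))"
      unfolding h_def by (intro position_fubini(3)[OF dim4 R supp_gradient supp_gradient] abs_indicator_le) simp
    also have "\<dots> = D V $ i $ j" by (rule position_integral_D)
    finally show ?thesis .
  qed
  then show ?thesis
    unfolding diffusion_matrix_def set_lebesgue_integral_def I_def[symmetric] by (simp only: vec_eq_iff) simp
qed

text \<open>By \<open>double_line_integral\<close> the two time integrals are a single one with the weight \<open>- s\<close>.\<close>

lemma Lambda_eq: "Lambda \<Phi> R V = - (D V *v V)"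
proof -
  define I where "I v x = (LBINT s. indicator {..0} s *\<^sub>R (LBINT u. indicator {..s} u *\<^sub>R grad \<Phi> (x + u *\<^sub>R v)))" for v x
  define h where "h i j x v = gauss (v + V) * (partial i (partial j \<Phi>) x * (LBINT s. (- s * indicator {..0} s) * partial j \<Phi> (x + s *\<^sub>R v)))" for i j x v
  have I: "I v x $ j = (LBINT s. (- s * indicator {..0} s) * partial j \<Phi> (x + s *\<^sub>R v))" if v: "v \<noteq> 0" for v x j
  proof -
    have 1: "(LBINT u. indicator {..s} u *\<^sub>R grad \<Phi> (x + u *\<^sub>R v)) $ l = (LBINT u. indicator {..s} u * partial l \<Phi> (x + u *\<^sub>R v))" for s l
    proof -
      have "(\<lambda>u. (indicator {..s} u *\<^sub>R grad \<Phi> (x + u *\<^sub>R v)) $ l) = (\<lambda>u. indicator {..s} u * partial l \<Phi> (x + u *\<^sub>R v))" for l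
        by (simp add: grad_def)
      moreover have "integrable lborel (\<lambda>u. indicator {..s} u * partial l \<Phi> (x + u *\<^sub>R v))" for l
        by (rule integrable_line[OF supp_gradient v]) (auto simp: indicator_def)
      ultimately show ?thesis
        using integral_vec(2)[of lborel "\<lambda>u. indicator {..s} u *\<^sub>R grad \<Phi> (x + u *\<^sub>R v)" l] by simp
    qed
    have "(\<lambda>s. (indicator {..0} s *\<^sub>R (LBINT u. indicator {..s} u *\<^sub>R grad \<Phi> (x + u *\<^sub>R v))) $ l) = (\<lambda>s. indicator {..0} s * (LBINT u. indicator {..s} u * partial l \<Phi> (x + u *\<^sub>R v)))" for l
      by (simp add: 1)
    then show ?thesis
      using integral_vec(2)[of lborel "\<lambda>s. indicator {..0} s *\<^sub>R (LBINT u. indicator {..s} u *\<^sub>R grad \<Phi> (x + u *\<^sub>R v))" j] double_line_integral[OF supp_gradient v]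
      unfolding I_def by simp
  qed
  have Im[measurable]: "(\<lambda>v. I v x) \<in> borel_measurable borel" for x
  proof -
    have e: "I v x = (LBINT s. (if s \<le> 0 then 1 else 0) *\<^sub>R (LBINT u. (if u \<le> s then 1 else 0) *\<^sub>R grad \<Phi> (x + u *\<^sub>R v)))" for v
      unfolding I_def by (intro Bochner_Integration.integral_cong refl arg_cong2[of _ _ _ _ scaleR]) (auto simp: indicator_def)
    show ?thesis unfolding e by measurable
  qed
  have hi: "integrable lborel (h i j x)" and hI: "integrable lborel (\<lambda>x. LBINT v. h i j x v)" for i j x
    unfolding h_def by (intro position_fubini[OF dim4 R supp_hessian supp_gradient] abs_indicator_le; simp)+
  let ?g = "\<lambda>i x v. \<Sum>j\<in>UNIV. h i j x v"
  have inner: "(LBINT v. gauss (v + V) *\<^sub>R (Hess \<Phi> x *v I v x)) $ i = (LBINT v. ?g i x v)" for x i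
  proof (rule integral_vec_AE)
    show "(\<lambda>v. gauss (v + V) *\<^sub>R (Hess \<Phi> x *v I v x)) \<in> borel_measurable lborel"
    proof -
      have "(\<lambda>w. Hess \<Phi> x *v w) \<in> borel_measurable borel"
        by (intro borel_measurable_continuous_onI linear_continuous_on) (simp add: linear_linear matrix_vector_mul_linear)
      from measurable_compose[OF Im this] show ?thesis by simp
    qed
    show "integrable lborel (?g i x)" for i by (intro Bochner_Integration.integrable_sum hi)
    show "AE v in lborel. (gauss (v + V) *\<^sub>R (Hess \<Phi> x *v I v x)) $ i = ?g i x v" for i
      by (rule AE_mp[OF AE_lborel_singleton[of 0]], rule AE_I2)
         (simp add: matrix_vector_mult_def Hess_def I h_def sum_distrib_left)
  qed
  let ?O = "\<lambda>x. indicator (cball 0 R) x *\<^sub>R (LBINT v. gauss (v + V) *\<^sub>R (Hess \<Phi> x *v I v x))"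
  have O: "?O x $ i = (\<Sum>j\<in>UNIV. \<integral>v. h i j x v \<partial>lborel)" for x i
  proof -
    have s: "(LBINT v. ?g i x v) = (\<Sum>j\<in>UNIV. \<integral>v. h i j x v \<partial>lborel)"
      by (intro Bochner_Integration.integral_sum hi)
    show ?thesis
      using inner[of x i] s outside_zero(2)[of x i] by (cases "x \<in> cball 0 R") (auto simp: h_def)
  qed
  have "(LBINT x. ?O x) $ i = (D V *v V) $ i" for i
  proof -
    have "(LBINT x. ?O x) $ i = (LBINT x. (\<Sum>j\<in>UNIV. \<integral>v. h i j x v \<partial>lborel))"
      unfolding O[symmetric] by (rule integral_vec(2)) (unfold O, intro Bochner_Integration.integrable_sum hI)
    also have "\<dots> = (\<Sum>j\<in>UNIV. (LBINT x. (LBINT v. h i j x v)))"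
      by (intro Bochner_Integration.integral_sum hI)
    also have "\<dots> = (\<Sum>j\<in>UNIV. (LBINT s. (- s * indicator {..0} s) * (LBINT v. gauss (v + V) * (LBINT x. partial i (partial j \<Phi>) x * partial j \<Phi> (x + s *\<^sub>R v)))))"
      unfolding h_def by (intro sum.cong refl position_fubini(3)[OF dim4 R supp_hessian supp_gradient] abs_indicator_le) simp
    also have "\<dots> = (D V *v V) $ i" by (rule position_integral_Lambda)
    finally show ?thesis .
  qed
  then show ?thesis
    unfolding Lambda_def set_lebesgue_integral_def I_def[symmetric] by (simp only: vec_eq_iff) simp
qed

lemma D_nth: "D V $ i $ j = c\<^sub>0 * ridge_mix (\<lambda>k. W k * sgn k $ i * sgn k $ j) sgn 1 V"
  by (simp add: D_def)

text \<open>Both sides carry the factor \<open>exp (- (sgn k \<bullet> V)\<^sup>2 / 2)\<close>: here it comes from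
  \<open>integral_dirac_gauss\<close>.\<close>

lemma landau_matrix_eq: "landau_matrix \<Phi> V = D V"
proof -
  let ?f = "\<lambda>k. ((cmod (fourier \<Phi> k))\<^sup>2 * integral_dirac k (\<lambda>v. gauss (v + V))) *\<^sub>R outer k k"
  let ?g = "\<lambda>i j k. (W k * sgn k $ i * sgn k $ j) * ridge 1 (sgn k \<bullet> V)"
  have e: "?f k $ i $ j = 1 / sqrt (2 * pi) * ?g i j k" for k i j
  proof (cases "k = 0")
    case False
    then show ?thesis
      unfolding fourier_P integral_dirac_gauss[OF False]
      by (simp add: outer_def ridge_def W_def sgn_nth)
  qed (simp add: outer_def W_def)
  have g: "integrable lborel (\<lambda>k. 1 / sqrt (2 * pi) * ?g i j k)" for i j
    by (intro integrable_mult_right ridge_integrable D_weight_integrable)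
  have r: "integrable lborel (\<lambda>k. ?f k $ i)" "(LBINT k. ?f k $ i) $ j = (LBINT k. 1 / sqrt (2 * pi) * ?g i j k)" for i j
    using integral_vec[of lborel "\<lambda>k. ?f k $ i"] g unfolding e by blast+
  have "(LBINT k. ?f k) $ i $ j = 1 / sqrt (2 * pi) * ridge_mix (\<lambda>k. W k * sgn k $ i * sgn k $ j) sgn 1 V" for i j
    using integral_vec(2)[of lborel ?f i, OF r(1)] r(2)[of i j]
    unfolding ridge_mix_def integral_mult_right_zero by (simp only:)
  note eq = this
  have c: "pi / (2 * pi) ^ CARD('n) * (1 / sqrt (2 * pi)) = c\<^sub>0"
  proof -
    have "sqrt (2 * pi) * sqrt (2 * pi) = 2 * pi" by simp
    then show ?thesis unfolding c\<^sub>0_def by (simp add: field_simps)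
  qed
  show ?thesis
    unfolding vec_eq_iff
  proof (intro allI)
    fix i j
    have "landau_matrix \<Phi> V $ i $ j = pi / (2 * pi) ^ CARD('n) * ((LBINT k. ?f k) $ i $ j)"
      by (simp only: landau_matrix_def vector_scaleR_component real_scaleR_def)
    then show "landau_matrix \<Phi> V $ i $ j = D V $ i $ j"
      unfolding eq D_nth c[symmetric] by (simp only: mult.assoc)
  qed
qed

lemma transpose_D: "transpose (D V) = D V"
  by (simp add: transpose_def vec_eq_iff D_nth mult_ac)

lemma sgn_facts: "(sgn :: real^'n \<Rightarrow> _) \<in> borel_measurable borel" "norm (sgn (k::real^'n)) \<le> 1"
  by (auto simp: norm_sgn)

lemma c0_pos: "c\<^sub>0 > 0" by (simp add: c\<^sub>0_def)

lemma const_mult_ridge_mix: "c * ridge_mix m n p V = ridge_mix (\<lambda>k. c * m k) n p V"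
  by (simp add: ridge_mix_def mult.assoc)

lemma D_ridge: "(\<lambda>V. D V $ i $ j) = ridge_mix (\<lambda>k. c\<^sub>0 * (W k * sgn k $ i * sgn k $ j)) sgn 1"
  by (rule ext) (simp only: D_nth const_mult_ridge_mix)

lemma C_k_D: "C_k l (\<lambda>V. D V $ i $ j)"
  unfolding D_ridge by (intro C_k_ridge_mix sgn_facts integrable_mult_right D_weight_integrable)

lemma D_differentiable: "(\<lambda>V. D V $ i $ j) differentiable (at V)" "partial l (\<lambda>V. D V $ i $ j) differentiable (at V)"
  using C_k_D[of 2 i j] by (auto simp: numeral_2_eq_2)

lemma continuous_D: "continuous_on UNIV (\<lambda>V. D V $ i $ j)"
  by (rule C_k_continuous[OF C_k_D[of 0]])

lemma D_bounded: "\<exists>K\<ge>0. \<forall>V. \<bar>D V $ i $ j\<bar> \<le> K"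
  using ridge_mix_bounded[of "\<lambda>k. c\<^sub>0 * (W k * sgn k $ i * sgn k $ j)" sgn 1] D_ridge[of i j]
    integrable_mult_right[OF D_weight_integrable, of c\<^sub>0 i j] sgn_facts(1) by (metis (no_types, lifting))

lemma DV_ridge: "(\<lambda>V. (D V *v V) $ i) = ridge_mix (\<lambda>k. c\<^sub>0 * (W k * sgn k $ i)) sgn [:0, 1:]"
  by (rule ext) (simp only: D_mult_V const_mult_ridge_mix)

lemma Lambda_bounded: "\<exists>K\<ge>0. \<forall>V. \<bar>Lambda \<Phi> R V $ i\<bar> \<le> K"
proof -
  obtain K where "K \<ge> 0" "\<And>V. \<bar>(D V *v V) $ i\<bar> \<le> K"
    using ridge_mix_bounded[of "\<lambda>k. c\<^sub>0 * (W k * sgn k $ i)" sgn "[:0, 1:]"] fun_cong[OF DV_ridge[of i]]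
      integrable_mult_right[OF unit_mult[OF W_integrable], of c\<^sub>0 i] sgn_facts(1) by (metis (no_types, lifting))
  then show ?thesis unfolding Lambda_eq by (intro exI[of _ K]) simp
qed

lemma continuous_Lambda: "continuous_on UNIV (Lambda \<Phi> R)"
proof -
  have c: "continuous_on UNIV (\<lambda>V. (D V *v V) $ i)" for i
    unfolding DV_ridge
    by (intro C_k_continuous[OF C_k_ridge_mix[where l=0]] sgn_facts integrable_mult_right unit_mult W_integrable)
  have "continuous_on UNIV (\<lambda>V. \<chi> i. - ((D V *v V) $ i))" by (intro continuous_on_vec_lambda continuous_on_minus c)
  moreover have "(\<lambda>V. \<chi> i. - ((D V *v V) $ i)) = Lambda \<Phi> R" by (simp add: Lambda_eq fun_eq_iff vec_eq_iff)
  ultimately show ?thesis by (simp only:)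
qed

text \<open>Differentiating the profile brings down \<open>- (sgn k \<bullet> V)\<close> times a component of \<open>sgn k\<close>;
  contraction leaves the squared norm of \<open>sgn k\<close>, and the result is that of \<open>D_mult_V\<close> with the
  opposite sign.\<close>

lemma divergence_D: "(\<Sum>j\<in>UNIV. partial j (\<lambda>W. D W $ i $ j) V) = - ((D V *v V) $ i)"
proof -
  have h: "hermite_step 1 = - [:0, 1:]" by (simp add: hermite_step_def)
  have "(\<Sum>j\<in>UNIV. partial j (\<lambda>W. D W $ i $ j) V)
    = (\<Sum>j\<in>UNIV. \<integral>k. c\<^sub>0 * (W k * sgn k $ i * sgn k $ j) * sgn k $ j * ridge (- [:0, 1:]) (sgn k \<bullet> V) \<partial>lborel)"
    unfolding D_ridge
    by (intro sum.cong refl) (subst partial_ridge_mix, (intro sgn_facts integrable_mult_right D_weight_integrable)+, simp add: ridge_mix_def h)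
  also have "\<dots> = (LBINT k. (\<Sum>j\<in>UNIV. c\<^sub>0 * (W k * sgn k $ i * sgn k $ j) * sgn k $ j * ridge (- [:0, 1:]) (sgn k \<bullet> V)))"
    by (intro Bochner_Integration.integral_sum[symmetric] ridge_integrable unit_mult integrable_mult_right D_weight_integrable)
  also have "\<dots> = (LBINT k. - (c\<^sub>0 * (W k * sgn k $ i) * ridge [:0, 1:] (sgn k \<bullet> V)))"
  proof (intro Bochner_Integration.integral_cong refl)
    fix k :: "real^'n"
    have "(\<Sum>j\<in>UNIV. c\<^sub>0 * (W k * sgn k $ i * sgn k $ j) * sgn k $ j * ridge (- [:0, 1:]) (sgn k \<bullet> V))
       = c\<^sub>0 * (W k * sgn k $ i) * ridge (- [:0, 1:]) (sgn k \<bullet> V) * (\<Sum>j\<in>UNIV. sgn k $ j * sgn k $ j)"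
      by (simp add: sum_distrib_left mult_ac)
    also have "(\<Sum>j\<in>UNIV. sgn k $ j * sgn k $ j) = (norm (sgn k))\<^sup>2"
      unfolding dot_square_norm[symmetric] inner_vec_def by simp
    also have "c\<^sub>0 * (W k * sgn k $ i) * ridge (- [:0, 1:]) (sgn k \<bullet> V) * (norm (sgn k))\<^sup>2 = - (c\<^sub>0 * (W k * sgn k $ i) * ridge [:0, 1:] (sgn k \<bullet> V))"
      by (cases "k = 0") (simp_all add: W_def norm_sgn ridge_def)
    finally show "(\<Sum>j\<in>UNIV. c\<^sub>0 * (W k * sgn k $ i * sgn k $ j) * sgn k $ j * ridge (- [:0, 1:]) (sgn k \<bullet> V))
       = - (c\<^sub>0 * (W k * sgn k $ i) * ridge [:0, 1:] (sgn k \<bullet> V))" .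
  qed
  also have "\<dots> = - ((D V *v V) $ i)" using fun_cong[OF DV_ridge[of i], of V] by (simp add: ridge_mix_def)
  finally show ?thesis .
qed

section \<open>Positive definiteness\<close>

text \<open>If the power spectrum vanished, so would all Gaussian averages of the autocorrelation of
  the potential, by \<open>smoothed_autocorrelation\<close>. Letting their width tend to zero gives the value
  of the autocorrelation at \<open>0\<close>, which is the integral of \<open>\<Phi>\<^sup>2\<close>.\<close>

lemma P_not_null: "\<not> (AE k in lborel. P k = 0)"
proof
  assume ae: "AE k in lborel. P k = 0"
  define f where "f y = (LBINT x. \<Phi> x * \<Phi> (x + y))" for y
  have i: "integrable lborel \<Phi>" by (rule cont_supp_integrable[OF supp_potential])
  obtain C where C: "C \<ge> 0" "\<And>x. \<bar>\<Phi> x\<bar> \<le> C" using cont_supp_bounded[OF supp_potential] by auto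
  have cont: "continuous_on UNIV \<Phi>" using supp_potential by (simp add: cont_supp_def)
  have smooth0: "(LBINT v. gauss (v + 0) * f (s *\<^sub>R v)) = 0" if s: "s \<noteq> 0" for s
  proof -
    have "(LBINT v. gauss (v + 0) * f (s *\<^sub>R v)) = 1 / (2 * pi) ^ CARD('n) * (LBINT k. E s k * (P k))"
      unfolding f_def smoothed_autocorrelation[OF supp_potential supp_potential s] by (simp add: P_def power2_eq_square)
    also have "(LBINT k. E s k * (P k)) = (\<integral>k. 0 \<partial>(lborel :: (real^'n) measure))"
      by (rule integral_cong_AE) (use ae in auto)
    finally show ?thesis by simp
  qed
  have fb: "\<bar>f y\<bar> \<le> (LBINT x. \<bar>\<Phi> x\<bar> * C)" for y
  proof -
    have b: "\<bar>\<Phi> x * \<Phi> (x + y)\<bar> \<le> \<bar>\<Phi> x\<bar> * C" for x unfolding abs_mult using C by (intro mult_left_mono) auto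
    have "integrable lborel (\<lambda>x. \<Phi> x * \<Phi> (x + y))"
    proof (rule Bochner_Integration.integrable_bound[of lborel "\<lambda>x. \<bar>\<Phi> x\<bar> * C"])
      show "AE x in lborel. norm (\<Phi> x * \<Phi> (x + y)) \<le> norm (\<bar>\<Phi> x\<bar> * C)"
        using order_trans[OF b abs_ge_self] by auto
    qed (use i in auto)
    then show ?thesis
      unfolding f_def using b i by (intro order_trans[OF integral_abs_bound] integral_mono integrable_abs) auto
  qed
  have f_lim: "(\<lambda>n. f (y n)) \<longlonglongrightarrow> f 0" if y: "y \<longlonglongrightarrow> 0" for y :: "nat \<Rightarrow> real^'n"
    unfolding f_def
  proof (rule integral_dominated_convergence[where w="\<lambda>x. \<bar>\<Phi> x\<bar> * C"])
    show "AE x in lborel. (\<lambda>n. \<Phi> x * \<Phi> (x + y n)) \<longlonglongrightarrow> \<Phi> x * \<Phi> (x + 0)"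
    proof (rule AE_I2)
      fix x
      have "(\<lambda>n. x + y n) \<longlonglongrightarrow> x + 0" by (intro tendsto_intros y)
      then have "(\<lambda>n. \<Phi> (x + y n)) \<longlonglongrightarrow> \<Phi> (x + 0)"
        using continuous_on_tendsto_compose[OF cont] by simp
      then show "(\<lambda>n. \<Phi> x * \<Phi> (x + y n)) \<longlonglongrightarrow> \<Phi> x * \<Phi> (x + 0)" by (intro tendsto_intros)
    qed
    show "AE x in lborel. norm (\<Phi> x * \<Phi> (x + y n)) \<le> \<bar>\<Phi> x\<bar> * C" for n
      using C by (auto simp: abs_mult intro!: AE_I2 mult_left_mono)
  qed (use i in auto)
  have "(\<lambda>n. LBINT v. gauss (v + 0) * f ((1 / real (Suc n)) *\<^sub>R v)) \<longlonglongrightarrow> (\<integral>v. gauss (v + 0) * f 0 \<partial>(lborel :: (real^'n) measure))"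
  proof (rule integral_dominated_convergence[where w="\<lambda>v. gauss (v + 0) * (LBINT x. \<bar>\<Phi> x\<bar> * C)"])
    show "AE v in lborel. (\<lambda>n. gauss (v + 0) * f ((1 / real (Suc n)) *\<^sub>R v)) \<longlonglongrightarrow> gauss (v + 0) * f 0"
    proof (rule AE_I2)
      fix v :: "real^'n"
      have "(\<lambda>n. (1 / real (Suc n)) *\<^sub>R v) \<longlonglongrightarrow> 0 *\<^sub>R v"
        by (intro tendsto_intros lim_1_over_n[THEN LIMSEQ_Suc])
      then have "(\<lambda>n. f ((1 / real (Suc n)) *\<^sub>R v)) \<longlonglongrightarrow> f 0" by (intro f_lim) simp
      then show "(\<lambda>n. gauss (v + 0) * f ((1 / real (Suc n)) *\<^sub>R v)) \<longlonglongrightarrow> gauss (v + 0) * f 0" by (intro tendsto_intros)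
    qed
    show "AE v in lborel. norm (gauss (v + 0) * f ((1 / real (Suc n)) *\<^sub>R v)) \<le> gauss (v + 0) * (LBINT x. \<bar>\<Phi> x\<bar> * C)" for n
      using fb less_imp_le[OF gauss_pos] by (auto simp: abs_mult intro!: AE_I2 mult_mono)
    show "(\<lambda>v. gauss (v + 0) * f ((1 / real (Suc n)) *\<^sub>R v)) \<in> borel_measurable lborel" for n
      unfolding f_def by measurable
    show "integrable lborel (\<lambda>v. gauss (v + 0) * (LBINT x. \<bar>\<Phi> x\<bar> * C))"
      by (intro integrable_mult_left integrable_gauss_shift)
  qed measurable
  note lim = this
  have z: "(LBINT v. gauss (v + 0) * f ((1 / real (Suc n)) *\<^sub>R v)) = 0" for n
    by (rule smooth0) simp
  have "(\<integral>v. gauss (v + 0) * f 0 \<partial>(lborel :: (real^'n) measure)) = 0"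
    by (rule LIMSEQ_unique[OF lim]) (simp only: z tendsto_const)
  then have "f 0 = 0" using integral_gauss[where 'n='n] by simp
  then have "(LBINT x. \<Phi> x * \<Phi> x) = 0" by (simp add: f_def)
  moreover have "integrable lborel (\<lambda>x. \<Phi> x * \<Phi> x)"
  proof (rule Bochner_Integration.integrable_bound[of lborel "\<lambda>x. \<Phi> x * C"])
    show "AE x in lborel. norm (\<Phi> x * \<Phi> x) \<le> norm (\<Phi> x * C)"
    proof (rule AE_I2)
      fix x
      have "\<bar>\<Phi> x\<bar> * \<bar>\<Phi> x\<bar> \<le> \<bar>\<Phi> x\<bar> * \<bar>C\<bar>" using C(2)[of x] by (intro mult_left_mono) auto
      then show "norm (\<Phi> x * \<Phi> x) \<le> norm (\<Phi> x * C)" by (simp only: real_norm_def abs_mult)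
    qed
  qed (use i in auto)
  ultimately have "AE x in lborel. \<Phi> x * \<Phi> x = 0"
    by (subst (asm) integral_nonneg_eq_0_iff_AE) auto
  then have "AE x\<in>UNIV in lborel. \<Phi> x = 0" by simp
  moreover obtain x0 where x0: "\<Phi> x0 \<noteq> 0" using nz by blast
  have "open {x. \<Phi> x \<noteq> 0}"
    by (rule open_Collect_neq[OF cont continuous_on_const])
  ultimately show False
  proof -
    obtain e where e: "e > 0" "ball x0 e \<subseteq> {x. \<Phi> x \<noteq> 0}"
      using \<open>open {x. \<Phi> x \<noteq> 0}\<close> x0 open_contains_ball by blast
    have "AE x in lborel. x \<notin> ball x0 e" using \<open>AE x\<in>UNIV in lborel. \<Phi> x = 0\<close> by eventually_elim (use e in auto)
    then have "emeasure lborel (ball x0 e) = 0" using AE_iff_null_sets[of "ball x0 e" lborel] by auto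
    then show False using content_ball_pos[OF e(1), of x0] by (simp add: measure_def)
  qed
qed

text \<open>The quadratic form is the integral of \<open>(sgn k \<bullet> x)\<^sup>2\<close> against a nonnegative density. If it
  vanished, the power spectrum would be zero outside the null set \<open>k \<bullet> x = 0\<close>.\<close>

lemma D_spd: "sym_pos_def (D V)"
  unfolding sym_pos_def_def
proof (intro conjI transpose_D allI impI)
  fix x :: "real^'n" assume x: "x \<noteq> 0"
  let ?g = "\<lambda>k. (sgn k \<bullet> x)\<^sup>2 * (W k * ridge 1 (sgn k \<bullet> V))"
  have t: "integrable lborel (\<lambda>k. x $ i * (x $ j * ((W k * sgn k $ i * sgn k $ j) * ridge 1 (sgn k \<bullet> V))))" for i j
    by (intro integrable_mult_right ridge_integrable D_weight_integrable)
  have s: "(\<Sum>i\<in>UNIV. \<Sum>j\<in>UNIV. x $ i * (x $ j * ((W k * sgn k $ i * sgn k $ j) * ridge 1 (sgn k \<bullet> V)))) = ?g k" for k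
  proof -
    have "(sgn k \<bullet> x)\<^sup>2 = (\<Sum>i\<in>UNIV. \<Sum>j\<in>UNIV. (sgn k $ i * x $ i) * (sgn k $ j * x $ j))"
      unfolding power2_eq_square inner_vec_def[of "sgn k" x] sum_product by simp
    then show ?thesis by (simp add: sum_distrib_left sum_distrib_right mult_ac)
  qed
  have gi: "integrable lborel ?g"
    unfolding s[symmetric] by (intro Bochner_Integration.integrable_sum t)
  have "x \<bullet> (D V *v x) = c\<^sub>0 * (\<Sum>i\<in>UNIV. \<Sum>j\<in>UNIV. \<integral>k. x $ i * (x $ j * ((W k * sgn k $ i * sgn k $ j) * ridge 1 (sgn k \<bullet> V))) \<partial>lborel)"
    unfolding inner_vec_def[of x] matrix_vector_mult_def D_nth ridge_mix_def integral_mult_right_zero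
    by (simp add: sum_distrib_left mult_ac)
  also have "(\<Sum>i\<in>UNIV. \<Sum>j\<in>UNIV. \<integral>k. x $ i * (x $ j * ((W k * sgn k $ i * sgn k $ j) * ridge 1 (sgn k \<bullet> V))) \<partial>lborel) = (LBINT k. ?g k)"
    unfolding s[symmetric] using t by (simp add: Bochner_Integration.integral_sum Bochner_Integration.integrable_sum)
  finally have eq: "x \<bullet> (D V *v x) = c\<^sub>0 * (LBINT k. ?g k)" .
  have g0: "?g k \<ge> 0" for k using P_nonneg[of k] by (simp add: W_def ridge_def)
  have "(LBINT k. ?g k) \<noteq> 0"
  proof
    assume "(LBINT k. ?g k) = 0"
    then have ae: "AE k in lborel. ?g k = 0"
      using integral_nonneg_eq_0_iff_AE[OF gi] g0 by auto
    have hyper: "AE k in lborel. x \<bullet> k \<noteq> 0"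
    proof -
      have "negligible {k. x \<bullet> k = 0}" using x by (intro negligible_hyperplane) simp
      moreover have "{k. x \<bullet> k = 0} \<in> sets borel" by (intro borel_closed closed_hyperplane)
      ultimately have "{k. x \<bullet> k = 0} \<in> null_sets lborel"
        by (simp add: negligible_iff_null_sets null_sets_completion_iff)
      from AE_not_in[OF this] show ?thesis by simp
    qed
    have "AE k in lborel. P k = 0"
      using ae hyper
    proof eventually_elim
      case (elim k)
      then have "k \<noteq> 0" by auto
      then have "sgn k \<bullet> x \<noteq> 0" using elim(2) inner_commute[of x k] unfolding sgn_inner by simp
      then have "W k * ridge 1 (sgn k \<bullet> V) = 0" using elim(1) by simp
      then show "P k = 0" using \<open>k \<noteq> 0\<close> by (simp add: W_def ridge_def)
    qed
    then show False using P_not_null by simp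
  qed
  moreover have "0 \<le> (LBINT k. ?g k)" using g0 by (intro integral_nonneg_AE) auto
  ultimately show "0 < x \<bullet> (D V *v x)" unfolding eq using c0_pos by simp
qed

lemma Sigma_works:
  shows "transpose (Sigma_coeff \<Phi> R V) = Sigma_coeff \<Phi> R V" "Sigma_coeff \<Phi> R V ** Sigma_coeff \<Phi> R V = D V"
  using spd_sqrt_works[OF D_spd] unfolding Sigma_coeff_def diffusion_matrix_eq sym_pos_def_def by auto

end

section \<open>Brownian increments\<close>

lemma norm_sum_squared:
  fixes x :: "'p \<Rightarrow> 'v::real_inner"
  shows "(norm (\<Sum>p\<in>I. x p))\<^sup>2 = (\<Sum>p\<in>I. \<Sum>q\<in>I. x p \<bullet> x q)"
  unfolding dot_square_norm[symmetric] inner_sum_left inner_sum_right by (rule sum.swap)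

lemma bounded_matrix_entry:
  fixes A :: "real^'n^'n"
  shows "\<bar>A $ i $ j\<bar> \<le> norm A"
  using component_le_norm_cart[of "A $ i" j] Finite_Cartesian_Product.norm_nth_le[of A i] by simp

lemma matrix_inner: "(A :: real^'n^'n) \<bullet> A' = (\<Sum>i\<in>UNIV. \<Sum>j\<in>UNIV. A $ i $ j * A' $ i $ j)"
  by (simp add: inner_vec_def)

text \<open>The length of the intersection of \<open>[a, b]\<close> and \<open>[c, d]\<close>.\<close>

definition overlap :: "real \<Rightarrow> real \<Rightarrow> real \<Rightarrow> real \<Rightarrow> real" where
  "overlap a b c d = max 0 (min b d - max a c)"

lemma interval_overlap_integral:
  "has_bochner_integral lborel (\<lambda>s. indicator {a<..b} s * indicator {c<..d} s :: real) (overlap a b c d)"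
proof -
  have e: "indicator {a<..b} s * indicator {c<..d} s = (indicator {max a c<..min b d} s :: real)" for s
    by (auto simp: indicator_def)
  show ?thesis
    unfolding e has_bochner_integral_iff overlap_def
    by (cases "max a c \<le> min b d") (auto intro!: integrable_real_indicator)
qed

locale brownian = prob_space M for M :: "'w measure" +
  fixes F :: "real \<Rightarrow> 'w measure" and B :: "real \<Rightarrow> 'w \<Rightarrow> real^'n"
  assumes filt: "filtration (space M) F" and sub: "\<And>t. subalgebra M (F t)"
    and bm: "brownian_motion M F B"
begin

lemma space_F: "space (F t) = space M" using sub[of t] by (simp add: subalgebra_def)

lemma F_mono: "f \<in> F s \<rightarrow>\<^sub>M N \<Longrightarrow> s \<le> t \<Longrightarrow> f \<in> F t \<rightarrow>\<^sub>M N"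
  using filtration.sets_F_mono[OF filt, of s t] space_F measurable_mono[of N N "F s" "F t"] by auto

lemma F_M: "f \<in> F s \<rightarrow>\<^sub>M N \<Longrightarrow> f \<in> M \<rightarrow>\<^sub>M N"
  by (rule measurable_from_subalg[OF sub])

lemma B_F: "0 \<le> t \<Longrightarrow> t \<le> 1 \<Longrightarrow> B t \<in> borel_measurable (F t)"
  using bm by (auto simp: brownian_motion_def adapted_def)

lemma B_M: "0 \<le> t \<Longrightarrow> t \<le> 1 \<Longrightarrow> B t \<in> borel_measurable M"
  using F_M[OF B_F] .

lemma indep_increment:
  fixes Z :: "'w \<Rightarrow> real" and h :: "real^'n \<Rightarrow> real"
  assumes st: "0 \<le> s" "s < t" "t \<le> 1" and Z: "Z \<in> borel_measurable (F s)" and h: "h \<in> borel_measurable borel"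
  shows "indep_var borel Z borel (\<lambda>w. h (B t w - B s w))"
proof -
  let ?D = "\<lambda>w. B t w - B s w"
  have [measurable]: "B t \<in> borel_measurable M" "B s \<in> borel_measurable M" using st by (auto intro: B_M)
  note [measurable] = h F_M[OF Z]
  have ind: "indep_set (sets (F s)) (sets (vimage_algebra (space M) ?D borel))"
    using bm st unfolding brownian_motion_def by blast
  have 1: "sigma_sets (space M) {Z -` A \<inter> space M |A. A \<in> sets borel} \<subseteq> sets (F s)"
    using sets.sigma_sets_subset[of "{Z -` A \<inter> space M |A. A \<in> sets borel}" "F s"] measurable_sets[OF Z]
    by (auto simp: space_F)
  have D: "?D \<in> vimage_algebra (space M) ?D borel \<rightarrow>\<^sub>M borel"
    by (rule measurable_vimage_algebra1) auto
  have 2: "sigma_sets (space M) {(\<lambda>w. h (?D w)) -` A \<inter> space M |A. A \<in> sets borel} \<subseteq> sets (vimage_algebra (space M) ?D borel)"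
    using sets.sigma_sets_subset[of "{(\<lambda>w. h (?D w)) -` A \<inter> space M |A. A \<in> sets borel}" "vimage_algebra (space M) ?D borel"]
      measurable_sets[OF measurable_compose[OF D h]] by auto
  have "indep_set (sigma_sets (space M) {Z -` A \<inter> space M |A. A \<in> sets borel})
     (sigma_sets (space M) {(\<lambda>w. h (?D w)) -` A \<inter> space M |A. A \<in> sets borel})"
    using ind unfolding indep_set_def by (rule indep_sets_mono_sets) (use 1 2 in \<open>auto split: bool.split\<close>)
  then show ?thesis unfolding indep_var_eq by simp
qed

text \<open>An increment is \<open>sqrt (t - s)\<close> times a standard Gaussian vector.\<close>

lemma increment_law:
  fixes h :: "real^'n \<Rightarrow> real"
  assumes st: "0 \<le> s" "s < t" "t \<le> 1" and h[measurable]: "h \<in> borel_measurable borel"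
    and i: "integrable lborel (\<lambda>y. gauss y * h (sqrt (t - s) *\<^sub>R y))"
  shows "integrable M (\<lambda>w. h (B t w - B s w))"
    and "(\<integral>w. h (B t w - B s w) \<partial>M) = (LBINT y. gauss y * h (sqrt (t - s) *\<^sub>R y))"
proof -
  let ?n = "CARD('n)"
  define \<delta> where "\<delta> = t - s"
  have \<delta>: "\<delta> > 0" using st by (simp add: \<delta>_def)
  define p :: "real^'n \<Rightarrow> real" where "p x = (2 * pi * \<delta>) powr (- real ?n / 2) * exp (- (norm x)\<^sup>2 / (2 * \<delta>))" for x
  have pn: "p x \<ge> 0" for x by (simp add: p_def)
  have [measurable]: "p \<in> borel_measurable borel" unfolding p_def[abs_def] by measurable
  have dist: "distributed M lborel (\<lambda>w. B t w - B s w) (\<lambda>x. ennreal (p x))"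
    using bm st unfolding brownian_motion_def p_def \<delta>_def by blast
  have pg: "\<bar>sqrt \<delta>\<bar> ^ DIM(real^'n) * p (sqrt \<delta> *\<^sub>R y) = gauss y" for y :: "real^'n"
  proof -
    have "(2 * pi * \<delta>) powr (- real ?n / 2) = (2 * pi) powr (- real ?n / 2) * \<delta> powr (- real ?n / 2)"
      using \<delta> by (simp add: powr_mult)
    moreover have "\<bar>sqrt \<delta>\<bar> ^ ?n = \<delta> powr (real ?n / 2)"
      using \<delta> by (simp add: powr_half_sqrt[symmetric] powr_realpow[symmetric] powr_powr)
    moreover have "\<delta> powr (real ?n / 2) * \<delta> powr (- real ?n / 2) = 1"
      using \<delta> by (simp add: powr_add[symmetric])
    moreover have "(norm (sqrt \<delta> *\<^sub>R y))\<^sup>2 = \<delta> * (norm y)\<^sup>2"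
      using \<delta> by (simp add: power_mult_distrib)
    ultimately show ?thesis using \<delta> unfolding p_def gauss_def by simp
  qed
  have e: "gauss y * h (sqrt \<delta> *\<^sub>R y) = \<bar>sqrt \<delta>\<bar> ^ DIM(real^'n) * (p (0 + sqrt \<delta> *\<^sub>R y) * h (0 + sqrt \<delta> *\<^sub>R y))" for y
    unfolding pg[symmetric] by simp
  have ip: "integrable lborel (\<lambda>x. p x * h x)"
  proof -
    have c: "sqrt \<delta> \<noteq> 0" using \<delta> by simp
    have "integrable lborel (\<lambda>y. \<bar>sqrt \<delta>\<bar> ^ DIM(real^'n) *\<^sub>R (p (0 + sqrt \<delta> *\<^sub>R y) * h (0 + sqrt \<delta> *\<^sub>R y)))"
      using i unfolding \<delta>_def[symmetric] e by simp
    then have "integrable (distr lborel borel (\<lambda>x. 0 + sqrt \<delta> *\<^sub>R x)) (\<lambda>x. \<bar>sqrt \<delta>\<bar> ^ DIM(real^'n) *\<^sub>R (p x * h x))"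
      by (subst integrable_distr_eq) auto
    then have "integrable (density (distr lborel borel (\<lambda>x::real^'n. 0 + sqrt \<delta> *\<^sub>R x)) (\<lambda>_. ennreal (\<bar>sqrt \<delta>\<bar> ^ DIM(real^'n)))) (\<lambda>x. p x * h x)"
      by (subst integrable_density) auto
    then show ?thesis using lborel_affine[OF c, of "0::real^'n"] by (simp add: ennreal_power[symmetric])
  qed
  have pd: "distributed M lborel (\<lambda>w. B t w - B s w) p" by (rule dist)
  show "integrable M (\<lambda>w. h (B t w - B s w))"
    using distributed_integrable[OF pd] ip pn by simp
  have "(\<integral>w. h (B t w - B s w) \<partial>M) = (LBINT x. p x * h x)"
    using distributed_integral[OF pd, of h] pn by simp
  also have "\<dots> = \<bar>sqrt \<delta>\<bar> ^ DIM(real^'n) * (LBINT y. p (0 + sqrt \<delta> *\<^sub>R y) * h (0 + sqrt \<delta> *\<^sub>R y))"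
    using \<delta> by (intro integral_lborel_affine) auto
  also have "\<dots> = (LBINT y. gauss y * h (sqrt \<delta> *\<^sub>R y))"
    unfolding e by (rule integral_mult_right_zero[symmetric])
  finally show "(\<integral>w. h (B t w - B s w) \<partial>M) = (LBINT y. gauss y * h (sqrt (t - s) *\<^sub>R y))"
    by (simp add: \<delta>_def)
qed

lemma mult_indep_increment:
  fixes Z :: "'w \<Rightarrow> real" and h :: "real^'n \<Rightarrow> real"
  assumes st: "0 \<le> s" "s < t" "t \<le> 1" and Z: "Z \<in> borel_measurable (F s)" and Zi: "integrable M Z"
    and h: "h \<in> borel_measurable borel" and i: "integrable lborel (\<lambda>y. gauss y * h (sqrt (t - s) *\<^sub>R y))"
    and v: "(LBINT y. gauss y * h (sqrt (t - s) *\<^sub>R y)) = c"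
  shows "has_bochner_integral M (\<lambda>w. Z w * h (B t w - B s w)) ((\<integral>w. Z w \<partial>M) * c)"
proof -
  note ind = indep_increment[OF st Z h] and law = increment_law[OF st h i]
  show ?thesis
    unfolding has_bochner_integral_iff v[symmetric] law(2)[symmetric]
    using indep_var_integrable[OF ind Zi law(1)] indep_var_lebesgue_integral[OF ind Zi law(1)] by simp
qed

lemma increment_mean:
  fixes Z :: "'w \<Rightarrow> real"
  assumes st: "0 \<le> s" "s \<le> t" "t \<le> 1" and Z: "Z \<in> borel_measurable (F s)" "integrable M Z"
  shows "has_bochner_integral M (\<lambda>w. Z w * (B t w - B s w) $ k) 0"
proof (cases "s = t")
  case False
  have "has_bochner_integral M (\<lambda>w. Z w * (B t w - B s w) $ k) ((\<integral>w. Z w \<partial>M) * 0)"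
  proof (rule mult_indep_increment[where h="\<lambda>x. x $ k"])
    have e: "gauss y * (sqrt (t - s) *\<^sub>R y) $ k = sqrt (t - s) * (gauss y * y $ k)" for y by simp
    show "integrable lborel (\<lambda>y. gauss y * (sqrt (t - s) *\<^sub>R y) $ k)"
      unfolding e by (intro integrable_mult_right gauss_mean)
    show "(LBINT y. gauss y * (sqrt (t - s) *\<^sub>R y) $ k) = 0"
      unfolding e integral_mult_right_zero gauss_mean by simp
  qed (use False st Z in auto)
  then show ?thesis by simp
qed (auto intro!: has_bochner_integral_zero)

lemma increment_covariance:
  fixes Z :: "'w \<Rightarrow> real"
  assumes st: "0 \<le> s" "s \<le> t" "t \<le> 1" and Z: "Z \<in> borel_measurable (F s)" "integrable M Z"
  shows "has_bochner_integral M (\<lambda>w. Z w * ((B t w - B s w) $ j * (B t w - B s w) $ k))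
     ((\<integral>w. Z w \<partial>M) * (if j = k then t - s else 0))"
proof (cases "s = t")
  case False
  show ?thesis
  proof (rule mult_indep_increment[where h="\<lambda>x. x $ j * x $ k"])
    have e: "gauss y * ((sqrt (t - s) *\<^sub>R y) $ j * (sqrt (t - s) *\<^sub>R y) $ k) = (t - s) * (gauss y * (y $ j * y $ k))" for y
    proof -
      have "sqrt (t - s) * sqrt (t - s) = t - s" using st by simp
      then show ?thesis by (simp add: mult_ac)
    qed
    show "integrable lborel (\<lambda>y. gauss y * ((sqrt (t - s) *\<^sub>R y) $ j * (sqrt (t - s) *\<^sub>R y) $ k))"
      unfolding e by (intro integrable_mult_right gauss_covariance)
    show "(LBINT y. gauss y * ((sqrt (t - s) *\<^sub>R y) $ j * (sqrt (t - s) *\<^sub>R y) $ k)) = (if j = k then t - s else 0)"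
      unfolding e integral_mult_right_zero gauss_covariance by simp
  qed (use False st Z in auto)
qed (auto intro!: has_bochner_integral_zero)

definition third_moment :: real where
  "third_moment = (LBINT y. gauss y * norm (y::real^'n) ^ 3)"

lemma increment_third_moment:
  assumes st: "0 \<le> s" "s \<le> t" "t \<le> 1"
  shows "has_bochner_integral M (\<lambda>w. norm (B t w - B s w) ^ 3) ((t - s) * sqrt (t - s) * third_moment)"
proof (cases "s = t")
  case False
  then have st': "0 \<le> s" "s < t" "t \<le> 1" using st by auto
  have e: "gauss y * norm (sqrt (t - s) *\<^sub>R y) ^ 3 = ((t - s) * sqrt (t - s)) * (gauss y * norm y ^ 3)" for y :: "real^'n"
  proof -
    have "sqrt (t - s) ^ 3 = (t - s) * sqrt (t - s)" using st by (simp add: power3_eq_cube)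
    then show ?thesis using st by (simp add: power_mult_distrib)
  qed
  have i: "integrable lborel (\<lambda>y::real^'n. gauss y * norm (sqrt (t - s) *\<^sub>R y) ^ 3)"
    unfolding e by (intro integrable_mult_right gauss_third_moment)
  show ?thesis
    using increment_law[OF st' _ i] unfolding has_bochner_integral_iff e integral_mult_right_zero third_moment_def by simp
qed (simp add: has_bochner_integral_iff)

lemma bounded_mult_integrable:
  fixes Z X :: "'w \<Rightarrow> real"
  assumes "Z \<in> borel_measurable M" "\<And>w. w \<in> space M \<Longrightarrow> \<bar>Z w\<bar> \<le> C" "integrable M X"
  shows "integrable M (\<lambda>w. Z w * X w)"
proof (rule Bochner_Integration.integrable_bound[of M "\<lambda>w. C * X w"])
  show "integrable M (\<lambda>w. C * X w)" using assms by simp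
  show "(\<lambda>w. Z w * X w) \<in> borel_measurable M" using assms by auto
  show "AE w in M. norm (Z w * X w) \<le> norm (C * X w)"
  proof (rule AE_I2)
    fix w assume "w \<in> space M"
    then have "\<bar>Z w\<bar> \<le> \<bar>C\<bar>" using assms(2)[of w] by linarith
    then show "norm (Z w * X w) \<le> norm (C * X w)" by (simp add: abs_mult mult_right_mono)
  qed
qed

lemma bounded_integrable:
  fixes Z :: "'w \<Rightarrow> real"
  assumes "Z \<in> borel_measurable M" "\<And>w. w \<in> space M \<Longrightarrow> \<bar>Z w\<bar> \<le> C"
  shows "integrable M Z"
  using bounded_mult_integrable[OF assms, of "\<lambda>_. 1"] by simp

text \<open>With \<open>e = min b d\<close>, cut the two increments at \<open>c\<close> and \<open>e\<close>. A product of increments over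
  disjoint intervals has mean zero because the later one is independent of the past; the common
  part \<open>[c, e]\<close> contributes its length.\<close>

lemma increment_overlap_le:
  fixes Z :: "'w \<Rightarrow> real"
  assumes o: "0 \<le> a" "a \<le> b" "b \<le> 1" "c \<le> d" "d \<le> 1" "a \<le> c"
    and Z: "Z \<in> borel_measurable (F c)" and ZC: "\<And>w. w \<in> space M \<Longrightarrow> \<bar>Z w\<bar> \<le> C"
  shows "has_bochner_integral M (\<lambda>w. Z w * ((B b w - B a w) $ j * (B d w - B c w) $ k))
     ((\<integral>w. Z w \<partial>M) * (if j = k then overlap a b c d else 0))"
proof -
  have ZM: "Z \<in> borel_measurable M" by (rule F_M[OF Z])
  have Zi: "integrable M Z" by (rule bounded_integrable[OF ZM ZC])
  have Bi: "integrable M (\<lambda>w. (B t w - B s w) $ l)" if "0 \<le> s" "s \<le> t" "t \<le> 1" for s t l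
  proof -
    have "has_bochner_integral M (\<lambda>w. 1 * (B t w - B s w) $ l) 0"
      by (rule increment_mean[OF that]) auto
    then show ?thesis unfolding mult_1 by (rule integrable.intros)
  qed
  have Yc: "has_bochner_integral M (\<lambda>w. (Z w * (B y w - B x w) $ l) * (B v w - B z w) $ l') 0"
    if "0 \<le> x" "x \<le> y" "y \<le> z" "c \<le> z" "z \<le> v" "v \<le> 1" for x y z v l l'
  proof (rule increment_mean)
    have [measurable]: "B y \<in> borel_measurable (F z)" "B x \<in> borel_measurable (F z)" "Z \<in> borel_measurable (F z)"
      using that o by (auto intro!: F_mono[OF B_F] F_mono[OF Z])
    show "(\<lambda>w. Z w * (B y w - B x w) $ l) \<in> borel_measurable (F z)" by measurable
    show "integrable M (\<lambda>w. Z w * (B y w - B x w) $ l)"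
      using that by (intro bounded_mult_integrable[OF ZM ZC] Bi) auto
  qed (use that in auto)
  show ?thesis
  proof (cases "b \<le> c")
    case True
    then have 0: "overlap a b c d = 0" using o by (simp add: overlap_def)
    have "has_bochner_integral M (\<lambda>w. (Z w * (B b w - B a w) $ j) * (B d w - B c w) $ k) 0"
      using True o by (intro Yc) auto
    then show ?thesis by (simp only: 0 mult.assoc if_cancel mult_zero_right)
  next
    case False
    define e where "e = min b d"
    have e: "c \<le> e" "e \<le> b" "e \<le> d" "e = b \<or> e = d" using False o by (auto simp: e_def)
    have ov: "overlap a b c d = e - c" using False o e by (simp add: overlap_def e_def)
    have "has_bochner_integral M (\<lambda>w. (Z w * (B c w - B a w) $ j) * (B d w - B c w) $ k
        + Z w * ((B e w - B c w) $ j * (B e w - B c w) $ k)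
        + (Z w * (B e w - B c w) $ j) * (B d w - B e w) $ k
        + (Z w * (B e w - B c w) $ k) * (B b w - B e w) $ j)
      (0 + (\<integral>w. Z w \<partial>M) * (if j = k then e - c else 0) + 0 + 0)"
      using o e by (intro has_bochner_integral_add Yc increment_covariance Z Zi) auto
    moreover have "(Z w * (B c w - B a w) $ j) * (B d w - B c w) $ k
        + Z w * ((B e w - B c w) $ j * (B e w - B c w) $ k)
        + (Z w * (B e w - B c w) $ j) * (B d w - B e w) $ k
        + (Z w * (B e w - B c w) $ k) * (B b w - B e w) $ j
        = Z w * ((B b w - B a w) $ j * (B d w - B c w) $ k)" for w
      using e(4) by (elim disjE) (simp_all add: algebra_simps)
    ultimately show ?thesis by (simp only: ov add_0_left add_0_right)
  qed
qed

lemma increment_overlap: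
  fixes Z :: "'w \<Rightarrow> real"
  assumes o: "0 \<le> a" "a \<le> b" "b \<le> 1" "0 \<le> c" "c \<le> d" "d \<le> 1"
    and Z: "Z \<in> borel_measurable (F (max a c))" and ZC: "\<And>w. w \<in> space M \<Longrightarrow> \<bar>Z w\<bar> \<le> C"
  shows "has_bochner_integral M (\<lambda>w. Z w * ((B b w - B a w) $ j * (B d w - B c w) $ k))
     ((\<integral>w. Z w \<partial>M) * (if j = k then overlap a b c d else 0))"
proof (cases "a \<le> c")
  case True
  then show ?thesis using increment_overlap_le[of a b c d Z C j k] o Z ZC by (simp add: max_def)
next
  case False
  then have "max a c = a" by simp
  moreover have "overlap c d a b = overlap a b c d" by (simp add: overlap_def min.commute max.commute)
  moreover have "has_bochner_integral M (\<lambda>w. Z w * ((B d w - B c w) $ k * (B b w - B a w) $ j))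
     ((\<integral>w. Z w \<partial>M) * (if k = j then overlap c d a b else 0))"
    using o Z False ZC by (intro increment_overlap_le) (auto simp: max_def)
  ultimately show ?thesis
    by (simp only: mult.commute[of "(B b _ - B a _) $ j"] eq_commute[of k j])
qed

text \<open>The isometry for intervals that may overlap, so that it applies to a difference of two
  simple processes without a common refinement of their subdivisions.\<close>

lemma elementary_isometry:
  fixes A :: "'p \<Rightarrow> 'w \<Rightarrow> real^'n^'n"
  assumes I: "finite I"
    and ab: "\<And>p. p \<in> I \<Longrightarrow> 0 \<le> a p" "\<And>p. p \<in> I \<Longrightarrow> a p \<le> b p" "\<And>p. p \<in> I \<Longrightarrow> b p \<le> 1"
    and A: "\<And>p. p \<in> I \<Longrightarrow> A p \<in> borel_measurable (F (a p))"
    and K: "\<And>p w. p \<in> I \<Longrightarrow> w \<in> space M \<Longrightarrow> norm (A p w) \<le> K p"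
  defines "S \<equiv> \<lambda>w. \<Sum>p\<in>I. A p w *v (B (b p) w - B (a p) w)"
    and "Q \<equiv> \<lambda>w. \<Sum>p\<in>I. \<Sum>q\<in>I. (A p w \<bullet> A q w) * overlap (a p) (b p) (a q) (b q)"
  shows "integrable M (\<lambda>w. (norm (S w))\<^sup>2)" "(\<integral>w. (norm (S w))\<^sup>2 \<partial>M) = (\<integral>w. Q w \<partial>M)"
    and "has_bochner_integral lborel (\<lambda>s. (norm (\<Sum>p\<in>I. indicator {a p<..b p} s *\<^sub>R A p w))\<^sup>2) (Q w)"
    and "integrable M Q"
proof -
  have AM: "p \<in> I \<Longrightarrow> A p \<in> borel_measurable M" for p using A F_M by blast
  have entry: "\<bar>A p w $ i $ j * A q w $ i' $ k\<bar> \<le> K p * K q" if "p \<in> I" "q \<in> I" "w \<in> space M" for p q i j i' k w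
  proof -
    have "\<bar>A p w $ i $ j\<bar> \<le> K p" "\<bar>A q w $ i' $ k\<bar> \<le> K q" "0 \<le> K p"
      using order_trans[OF bounded_matrix_entry K[OF that(1,3)]] order_trans[OF bounded_matrix_entry K[OF that(2,3)]]
        order_trans[OF norm_ge_zero K[OF that(1,3)]] by blast+
    then show ?thesis unfolding abs_mult by (intro mult_mono) auto
  qed
  have Ei: "integrable M (\<lambda>w. A p w $ i $ j * A q w $ i' $ k)" if "p \<in> I" "q \<in> I" for p q i j i' k
  proof (rule bounded_integrable)
    show "(\<lambda>w. A p w $ i $ j * A q w $ i' $ k) \<in> borel_measurable M"
      using AM[OF that(1)] AM[OF that(2)] by measurable
  qed (rule entry[OF that])
  have one: "has_bochner_integral M (\<lambda>w. (A p w $ i $ j * A q w $ i $ k) * ((B (b p) w - B (a p) w) $ j * (B (b q) w - B (a q) w) $ k))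
      ((\<integral>w. A p w $ i $ j * A q w $ i $ k \<partial>M) * (if j = k then overlap (a p) (b p) (a q) (b q) else 0))"
    if "p \<in> I" "q \<in> I" for p q i j k
  proof (rule increment_overlap)
    have [measurable]: "A p \<in> borel_measurable (F (max (a p) (a q)))" "A q \<in> borel_measurable (F (max (a p) (a q)))"
      using A[OF that(1)] A[OF that(2)] by (auto intro: F_mono)
    show "(\<lambda>w. A p w $ i $ j * A q w $ i $ k) \<in> borel_measurable (F (max (a p) (a q)))" by measurable
  qed (use that ab entry in auto)
  have S2: "(norm (S w))\<^sup>2 = (\<Sum>p\<in>I. \<Sum>q\<in>I. \<Sum>i\<in>UNIV. \<Sum>j\<in>UNIV. \<Sum>k\<in>UNIV. (A p w $ i $ j * A q w $ i $ k) * ((B (b p) w - B (a p) w) $ j * (B (b q) w - B (a q) w) $ k))" for w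
  proof -
    have "(norm (S w))\<^sup>2 = (\<Sum>p\<in>I. \<Sum>q\<in>I. (A p w *v (B (b p) w - B (a p) w)) \<bullet> (A q w *v (B (b q) w - B (a q) w)))"
      unfolding S_def by (rule norm_sum_squared)
    also have "\<dots> = (\<Sum>p\<in>I. \<Sum>q\<in>I. \<Sum>i\<in>UNIV. \<Sum>j\<in>UNIV. \<Sum>k\<in>UNIV. (A p w $ i $ j * A q w $ i $ k) * ((B (b p) w - B (a p) w) $ j * (B (b q) w - B (a q) w) $ k))"
      unfolding inner_vec_def matrix_vector_mult_def
      by (simp add: sum_product mult_ac)
    finally show ?thesis .
  qed
  have hb: "has_bochner_integral M (\<lambda>w. (norm (S w))\<^sup>2)
     (\<Sum>p\<in>I. \<Sum>q\<in>I. \<Sum>i\<in>UNIV. \<Sum>j\<in>UNIV. \<Sum>k\<in>UNIV. (\<integral>w. A p w $ i $ j * A q w $ i $ k \<partial>M) * (if j = k then overlap (a p) (b p) (a q) (b q) else 0))"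
    unfolding S2 by (intro has_bochner_integral_sum one)
  have Q: "has_bochner_integral M Q (\<Sum>p\<in>I. \<Sum>q\<in>I. \<Sum>i\<in>UNIV. \<Sum>j\<in>UNIV. (\<integral>w. A p w $ i $ j * A q w $ i $ j \<partial>M) * overlap (a p) (b p) (a q) (b q))"
    unfolding Q_def matrix_inner sum_distrib_right
    by (intro has_bochner_integral_sum has_bochner_integral_mult_left) (auto simp: has_bochner_integral_iff Ei)
  have "(\<Sum>k\<in>UNIV. (\<integral>w. A p w $ i $ j * A q w $ i $ k \<partial>M) * (if j = k then c else 0)) = (\<integral>w. A p w $ i $ j * A q w $ i $ j \<partial>M) * c" for p q i j c
    by (simp add: if_distrib[of "(*) _"] cong: if_cong)
  then have hb': "has_bochner_integral M (\<lambda>w. (norm (S w))\<^sup>2) (\<Sum>p\<in>I. \<Sum>q\<in>I. \<Sum>i\<in>UNIV. \<Sum>j\<in>UNIV. (\<integral>w. A p w $ i $ j * A q w $ i $ j \<partial>M) * overlap (a p) (b p) (a q) (b q))"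
    using hb by (simp only:)
  show "integrable M (\<lambda>w. (norm (S w))\<^sup>2)" "integrable M Q" "(\<integral>w. (norm (S w))\<^sup>2 \<partial>M) = (\<integral>w. Q w \<partial>M)"
    using hb' Q unfolding has_bochner_integral_iff by simp_all
  have e: "(norm (\<Sum>p\<in>I. indicator {a p<..b p} s *\<^sub>R A p w))\<^sup>2 = (\<Sum>p\<in>I. \<Sum>q\<in>I. (A p w \<bullet> A q w) * (indicator {a p<..b p} s * indicator {a q<..b q} s))" for s
    unfolding norm_sum_squared by (simp add: mult_ac)
  show "has_bochner_integral lborel (\<lambda>s. (norm (\<Sum>p\<in>I. indicator {a p<..b p} s *\<^sub>R A p w))\<^sup>2) (Q w)"
    unfolding e Q_def by (intro has_bochner_integral_sum has_bochner_integral_mult_right interval_overlap_integral)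
qed

end

section \<open>Joint measurability and the generator\<close>

lemma matrix_vector_norm: "norm (A *v x) \<le> norm (A :: real^'n^'n) * norm x"
proof -
  have "(norm (A *v x))\<^sup>2 = (\<Sum>i\<in>UNIV. (A $ i \<bullet> x)\<^sup>2)"
    unfolding dot_square_norm[symmetric] inner_vec_def[of "A *v x"]
    by (simp add: matrix_vector_mult_def inner_vec_def power2_eq_square)
  also have "\<dots> \<le> (\<Sum>i\<in>UNIV. (norm (A $ i))\<^sup>2 * (norm x)\<^sup>2)"
  proof (rule sum_mono)
    show "(A $ i \<bullet> x)\<^sup>2 \<le> (norm (A $ i))\<^sup>2 * (norm x)\<^sup>2" for i
      using Cauchy_Schwarz_ineq[of "A $ i" x] unfolding dot_square_norm .
  qed
  also have "\<dots> = (norm A * norm x)\<^sup>2"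
  proof -
    have "(norm A)\<^sup>2 = (\<Sum>i\<in>UNIV. (norm (A $ i))\<^sup>2)"
      unfolding dot_square_norm[symmetric] inner_vec_def[of A] ..
    then show ?thesis by (simp add: power_mult_distrib sum_distrib_right)
  qed
  finally show ?thesis by (rule power2_le_imp_le) simp
qed

text \<open>The processes are only meaningful on \<open>[0, t]\<close>; freezing time at the ends of this interval
  extends them to the line, where product measurability is stated.\<close>

definition clip :: "real \<Rightarrow> real \<Rightarrow> real" where "clip t s = max 0 (min t s)"

lemma clip_bounds: "0 \<le> t \<Longrightarrow> 0 \<le> clip t s" "0 \<le> t \<Longrightarrow> clip t s \<le> t"
  by (auto simp: clip_def)

lemma clip_id: "0 \<le> s \<Longrightarrow> s \<le> t \<Longrightarrow> clip t s = s"
  by (auto simp: clip_def)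

lemma continuous_clip: "continuous_on S (clip t)"
  unfolding clip_def[abs_def] by (intro continuous_intros)

lemma clip_measurable [measurable]: "clip t \<in> borel_measurable borel"
  by (rule borel_measurable_continuous_onI[OF continuous_clip])

text \<open>Round the time down to a multiple of \<open>1 / n\<close>: this takes countably many values, and by
  continuity the approximations converge.\<close>

lemma continuous_process_measurable:
  fixes X :: "real \<Rightarrow> 'w \<Rightarrow> 'b::metric_space"
  assumes t: "0 \<le> t" and X: "\<And>s. 0 \<le> s \<Longrightarrow> s \<le> t \<Longrightarrow> X s \<in> borel_measurable N"
    and c: "\<And>w. w \<in> space N \<Longrightarrow> continuous_on {0..t} (\<lambda>s. X s w)"
  shows "(\<lambda>(s, w). X (clip t s) w) \<in> borel_measurable (borel \<Otimes>\<^sub>M N)"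
proof (rule borel_measurable_LIMSEQ_metric)
  let ?r = "\<lambda>n s. real_of_int \<lfloor>s * real (Suc n)\<rfloor> / real (Suc n)"
  fix n
  show "(\<lambda>p. X (clip t (?r n (fst p))) (snd p)) \<in> borel_measurable (borel \<Otimes>\<^sub>M N)"
  proof (rule measurable_compose_countable[where f="\<lambda>z p. X (clip t (real_of_int z / real (Suc n))) (snd p)" and g="\<lambda>p. \<lfloor>fst p * real (Suc n)\<rfloor>"])
    show "(\<lambda>p. X (clip t (real_of_int z / real (Suc n))) (snd p)) \<in> borel_measurable (borel \<Otimes>\<^sub>M N)" for z
      by (rule measurable_compose[OF measurable_snd X]) (use t in \<open>auto simp: clip_bounds\<close>)
    show "(\<lambda>p. \<lfloor>fst p * real (Suc n)\<rfloor>) \<in> borel \<Otimes>\<^sub>M N \<rightarrow>\<^sub>M count_space UNIV" by measurable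
  qed
next
  let ?r = "\<lambda>n s. real_of_int \<lfloor>s * real (Suc n)\<rfloor> / real (Suc n)"
  fix p :: "real \<times> 'w" assume "p \<in> space (borel \<Otimes>\<^sub>M N)"
  then have w: "snd p \<in> space N" by (auto simp: space_pair_measure)
  have lim: "(\<lambda>n. ?r n (fst p)) \<longlonglongrightarrow> fst p"
  proof (rule tendsto_sandwich[OF _ _ _ tendsto_const])
    show "\<forall>\<^sub>F n in sequentially. fst p - 1 / real (Suc n) \<le> ?r n (fst p)"
    proof (intro always_eventually allI)
      fix n
      have "fst p * real (Suc n) - 1 \<le> real_of_int \<lfloor>fst p * real (Suc n)\<rfloor>" by linarith
      then have "(fst p * real (Suc n) - 1) / real (Suc n) \<le> ?r n (fst p)" by (rule divide_right_mono) simp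
      then show "fst p - 1 / real (Suc n) \<le> ?r n (fst p)" by (simp add: diff_divide_distrib)
    qed
    show "\<forall>\<^sub>F n in sequentially. ?r n (fst p) \<le> fst p"
    proof (intro always_eventually allI)
      fix n
      have "real_of_int \<lfloor>fst p * real (Suc n)\<rfloor> / real (Suc n) \<le> (fst p * real (Suc n)) / real (Suc n)"
        by (rule divide_right_mono) auto
      then show "?r n (fst p) \<le> fst p" by simp
    qed
    have "(\<lambda>n. fst p - 1 / real (Suc n)) \<longlonglongrightarrow> fst p - 0"
      by (intro tendsto_intros lim_1_over_n[THEN LIMSEQ_Suc])
    then show "(\<lambda>n. fst p - 1 / real (Suc n)) \<longlonglongrightarrow> fst p" by simp
  qed
  have "continuous_on UNIV (\<lambda>s. X (clip t s) (snd p))"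
    by (rule continuous_on_compose2[OF c[OF w] continuous_clip]) (use t in \<open>auto simp: clip_bounds\<close>)
  from continuous_on_tendsto_compose[OF this lim]
  show "(\<lambda>n. X (clip t (?r n (fst p))) (snd p)) \<longlonglongrightarrow> (case p of (s, w) \<Rightarrow> X (clip t s) w)"
    by (simp add: case_prod_beta)
qed

text \<open>The position \<open>y\<close> and the coefficients \<open>b\<close>, \<open>A\<close> are separate arguments, since
  approximations replace them one at a time.\<close>

definition generator :: "(real^'n \<Rightarrow> real) \<Rightarrow> real^'n \<Rightarrow> real^'n \<Rightarrow> real^'n^'n \<Rightarrow> real" where
  "generator \<phi> y b A = grad \<phi> y \<bullet> b + (A ** transpose A) \<bullet> Hess \<phi> y / 2"

lemma matrix_mult_transpose_nth: "((A :: real^'n^'n) ** transpose A) $ i $ j = (\<Sum>p\<in>UNIV. A $ i $ p * A $ j $ p)"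
  by (simp add: matrix_matrix_mult_def transpose_def)

lemma hess_form_matrix:
  fixes A :: "real^'n^'n"
  shows
  "hess_form \<phi> y (A *v x) = (\<Sum>i\<in>UNIV. \<Sum>j\<in>UNIV. \<Sum>p\<in>UNIV. \<Sum>q\<in>UNIV. (A $ i $ p * A $ j $ q * partial i (partial j \<phi>) y) * (x $ p * x $ q))"
proof -
  have "(A *v x) $ i * (A *v x) $ j * partial i (partial j \<phi>) y = (\<Sum>p\<in>UNIV. \<Sum>q\<in>UNIV. (A $ i $ p * A $ j $ q * partial i (partial j \<phi>) y) * (x $ p * x $ q))" for i j
    unfolding matrix_vector_mult_def vec_lambda_beta sum_product sum_distrib_right
    by (intro sum.cong refl) (simp add: sum_distrib_left sum_distrib_right mult_ac)
  then show ?thesis unfolding hess_form_def by (simp only:)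
qed

lemma generator_second_order:
  fixes A :: "real^'n^'n"
  shows
  "(A ** transpose A) \<bullet> Hess \<phi> y = (\<Sum>i\<in>UNIV. \<Sum>j\<in>UNIV. \<Sum>p\<in>UNIV. \<Sum>q\<in>UNIV. (A $ i $ p * A $ j $ q * partial i (partial j \<phi>) y) * (if p = q then 1 else 0))"
  unfolding matrix_inner matrix_mult_transpose_nth
  by (simp add: Hess_def sum_distrib_right if_distrib[of "(*) _"] cong: if_cong)

lemma matrix_mult_transpose_norm: "norm ((A :: real^'n^'n) ** transpose A) \<le> real CARD('n) * real CARD('n) * (norm A)\<^sup>2"
proof -
  have e: "\<bar>(A ** transpose A) $ i $ j\<bar> \<le> (norm A)\<^sup>2" for i j
  proof -
    have "(A ** transpose A) $ i $ j = A $ i \<bullet> A $ j" by (simp add: matrix_mult_transpose_nth inner_vec_def)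
    also have "\<bar>\<dots>\<bar> \<le> norm (A $ i) * norm (A $ j)" by (rule Cauchy_Schwarz_ineq2)
    also have "\<dots> \<le> norm A * norm A" by (intro mult_mono Finite_Cartesian_Product.norm_nth_le) auto
    finally show ?thesis by (simp add: power2_eq_square)
  qed
  have "norm (A ** transpose A) \<le> (\<Sum>i\<in>UNIV. norm ((A ** transpose A) $ i))"
    unfolding norm_vec_def by (rule L2_set_le_sum) simp
  also have "\<dots> \<le> (\<Sum>i\<in>UNIV. \<Sum>j\<in>UNIV. \<bar>(A ** transpose A) $ i $ j\<bar>)"
    by (intro sum_mono norm_le_l1_cart)
  also have "\<dots> \<le> (\<Sum>i\<in>(UNIV::'n set). \<Sum>j\<in>(UNIV::'n set). (norm A)\<^sup>2)" by (intro sum_mono e)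
  finally show ?thesis by simp
qed

text \<open>A single constant for all bounds keeps the error terms of the one-step estimate short.\<close>

lemma test_function_uniform:
  fixes \<phi> :: "real^'n \<Rightarrow> real"
  assumes \<phi>: "test_function \<phi>"
  shows "\<exists>C\<ge>0. (\<forall>x. \<bar>\<phi> x\<bar> \<le> C) \<and> (\<forall>x y. \<bar>\<phi> y - \<phi> x\<bar> \<le> C * norm (y - x))
     \<and> (\<forall>x. norm (grad \<phi> x) \<le> C) \<and> (\<forall>x y. norm (grad \<phi> y - grad \<phi> x) \<le> C * norm (y - x))
     \<and> (\<forall>x. norm (Hess \<phi> x) \<le> C) \<and> (\<forall>x y. norm (Hess \<phi> y - Hess \<phi> x) \<le> C * norm (y - x))
     \<and> (\<forall>x h. \<bar>\<phi> (x + h) - \<phi> x - grad \<phi> x \<bullet> h - hess_form \<phi> x h / 2\<bar> \<le> C * norm h ^ 3)"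
proof -
  note t1 = test_function_partial[OF \<phi>] note t2 = test_function_partial[OF t1]
  obtain B0 where B0: "B0 \<ge> 0" "\<And>x. \<bar>\<phi> x\<bar> \<le> B0" using test_function_facts(3)[OF \<phi>] by blast
  obtain L0 where L0: "L0 \<ge> 0" "\<And>x y. \<bar>\<phi> y - \<phi> x\<bar> \<le> L0 * norm (y - x)" using test_function_lipschitz[OF \<phi>] by blast
  obtain T where T: "T \<ge> 0" "\<And>x h. \<bar>\<phi> (x + h) - \<phi> x - grad \<phi> x \<bullet> h - hess_form \<phi> x h / 2\<bar> \<le> T * norm h ^ 3"
    using test_function_taylor[OF \<phi>] by blast
  have "\<forall>i. \<exists>C\<ge>0. \<forall>x. \<bar>partial i \<phi> x\<bar> \<le> C" using test_function_facts(3)[OF t1] by blast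
  then obtain B1 where B1: "\<And>i. B1 i \<ge> 0" "\<And>i x. \<bar>partial i \<phi> x\<bar> \<le> B1 i" by metis
  have "\<forall>i. \<exists>C\<ge>0. \<forall>x y. \<bar>partial i \<phi> y - partial i \<phi> x\<bar> \<le> C * norm (y - x)" using test_function_lipschitz[OF t1] by blast
  then obtain L1 where L1: "\<And>i. L1 i \<ge> 0" "\<And>i x y. \<bar>partial i \<phi> y - partial i \<phi> x\<bar> \<le> L1 i * norm (y - x)" by metis
  have "\<forall>i j. \<exists>C\<ge>0. \<forall>x. \<bar>partial i (partial j \<phi>) x\<bar> \<le> C" using test_function_facts(3)[OF t2] by blast
  then obtain B2 where B2: "\<And>i j. B2 i j \<ge> 0" "\<And>i j x. \<bar>partial i (partial j \<phi>) x\<bar> \<le> B2 i j" by metis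
  have "\<forall>i j. \<exists>C\<ge>0. \<forall>x y. \<bar>partial i (partial j \<phi>) y - partial i (partial j \<phi>) x\<bar> \<le> C * norm (y - x)" using test_function_lipschitz[OF t2] by blast
  then obtain L2 where L2: "\<And>i j. L2 i j \<ge> 0" "\<And>i j x y. \<bar>partial i (partial j \<phi>) y - partial i (partial j \<phi>) x\<bar> \<le> L2 i j * norm (y - x)" by metis
  define b1 where "b1 = sum B1 UNIV" define l1 where "l1 = sum L1 UNIV"
  define b2 where "b2 = (\<Sum>i\<in>UNIV. \<Sum>j\<in>UNIV. B2 i j)" define l2 where "l2 = (\<Sum>i\<in>UNIV. \<Sum>j\<in>UNIV. L2 i j)"
  have nn: "b1 \<ge> 0" "l1 \<ge> 0" "b2 \<ge> 0" "l2 \<ge> 0"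
    unfolding b1_def l1_def b2_def l2_def using B1 L1 B2 L2 by (auto intro!: sum_nonneg)
  define C where "C = B0 + L0 + T + b1 + l1 + b2 + l2"
  have C: "B0 \<le> C" "L0 \<le> C" "T \<le> C" "b1 \<le> C" "l1 \<le> C" "b2 \<le> C" "l2 \<le> C" "0 \<le> C"
    using nn B0(1) L0(1) T(1) by (auto simp: C_def)
  have up: "c * norm z \<le> C * norm z" if "c \<le> C" for c and z :: "real^'n" using that by (rule mult_right_mono) simp
  have g1: "norm (grad \<phi> x) \<le> b1" for x
    unfolding b1_def by (rule order_trans[OF norm_le_l1_cart]) (intro sum_mono, simp add: grad_def B1)
  have g2: "norm (grad \<phi> y - grad \<phi> x) \<le> l1 * norm (y - x)" for x y
    unfolding l1_def sum_distrib_right by (rule order_trans[OF norm_le_l1_cart]) (intro sum_mono, simp add: grad_def L1)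
  have mat: "norm (H :: real^'n^'n) \<le> (\<Sum>i\<in>UNIV. \<Sum>j\<in>UNIV. \<bar>H $ i $ j\<bar>)" for H
  proof -
    have "norm H \<le> (\<Sum>i\<in>UNIV. norm (H $ i))" unfolding norm_vec_def[of H] by (rule L2_set_le_sum) simp
    also have "\<dots> \<le> (\<Sum>i\<in>UNIV. \<Sum>j\<in>UNIV. \<bar>H $ i $ j\<bar>)" by (intro sum_mono norm_le_l1_cart)
    finally show ?thesis .
  qed
  have h1: "norm (Hess \<phi> x) \<le> b2" for x
    unfolding b2_def by (rule order_trans[OF mat]) (intro sum_mono, simp add: Hess_def B2)
  have h2: "norm (Hess \<phi> y - Hess \<phi> x) \<le> l2 * norm (y - x)" for x y
    unfolding l2_def sum_distrib_right by (rule order_trans[OF mat]) (intro sum_mono, simp add: Hess_def L2)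
  have "T * norm h ^ 3 \<le> C * norm h ^ 3" for h :: "real^'n" using C(3) by (rule mult_right_mono) simp
  then show ?thesis
    using C order_trans[OF B0(2) C(1)] order_trans[OF L0(2) up[OF C(2)]] order_trans[OF g1 C(4)] order_trans[OF g2 up[OF C(5)]]
      order_trans[OF h1 C(6)] order_trans[OF h2 up[OF C(7)]] order_trans[OF T(2)]
    by (intro exI[of _ C]) blast
qed

lemma hess_form_eq: "hess_form \<phi> x h = (outer h h) \<bullet> Hess \<phi> x"
  unfolding hess_form_def matrix_inner by (simp add: outer_def Hess_def)

lemma norm_outer: "norm (outer a b :: real^'n^'n) = norm a * norm b"
proof -
  have "(norm (outer a b))\<^sup>2 = (norm a * norm b)\<^sup>2"
    unfolding power_mult_distrib dot_square_norm[symmetric] matrix_inner inner_vec_def[of a] inner_vec_def[of b] sum_product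
    by (simp add: outer_def mult_ac)
  then show ?thesis by (simp add: power2_eq_iff_nonneg)
qed

lemma hess_form_perturb:
  assumes "norm (Hess \<phi> x) \<le> C"
  shows "\<bar>hess_form \<phi> x (a + b) - hess_form \<phi> x b\<bar> \<le> (2 * norm a * norm b + (norm a)\<^sup>2) * C"
proof -
  have o: "outer (a + b) (a + b) - outer b b = outer a a + outer a b + outer b a"
    by (simp add: outer_def vec_eq_iff algebra_simps)
  have "hess_form \<phi> x (a + b) - hess_form \<phi> x b = (outer a a + outer a b + outer b a) \<bullet> Hess \<phi> x"
    unfolding hess_form_eq inner_diff_left[symmetric] o ..
  also have "\<bar>\<dots>\<bar> \<le> norm (outer a a + outer a b + outer b a) * norm (Hess \<phi> x)" by (rule Cauchy_Schwarz_ineq2)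
  also have "\<dots> \<le> (2 * norm a * norm b + (norm a)\<^sup>2) * C"
  proof (intro mult_mono assms)
    have "norm (outer a a + outer a b + outer b a) \<le> norm (outer a a) + norm (outer a b) + norm (outer b a)"
      by (intro norm_triangle_le add_mono norm_triangle_ineq) auto
    then show "norm (outer a a + outer a b + outer b a) \<le> 2 * norm a * norm b + (norm a)\<^sup>2"
      by (simp add: norm_outer power2_eq_square mult_ac)
  qed auto
  finally show ?thesis .
qed

lemma generator_diff:
  assumes g: "norm (grad \<phi> y - grad \<phi> x) \<le> C * r" and h: "norm (Hess \<phi> y - Hess \<phi> x) \<le> C * r"
    and b: "norm b \<le> K" and A: "norm A \<le> K'" and r: "0 \<le> C * r"
  shows "\<bar>generator \<phi> y b (A :: real^'n^'n) - generator \<phi> x b A\<bar> \<le> C * r * (K + real CARD('n) * real CARD('n) * K'\<^sup>2)"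
proof -
  have "generator \<phi> y b A - generator \<phi> x b A = (grad \<phi> y - grad \<phi> x) \<bullet> b + ((A ** transpose A) \<bullet> (Hess \<phi> y - Hess \<phi> x)) / 2"
    by (simp add: generator_def inner_diff_left inner_diff_right diff_divide_distrib)
  also have "\<bar>\<dots>\<bar> \<le> \<bar>(grad \<phi> y - grad \<phi> x) \<bullet> b\<bar> + \<bar>(A ** transpose A) \<bullet> (Hess \<phi> y - Hess \<phi> x)\<bar>"
    by linarith
  also have "\<dots> \<le> (C * r) * K + (real CARD('n) * real CARD('n) * K'\<^sup>2) * (C * r)"
  proof (intro add_mono order_trans[OF Cauchy_Schwarz_ineq2] mult_mono g b h r)
    have "(norm A)\<^sup>2 \<le> K'\<^sup>2" using A by (intro power_mono) auto
    then show "norm (A ** transpose A) \<le> real CARD('n) * real CARD('n) * K'\<^sup>2"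
      by (intro order_trans[OF matrix_mult_transpose_norm] mult_left_mono) auto
  qed auto
  finally show ?thesis by (simp add: algebra_simps)
qed

section \<open>Ito's formula with a frozen noise coefficient\<close>

lemma norm_add_cubed:
  fixes a b :: "'a::real_normed_vector"
  shows "norm (a + b) ^ 3 \<le> 4 * (norm a ^ 3 + norm b ^ 3)"
proof -
  define x where "x = norm a" define y where "y = norm b"
  have xy: "0 \<le> x" "0 \<le> y" by (simp_all add: x_def y_def)
  have "norm (a + b) ^ 3 \<le> (x + y) ^ 3"
    unfolding x_def y_def by (intro power_mono norm_triangle_ineq) simp
  also have "\<dots> \<le> 4 * (x ^ 3 + y ^ 3)"
  proof -
    have "0 \<le> 3 * ((x + y) * (x - y)\<^sup>2)" using xy by simp
    also have "\<dots> = 4 * (x ^ 3 + y ^ 3) - (x + y) ^ 3"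
      by (simp add: power2_eq_square power3_eq_cube algebra_simps)
    finally show ?thesis by simp
  qed
  finally show ?thesis unfolding x_def y_def .
qed

lemma vector_interval_integral:
  fixes h :: "real \<Rightarrow> 'a::euclidean_space"
  assumes h: "h \<in> borel_measurable borel" "\<And>s. norm (h s) \<le> C" and ab: "u \<le> v"
  shows "integrable lborel (\<lambda>s. indicator {u..v} s *\<^sub>R h s)"
    and "norm (LBINT s. indicator {u..v} s *\<^sub>R h s) \<le> C * (v - u)"
proof -
  have ii: "integrable lborel (\<lambda>s. C * indicator {u..v} s)" by (intro integrable_mult_right integrable_real_indicator) (auto simp: emeasure_lborel_Icc_eq)
  have b: "norm (indicator {u..v} s *\<^sub>R h s) \<le> C * indicator {u..v} s" for s
    using h(2)[of s] by (simp add: indicator_def)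
  show i: "integrable lborel (\<lambda>s. indicator {u..v} s *\<^sub>R h s)"
  proof (rule Bochner_Integration.integrable_bound[OF ii])
    show "(\<lambda>s. indicator {u..v} s *\<^sub>R h s) \<in> borel_measurable lborel" using h(1) by measurable
    show "AE s in lborel. norm (indicator {u..v} s *\<^sub>R h s) \<le> norm (C * indicator {u..v} s)"
      using order_trans[OF b abs_ge_self] by auto
  qed
  have "norm (LBINT s. indicator {u..v} s *\<^sub>R h s) \<le> (LBINT s. C * indicator {u..v} s)"
    by (rule Bochner_Integration.integral_norm_bound_integral[OF i ii b])
  then show "norm (LBINT s. indicator {u..v} s *\<^sub>R h s) \<le> C * (v - u)" using ab by simp
qed

lemma vector_interval_split:
  fixes h :: "real \<Rightarrow> 'a::euclidean_space"
  assumes h: "h \<in> borel_measurable borel" "\<And>s. norm (h s) \<le> C" and abc: "a \<le> u" "u \<le> v"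
  shows "(LBINT s. indicator {a..v} s *\<^sub>R h s) = (LBINT s. indicator {a..u} s *\<^sub>R h s) + (LBINT s. indicator {u..v} s *\<^sub>R h s)"
proof -
  have "(LBINT s. indicator {a..v} s *\<^sub>R h s) = (LBINT s. indicator {a..u} s *\<^sub>R h s + indicator {u..v} s *\<^sub>R h s)"
  proof (rule integral_cong_AE)
    show "AE s in lborel. indicator {a..v} s *\<^sub>R h s = indicator {a..u} s *\<^sub>R h s + indicator {u..v} s *\<^sub>R h s"
      by (rule AE_mp[OF AE_lborel_singleton[of u]], rule AE_I2) (use abc in \<open>auto simp: indicator_def\<close>)
  qed (use h(1) in measurable)
  also have "\<dots> = (LBINT s. indicator {a..u} s *\<^sub>R h s) + (LBINT s. indicator {u..v} s *\<^sub>R h s)"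
    using vector_interval_integral(1)[OF h abc(1)] vector_interval_integral(1)[OF h abc(2)] by simp
  finally show ?thesis .
qed

lemma interval_indicator_integral:
  fixes h :: "real \<Rightarrow> real"
  assumes "h \<in> borel_measurable borel" "\<And>s. \<bar>h s\<bar> \<le> C" "u \<le> v"
  shows "integrable lborel (\<lambda>s. indicator {u..v} s * h s)"
    and "\<bar>LBINT s. indicator {u..v} s * h s\<bar> \<le> C * (v - u)"
  using vector_interval_integral[of h C u v] assms by simp_all

lemma interval_integral_split:
  fixes h :: "real \<Rightarrow> real"
  assumes "h \<in> borel_measurable borel" "\<And>s. \<bar>h s\<bar> \<le> C" "a \<le> u" "u \<le> v"
  shows "(LBINT s. indicator {a..v} s * h s) = (LBINT s. indicator {a..u} s * h s) + (LBINT s. indicator {u..v} s * h s)"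
  using vector_interval_split[of h C a u v] assms by simp

lemma generator_bound:
  assumes "norm (grad \<phi> y) \<le> C" "norm (Hess \<phi> y) \<le> C" "norm b \<le> K" "norm (A :: real^'n^'n) \<le> K'"
  shows "\<bar>generator \<phi> y b A\<bar> \<le> C * (K + real CARD('n) * real CARD('n) * K'\<^sup>2)"
proof -
  have C: "0 \<le> C" using assms(1) norm_ge_zero order_trans by blast
  have "\<bar>generator \<phi> y b A\<bar> \<le> \<bar>grad \<phi> y \<bullet> b\<bar> + \<bar>(A ** transpose A) \<bullet> Hess \<phi> y\<bar>"
    unfolding generator_def by linarith
  also have "\<dots> \<le> C * K + (real CARD('n) * real CARD('n) * K'\<^sup>2) * C"
  proof (intro add_mono order_trans[OF Cauchy_Schwarz_ineq2] mult_mono assms C)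
    have "(norm A)\<^sup>2 \<le> K'\<^sup>2" using assms(4) by (intro power_mono) auto
    then show "norm (A ** transpose A) \<le> real CARD('n) * real CARD('n) * K'\<^sup>2"
      by (intro order_trans[OF matrix_mult_transpose_norm] mult_left_mono) auto
  qed auto
  finally show ?thesis by (simp add: algebra_simps)
qed

lemma test_function_continuous:
  fixes \<phi> :: "real^'n \<Rightarrow> real"
  assumes \<phi>: "test_function \<phi>"
  shows "continuous_on UNIV (grad \<phi>)" "continuous_on UNIV (Hess \<phi>)"
  unfolding grad_def[abs_def] Hess_def[abs_def]
  by (intro continuous_on_vec_lambda test_function_facts test_function_partial \<phi>)+

lemma test_function_measurable:
  fixes \<phi> :: "real^'n \<Rightarrow> real"
  assumes \<phi>: "test_function \<phi>"
  shows "\<phi> \<in> borel_measurable borel" "grad \<phi> \<in> borel_measurable borel" "Hess \<phi> \<in> borel_measurable borel"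
    "partial i (partial j \<phi>) \<in> borel_measurable borel"
  by (intro borel_measurable_continuous_onI test_function_facts(2) test_function_continuous[OF \<phi>] test_function_partial \<phi>)+

lemma matrix_mult_transpose_measurable [measurable (raw)]:
  fixes A :: "'a \<Rightarrow> real^'n^'n"
  assumes [measurable]: "A \<in> borel_measurable N"
  shows "(\<lambda>x. A x ** transpose (A x)) \<in> borel_measurable N"
proof -
  have "continuous_on UNIV (\<lambda>A :: real^'n^'n. \<chi> i j. \<Sum>p\<in>UNIV. A $ i $ p * A $ j $ p)"
    by (intro continuous_on_vec_lambda continuous_intros)
  moreover have "(\<lambda>A :: real^'n^'n. \<chi> i j. \<Sum>p\<in>UNIV. A $ i $ p * A $ j $ p) = (\<lambda>A. A ** transpose A)"
    by (simp add: fun_eq_iff vec_eq_iff matrix_mult_transpose_nth)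
  ultimately have "(\<lambda>A :: real^'n^'n. A ** transpose A) \<in> borel_measurable borel"
    by (intro borel_measurable_continuous_onI) (simp only:)
  from measurable_compose[OF assms this] show ?thesis .
qed

lemma matrix_vector_mult_measurable [measurable (raw)]:
  fixes A :: "'a \<Rightarrow> real^'n^'n" and x :: "'a \<Rightarrow> real^'n"
  assumes [measurable]: "A \<in> borel_measurable N" "x \<in> borel_measurable N"
  shows "(\<lambda>z. A z *v x z) \<in> borel_measurable N"
proof -
  have "continuous_on UNIV (\<lambda>p :: (real^'n^'n) \<times> (real^'n). \<chi> i. \<Sum>j\<in>UNIV. fst p $ i $ j * snd p $ j)"
    by (intro continuous_on_vec_lambda continuous_intros)
  moreover have "(\<lambda>p :: (real^'n^'n) \<times> (real^'n). \<chi> i. \<Sum>j\<in>UNIV. fst p $ i $ j * snd p $ j) = (\<lambda>p. fst p *v snd p)"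
    by (simp add: fun_eq_iff vec_eq_iff matrix_vector_mult_def)
  ultimately have "(\<lambda>p :: (real^'n^'n) \<times> (real^'n). fst p *v snd p) \<in> borel_measurable borel"
    by (intro borel_measurable_continuous_onI) (simp only:)
  from measurable_compose[OF borel_measurable_Pair[OF assms] this] show ?thesis by simp
qed

lemma generator_measurable:
  fixes \<phi> :: "real^'n \<Rightarrow> real"
  assumes \<phi>: "test_function \<phi>" and [measurable]: "y \<in> borel_measurable N" "b \<in> borel_measurable N" "A \<in> borel_measurable N"
  shows "(\<lambda>x. generator \<phi> (y x) (b x) (A x)) \<in> borel_measurable N"
proof -
  have [measurable]: "(\<lambda>x. grad \<phi> (y x)) \<in> borel_measurable N" "(\<lambda>x. Hess \<phi> (y x)) \<in> borel_measurable N"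
    using test_function_measurable[OF \<phi>] by (auto intro: measurable_compose[OF assms(2)])
  show ?thesis unfolding generator_def by measurable
qed

context brownian
begin

lemma mean_increment_le:
  assumes st: "0 \<le> s" "s \<le> t" "t \<le> 1"
  shows "integrable M (\<lambda>w. norm (B t w - B s w))"
    and "(\<integral>w. norm (B t w - B s w) \<partial>M) \<le> (1 + third_moment) * sqrt (t - s)"
proof -
  have [measurable]: "B t \<in> borel_measurable M" "B s \<in> borel_measurable M" using st by (auto intro: B_M)
  note m3 = increment_third_moment[OF st]
  have i3: "integrable M (\<lambda>w. norm (B t w - B s w) ^ 3)" using m3 by (rule integrable.intros)
  have e3: "(\<integral>w. norm (B t w - B s w) ^ 3 \<partial>M) = (t - s) * sqrt (t - s) * third_moment"
    using m3 by (rule has_bochner_integral_integral_eq)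
  have "integrable M (\<lambda>w. norm (B t w - B s w)) \<and> (\<integral>w. norm (B t w - B s w) \<partial>M) \<le> (1 + third_moment) * sqrt (t - s)"
  proof (cases "s = t")
    case False
    define h where "h = t - s"
    have h: "h > 0" using st False by (simp add: h_def)
    have b: "x \<le> sqrt h + x ^ 3 / h" if "0 \<le> x" for x
    proof (cases "x \<le> sqrt h")
      case True then show ?thesis using h that by (simp add: add_increasing2)
    next
      case False
      then have "(sqrt h)\<^sup>2 \<le> x\<^sup>2" using h by (intro power_mono) auto
      then have "h * x \<le> x\<^sup>2 * x" using h that by (intro mult_right_mono) auto
      then have "x \<le> x ^ 3 / h" using h by (simp add: pos_le_divide_eq power2_eq_square power3_eq_cube mult.commute)
      then show ?thesis using h by (simp add: add_increasing)
    qed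
    have i: "integrable M (\<lambda>w. sqrt h + norm (B t w - B s w) ^ 3 / h)" using i3 by simp
    have I: "integrable M (\<lambda>w. norm (B t w - B s w))"
    proof (rule Bochner_Integration.integrable_bound[OF i])
      show "AE w in M. norm (norm (B t w - B s w)) \<le> norm (sqrt h + norm (B t w - B s w) ^ 3 / h)"
        using order_trans[OF b abs_ge_self] by (auto intro!: AE_I2)
    qed measurable
    have "(\<integral>w. norm (B t w - B s w) \<partial>M) \<le> (\<integral>w. sqrt h + norm (B t w - B s w) ^ 3 / h \<partial>M)"
      by (intro integral_mono I i b) simp
    also have "\<dots> = sqrt h + ((t - s) * sqrt (t - s) * third_moment) / h"
      using i3 e3 prob_space by simp
    also have "\<dots> = (1 + third_moment) * sqrt h"
      using h by (simp add: h_def[symmetric] algebra_simps)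
    finally show ?thesis using I by (simp add: h_def)
  qed simp
  then show "integrable M (\<lambda>w. norm (B t w - B s w))"
    and "(\<integral>w. norm (B t w - B s w) \<partial>M) \<le> (1 + third_moment) * sqrt (t - s)" by simp_all
qed

lemma third_moment_nonneg: "0 \<le> third_moment"
  unfolding third_moment_def using gauss_pos by (intro integral_nonneg_AE AE_I2 mult_nonneg_nonneg) (auto intro: less_imp_le)

lemma integral_time_swap:
  fixes h :: "real \<Rightarrow> 'w \<Rightarrow> real"
  assumes hm: "(\<lambda>(s, w). h s w) \<in> borel_measurable (borel \<Otimes>\<^sub>M M)"
    and hb: "\<And>s w. w \<in> space M \<Longrightarrow> \<bar>h s w\<bar> \<le> C" and uv: "u \<le> v"
  shows "integrable (lborel \<Otimes>\<^sub>M M) (\<lambda>(s, w). indicator {u..v} s * h s w)"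
    and "integrable M (\<lambda>w. LBINT s. indicator {u..v} s * h s w)"
    and "(\<integral>w. (LBINT s. indicator {u..v} s * h s w) \<partial>M) = (LBINT s. indicator {u..v} s * (\<integral>w. h s w \<partial>M))"
proof -
  interpret P: pair_sigma_finite lborel M ..
  have C: "0 \<le> C" using hb[of _ 0] not_empty by force
  have ii: "integrable (lborel \<Otimes>\<^sub>M M) (\<lambda>p. C * indicator ({u..v} \<times> space M) p)"
  proof (intro integrable_mult_right integrable_real_indicator)
    show "{u..v} \<times> space M \<in> sets (lborel \<Otimes>\<^sub>M M)" by (intro pair_measureI) auto
    have "emeasure (lborel \<Otimes>\<^sub>M M) ({u..v} \<times> space M) = emeasure lborel {u..v} * emeasure M (space M)"
      by (intro emeasure_pair_measure_Times) auto
    then show "emeasure (lborel \<Otimes>\<^sub>M M) ({u..v} \<times> space M) < \<infinity>" using uv by (simp add: emeasure_space_1)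
  qed
  have hm': "(\<lambda>(s, w). indicator {u..v} s * h s w) \<in> borel_measurable (lborel \<Otimes>\<^sub>M M)"
  proof -
    note [measurable] = hm
    have "(\<lambda>(s, w). indicator {u..v} s * h s w) \<in> borel_measurable (borel \<Otimes>\<^sub>M M)" by measurable
    then show ?thesis by (simp cong: measurable_cong_sets sets_pair_measure_cong)
  qed
  show i: "integrable (lborel \<Otimes>\<^sub>M M) (\<lambda>(s, w). indicator {u..v} s * h s w)"
  proof (rule Bochner_Integration.integrable_bound[OF ii hm'], rule AE_I2)
    fix p :: "real \<times> 'w" assume "p \<in> space (lborel \<Otimes>\<^sub>M M)"
    then have "snd p \<in> space M" by (auto simp: space_pair_measure)
    then show "norm (case p of (s, w) \<Rightarrow> indicator {u..v} s * h s w) \<le> norm (C * indicator ({u..v} \<times> space M) p)"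
      using hb[of "snd p" "fst p"] C by (auto simp: indicator_def split: prod.splits)
  qed
  show "integrable M (\<lambda>w. LBINT s. indicator {u..v} s * h s w)" by (rule P.integrable_snd[OF i])
  show "(\<integral>w. (LBINT s. indicator {u..v} s * h s w) \<partial>M) = (LBINT s. indicator {u..v} s * (\<integral>w. h s w \<partial>M))"
    using P.Fubini_integral[OF i] by simp
qed

text \<open>Let \<open>G v\<close> be the difference of \<open>E \<phi> (Y v)\<close> and the integral of the expected generator up
  to \<open>v\<close>. Over an interval of length \<open>h\<close>, the Taylor expansion at \<open>Y u\<close> has a linear noise term
  of mean zero, because \<open>Y u\<close> and \<open>A\<close> are known at time \<open>u\<close>; its quadratic term has mean \<open>h\<close>
  times half of \<open>(A ** transpose A) \<bullet> Hess \<phi> (Y u)\<close>; and the remainder, a third moment of the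
  increment, is of order \<open>h * sqrt h\<close>. Evaluating the generator at \<open>Y u\<close> instead of \<open>Y s\<close> costs
  as much. Hence \<open>G\<close> is constant by \<open>constant_if_superlinear_modulus\<close>.\<close>

lemma ito_step:
  fixes Y b :: "real \<Rightarrow> 'w \<Rightarrow> real^'n" and A :: "'w \<Rightarrow> real^'n^'n" and \<phi> :: "real^'n \<Rightarrow> real"
  assumes ab: "0 \<le> \<alpha>" "\<alpha> \<le> \<beta>" "\<beta> \<le> 1"
    and A: "A \<in> borel_measurable (F \<alpha>)" "\<And>w. w \<in> space M \<Longrightarrow> norm (A w) \<le> K"
    and b: "(\<lambda>(s, w). b s w) \<in> borel_measurable (borel \<Otimes>\<^sub>M M)" "\<And>s w. w \<in> space M \<Longrightarrow> norm (b s w) \<le> K'"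
    and Y: "(\<lambda>(s, w). Y s w) \<in> borel_measurable (borel \<Otimes>\<^sub>M M)" "\<And>s. \<alpha> \<le> s \<Longrightarrow> s \<le> \<beta> \<Longrightarrow> Y s \<in> borel_measurable (F s)"
    and incr: "\<And>u v w. w \<in> space M \<Longrightarrow> \<alpha> \<le> u \<Longrightarrow> u \<le> v \<Longrightarrow> v \<le> \<beta> \<Longrightarrow>
       Y v w = Y u w + ((LBINT s. indicator {u..v} s *\<^sub>R b s w) + A w *v (B v w - B u w))"
    and \<phi>: "test_function \<phi>"
  shows "(\<integral>w. \<phi> (Y \<beta> w) \<partial>M) - (\<integral>w. \<phi> (Y \<alpha> w) \<partial>M)
     = (LBINT s. indicator {\<alpha>..\<beta>} s * (\<integral>w. generator \<phi> (Y s w) (b s w) (A w) \<partial>M))"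
proof -
  obtain C where C0: "C \<ge> 0" and Cb: "\<And>x. \<bar>\<phi> x\<bar> \<le> C" and Cg: "\<And>x. norm (grad \<phi> x) \<le> C"
    and Cg': "\<And>x y. norm (grad \<phi> y - grad \<phi> x) \<le> C * norm (y - x)"
    and CH: "\<And>x. norm (Hess \<phi> x) \<le> C" and CH': "\<And>x y. norm (Hess \<phi> y - Hess \<phi> x) \<le> C * norm (y - x)"
    and CT: "\<And>x h. \<bar>\<phi> (x + h) - \<phi> x - grad \<phi> x \<bullet> h - hess_form \<phi> x h / 2\<bar> \<le> C * norm h ^ 3"
    using test_function_uniform[OF \<phi>] by blast
  note \<phi>m[measurable] = test_function_measurable[OF \<phi>]
  obtain w0 where w0: "w0 \<in> space M" using not_empty by blast
  have K: "0 \<le> K" "0 \<le> K'" using order_trans[OF norm_ge_zero A(2)[OF w0]] order_trans[OF norm_ge_zero b(2)[OF w0]] by auto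
  have AM[measurable]: "A \<in> borel_measurable M" by (rule F_M[OF A(1)])
  define N where "N = real CARD('n) * real CARD('n)"
  define g where "g s = (\<integral>w. generator \<phi> (Y s w) (b s w) (A w) \<partial>M)" for s
  define L where "L = C * (K' + N * K\<^sup>2)"
  have gen_b: "\<bar>generator \<phi> y (b s w) (A w)\<bar> \<le> L" if "w \<in> space M" for y s w
    unfolding L_def N_def by (rule generator_bound) (use Cg CH A(2) b(2) that in auto)
  have joint_A: "(\<lambda>p. A (snd p)) \<in> borel_measurable (borel \<Otimes>\<^sub>M M)" by measurable
  have joint: "(\<lambda>(s, w). generator \<phi> (Z s w) (b s w) (A w)) \<in> borel_measurable (borel \<Otimes>\<^sub>M M)"
    if Z: "(\<lambda>(s, w). Z s w) \<in> borel_measurable (borel \<Otimes>\<^sub>M M)" for Z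
    using generator_measurable[OF \<phi> Z b(1) joint_A] by (simp add: case_prod_beta)
  have sect: "(\<lambda>w. f s w) \<in> borel_measurable M" if "(\<lambda>(s, w). f s w) \<in> borel_measurable (borel \<Otimes>\<^sub>M M)" for f :: "real \<Rightarrow> 'w \<Rightarrow> 'z::topological_space" and s
    using measurable_compose[OF measurable_Pair1'[of s borel M] that] by simp
  have gm: "g \<in> borel_measurable borel"
    unfolding g_def using joint[OF Y(1)] by (rule borel_measurable_lebesgue_integral)
  have g_b: "\<bar>g s\<bar> \<le> L" for s
  proof -
    have i: "integrable M (\<lambda>w. generator \<phi> (Y s w) (b s w) (A w))"
      by (rule bounded_integrable[OF sect[OF joint[OF Y(1)]] gen_b])
    have "\<bar>g s\<bar> \<le> (\<integral>w. L \<partial>M)"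
      unfolding g_def by (intro order_trans[OF integral_abs_bound] integral_mono integrable_abs i gen_b) auto
    then show ?thesis by (simp add: prob_space)
  qed
  define G where "G v = (\<integral>w. \<phi> (Y v w) \<partial>M) - (LBINT s. indicator {\<alpha>..v} s * g s)" for v
  define m where "m = third_moment"
  have m: "0 \<le> m" unfolding m_def by (rule third_moment_nonneg)
  define C1 where "C1 = 4 * C * (K' ^ 3 + K ^ 3 * m) + C / 2 * (2 * K' * K * (1 + m) + K'\<^sup>2)"
  define C2 where "C2 = C * (K' + N * K\<^sup>2) * (K' + K * (1 + m))"
  have key: "\<bar>G v - G u\<bar> \<le> (C1 + C2) * ((v - u) * sqrt (v - u))" if uv: "\<alpha> \<le> u" "u \<le> v" "v \<le> \<beta>" for u v
  proof -
    define h where "h = v - u"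
    have h: "0 \<le> h" "h \<le> 1" using uv ab by (auto simp: h_def)
    have uv1: "0 \<le> u" "v \<le> 1" using uv ab by auto
    have hs: "h * h \<le> h * sqrt h" "h * h * h \<le> h * sqrt h"
    proof -
      have "h = sqrt h * sqrt h" using h by simp
      also have "\<dots> \<le> sqrt h * 1" using h by (intro mult_left_mono) auto
      finally have "h \<le> sqrt h" by simp
      then show 1: "h * h \<le> h * sqrt h" using h by (intro mult_left_mono) auto
      have "(h * h) * h \<le> (h * h) * 1" using h by (intro mult_left_mono) auto
      then show "h * h * h \<le> h * sqrt h" using 1 by simp
    qed
    define \<beta>' where "\<beta>' w = (LBINT s. indicator {u..v} s *\<^sub>R b s w)" for w
    define \<Delta> where "\<Delta> w = B v w - B u w" for w
    have [measurable]: "B u \<in> borel_measurable M" "B v \<in> borel_measurable M" using uv1 uv by (auto intro: B_M)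
    have \<Delta>m[measurable]: "\<Delta> \<in> borel_measurable M" unfolding \<Delta>_def by measurable
    have YuF: "Y u \<in> borel_measurable (F u)" using uv by (intro Y(2)) auto
    have Ym[measurable]: "Y u \<in> borel_measurable M" "Y v \<in> borel_measurable M" using F_M[OF Y(2)[of u]] F_M[OF Y(2)[of v]] uv by auto
    have \<beta>m[measurable]: "\<beta>' \<in> borel_measurable M"
    proof -
      have "(\<lambda>p. indicator {u..v} (snd p) *\<^sub>R b (snd p) (fst p)) \<in> borel_measurable (M \<Otimes>\<^sub>M borel)"
      proof -
        have "(\<lambda>p. b (snd p) (fst p)) \<in> borel_measurable (M \<Otimes>\<^sub>M borel)"
          using measurable_compose[OF measurable_pair_swap'[of M borel] b(1)] by (simp add: case_prod_beta)
        then show ?thesis by measurable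
      qed
      then have "(\<lambda>(w, s). indicator {u..v} s *\<^sub>R b s w) \<in> borel_measurable (M \<Otimes>\<^sub>M lborel)"
        by (simp add: case_prod_beta cong: measurable_cong_sets sets_pair_measure_cong)
      then show ?thesis unfolding \<beta>'_def by (rule lborel.borel_measurable_lebesgue_integral)
    qed
    have bsec: "(\<lambda>s. b s w) \<in> borel_measurable borel" if "w \<in> space M" for w
      using measurable_compose[OF measurable_Pair2'[OF that, of borel] b(1)] by simp
    have bint: "integrable lborel (\<lambda>s. indicator {u..v} s *\<^sub>R b s w)" if w: "w \<in> space M" for w
      by (rule vector_interval_integral(1)[OF bsec[OF w] b(2)[OF w] uv(2)])
    have \<beta>b: "norm (\<beta>' w) \<le> K' * h" if w: "w \<in> space M" for w
      unfolding \<beta>'_def h_def by (rule vector_interval_integral(2)[OF bsec[OF w] b(2)[OF w] uv(2)])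
    have Ab: "norm (A w *v \<Delta> w) \<le> K * norm (\<Delta> w)" if "w \<in> space M" for w
      by (rule order_trans[OF matrix_vector_norm mult_right_mono[OF A(2)[OF that]]]) simp
    have Yv: "Y v w = Y u w + (\<beta>' w + A w *v \<Delta> w)" if "w \<in> space M" for w
      unfolding \<beta>'_def \<Delta>_def by (rule incr[OF that uv])
    \<comment> \<open>moments of the Brownian increment\<close>
    have \<Delta>1: "integrable M (\<lambda>w. norm (\<Delta> w))" "(\<integral>w. norm (\<Delta> w) \<partial>M) \<le> (1 + m) * sqrt h"
      using mean_increment_le[OF uv1(1) uv(2) uv1(2)] unfolding \<Delta>_def m_def h_def by auto
    have \<Delta>3: "integrable M (\<lambda>w. norm (\<Delta> w) ^ 3)" "(\<integral>w. norm (\<Delta> w) ^ 3 \<partial>M) = h * sqrt h * m"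
      using increment_third_moment[OF uv1(1) uv(2) uv1(2)] unfolding \<Delta>_def m_def h_def has_bochner_integral_iff by auto
    \<comment> \<open>the contributions of the drift and of the noise, and the quadratic one of the noise\<close>
    define T1 where "T1 w = grad \<phi> (Y u w) \<bullet> \<beta>' w" for w
    define T2 where "T2 w = grad \<phi> (Y u w) \<bullet> (A w *v \<Delta> w)" for w
    define T3 where "T3 w = hess_form \<phi> (Y u w) (A w *v \<Delta> w)" for w
    define e where "e w = C * (4 * ((K' * h) ^ 3 + (K * norm (\<Delta> w)) ^ 3)) + (2 * (K' * h) * (K * norm (\<Delta> w)) + (K' * h)\<^sup>2) * C / 2" for w
    have pointwise: "\<bar>\<phi> (Y v w) - \<phi> (Y u w) - T1 w - T2 w - T3 w / 2\<bar> \<le> e w" if w: "w \<in> space M" for w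
    proof -
      let ?d = "\<beta>' w + A w *v \<Delta> w"
      have "norm ?d ^ 3 \<le> 4 * (norm (\<beta>' w) ^ 3 + norm (A w *v \<Delta> w) ^ 3)" by (rule norm_add_cubed)
      also have "\<dots> \<le> 4 * ((K' * h) ^ 3 + (K * norm (\<Delta> w)) ^ 3)"
        using \<beta>b[OF w] Ab[OF w] by (intro mult_left_mono add_mono power_mono) auto
      finally have "C * norm ?d ^ 3 \<le> C * (4 * ((K' * h) ^ 3 + (K * norm (\<Delta> w)) ^ 3))" using C0 by (rule mult_left_mono)
      with CT[of "Y u w" ?d]
      have 1: "\<bar>\<phi> (Y v w) - \<phi> (Y u w) - grad \<phi> (Y u w) \<bullet> ?d - hess_form \<phi> (Y u w) ?d / 2\<bar> \<le> C * (4 * ((K' * h) ^ 3 + (K * norm (\<Delta> w)) ^ 3))"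
        unfolding Yv[OF w] by linarith
      have "\<bar>hess_form \<phi> (Y u w) ?d - T3 w\<bar> \<le> (2 * norm (\<beta>' w) * norm (A w *v \<Delta> w) + (norm (\<beta>' w))\<^sup>2) * C"
        unfolding T3_def by (rule hess_form_perturb[OF CH])
      also have "\<dots> \<le> (2 * (K' * h) * (K * norm (\<Delta> w)) + (K' * h)\<^sup>2) * C"
        using \<beta>b[OF w] Ab[OF w] C0 K h by (intro mult_right_mono add_mono mult_mono power_mono) auto
      finally have 2: "\<bar>hess_form \<phi> (Y u w) ?d - T3 w\<bar> \<le> (2 * (K' * h) * (K * norm (\<Delta> w)) + (K' * h)\<^sup>2) * C" .
      have 3: "grad \<phi> (Y u w) \<bullet> ?d = T1 w + T2 w" by (simp add: T1_def T2_def inner_add_right)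
      show ?thesis using 1 2 unfolding 3 e_def by argo
    qed
    have ei: "integrable M e"
      unfolding e_def power_mult_distrib using \<Delta>1(1) \<Delta>3(1)
      by (intro Bochner_Integration.integrable_add integrable_mult_right integrable_mult_left integrable_divide integrable_const) auto
    have ee: "(\<integral>w. e w \<partial>M) \<le> C1 * (h * sqrt h)"
    proof -
      have "(\<integral>w. e w \<partial>M) = (\<integral>w. (4 * C * K' ^ 3 * h ^ 3 + C / 2 * (K'\<^sup>2 * h\<^sup>2)) + (4 * C * K ^ 3) * norm (\<Delta> w) ^ 3 + (C / 2 * (2 * K' * h * K)) * norm (\<Delta> w) \<partial>M)"
        unfolding e_def by (intro Bochner_Integration.integral_cong refl) (simp add: power_mult_distrib algebra_simps)
      also have "\<dots> = (4 * C * K' ^ 3 * h ^ 3 + C / 2 * (K'\<^sup>2 * h\<^sup>2)) + (4 * C * K ^ 3) * (h * sqrt h * m) + (C / 2 * (2 * K' * h * K)) * (\<integral>w. norm (\<Delta> w) \<partial>M)"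
        using \<Delta>1(1) \<Delta>3 prob_space by simp
      also have "\<dots> \<le> (4 * C * K' ^ 3 * (h * sqrt h) + C / 2 * (K'\<^sup>2 * (h * sqrt h))) + (4 * C * K ^ 3) * (h * sqrt h * m) + (C / 2 * (2 * K' * h * K)) * ((1 + m) * sqrt h)"
        using hs \<Delta>1(2) C0 K h by (intro add_mono mult_left_mono order_refl) (auto simp: power2_eq_square power3_eq_cube)
      also have "\<dots> = C1 * (h * sqrt h)" unfolding C1_def by (simp add: algebra_simps)
      finally show ?thesis .
    qed
    \<comment> \<open>the linear noise term has mean zero, as \<open>Y u\<close> and \<open>A\<close> are known at time \<open>u\<close>\<close>
    have Aent: "\<bar>A w $ i $ p\<bar> \<le> K" if "w \<in> space M" for w i p
      by (rule order_trans[OF bounded_matrix_entry A(2)[OF that]])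
    have AF[measurable]: "A \<in> borel_measurable (F u)" by (rule F_mono[OF A(1) uv(1)])
    note [measurable] = YuF
    have T2: "has_bochner_integral M T2 0"
    proof -
      have e: "T2 w = (\<Sum>i\<in>UNIV. \<Sum>p\<in>UNIV. (grad \<phi> (Y u w) $ i * A w $ i $ p) * \<Delta> w $ p)" for w
        unfolding T2_def inner_vec_def[of "grad \<phi> (Y u w)"] matrix_vector_mult_def by (simp add: sum_distrib_left mult_ac)
      have "has_bochner_integral M T2 (\<Sum>i\<in>(UNIV::'n set). \<Sum>p\<in>(UNIV::'n set). 0)"
        unfolding e[abs_def]
      proof (intro has_bochner_integral_sum)
        fix i p
        have Zm: "(\<lambda>w. grad \<phi> (Y u w) $ i * A w $ i $ p) \<in> borel_measurable (F u)" by measurable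
        show "has_bochner_integral M (\<lambda>w. (grad \<phi> (Y u w) $ i * A w $ i $ p) * \<Delta> w $ p) 0"
          unfolding \<Delta>_def
        proof (rule increment_mean[OF uv1(1) uv(2) uv1(2) Zm], rule bounded_integrable[OF F_M[OF Zm]])
          fix w assume w: "w \<in> space M"
          have "\<bar>grad \<phi> (Y u w) $ i\<bar> \<le> C" by (rule order_trans[OF component_le_norm_cart Cg])
          then show "\<bar>grad \<phi> (Y u w) $ i * A w $ i $ p\<bar> \<le> C * K"
            unfolding abs_mult using Aent[OF w] C0 by (intro mult_mono) auto
        qed
      qed
      then show ?thesis by simp
    qed
    \<comment> \<open>the quadratic term has \<open>h\<close> times the mean of \<open>S\<close>\<close>
    define S where "S w = (A w ** transpose (A w)) \<bullet> Hess \<phi> (Y u w)" for w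
    have T3: "has_bochner_integral M T3 (h * (\<integral>w. S w \<partial>M))" and Si: "integrable M S"
    proof -
      let ?Z = "\<lambda>i j p q w. A w $ i $ p * A w $ j $ q * partial i (partial j \<phi>) (Y u w)"
      have Zm: "?Z i j p q \<in> borel_measurable (F u)" for i j p q by measurable
      have Zi: "integrable M (?Z i j p q)" for i j p q
      proof (rule bounded_integrable[OF F_M[OF Zm]])
        fix w assume w: "w \<in> space M"
        have "\<bar>Hess \<phi> (Y u w) $ i $ j\<bar> \<le> C" by (rule order_trans[OF bounded_matrix_entry CH])
        then have "\<bar>partial i (partial j \<phi>) (Y u w)\<bar> \<le> C" by (simp add: Hess_def)
        then show "\<bar>?Z i j p q w\<bar> \<le> K * K * C"
          unfolding abs_mult using Aent[OF w] K by (intro mult_mono) auto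
      qed
      have S: "S w = (\<Sum>i\<in>UNIV. \<Sum>j\<in>UNIV. \<Sum>p\<in>UNIV. \<Sum>q\<in>UNIV. ?Z i j p q w * (if p = q then 1 else 0))" for w
        unfolding S_def by (rule generator_second_order)
      have SI: "has_bochner_integral M S (\<Sum>i\<in>UNIV. \<Sum>j\<in>UNIV. \<Sum>p\<in>UNIV. \<Sum>q\<in>UNIV. (\<integral>w. ?Z i j p q w \<partial>M) * (if p = q then 1 else 0))"
        unfolding S[abs_def] by (intro has_bochner_integral_sum has_bochner_integral_mult_left) (simp add: has_bochner_integral_iff Zi)
      then show "integrable M S" by (rule integrable.intros)
      have "has_bochner_integral M T3 (\<Sum>i\<in>UNIV. \<Sum>j\<in>UNIV. \<Sum>p\<in>UNIV. \<Sum>q\<in>UNIV. (\<integral>w. ?Z i j p q w \<partial>M) * (if p = q then v - u else 0))"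
        unfolding T3_def hess_form_matrix \<Delta>_def
        by (intro has_bochner_integral_sum increment_covariance uv1 uv(2) Zm Zi)
      also have "(\<Sum>i\<in>UNIV. \<Sum>j\<in>UNIV. \<Sum>p\<in>UNIV. \<Sum>q\<in>UNIV. (\<integral>w. ?Z i j p q w \<partial>M) * (if p = q then v - u else 0))
        = h * (\<Sum>i\<in>UNIV. \<Sum>j\<in>UNIV. \<Sum>p\<in>UNIV. \<Sum>q\<in>UNIV. (\<integral>w. ?Z i j p q w \<partial>M) * (if p = q then 1 else 0))"
        unfolding sum_distrib_left by (intro sum.cong refl) (simp add: h_def)
      also have "(\<Sum>i\<in>UNIV. \<Sum>j\<in>UNIV. \<Sum>p\<in>UNIV. \<Sum>q\<in>UNIV. (\<integral>w. ?Z i j p q w \<partial>M) * (if p = q then 1 else 0)) = (\<integral>w. S w \<partial>M)"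
        using has_bochner_integral_integral_eq[OF SI] by simp
      finally show "has_bochner_integral M T3 (h * (\<integral>w. S w \<partial>M))" .
    qed
    have T1m: "T1 \<in> borel_measurable M" unfolding T1_def by measurable
    have T1i: "integrable M T1"
    proof (rule bounded_integrable[OF T1m])
      fix w assume w: "w \<in> space M"
      show "\<bar>T1 w\<bar> \<le> C * (K' * h)"
        unfolding T1_def using \<beta>b[OF w] Cg C0 by (intro order_trans[OF Cauchy_Schwarz_ineq2] mult_mono) auto
    qed
    have \<phi>i: "integrable M (\<lambda>w. \<phi> (Y u w))" "integrable M (\<lambda>w. \<phi> (Y v w))"
      by (intro bounded_integrable[where C=C] Cb; measurable)+
    have T3i: "integrable M T3" "(\<integral>w. T3 w \<partial>M) = h * (\<integral>w. S w \<partial>M)" and T2i: "integrable M T2" "(\<integral>w. T2 w \<partial>M) = 0"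
      using T3 T2 unfolding has_bochner_integral_iff by auto
    have first: "\<bar>(\<integral>w. \<phi> (Y v w) \<partial>M) - (\<integral>w. \<phi> (Y u w) \<partial>M) - ((\<integral>w. T1 w \<partial>M) + h * (\<integral>w. S w \<partial>M) / 2)\<bar> \<le> C1 * (h * sqrt h)"
    proof -
      have ri: "integrable M (\<lambda>w. \<phi> (Y v w) - \<phi> (Y u w) - T1 w - T2 w - T3 w / 2)"
        using \<phi>i T1i T2i(1) T3i(1) by auto
      have "(\<integral>w. \<phi> (Y v w) - \<phi> (Y u w) - T1 w - T2 w - T3 w / 2 \<partial>M)
          = (\<integral>w. \<phi> (Y v w) \<partial>M) - (\<integral>w. \<phi> (Y u w) \<partial>M) - ((\<integral>w. T1 w \<partial>M) + h * (\<integral>w. S w \<partial>M) / 2)"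
        using \<phi>i T1i T2i T3i by simp
      moreover have "\<bar>\<integral>w. \<phi> (Y v w) - \<phi> (Y u w) - T1 w - T2 w - T3 w / 2 \<partial>M\<bar> \<le> (\<integral>w. e w \<partial>M)"
        by (intro order_trans[OF integral_abs_bound] integral_mono integrable_abs ri ei pointwise)
      ultimately show ?thesis using ee by linarith
    qed
    \<comment> \<open>the leading terms are the time integral of the generator frozen at \<open>Y u\<close>\<close>
    define g' where "g' s = (\<integral>w. generator \<phi> (Y u w) (b s w) (A w) \<partial>M)" for s
    have jointu: "(\<lambda>(s, w). generator \<phi> (Y u w) (b s w) (A w)) \<in> borel_measurable (borel \<Otimes>\<^sub>M M)"
      by (rule joint) measurable
    have frozen: "(LBINT s. indicator {u..v} s * g' s) = (\<integral>w. T1 w \<partial>M) + h * (\<integral>w. S w \<partial>M) / 2"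
    proof -
      have "(LBINT s. indicator {u..v} s * g' s) = (\<integral>w. (LBINT s. indicator {u..v} s * generator \<phi> (Y u w) (b s w) (A w)) \<partial>M)"
        unfolding g'_def by (rule integral_time_swap(3)[OF jointu gen_b uv(2), symmetric])
      also have "\<dots> = (\<integral>w. T1 w + h * S w / 2 \<partial>M)"
      proof (rule Bochner_Integration.integral_cong[OF refl])
        fix w assume w: "w \<in> space M"
        have "(LBINT s. indicator {u..v} s * generator \<phi> (Y u w) (b s w) (A w))
            = (LBINT s. grad \<phi> (Y u w) \<bullet> (indicator {u..v} s *\<^sub>R b s w) + S w / 2 * indicator {u..v} s)"
          by (intro Bochner_Integration.integral_cong refl) (simp add: generator_def S_def algebra_simps)
        also have "\<dots> = (LBINT s. grad \<phi> (Y u w) \<bullet> (indicator {u..v} s *\<^sub>R b s w)) + (LBINT s. S w / 2 * indicator {u..v} s)"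
          by (intro Bochner_Integration.integral_add integrable_inner_right integrable_mult_right integrable_real_indicator bint[OF w]) (auto simp: emeasure_lborel_Icc_eq)
        also have "\<dots> = T1 w + h * S w / 2"
        proof -
          have "(LBINT s. grad \<phi> (Y u w) \<bullet> (indicator {u..v} s *\<^sub>R b s w)) = T1 w"
            unfolding T1_def \<beta>'_def by (rule integral_inner_right[OF bint[OF w]])
          moreover have "(LBINT s. S w / 2 * indicator {u..v} s) = h * S w / 2"
            using uv by (simp add: h_def)
          ultimately show ?thesis by (simp only:)
        qed
        finally show "(LBINT s. indicator {u..v} s * generator \<phi> (Y u w) (b s w) (A w)) = T1 w + h * S w / 2" .
      qed
      also have "\<dots> = (\<integral>w. T1 w \<partial>M) + h * (\<integral>w. S w \<partial>M) / 2" using T1i Si by simp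
      finally show ?thesis .
    qed
    have g'm: "g' \<in> borel_measurable borel"
      unfolding g'_def using jointu by (rule borel_measurable_lebesgue_integral)
    have gi_any: "integrable M (\<lambda>w. generator \<phi> (Z s w) (b s w) (A w))" if "(\<lambda>(s, w). generator \<phi> (Z s w) (b s w) (A w)) \<in> borel_measurable (borel \<Otimes>\<^sub>M M)" for Z s
      by (rule bounded_integrable[OF sect[OF that] gen_b])
    have close: "\<bar>g s - g' s\<bar> \<le> C2 * sqrt h" if s: "u \<le> s" "s \<le> v" for s
    proof -
      have dist: "norm (Y s w - Y u w) \<le> K' * h + K * norm (B s w - B u w)" if w: "w \<in> space M" for w
      proof -
        have eq: "Y s w - Y u w = (LBINT r. indicator {u..s} r *\<^sub>R b r w) + A w *v (B s w - B u w)"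
          using incr[OF w uv(1) s(1)] s uv by simp
        have n1: "norm (LBINT r. indicator {u..s} r *\<^sub>R b r w) \<le> K' * h"
        proof -
          have "norm (LBINT r. indicator {u..s} r *\<^sub>R b r w) \<le> K' * (s - u)"
            by (rule vector_interval_integral(2)[OF bsec[OF w] b(2)[OF w] s(1)])
          also have "\<dots> \<le> K' * h" using s K by (intro mult_left_mono) (auto simp: h_def)
          finally show ?thesis .
        qed
        have n2: "norm (A w *v (B s w - B u w)) \<le> K * norm (B s w - B u w)"
          by (rule order_trans[OF matrix_vector_norm mult_right_mono[OF A(2)[OF w]]]) simp
        show ?thesis unfolding eq by (rule norm_triangle_mono[OF n1 n2])
      qed
      have s1: "s \<le> 1" using s uv1 by simp
      note inc = mean_increment_le[OF uv1(1) s(1) s1]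
      let ?d = "\<lambda>w. generator \<phi> (Y s w) (b s w) (A w) - generator \<phi> (Y u w) (b s w) (A w)"
      let ?e = "\<lambda>w. C * (K' * h + K * norm (B s w - B u w)) * (K' + N * K\<^sup>2)"
      have ei': "integrable M ?e" using inc(1) by simp
      have N: "0 \<le> N" by (simp add: N_def)
      have pw: "\<bar>?d w\<bar> \<le> ?e w" if w: "w \<in> space M" for w
      proof -
        let ?r = "K' * h + K * norm (B s w - B u w)"
        have r: "C * norm (Y s w - Y u w) \<le> C * ?r" using dist[OF w] C0 by (rule mult_left_mono)
        show ?thesis
          unfolding N_def
          by (rule generator_diff[OF order_trans[OF Cg' r] order_trans[OF CH' r] b(2)[OF w] A(2)[OF w]])
             (use C0 K h in auto)
      qed
      have "g s - g' s = (\<integral>w. ?d w \<partial>M)"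
        unfolding g_def g'_def using gi_any[OF joint[OF Y(1)], of s] gi_any[OF jointu, of s] by simp
      also have "\<bar>\<dots>\<bar> \<le> (\<integral>w. ?e w \<partial>M)"
        using gi_any[OF joint[OF Y(1)], of s] gi_any[OF jointu, of s]
        by (intro order_trans[OF integral_abs_bound] integral_mono integrable_abs ei' pw Bochner_Integration.integrable_diff)
      also have "\<dots> = C * (K' + N * K\<^sup>2) * (K' * h + K * (\<integral>w. norm (B s w - B u w) \<partial>M))"
        using inc(1) prob_space by (simp add: algebra_simps)
      also have "\<dots> \<le> C * (K' + N * K\<^sup>2) * (K' * sqrt h + K * ((1 + m) * sqrt h))"
      proof (intro mult_left_mono add_mono)
        have "sqrt (s - u) \<le> sqrt h" using s by (simp add: h_def)
        then have "(1 + m) * sqrt (s - u) \<le> (1 + m) * sqrt h" using m by (intro mult_left_mono) auto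
        then show "(\<integral>w. norm (B s w - B u w) \<partial>M) \<le> (1 + m) * sqrt h" using inc(2) unfolding m_def by linarith
        have "sqrt h * sqrt h \<le> 1 * sqrt h" using h by (intro mult_right_mono) auto
        then show "h \<le> sqrt h" using h by simp
      qed (use C0 K N in auto)
      also have "\<dots> = C2 * sqrt h" unfolding C2_def by (simp add: algebra_simps)
      finally show ?thesis .
    qed
    have g'_b: "\<bar>g' s\<bar> \<le> L" for s
    proof -
      have "\<bar>g' s\<bar> \<le> (\<integral>w. L \<partial>M)"
        unfolding g'_def by (intro order_trans[OF integral_abs_bound] integral_mono integrable_abs gi_any[OF jointu] gen_b) auto
      then show ?thesis by (simp add: prob_space)
    qed
    have second: "\<bar>(LBINT s. indicator {u..v} s * g s) - (LBINT s. indicator {u..v} s * g' s)\<bar> \<le> C2 * (h * sqrt h)"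
    proof -
      have i: "integrable lborel (\<lambda>s. indicator {u..v} s * g s)" "integrable lborel (\<lambda>s. indicator {u..v} s * g' s)"
        using interval_indicator_integral(1)[OF gm g_b uv(2)] interval_indicator_integral(1)[OF g'm g'_b uv(2)] by auto
      have "(LBINT s. indicator {u..v} s * g s) - (LBINT s. indicator {u..v} s * g' s) = (LBINT s. indicator {u..v} s * g s - indicator {u..v} s * g' s)"
        using i by simp
      also have "\<bar>\<dots>\<bar> \<le> (LBINT s. (C2 * sqrt h) * indicator {u..v} s)"
      proof (intro order_trans[OF integral_abs_bound] integral_mono integrable_abs Bochner_Integration.integrable_diff i)
        show "integrable lborel (\<lambda>s. (C2 * sqrt h) * indicator {u..v} s)" by (intro integrable_mult_right integrable_real_indicator) (auto simp: emeasure_lborel_Icc_eq)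
        show "\<bar>indicator {u..v} s * g s - indicator {u..v} s * g' s\<bar> \<le> (C2 * sqrt h) * indicator {u..v} s" for s
          using close[of s] by (simp add: indicator_def)
      qed
      also have "\<dots> = C2 * (h * sqrt h)" using uv by (simp add: h_def)
      finally show ?thesis .
    qed
    have "G v - G u = (\<integral>w. \<phi> (Y v w) \<partial>M) - (\<integral>w. \<phi> (Y u w) \<partial>M) - (LBINT s. indicator {u..v} s * g s)"
      unfolding G_def using interval_integral_split[OF gm g_b uv(1,2)] by simp
    then show ?thesis
      using first second unfolding frozen h_def[symmetric] distrib_right by linarith
  qed
  have "G \<beta> = G \<alpha>" by (rule constant_if_superlinear_modulus[OF ab(2) key])
  moreover have "(LBINT s. indicator {\<alpha>..\<alpha>} s * g s) = 0"
    using interval_indicator_integral(2)[OF gm g_b order_refl, of \<alpha>] by simp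
  ultimately show ?thesis unfolding G_def g_def by simp
qed

end

section \<open>Simple processes\<close>

lemma simple_tau_mono:
  assumes "simple_process M F T m \<tau> A" "i \<le> j" "j \<le> m"
  shows "\<tau> i \<le> \<tau> j"
  using assms(2,3)
proof (induction j rule: dec_induct)
  case (step n)
  then have "\<tau> n \<le> \<tau> (Suc n)" using assms(1) unfolding simple_process_def by auto
  with step show ?case by auto
qed simp

lemma simple_tau_bounds:
  assumes "simple_process M F T m \<tau> A" "i \<le> m"
  shows "0 \<le> \<tau> i" "\<tau> i \<le> T"
  using simple_tau_mono[OF assms(1), of 0 i] simple_tau_mono[OF assms(1), of i m] assms
  unfolding simple_process_def by auto

lemma simple_value_piece:
  assumes S: "simple_process M F T m \<tau> A" and i: "i < m" and s: "\<tau> i < s" "s \<le> \<tau> (Suc i)"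
  shows "simple_value m \<tau> C s w = C i w"
proof -
  have "indicator {\<tau> j<..\<tau> (Suc j)} s *\<^sub>R C j w = (if j = i then C i w else 0)" if "j < m" for j
  proof (cases j i rule: linorder_cases)
    case less
    then have "\<tau> (Suc j) \<le> \<tau> i" using i by (intro simple_tau_mono[OF S]) auto
    then show ?thesis using s less by (simp add: indicator_def)
  next
    case greater
    then have "\<tau> (Suc i) \<le> \<tau> j" using that by (intro simple_tau_mono[OF S]) auto
    then show ?thesis using s greater by (simp add: indicator_def)
  qed (use s in \<open>simp add: indicator_def\<close>)
  then have "simple_value m \<tau> C s w = (\<Sum>j<m. if j = i then C i w else 0)"
    unfolding simple_value_def by (intro sum.cong) auto
  then show ?thesis using i by simp
qed

lemma simple_value_cases:
  fixes M :: "'w measure" and A :: "nat \<Rightarrow> 'w \<Rightarrow> real^'n^'n"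
  assumes S: "simple_process M F T m \<tau> A"
  obtains (piece) i where "i < m" "\<tau> i < s" "s \<le> \<tau> (Suc i)" "\<And>C w. simple_value m \<tau> C s (w::'w) = (C i w :: real^'n^'n)"
  | (outside) "\<not> (0 < s \<and> s \<le> T)" "\<And>C w. simple_value m \<tau> C s (w::'w) = (0 :: real^'n^'n)"
proof (cases "\<exists>i<m. \<tau> i < s \<and> s \<le> \<tau> (Suc i)")
  case True
  then obtain i where "i < m" "\<tau> i < s" "s \<le> \<tau> (Suc i)" by blast
  with simple_value_piece[OF S this] show ?thesis by (intro piece) auto
next
  case False
  have "\<not> s \<le> \<tau> k" if "0 < s" "k \<le> m" for k
    using that
  proof (induction k)
    case 0 then show ?case using S by (simp add: simple_process_def)
  next
    case (Suc k) then show ?case using False by (metis Suc_le_lessD less_imp_le not_le)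
  qed
  then have "\<not> (0 < s \<and> s \<le> T)" using S unfolding simple_process_def by blast
  moreover have "simple_value m \<tau> C s w = 0" for C :: "nat \<Rightarrow> 'w \<Rightarrow> real^'n^'n" and w
    unfolding simple_value_def using False by (intro sum.neutral) (auto simp: indicator_def)
  ultimately show ?thesis by (rule outside)
qed

text \<open>The terms kept are those up to the first time at which the partial sum exceeds \<open>\<delta>\<close>, that
  one excluded.\<close>

lemma stopped_sum_le:
  fixes c :: "nat \<Rightarrow> real"
  assumes c: "\<And>i. i < k \<Longrightarrow> 0 \<le> c i" and \<delta>: "0 \<le> \<delta>"
  shows "(\<Sum>i<k. if (\<Sum>j\<le>i. c j) \<le> \<delta> then c i else 0) \<le> \<delta>"
  using c
proof (induction k)
  case (Suc k)
  show ?case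
  proof (cases "(\<Sum>j\<le>k. c j) \<le> \<delta>")
    case True
    have "(\<Sum>j\<le>i. c j) \<le> \<delta>" if "i \<le> k" for i
    proof -
      have "(\<Sum>j\<le>i. c j) \<le> (\<Sum>j\<le>k. c j)" using that Suc.prems by (intro sum_mono2) auto
      with True show ?thesis by simp
    qed
    then have "(\<Sum>i<Suc k. if (\<Sum>j\<le>i. c j) \<le> \<delta> then c i else 0) = (\<Sum>i\<le>k. c i)"
      unfolding lessThan_Suc_atMost by (intro sum.cong) auto
    with True show ?thesis by simp
  next
    case False
    then show ?thesis using Suc by simp
  qed
qed (use \<delta> in simp)

section \<open>Truncation\<close>

text \<open>Projection onto a ball. It does not increase distances to points of the ball, so
  truncating an approximation of a bounded process improves it.\<close>

definition trunc :: "real \<Rightarrow> 'a::euclidean_space \<Rightarrow> 'a" where "trunc K = closest_point (cball 0 K)"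

lemma trunc_facts:
  fixes x y :: "'a::euclidean_space"
  assumes K: "0 \<le> K"
  shows "norm (trunc K x) \<le> K" and "norm y \<le> K \<Longrightarrow> norm (trunc K x - y) \<le> norm (x - y)"
    and "norm y \<le> K \<Longrightarrow> norm (x - trunc K x) \<le> norm (x - y)" and "trunc K 0 = (0::'a)"
    and "trunc K \<in> borel_measurable (borel :: 'a measure)"
proof -
  have c: "closed (cball (0::'a) K)" "convex (cball (0::'a) K)" "cball (0::'a) K \<noteq> {}" using K by auto
  show "norm (trunc K x) \<le> K" using closest_point_in_set[OF c(1,3), of x] by (simp add: trunc_def)
  show "norm (trunc K x - y) \<le> norm (x - y)" if y: "norm y \<le> K"
    using closest_point_lipschitz[OF c(2,1,3), of x y] closest_point_self[of y "cball 0 K"] y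
    by (simp add: trunc_def dist_norm)
  show "norm (x - trunc K x) \<le> norm (x - y)" if y: "norm y \<le> K"
    using closest_point_le[OF c(1), of y x] y by (simp add: trunc_def dist_norm)
  show "trunc K 0 = (0::'a)" using K by (simp add: trunc_def closest_point_self)
  show "trunc K \<in> borel_measurable (borel :: 'a measure)"
    unfolding trunc_def by (intro borel_measurable_continuous_onI continuous_on_closest_point c)
qed

context brownian
begin

lemma markov:
  fixes X :: "'w \<Rightarrow> real"
  assumes X: "integrable M X" "\<And>w. w \<in> space M \<Longrightarrow> 0 \<le> X w" and e: "0 < e"
  shows "prob {w \<in> space M. e < X w} \<le> (\<integral>w. X w \<partial>M) / e"
proof -
  have [measurable]: "X \<in> borel_measurable M" using X by auto
  let ?E = "{w \<in> space M. e < X w}"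
  have E: "?E \<in> sets M" by measurable
  have "e * prob ?E = (\<integral>w. e * indicator ?E w \<partial>M)" using E by simp
  also have "\<dots> \<le> (\<integral>w. X w \<partial>M)"
  proof (intro integral_mono X)
    show "integrable M (\<lambda>w. e * indicator ?E w)" using E by (intro integrable_mult_right integrable_real_indicator) (auto simp: emeasure_eq_measure)
    show "e * indicator ?E w \<le> X w" if "w \<in> space M" for w using X(2)[OF that] e by (auto simp: indicator_def)
  qed
  finally show ?thesis using e by (simp add: pos_le_divide_eq mult.commute)
qed

lemma simple_measurable:
  assumes S: "simple_process M F T m \<tau> A" and i: "i < m"
  shows "A i \<in> borel_measurable (F (\<tau> i))" "A i \<in> borel_measurable M"
  using S i F_M unfolding simple_process_def by blast+

lemma simple_second_moment:
  assumes S: "simple_process M F T m \<tau> A" and T: "T \<le> 1"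
  shows "integrable M (\<lambda>w. (norm (simple_integral B m \<tau> A w))\<^sup>2)"
    and "(\<integral>w. (norm (simple_integral B m \<tau> A w))\<^sup>2 \<partial>M) = (\<integral>w. (\<Sum>i<m. (norm (A i w))\<^sup>2 * (\<tau> (Suc i) - \<tau> i)) \<partial>M)"
    and "has_bochner_integral lborel (\<lambda>s. (norm (simple_value m \<tau> A s w))\<^sup>2) (\<Sum>i<m. (norm (A i w))\<^sup>2 * (\<tau> (Suc i) - \<tau> i))"
proof -
  have "\<forall>i<m. \<exists>K. \<forall>w\<in>space M. norm (A i w) \<le> K"
    using S unfolding simple_process_def bounded_iff by simp
  then obtain K where K: "\<And>i w. i < m \<Longrightarrow> w \<in> space M \<Longrightarrow> norm (A i w) \<le> K i" by metis
  have Q: "(\<Sum>p<m. \<Sum>q<m. (A p w \<bullet> A q w) * overlap (\<tau> p) (\<tau> (Suc p)) (\<tau> q) (\<tau> (Suc q))) = (\<Sum>i<m. (norm (A i w))\<^sup>2 * (\<tau> (Suc i) - \<tau> i))" for w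
  proof (intro sum.cong refl)
    fix p assume p: "p \<in> {..<m}"
    have "(A p w \<bullet> A q w) * overlap (\<tau> p) (\<tau> (Suc p)) (\<tau> q) (\<tau> (Suc q)) = (if q = p then (norm (A p w))\<^sup>2 * (\<tau> (Suc p) - \<tau> p) else 0)" if "q < m" for q
    proof (cases q p rule: linorder_cases)
      case less
      then have "\<tau> (Suc q) \<le> \<tau> p" using p by (intro simple_tau_mono[OF S]) auto
      then show ?thesis using less by (simp add: overlap_def)
    next
      case greater
      then have "\<tau> (Suc p) \<le> \<tau> q" using that by (intro simple_tau_mono[OF S]) auto
      then show ?thesis using greater by (simp add: overlap_def)
    next
      case equal
      then show ?thesis using simple_tau_mono[OF S, of p "Suc p"] p by (simp add: overlap_def dot_square_norm)
    qed
    then have "(\<Sum>q<m. (A p w \<bullet> A q w) * overlap (\<tau> p) (\<tau> (Suc p)) (\<tau> q) (\<tau> (Suc q))) = (\<Sum>q<m. if q = p then (norm (A p w))\<^sup>2 * (\<tau> (Suc p) - \<tau> p) else 0)"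
      by (intro sum.cong) auto
    then show "(\<Sum>q<m. (A p w \<bullet> A q w) * overlap (\<tau> p) (\<tau> (Suc p)) (\<tau> q) (\<tau> (Suc q))) = (norm (A p w))\<^sup>2 * (\<tau> (Suc p) - \<tau> p)"
      using p by simp
  qed
  have b: "0 \<le> \<tau> i" "\<tau> i \<le> \<tau> (Suc i)" "\<tau> (Suc i) \<le> 1" if "i \<in> {..<m}" for i
    using simple_tau_bounds[OF S, of i] simple_tau_bounds[OF S, of "Suc i"] simple_tau_mono[OF S, of i "Suc i"] that T by auto
  have a: "A i \<in> borel_measurable (F (\<tau> i))" if "i \<in> {..<m}" for i using simple_measurable(1)[OF S] that by simp
  have k: "norm (A i w) \<le> K i" if "i \<in> {..<m}" "w \<in> space M" for i w using K that by simp
  note iso = elementary_isometry[of "{..<m}" \<tau> "\<lambda>i. \<tau> (Suc i)" A K, OF finite_lessThan b a k, unfolded Q]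
  show "integrable M (\<lambda>w. (norm (simple_integral B m \<tau> A w))\<^sup>2)"
    using iso(1) unfolding simple_integral_def .
  show "(\<integral>w. (norm (simple_integral B m \<tau> A w))\<^sup>2 \<partial>M) = (\<integral>w. (\<Sum>i<m. (norm (A i w))\<^sup>2 * (\<tau> (Suc i) - \<tau> i)) \<partial>M)"
    using iso(2) unfolding simple_integral_def .
  show "has_bochner_integral lborel (\<lambda>s. (norm (simple_value m \<tau> A s w))\<^sup>2) (\<Sum>i<m. (norm (A i w))\<^sup>2 * (\<tau> (Suc i) - \<tau> i))"
    using iso(3) unfolding simple_value_def .
qed

lemma simple_integral_measurable:
  assumes S: "simple_process M F T m \<tau> A" and T: "T \<le> 1"
  shows "simple_integral B m \<tau> A \<in> borel_measurable M"
  unfolding simple_integral_def[abs_def]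
proof (rule borel_measurable_sum)
  fix i assume i: "i \<in> {..<m}"
  have [measurable]: "B (\<tau> i) \<in> borel_measurable M" "B (\<tau> (Suc i)) \<in> borel_measurable M" "A i \<in> borel_measurable M"
    using simple_tau_bounds[OF S, of i] simple_tau_bounds[OF S, of "Suc i"] i T simple_measurable(2)[OF S]
    by (auto intro!: B_M)
  show "(\<lambda>w. A i w *v (B (\<tau> (Suc i)) w - B (\<tau> i) w)) \<in> borel_measurable M" by measurable
qed

text \<open>Drop the integrand once the accumulated square, which is known at the beginning of each
  piece, would exceed \<open>\<delta>\<close>. The integral of what remains has second moment at most \<open>\<delta>\<close>, and it
  differs from the original one only on the first event.\<close>

lemma simple_integral_prob:
  assumes S: "simple_process M F T m \<tau> A" and T: "T \<le> 1" and e: "0 < \<epsilon>" and d: "0 < \<delta>"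
  shows "prob {w \<in> space M. \<epsilon> < norm (simple_integral B m \<tau> A w)}
     \<le> prob {w \<in> space M. \<delta> < (\<Sum>i<m. (norm (A i w))\<^sup>2 * (\<tau> (Suc i) - \<tau> i))} + \<delta> / \<epsilon>\<^sup>2"
proof -
  define c where "c i w = (norm (A i w))\<^sup>2 * (\<tau> (Suc i) - \<tau> i)" for i w
  have c0: "0 \<le> c i w" if "i < m" for i w
    using simple_tau_mono[OF S, of i "Suc i"] that by (simp add: c_def)
  \<comment> \<open>the partial sum includes the piece \<open>i\<close> itself: \<open>A i\<close> is known at its left end\<close>
  define A' where "A' i w = (if (\<Sum>j\<le>i. c j w) \<le> \<delta> then A i w else 0)" for i w
  have cF: "c j \<in> borel_measurable (F (\<tau> i))" if "j \<le> i" "i < m" for i j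
  proof -
    have "A j \<in> borel_measurable (F (\<tau> i))"
      using simple_measurable(1)[OF S, of j] simple_tau_mono[OF S, of j i] that by (auto intro: F_mono)
    then show ?thesis unfolding c_def[abs_def] by measurable
  qed
  have cM: "c i \<in> borel_measurable M" if "i < m" for i using F_M[OF cF[of i i]] that by simp
  have S': "simple_process M F T m \<tau> A'"
    unfolding simple_process_def
  proof (intro conjI allI impI)
    fix i assume i: "i < m"
    have [measurable]: "(\<lambda>w. \<Sum>j\<le>i. c j w) \<in> borel_measurable (F (\<tau> i))" using cF i by (intro borel_measurable_sum) auto
    note [measurable] = simple_measurable(1)[OF S i]
    show "A' i \<in> borel_measurable (F (\<tau> i))" unfolding A'_def[abs_def] by measurable
    have "\<exists>K. \<forall>w\<in>space M. norm (A i w) \<le> K" using S i unfolding simple_process_def bounded_iff by auto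
    then obtain K where "\<And>w. w \<in> space M \<Longrightarrow> norm (A i w) \<le> K" by blast
    then have "norm (A' i w) \<le> max K 0" if "w \<in> space M" for w using that unfolding A'_def by (auto simp: le_max_iff_disj)
    then show "bounded (A' i ` space M)" unfolding bounded_iff by blast
  qed (use S in \<open>auto simp: simple_process_def\<close>)
  let ?I = "simple_integral B m \<tau> A" and ?I' = "simple_integral B m \<tau> A'"
  have [measurable]: "?I \<in> borel_measurable M" "?I' \<in> borel_measurable M"
    by (rule simple_integral_measurable[OF S T] simple_integral_measurable[OF S' T])+
  have [measurable]: "(\<lambda>w. \<Sum>i<m. c i w) \<in> borel_measurable M" using cM by (intro borel_measurable_sum) auto
  have "(\<integral>w. (norm (?I' w))\<^sup>2 \<partial>M) \<le> \<delta>"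
  proof -
    have q: "(\<Sum>i<m. (norm (A' i w))\<^sup>2 * (\<tau> (Suc i) - \<tau> i)) \<le> \<delta>" for w
    proof -
      have "(\<Sum>i<m. (norm (A' i w))\<^sup>2 * (\<tau> (Suc i) - \<tau> i)) = (\<Sum>i<m. if (\<Sum>j\<le>i. c j w) \<le> \<delta> then c i w else 0)"
        by (intro sum.cong refl) (simp add: A'_def c_def)
      also have "\<dots> \<le> \<delta>" using c0 d by (intro stopped_sum_le) auto
      finally show ?thesis .
    qed
    have q0: "0 \<le> (\<Sum>i<m. (norm (A' i w))\<^sup>2 * (\<tau> (Suc i) - \<tau> i))" for w
      using simple_tau_mono[OF S] by (intro sum_nonneg mult_nonneg_nonneg) auto
    have "(\<integral>w. (norm (?I' w))\<^sup>2 \<partial>M) \<le> (\<integral>w. \<delta> \<partial>M)"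
      unfolding simple_second_moment(2)[OF S' T]
    proof (intro integral_mono bounded_integrable[where C=\<delta>] q)
      show "(\<lambda>w. \<Sum>i<m. (norm (A' i w))\<^sup>2 * (\<tau> (Suc i) - \<tau> i)) \<in> borel_measurable M"
      proof (rule borel_measurable_sum)
        fix i assume "i \<in> {..<m}"
        then have [measurable]: "A' i \<in> borel_measurable M" using simple_measurable(2)[OF S'] by simp
        show "(\<lambda>w. (norm (A' i w))\<^sup>2 * (\<tau> (Suc i) - \<tau> i)) \<in> borel_measurable M" by measurable
      qed
      show "\<bar>\<Sum>i<m. (norm (A' i w))\<^sup>2 * (\<tau> (Suc i) - \<tau> i)\<bar> \<le> \<delta>" for w using q q0 by simp
    qed (use d in auto)
    then show ?thesis by (simp add: prob_space)
  qed
  then have m: "prob {w \<in> space M. \<epsilon>\<^sup>2 < (norm (?I' w))\<^sup>2} \<le> \<delta> / \<epsilon>\<^sup>2"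
    using markov[OF simple_second_moment(1)[OF S' T], of "\<epsilon>\<^sup>2"] e by (simp add: divide_right_mono order_trans)
  have "prob {w \<in> space M. \<epsilon> < norm (?I w)} \<le> prob ({w \<in> space M. \<delta> < (\<Sum>i<m. c i w)} \<union> {w \<in> space M. \<epsilon>\<^sup>2 < (norm (?I' w))\<^sup>2})"
  proof (rule finite_measure_mono)
    show "{w \<in> space M. \<epsilon> < norm (?I w)} \<subseteq> {w \<in> space M. \<delta> < (\<Sum>i<m. c i w)} \<union> {w \<in> space M. \<epsilon>\<^sup>2 < (norm (?I' w))\<^sup>2}"
    proof (intro subsetI, elim CollectE conjE)
      fix w assume w: "w \<in> space M" and b: "\<epsilon> < norm (?I w)"
      show "w \<in> {w \<in> space M. \<delta> < (\<Sum>i<m. c i w)} \<union> {w \<in> space M. \<epsilon>\<^sup>2 < (norm (?I' w))\<^sup>2}"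
      proof (cases "\<delta> < (\<Sum>i<m. c i w)")
        case False
        have "(\<Sum>j\<le>i. c j w) \<le> \<delta>" if "i < m" for i
        proof -
          have "(\<Sum>j\<le>i. c j w) \<le> (\<Sum>j<m. c j w)" using that c0 by (intro sum_mono2) auto
          with False show ?thesis by simp
        qed
        then have "?I' w = ?I w" unfolding simple_integral_def by (intro sum.cong refl) (simp add: A'_def)
        then have "\<epsilon>\<^sup>2 < (norm (?I' w))\<^sup>2" using b e by (simp add: power_strict_mono)
        then show ?thesis using w by simp
      qed (use w in simp)
    qed
  qed measurable
  also have "\<dots> \<le> prob {w \<in> space M. \<delta> < (\<Sum>i<m. c i w)} + prob {w \<in> space M. \<epsilon>\<^sup>2 < (norm (?I' w))\<^sup>2}"
    by (intro measure_Un_le) measurable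
  also have "\<dots> \<le> prob {w \<in> space M. \<delta> < (\<Sum>i<m. c i w)} + \<delta> / \<epsilon>\<^sup>2" using m by simp
  finally show ?thesis unfolding c_def .
qed

section \<open>Mean square approximation of bounded integrands\<close>

lemma progressive_joint:
  fixes H :: "real \<Rightarrow> 'w \<Rightarrow> 'b::topological_space"
  assumes H: "progressive F T H" and T: "0 \<le> T"
  shows "(\<lambda>(s, w). H (clip T s) w) \<in> borel_measurable (borel \<Otimes>\<^sub>M M)"
proof -
  have h: "(\<lambda>(s, w). H s w) \<in> borel_measurable (restrict_space borel {0..T} \<Otimes>\<^sub>M F T)"
    using H T unfolding progressive_def by auto
  have "(\<lambda>p. (clip T (fst p), snd p)) \<in> borel \<Otimes>\<^sub>M M \<rightarrow>\<^sub>M restrict_space borel {0..T} \<Otimes>\<^sub>M F T"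
  proof (rule measurable_Pair)
    show "(\<lambda>p. clip T (fst p)) \<in> borel \<Otimes>\<^sub>M M \<rightarrow>\<^sub>M restrict_space borel {0..T}"
      by (rule measurable_restrict_space2) (auto simp: clip_bounds[OF T])
    show "(\<lambda>p. snd p) \<in> borel \<Otimes>\<^sub>M M \<rightarrow>\<^sub>M F T"
      by (rule measurable_compose[OF measurable_snd measurable_from_subalg[OF sub measurable_ident_sets[OF refl], unfolded id_def]])
  qed
  from measurable_compose[OF this h] show ?thesis by (simp add: case_prod_beta)
qed

lemma simple_value_joint:
  assumes S: "simple_process M F T m \<tau> A"
  shows "(\<lambda>(s, w). simple_value m \<tau> A s w) \<in> borel_measurable (borel \<Otimes>\<^sub>M M)"
proof -
  have "(\<lambda>p. \<Sum>i<m. indicator {\<tau> i<..\<tau> (Suc i)} (fst p) *\<^sub>R A i (snd p)) \<in> borel_measurable (borel \<Otimes>\<^sub>M M)"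
  proof (rule borel_measurable_sum)
    fix i assume "i \<in> {..<m}"
    then have [measurable]: "A i \<in> borel_measurable M" using simple_measurable(2)[OF S] by simp
    show "(\<lambda>p. indicator {\<tau> i<..\<tau> (Suc i)} (fst p) *\<^sub>R A i (snd p)) \<in> borel_measurable (borel \<Otimes>\<^sub>M M)" by measurable
  qed
  then show ?thesis unfolding simple_value_def by (simp add: case_prod_beta)
qed

lemma simple_value_bound:
  assumes S: "simple_process M F T m \<tau> A" and K: "0 \<le> K" "\<And>i. i < m \<Longrightarrow> norm (A i w) \<le> K"
  shows "norm (simple_value m \<tau> A s w) \<le> K"
  by (rule simple_value_cases[OF S, of s]) (use K in auto)

lemma simple_process_map:
  assumes S: "simple_process M F T m \<tau> A"
    and f: "f \<in> borel_measurable borel" and b: "\<And>x. norm (f x) \<le> norm x"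
  shows "simple_process M F T m \<tau> (\<lambda>i w. f (A i w))"
  unfolding simple_process_def
proof (intro conjI allI impI)
  fix i assume i: "i < m"
  show "(\<lambda>w. f (A i w)) \<in> borel_measurable (F (\<tau> i))"
    by (rule measurable_compose[OF simple_measurable(1)[OF S i] f])
  have "\<exists>K. \<forall>w\<in>space M. norm (A i w) \<le> K" using S i unfolding simple_process_def bounded_iff by auto
  then obtain K where "\<And>w. w \<in> space M \<Longrightarrow> norm (A i w) \<le> K" by blast
  then have "\<And>w. w \<in> space M \<Longrightarrow> norm (f (A i w)) \<le> K" using b order_trans by blast
  then show "bounded ((\<lambda>w. f (A i w)) ` space M)" unfolding bounded_iff by blast
qed (use S in \<open>auto simp: simple_process_def\<close>)

text \<open>Truncated processes are compared in expectation, whereas the definition of the stochastic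
  integral only gives convergence in probability.\<close>

definition mean_square_dist :: "real \<Rightarrow> nat \<Rightarrow> (nat \<Rightarrow> real) \<Rightarrow> (nat \<Rightarrow> 'w \<Rightarrow> real^'n^'n) \<Rightarrow> (real \<Rightarrow> 'w \<Rightarrow> real^'n^'n) \<Rightarrow> real" where
  "mean_square_dist T m \<tau> A H = (\<integral>w. (LBINT s. indicator {0..T} s * (norm (simple_value m \<tau> A s w - H s w))\<^sup>2) \<partial>M)"

lemma square_dist_facts:
  assumes S: "simple_process M F T' m \<tau> A" and K: "0 \<le> K" "\<forall>i<m. \<forall>w\<in>space M. norm (A i w) \<le> K"
    and T: "0 \<le> T" and H: "(\<lambda>(s, w). H (clip T s) w) \<in> borel_measurable (borel \<Otimes>\<^sub>M M)"
    and HK: "\<forall>s\<in>{0..T}. \<forall>w\<in>space M. norm (H s w :: real^'n^'n) \<le> K"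
  shows "w \<in> space M \<Longrightarrow> integrable lborel (\<lambda>s. indicator {0..T} s * (norm (simple_value m \<tau> A s w - H s w))\<^sup>2)"
    and "integrable M (\<lambda>w. LBINT s. indicator {0..T} s * (norm (simple_value m \<tau> A s w - H s w))\<^sup>2)"
    and "w \<in> space M \<Longrightarrow> (LBINT s. indicator {0..T} s * (norm (simple_value m \<tau> A s w - H s w))\<^sup>2) \<le> 4 * K\<^sup>2 * T"
    and "0 \<le> (LBINT s. indicator {0..T} s * (norm (simple_value m \<tau> A s w - H s w))\<^sup>2)"
proof -
  let ?h = "\<lambda>s w. (norm (simple_value m \<tau> A s w - H (clip T s) w))\<^sup>2"
  note [measurable] = H simple_value_joint[OF S]
  have hm: "(\<lambda>(s, w). ?h s w) \<in> borel_measurable (borel \<Otimes>\<^sub>M M)"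
  proof -
    have "(\<lambda>p. (norm ((case p of (s, w) \<Rightarrow> simple_value m \<tau> A s w) - (case p of (s, w) \<Rightarrow> H (clip T s) w)))\<^sup>2) \<in> borel_measurable (borel \<Otimes>\<^sub>M M)"
      by measurable
    then show ?thesis by (simp add: case_prod_beta)
  qed
  have hb: "\<bar>?h s w\<bar> \<le> 4 * K\<^sup>2" if w: "w \<in> space M" for s w
  proof -
    have "norm (simple_value m \<tau> A s w - H (clip T s) w) \<le> K + K"
      using simple_value_bound[OF S K(1), of w s] K(2) w HK[rule_format, of "clip T s" w] clip_bounds[OF T, of s]
      by (intro order_trans[OF norm_triangle_ineq4] add_mono) auto
    then have "?h s w \<le> (K + K)\<^sup>2" by (intro power_mono) auto
    also have "(K + K)\<^sup>2 = 4 * K\<^sup>2" by (simp add: power2_eq_square)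
    finally show ?thesis by simp
  qed
  have e: "indicator {0..T} s * (norm (simple_value m \<tau> A s w - H s w))\<^sup>2 = indicator {0..T} s * ?h s w" for s w
    by (auto simp: indicator_def clip_id)
  have sect: "(\<lambda>s. ?h s w) \<in> borel_measurable borel" if "w \<in> space M" for w
    using measurable_compose[OF measurable_Pair2'[OF that, of borel] hm] by simp
  show "integrable lborel (\<lambda>s. indicator {0..T} s * (norm (simple_value m \<tau> A s w - H s w))\<^sup>2)" if w: "w \<in> space M"
    unfolding e by (rule interval_indicator_integral(1)[OF sect[OF w] hb[OF w] T])
  show "integrable M (\<lambda>w. LBINT s. indicator {0..T} s * (norm (simple_value m \<tau> A s w - H s w))\<^sup>2)"
    unfolding e by (rule integral_time_swap(2)[OF hm hb T])
  show "(LBINT s. indicator {0..T} s * (norm (simple_value m \<tau> A s w - H s w))\<^sup>2) \<le> 4 * K\<^sup>2 * T" if w: "w \<in> space M"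
    unfolding e using interval_indicator_integral(2)[OF sect[OF w] hb[OF w] T] by simp
  show "0 \<le> (LBINT s. indicator {0..T} s * (norm (simple_value m \<tau> A s w - H s w))\<^sup>2)"
    by (intro integral_nonneg_AE AE_I2) auto
qed

lemma mean_square_dist_nonneg: "0 \<le> mean_square_dist T m \<tau> A H"
  unfolding mean_square_dist_def by (intro integral_nonneg_AE AE_I2) (auto intro!: integral_nonneg_AE)

text \<open>Truncate the given simple processes at the bound \<open>K\<close> of \<open>H\<close>. Their square distances to \<open>H\<close>
  decrease and are bounded, so convergence in probability becomes convergence in mean. The parts
  cut off are dominated by the distance to \<open>H\<close>, so their integrals tend to zero in probability
  by \<open>simple_integral_prob\<close>, and the limit of the integrals is unchanged.\<close>

lemma bounded_approximation:
  assumes I: "ito_integral M F B T H I" and T: "0 \<le> T" "T \<le> 1" and K: "0 \<le> K"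
    and HK: "\<And>s w. 0 \<le> s \<Longrightarrow> s \<le> T \<Longrightarrow> w \<in> space M \<Longrightarrow> norm (H s w) \<le> K"
  obtains m \<tau> A where "\<forall>n::nat. simple_process M F T (m n) (\<tau> n) (A n)"
    and "\<forall>n i w. norm (A n i w) \<le> K"
    and "(\<lambda>n. mean_square_dist T (m n) (\<tau> n) (A n) H) \<longlonglongrightarrow> 0"
    and "\<forall>\<epsilon>>0. (\<lambda>n. prob {w \<in> space M. \<epsilon> < norm (simple_integral B (m n) (\<tau> n) (A n) w - I w)}) \<longlonglongrightarrow> 0"
proof -
  obtain m \<tau> A where S: "\<And>n. simple_process M F T (m n) (\<tau> n) (A n)"
    and D: "tends_to_0_in_prob M (\<lambda>n w. \<integral>\<^sup>+s\<in>{0..T}. ennreal ((norm (simple_value (m n) (\<tau> n) (A n) s w - H s w))\<^sup>2) \<partial>lborel)"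
    and L: "tends_to_0_in_prob M (\<lambda>n w. ennreal (norm (simple_integral B (m n) (\<tau> n) (A n) w - I w)))"
    and P: "progressive F T H" and Im[measurable]: "I \<in> borel_measurable M"
    using I unfolding ito_integral_def by blast
  note Hj = progressive_joint[OF P T(1)]
  define D' where "D' n w = (\<integral>\<^sup>+s\<in>{0..T}. ennreal ((norm (simple_value (m n) (\<tau> n) (A n) s w - H s w))\<^sup>2) \<partial>lborel)" for n w
  have D'm[measurable]: "D' n \<in> borel_measurable M" for n
  proof -
    have "(\<lambda>p. (norm ((case p of (s, w) \<Rightarrow> simple_value (m n) (\<tau> n) (A n) s w) - (case p of (s, w) \<Rightarrow> H (clip T s) w)))\<^sup>2) \<in> borel_measurable (borel \<Otimes>\<^sub>M M)"
      using Hj simple_value_joint[OF S[of n]] by measurable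
    from measurable_compose[OF measurable_pair_swap'[of M borel] this]
    have "(\<lambda>p. (norm (simple_value (m n) (\<tau> n) (A n) (snd p) (fst p) - H (clip T (snd p)) (fst p)))\<^sup>2) \<in> borel_measurable (M \<Otimes>\<^sub>M borel)"
      by (simp add: case_prod_beta)
    then have "(\<lambda>p. ennreal ((norm (simple_value (m n) (\<tau> n) (A n) (snd p) (fst p) - H (clip T (snd p)) (fst p)))\<^sup>2) * indicator {0..T} (snd p)) \<in> borel_measurable (M \<Otimes>\<^sub>M borel)"
      by measurable
    then have "(\<lambda>(w, s). ennreal ((norm (simple_value (m n) (\<tau> n) (A n) s w - H (clip T s) w))\<^sup>2) * indicator {0..T} s) \<in> borel_measurable (M \<Otimes>\<^sub>M lborel)"
      by (simp add: case_prod_beta cong: measurable_cong_sets sets_pair_measure_cong)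
    from lborel.borel_measurable_nn_integral[OF this]
    have "(\<lambda>w. \<integral>\<^sup>+s\<in>{0..T}. ennreal ((norm (simple_value (m n) (\<tau> n) (A n) s w - H (clip T s) w))\<^sup>2) \<partial>lborel) \<in> borel_measurable M" .
    moreover have "D' n w = (\<integral>\<^sup>+s\<in>{0..T}. ennreal ((norm (simple_value (m n) (\<tau> n) (A n) s w - H (clip T s) w))\<^sup>2) \<partial>lborel)" for w
      unfolding D'_def by (intro nn_integral_cong) (auto simp: indicator_def clip_id)
    ultimately show ?thesis by (simp cong: measurable_cong)
  qed
  have D'lim: "(\<lambda>n. prob {w \<in> space M. ennreal e < D' n w}) \<longlonglongrightarrow> 0" if "0 < e" for e
    using D that unfolding tends_to_0_in_prob_def D'_def by blast
  define A' where "A' n i w = trunc K (A n i w)" for n i w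
  have tb: "norm (trunc K x) \<le> norm x" for x :: "real^'n^'n"
    using trunc_facts(2)[OF K, of 0 x] K by simp
  have S': "simple_process M F T (m n) (\<tau> n) (A' n)" for n
    unfolding A'_def by (rule simple_process_map[OF S trunc_facts(5)[OF K] tb])
  have A'K: "norm (A' n i w) \<le> K" for n i w unfolding A'_def by (rule trunc_facts(1)[OF K])
  have cmp: "norm (simple_value (m n) (\<tau> n) (A' n) s w - H s w) \<le> norm (simple_value (m n) (\<tau> n) (A n) s w - H s w)"
    if "0 \<le> s" "s \<le> T" "w \<in> space M" for n s w
  using S[of n]
proof (cases rule: simple_value_cases[where s=s])
    case (piece i)
    show ?thesis unfolding piece(4) A'_def by (rule trunc_facts(2)[OF K HK[OF that]])
  next
    case outside
    then show ?thesis by simp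
  qed
  define d where "d n w = (LBINT s. indicator {0..T} s * (norm (simple_value (m n) (\<tau> n) (A' n) s w - H s w))\<^sup>2)" for n w
  have HKo: "\<forall>s\<in>{0..T}. \<forall>w\<in>space M. norm (H s w) \<le> K" using HK by auto
  have A'Ko: "\<forall>i<m n. \<forall>w\<in>space M. norm (A' n i w) \<le> K" for n using A'K by auto
  note sq = square_dist_facts[OF S' K A'Ko T(1) Hj HKo, folded d_def]
  have d_le: "ennreal (d n w) \<le> D' n w" if w: "w \<in> space M" for n w
  proof -
    have "ennreal (d n w) = (\<integral>\<^sup>+s. ennreal (indicator {0..T} s * (norm (simple_value (m n) (\<tau> n) (A' n) s w - H s w))\<^sup>2) \<partial>lborel)"
      unfolding d_def by (rule nn_integral_eq_integral[symmetric, OF sq(1)[OF w]]) simp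
    also have "\<dots> \<le> D' n w"
      unfolding D'_def using cmp w by (intro nn_integral_mono) (auto simp: indicator_def intro!: ennreal_leI power_mono)
    finally show ?thesis .
  qed
  have dlim: "(\<lambda>n. \<integral>w. d n w \<partial>M) \<longlonglongrightarrow> 0"
  proof (rule LIMSEQ_I)
    fix r :: real assume r: "0 < r"
    define c where "c = 4 * K\<^sup>2 * T"
    have c: "0 \<le> c" using T by (simp add: c_def)
    have "0 < r / 2" using r by simp
    from LIMSEQ_D[OF D'lim[OF this], of "r / (2 * (c + 1))"] r c
    obtain N where N: "\<And>n. N \<le> n \<Longrightarrow> prob {w \<in> space M. ennreal (r / 2) < D' n w} < r / (2 * (c + 1))" by auto
    show "\<exists>no. \<forall>n\<ge>no. norm ((\<integral>w. d n w \<partial>M) - 0) < r"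
    proof (intro exI[of _ N] allI impI)
      fix n assume n: "N \<le> n"
      let ?E = "{w \<in> space M. ennreal (r / 2) < D' n w}"
      have E: "?E \<in> sets M" by measurable
      have "(\<integral>w. d n w \<partial>M) \<le> (\<integral>w. r / 2 + c * indicator ?E w \<partial>M)"
      proof (intro integral_mono sq(2))
        show "integrable M (\<lambda>w. r / 2 + c * indicator ?E w)"
          using E by (intro Bochner_Integration.integrable_add integrable_mult_right integrable_real_indicator) (auto simp: emeasure_eq_measure)
        fix w assume w: "w \<in> space M"
        show "d n w \<le> r / 2 + c * indicator ?E w"
        proof (cases "w \<in> ?E")
          case True then show ?thesis using sq(3)[OF w, of n] r by (simp add: c_def)
        next
          case False
          then have "D' n w \<le> ennreal (r / 2)" using w by auto
          then have "ennreal (d n w) \<le> ennreal (r / 2)" using d_le[OF w, of n] by (rule order_trans[rotated])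
          then show ?thesis using r False by (simp add: ennreal_le_iff)
        qed
      qed
      also have "\<dots> = r / 2 + c * prob ?E" using E prob_space by (simp add: emeasure_eq_measure)
      also have "\<dots> \<le> r / 2 + c * (r / (2 * (c + 1)))" using N[OF n] c by (intro add_left_mono mult_left_mono) auto
      also have "\<dots> < r" using r c by (simp add: field_simps)
      finally show "norm ((\<integral>w. d n w \<partial>M) - 0) < r"
        using sq(4) by (simp add: Bochner_Integration.integral_nonneg)
    qed
  qed
  have prob_lim: "(\<lambda>n. prob {w \<in> space M. \<epsilon> < norm (simple_integral B (m n) (\<tau> n) (A' n) w - I w)}) \<longlonglongrightarrow> 0" if \<epsilon>: "0 < \<epsilon>" for \<epsilon>
  proof (rule LIMSEQ_I)
    fix r :: real assume r: "0 < r"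
    define e where "e = \<epsilon> / 2"
    have e: "0 < e" using \<epsilon> by (simp add: e_def)
    define \<delta> where "\<delta> = r / 3 * e\<^sup>2"
    have \<delta>: "0 < \<delta>" using r e by (simp add: \<delta>_def)
    \<comment> \<open>the part that truncation removes\<close>
    define A2 where "A2 n i w = A n i w - trunc K (A n i w)" for n i w
    have nb: "norm (x - trunc K x) \<le> norm x" for x :: "real^'n^'n" using trunc_facts(3)[OF K, of 0 x] K by simp
    have S2: "simple_process M F T (m n) (\<tau> n) (A2 n)" for n
      unfolding A2_def by (rule simple_process_map[OF S _ nb]) (use trunc_facts(5)[OF K, where 'a="real^'n^'n"] in measurable)
    have c_le: "ennreal (\<Sum>i<m n. (norm (A2 n i w))\<^sup>2 * (\<tau> n (Suc i) - \<tau> n i)) \<le> D' n w" if w: "w \<in> space M" for n w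
    proof -
      note hb = simple_second_moment(3)[OF S2 T(2), of n w]
      have "ennreal (\<Sum>i<m n. (norm (A2 n i w))\<^sup>2 * (\<tau> n (Suc i) - \<tau> n i)) = (\<integral>\<^sup>+s. ennreal ((norm (simple_value (m n) (\<tau> n) (A2 n) s w))\<^sup>2) \<partial>lborel)"
        using has_bochner_integral_integral_eq[OF hb] nn_integral_eq_integral[OF integrable.intros[OF hb]] by simp
      also have "\<dots> \<le> D' n w"
        unfolding D'_def
      proof (rule nn_integral_mono)
        fix s :: real
        show "ennreal ((norm (simple_value (m n) (\<tau> n) (A2 n) s w))\<^sup>2) \<le> ennreal ((norm (simple_value (m n) (\<tau> n) (A n) s w - H s w))\<^sup>2) * indicator {0..T} s"
        using S[of n]
proof (cases rule: simple_value_cases[where s=s])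
          case (piece i)
          have s: "0 \<le> s" "s \<le> T"
            using simple_tau_bounds[OF S[of n], of i] simple_tau_bounds[OF S[of n], of "Suc i"] piece by auto
          have "norm (A2 n i w) \<le> norm (A n i w - H s w)"
            unfolding A2_def by (rule trunc_facts(3)[OF K HK[OF s w]])
          then show ?thesis unfolding piece(4) using s by (simp add: ennreal_leI power_mono)
        next
          case outside
          then show ?thesis by simp
        qed
      qed
      finally show ?thesis .
    qed
    have diff: "simple_integral B (m n) (\<tau> n) (A2 n) w = simple_integral B (m n) (\<tau> n) (A n) w - simple_integral B (m n) (\<tau> n) (A' n) w" for n w
      unfolding simple_integral_def A2_def A'_def by (simp add: sum_subtractf matrix_vector_mult_diff_rdistrib)
    have Lr: "(\<lambda>n. prob {w \<in> space M. e < norm (simple_integral B (m n) (\<tau> n) (A n) w - I w)}) \<longlonglongrightarrow> 0"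
      using L e unfolding tends_to_0_in_prob_def by (auto simp: ennreal_less_iff)
    obtain N1 where N1: "\<And>n. N1 \<le> n \<Longrightarrow> prob {w \<in> space M. e < norm (simple_integral B (m n) (\<tau> n) (A n) w - I w)} < r / 3"
      using LIMSEQ_D[OF Lr, of "r / 3"] r by auto
    obtain N2 where N2: "\<And>n. N2 \<le> n \<Longrightarrow> prob {w \<in> space M. ennreal \<delta> < D' n w} < r / 3"
      using LIMSEQ_D[OF D'lim[OF \<delta>], of "r / 3"] r by auto
    show "\<exists>no. \<forall>n\<ge>no. norm (prob {w \<in> space M. \<epsilon> < norm (simple_integral B (m n) (\<tau> n) (A' n) w - I w)} - 0) < r"
    proof (intro exI[of _ "max N1 N2"] allI impI)
      fix n assume n: "max N1 N2 \<le> n"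
      note [measurable] = simple_integral_measurable[OF S T(2), of n] simple_integral_measurable[OF S' T(2), of n] simple_integral_measurable[OF S2 T(2), of n]
      let ?E1 = "{w \<in> space M. e < norm (simple_integral B (m n) (\<tau> n) (A2 n) w)}"
      let ?E2 = "{w \<in> space M. e < norm (simple_integral B (m n) (\<tau> n) (A n) w - I w)}"
      have "prob {w \<in> space M. \<epsilon> < norm (simple_integral B (m n) (\<tau> n) (A' n) w - I w)} \<le> prob (?E1 \<union> ?E2)"
      proof (rule finite_measure_mono)
        show "{w \<in> space M. \<epsilon> < norm (simple_integral B (m n) (\<tau> n) (A' n) w - I w)} \<subseteq> ?E1 \<union> ?E2"
        proof (intro subsetI, elim CollectE conjE)
          fix w assume w: "w \<in> space M" and b: "\<epsilon> < norm (simple_integral B (m n) (\<tau> n) (A' n) w - I w)"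
          have "norm (simple_integral B (m n) (\<tau> n) (A' n) w - I w) \<le> norm (simple_integral B (m n) (\<tau> n) (A n) w - I w) + norm (simple_integral B (m n) (\<tau> n) (A2 n) w)"
            using norm_triangle_ineq4[of "simple_integral B (m n) (\<tau> n) (A n) w - I w" "simple_integral B (m n) (\<tau> n) (A2 n) w"]
            unfolding diff by (simp add: algebra_simps)
          with b show "w \<in> ?E1 \<union> ?E2" using w unfolding e_def by auto
        qed
      qed measurable
      also have "\<dots> \<le> prob ?E1 + prob ?E2" by (intro measure_Un_le) measurable
      also have "prob ?E1 \<le> prob {w \<in> space M. \<delta> < (\<Sum>i<m n. (norm (A2 n i w))\<^sup>2 * (\<tau> n (Suc i) - \<tau> n i))} + \<delta> / e\<^sup>2"
        by (rule simple_integral_prob[OF S2 T(2) e \<delta>])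
      also have "prob {w \<in> space M. \<delta> < (\<Sum>i<m n. (norm (A2 n i w))\<^sup>2 * (\<tau> n (Suc i) - \<tau> n i))} \<le> prob {w \<in> space M. ennreal \<delta> < D' n w}"
      proof (rule finite_measure_mono)
        show "{w \<in> space M. \<delta> < (\<Sum>i<m n. (norm (A2 n i w))\<^sup>2 * (\<tau> n (Suc i) - \<tau> n i))} \<subseteq> {w \<in> space M. ennreal \<delta> < D' n w}"
        proof (intro subsetI, elim CollectE conjE)
          fix w assume w: "w \<in> space M" and b: "\<delta> < (\<Sum>i<m n. (norm (A2 n i w))\<^sup>2 * (\<tau> n (Suc i) - \<tau> n i))"
          have "ennreal \<delta> < ennreal (\<Sum>i<m n. (norm (A2 n i w))\<^sup>2 * (\<tau> n (Suc i) - \<tau> n i))"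
            using b \<delta> by (simp add: ennreal_less_iff)
          also have "\<dots> \<le> D' n w" by (rule c_le[OF w])
          finally show "w \<in> {w \<in> space M. ennreal \<delta> < D' n w}" using w by simp
        qed
      qed measurable
      finally have "prob {w \<in> space M. \<epsilon> < norm (simple_integral B (m n) (\<tau> n) (A' n) w - I w)} \<le> prob {w \<in> space M. ennreal \<delta> < D' n w} + \<delta> / e\<^sup>2 + prob ?E2" by simp
      moreover have "\<delta> / e\<^sup>2 = r / 3" using e by (simp add: \<delta>_def)
      ultimately show "norm (prob {w \<in> space M. \<epsilon> < norm (simple_integral B (m n) (\<tau> n) (A' n) w - I w)} - 0) < r"
        using N1[of n] N2[of n] n by simp
    qed
  qed
  have msd: "mean_square_dist T (m n) (\<tau> n) (A' n) H = (\<integral>w. d n w \<partial>M)" for n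
    unfolding mean_square_dist_def d_def ..
  show ?thesis
    by (rule that[of m \<tau> A']) (use dlim prob_lim S' A'K in \<open>simp_all add: msd\<close>)
qed

section \<open>Simple integrals up to an intermediate time\<close>

text \<open>A simple integral stopped at time \<open>u\<close>: pieces that begin after \<open>u\<close> contribute nothing.\<close>

definition cut_integral :: "nat \<Rightarrow> (nat \<Rightarrow> real) \<Rightarrow> (nat \<Rightarrow> 'w \<Rightarrow> real^'n^'n) \<Rightarrow> real \<Rightarrow> 'w \<Rightarrow> real^'n" where
  "cut_integral m \<tau> A u w = (\<Sum>i<m. A i w *v (B (min (\<tau> (Suc i)) u) w - B (min (\<tau> i) u) w))"

text \<open>The integrals over \<open>[0, u]\<close> and over \<open>[0, t]\<close> are limits along unrelated sequences of
  simple processes. Both sequences are close to \<open>H\<close> in mean square, so the isometry bounds the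
  distance between an integral of the second kind, cut at \<open>u\<close>, and one of the first kind.\<close>

lemma cut_integral_compare:
  assumes S: "simple_process M F t m \<tau> A" and S': "simple_process M F u m' \<tau>' A'"
    and tu: "0 \<le> u" "u \<le> t" "t \<le> 1"
    and K: "0 \<le> K" "\<And>i w. norm (A i w) \<le> K" "\<And>i w. norm (A' i w) \<le> K"
    and H: "(\<lambda>(s, w). H (clip t s) w) \<in> borel_measurable (borel \<Otimes>\<^sub>M M)"
    and HK: "\<And>s w. 0 \<le> s \<Longrightarrow> s \<le> t \<Longrightarrow> w \<in> space M \<Longrightarrow> norm (H s w :: real^'n^'n) \<le> K"
  shows "integrable M (\<lambda>w. (norm (cut_integral m \<tau> A u w - simple_integral B m' \<tau>' A' w))\<^sup>2)"
    and "(\<integral>w. (norm (cut_integral m \<tau> A u w - simple_integral B m' \<tau>' A' w))\<^sup>2 \<partial>M)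
      \<le> 2 * mean_square_dist t m \<tau> A H + 2 * mean_square_dist u m' \<tau>' A' H"
proof -
  \<comment> \<open>the pieces of both processes, those of the second with opposite sign, as one family for
    \<open>elementary_isometry\<close>\<close>
  define I where "I = {i. i < m \<and> \<tau> i \<le> u}"
  have finI: "finite I" unfolding I_def by simp
  define a where "a = case_sum \<tau> \<tau>'"
  define b where "b = case_sum (\<lambda>i. min (\<tau> (Suc i)) u) (\<lambda>i. \<tau>' (Suc i))"
  define C where "C = case_sum A (\<lambda>i w. - A' i w)"
  have fin: "finite (I <+> {..<m'})" using finI by simp
  have p: "0 \<le> a p" "a p \<le> b p" "b p \<le> 1" if "p \<in> I <+> {..<m'}" for p
  proof -
    have "0 \<le> a p \<and> a p \<le> b p \<and> b p \<le> 1"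
      using that
    proof (elim PlusE)
      fix i assume "p = Inl i" "i \<in> I"
      then show ?thesis
        using simple_tau_bounds[OF S, of i] simple_tau_mono[OF S, of i "Suc i"] tu by (auto simp: a_def b_def I_def)
    next
      fix i assume "p = Inr i" "i \<in> {..<m'}"
      then show ?thesis
        using simple_tau_bounds[OF S', of i] simple_tau_bounds[OF S', of "Suc i"] simple_tau_mono[OF S', of i "Suc i"] tu by (auto simp: a_def b_def)
    qed
    then show "0 \<le> a p" "a p \<le> b p" "b p \<le> 1" by auto
  qed
  have Cm: "C p \<in> borel_measurable (F (a p))" if "p \<in> I <+> {..<m'}" for p
    using that simple_measurable(1)[OF S] simple_measurable(1)[OF S'] by (auto simp: C_def a_def I_def elim!: PlusE)
  have Cb: "norm (C p w) \<le> K" if "p \<in> I <+> {..<m'}" "w \<in> space M" for p w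
    using that K by (auto simp: C_def elim!: PlusE)
  have sum_eq: "(\<Sum>p\<in>I <+> {..<m'}. C p w *v (B (b p) w - B (a p) w)) = cut_integral m \<tau> A u w - simple_integral B m' \<tau>' A' w" for w
  proof -
    have "(\<Sum>p\<in>I <+> {..<m'}. C p w *v (B (b p) w - B (a p) w)) = (\<Sum>i\<in>I. A i w *v (B (min (\<tau> (Suc i)) u) w - B (\<tau> i) w)) + (\<Sum>i<m'. (- A' i w) *v (B (\<tau>' (Suc i)) w - B (\<tau>' i) w))"
      using finI by (simp add: sum.Plus C_def a_def b_def)
    also have "(\<Sum>i<m'. (- A' i w) *v (B (\<tau>' (Suc i)) w - B (\<tau>' i) w)) = - simple_integral B m' \<tau>' A' w"
      unfolding simple_integral_def sum_negf[symmetric]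
      by (intro sum.cong refl) (simp add: vec_eq_iff matrix_vector_mult_def sum_negf)
    also have "(\<Sum>i\<in>I. A i w *v (B (min (\<tau> (Suc i)) u) w - B (\<tau> i) w)) = cut_integral m \<tau> A u w"
      unfolding cut_integral_def
    proof (rule sum.mono_neutral_cong_left)
      show "\<forall>i\<in>{..<m} - I. A i w *v (B (min (\<tau> (Suc i)) u) w - B (min (\<tau> i) u) w) = 0"
      proof
        fix i assume i: "i \<in> {..<m} - I"
        then have "u < \<tau> i" by (auto simp: I_def)
        moreover have "\<tau> i \<le> \<tau> (Suc i)" using i by (intro simple_tau_mono[OF S]) auto
        ultimately show "A i w *v (B (min (\<tau> (Suc i)) u) w - B (min (\<tau> i) u) w) = 0" by (simp add: min_def)
      qed
    qed (auto simp: I_def)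
    finally show ?thesis by simp
  qed
  have val_eq: "(\<Sum>p\<in>I <+> {..<m'}. indicator {a p<..b p} s *\<^sub>R C p w) = (if s \<le> u then simple_value m \<tau> A s w else 0) - simple_value m' \<tau>' A' s w" for s w
  proof -
    have "(\<Sum>p\<in>I <+> {..<m'}. indicator {a p<..b p} s *\<^sub>R C p w) = (\<Sum>i\<in>I. indicator {\<tau> i<..min (\<tau> (Suc i)) u} s *\<^sub>R A i w) + (\<Sum>i<m'. indicator {\<tau>' i<..\<tau>' (Suc i)} s *\<^sub>R (- A' i w))"
      by (simp only: sum.Plus[OF finI finite_lessThan] o_def C_def a_def b_def sum.case)
    also have "(\<Sum>i<m'. indicator {\<tau>' i<..\<tau>' (Suc i)} s *\<^sub>R (- A' i w)) = - simple_value m' \<tau>' A' s w"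
      by (simp add: simple_value_def sum_negf)
    also have "(\<Sum>i\<in>I. indicator {\<tau> i<..min (\<tau> (Suc i)) u} s *\<^sub>R A i w) = (if s \<le> u then simple_value m \<tau> A s w else 0)"
    proof (cases "s \<le> u")
      case True
      have "(\<Sum>i\<in>I. indicator {\<tau> i<..min (\<tau> (Suc i)) u} s *\<^sub>R A i w) = simple_value m \<tau> A s w"
        unfolding simple_value_def
        by (rule sum.mono_neutral_cong_left) (use True in \<open>auto simp: I_def indicator_def\<close>)
      then show ?thesis using True by simp
    next
      case False
      then show ?thesis by (simp add: indicator_def)
    qed
    finally show ?thesis by simp
  qed
  note iso = elementary_isometry[of "I <+> {..<m'}" a b C "\<lambda>_. K", OF fin p Cm Cb, unfolded sum_eq val_eq]
  show "integrable M (\<lambda>w. (norm (cut_integral m \<tau> A u w - simple_integral B m' \<tau>' A' w))\<^sup>2)" using iso(1) .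
  let ?d = "\<lambda>w. LBINT s. indicator {0..t} s * (norm (simple_value m \<tau> A s w - H s w))\<^sup>2"
  let ?d' = "\<lambda>w. LBINT s. indicator {0..u} s * (norm (simple_value m' \<tau>' A' s w - H s w))\<^sup>2"
  have Hu: "(\<lambda>(s, w). H (clip u s) w) \<in> borel_measurable (borel \<Otimes>\<^sub>M M)"
  proof -
    have "(\<lambda>p. (clip u (fst p), snd p)) \<in> borel \<Otimes>\<^sub>M M \<rightarrow>\<^sub>M borel \<Otimes>\<^sub>M M" by measurable
    from measurable_compose[OF this H]
    have "(\<lambda>p. H (clip t (clip u (fst p))) (snd p)) \<in> borel_measurable (borel \<Otimes>\<^sub>M M)" by simp
    moreover have "clip t (clip u s) = clip u s" for s using tu by (intro clip_id) (auto simp: clip_def)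
    ultimately show ?thesis by (simp add: case_prod_beta)
  qed
  have t0: "0 \<le> t" using tu by simp
  have HKo: "\<forall>s\<in>{0..t}. \<forall>w\<in>space M. norm (H s w) \<le> K" "\<forall>s\<in>{0..u}. \<forall>w\<in>space M. norm (H s w) \<le> K"
    using HK tu by auto
  have AKo: "\<forall>i<m. \<forall>w\<in>space M. norm (A i w) \<le> K" "\<forall>i<m'. \<forall>w\<in>space M. norm (A' i w) \<le> K" using K by auto
  note sq = square_dist_facts[OF S K(1) AKo(1) t0 H HKo(1)] and sq' = square_dist_facts[OF S' K(1) AKo(2) tu(1) Hu HKo(2)]
  have Q: "(\<Sum>p\<in>I <+> {..<m'}. \<Sum>q\<in>I <+> {..<m'}. (C p w \<bullet> C q w) * overlap (a p) (b p) (a q) (b q)) \<le> 2 * ?d w + 2 * ?d' w"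
    if w: "w \<in> space M" for w
  proof -
    have hb: "has_bochner_integral lborel (\<lambda>s. (norm ((if s \<le> u then simple_value m \<tau> A s w else 0) - simple_value m' \<tau>' A' s w))\<^sup>2)
       (\<Sum>p\<in>I <+> {..<m'}. \<Sum>q\<in>I <+> {..<m'}. (C p w \<bullet> C q w) * overlap (a p) (b p) (a q) (b q))"
      by (rule iso(3))
    have "(\<Sum>p\<in>I <+> {..<m'}. \<Sum>q\<in>I <+> {..<m'}. (C p w \<bullet> C q w) * overlap (a p) (b p) (a q) (b q))
        = (LBINT s. (norm ((if s \<le> u then simple_value m \<tau> A s w else 0) - simple_value m' \<tau>' A' s w))\<^sup>2)"
      by (rule has_bochner_integral_integral_eq[OF hb, symmetric])
    also have "\<dots> \<le> (LBINT s. 2 * (indicator {0..t} s * (norm (simple_value m \<tau> A s w - H s w))\<^sup>2) + 2 * (indicator {0..u} s * (norm (simple_value m' \<tau>' A' s w - H s w))\<^sup>2))"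
    proof (rule integral_mono[OF integrable.intros[OF hb]])
      show "integrable lborel (\<lambda>s. 2 * (indicator {0..t} s * (norm (simple_value m \<tau> A s w - H s w))\<^sup>2) + 2 * (indicator {0..u} s * (norm (simple_value m' \<tau>' A' s w - H s w))\<^sup>2))"
        using sq(1)[OF w] sq'(1)[OF w] by simp
      fix s :: real
      have out: "simple_value m \<tau> A s w = 0" if "s \<le> 0"
        using S
      proof (cases rule: simple_value_cases[where s=s])
        case (piece i) then show ?thesis using simple_tau_bounds(1)[OF S, of i] that by simp
      qed simp
      have out': "simple_value m' \<tau>' A' s w = 0" if "s \<le> 0 \<or> u < s"
        using S'
      proof (cases rule: simple_value_cases[where s=s])
        case (piece i) then show ?thesis
          using simple_tau_bounds(1)[OF S', of i] simple_tau_bounds(2)[OF S', of "Suc i"] that by auto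
      qed simp
      show "(norm ((if s \<le> u then simple_value m \<tau> A s w else 0) - simple_value m' \<tau>' A' s w))\<^sup>2
         \<le> 2 * (indicator {0..t} s * (norm (simple_value m \<tau> A s w - H s w))\<^sup>2) + 2 * (indicator {0..u} s * (norm (simple_value m' \<tau>' A' s w - H s w))\<^sup>2)"
      proof (cases "0 < s \<and> s \<le> u")
        case True
        let ?x = "simple_value m \<tau> A s w - H s w" and ?y = "simple_value m' \<tau>' A' s w - H s w"
        have "(norm (?x - ?y))\<^sup>2 \<le> (norm ?x + norm ?y)\<^sup>2" by (intro power_mono norm_triangle_ineq4) simp
        also have "\<dots> \<le> 2 * (norm ?x)\<^sup>2 + 2 * (norm ?y)\<^sup>2"
          using zero_le_power2[of "norm ?x - norm ?y"] by (simp add: power2_eq_square algebra_simps)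
        finally show ?thesis using True tu by (simp add: algebra_simps)
      next
        case False
        then have "(if s \<le> u then simple_value m \<tau> A s w else 0) - simple_value m' \<tau>' A' s w = 0" using out out' by auto
        then show ?thesis by simp
      qed
    qed
    also have "\<dots> = 2 * ?d w + 2 * ?d' w" using sq(1)[OF w] sq'(1)[OF w] by simp
    finally show ?thesis .
  qed
  let ?Q = "\<lambda>w. \<Sum>p\<in>I <+> {..<m'}. \<Sum>q\<in>I <+> {..<m'}. (C p w \<bullet> C q w) * overlap (a p) (b p) (a q) (b q)"
  have iso2: "(\<integral>w. (norm (cut_integral m \<tau> A u w - simple_integral B m' \<tau>' A' w))\<^sup>2 \<partial>M) = (\<integral>w. ?Q w \<partial>M)"
    by (rule iso(2))
  have Qi: "integrable M ?Q"
    by (rule iso(4))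
  have "(\<integral>w. (norm (cut_integral m \<tau> A u w - simple_integral B m' \<tau>' A' w))\<^sup>2 \<partial>M) \<le> (\<integral>w. 2 * ?d w + 2 * ?d' w \<partial>M)"
    by (subst iso2, rule integral_mono[OF Qi _ Q]) (use sq(2) sq'(2) in simp)
  also have "\<dots> = 2 * mean_square_dist t m \<tau> A H + 2 * mean_square_dist u m' \<tau>' A' H"
    unfolding mean_square_dist_def using sq(2) sq'(2) by simp
  finally show "(\<integral>w. (norm (cut_integral m \<tau> A u w - simple_integral B m' \<tau>' A' w))\<^sup>2 \<partial>M)
      \<le> 2 * mean_square_dist t m \<tau> A H + 2 * mean_square_dist u m' \<tau>' A' H" .
qed

section \<open>Ito's formula for simple integrands\<close>

lemma cut_integral_zero:
  assumes S: "simple_process M F t m \<tau> A" shows "cut_integral m \<tau> A 0 w = 0"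
  unfolding cut_integral_def
proof (intro sum.neutral ballI)
  fix i assume "i \<in> {..<m}"
  then have "min (\<tau> i) 0 = 0" "min (\<tau> (Suc i)) 0 = 0"
    using simple_tau_bounds(1)[OF S, of i] simple_tau_bounds(1)[OF S, of "Suc i"] by auto
  then show "A i w *v (B (min (\<tau> (Suc i)) 0) w - B (min (\<tau> i) 0) w) = 0" by simp
qed

lemma cut_integral_piece:
  assumes S: "simple_process M F t m \<tau> A" and i: "i < m" and uv: "\<tau> i \<le> u" "u \<le> v" "v \<le> \<tau> (Suc i)"
  shows "cut_integral m \<tau> A v w = cut_integral m \<tau> A u w + A i w *v (B v w - B u w)"
proof -
  have "A j w *v (B (min (\<tau> (Suc j)) v) w - B (min (\<tau> j) v) w)
      = A j w *v (B (min (\<tau> (Suc j)) u) w - B (min (\<tau> j) u) w) + (if j = i then A i w *v (B v w - B u w) else 0)"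
    if j: "j \<in> {..<m}" for j
  proof (cases j i rule: linorder_cases)
    case less
    then have "\<tau> (Suc j) \<le> u" "\<tau> j \<le> \<tau> (Suc j)"
      using simple_tau_mono[OF S, of "Suc j" i] simple_tau_mono[OF S, of j "Suc j"] i uv by auto
    then show ?thesis using less uv by (simp add: min_absorb1)
  next
    case greater
    then have "v \<le> \<tau> j" "\<tau> j \<le> \<tau> (Suc j)"
      using simple_tau_mono[OF S, of "Suc i" j] simple_tau_mono[OF S, of j "Suc j"] j uv by auto
    then show ?thesis using greater uv by (simp add: min_absorb2)
  next
    case equal
    then show ?thesis using uv by (simp add: min_absorb1 min_absorb2 matrix_vector_mult_diff_distrib)
  qed
  then have "cut_integral m \<tau> A v w = (\<Sum>j<m. A j w *v (B (min (\<tau> (Suc j)) u) w - B (min (\<tau> j) u) w) + (if j = i then A i w *v (B v w - B u w) else 0))"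
    unfolding cut_integral_def by (rule sum.cong[OF refl])
  then show ?thesis using i by (simp add: sum.distrib cut_integral_def)
qed

lemma cut_integral_adapted:
  assumes S: "simple_process M F t m \<tau> A" and s: "0 \<le> s" "s \<le> 1"
  shows "cut_integral m \<tau> A s \<in> borel_measurable (F s)"
  unfolding cut_integral_def[abs_def]
proof (rule borel_measurable_sum)
  fix i assume i: "i \<in> {..<m}"
  have m: "0 \<le> \<tau> i" "\<tau> i \<le> \<tau> (Suc i)" using simple_tau_bounds(1)[OF S, of i] simple_tau_mono[OF S, of i "Suc i"] i by auto
  show "(\<lambda>w. A i w *v (B (min (\<tau> (Suc i)) s) w - B (min (\<tau> i) s) w)) \<in> borel_measurable (F s)"
  proof (cases "\<tau> i \<le> s")
    case True
    have [measurable]: "A i \<in> borel_measurable (F s)" using simple_measurable(1)[OF S, of i] i True by (auto intro: F_mono)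
    have [measurable]: "B (min (\<tau> (Suc i)) s) \<in> borel_measurable (F s)" "B (min (\<tau> i) s) \<in> borel_measurable (F s)"
      using m s by (auto intro!: F_mono[OF B_F])
    show ?thesis by measurable
  next
    case False
    then have "min (\<tau> (Suc i)) s = min (\<tau> i) s" using m by simp
    then show ?thesis by simp
  qed
qed

lemma cut_integral_continuous:
  assumes S: "simple_process M F t m \<tau> A" and t: "t \<le> 1" and w: "w \<in> space M"
  shows "continuous_on {0..t} (\<lambda>s. cut_integral m \<tau> A s w)"
proof -
  have c: "continuous_on {0..1} (\<lambda>s. B s w)" using bm w unfolding brownian_motion_def continuous_paths_def by blast
  have cB: "continuous_on {0..t} (\<lambda>s. B (min r s) w)" if "0 \<le> r" for r
    using that t by (intro continuous_on_compose2[OF c] continuous_intros) auto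
  have mv: "continuous_on {0..t} (\<lambda>s. C *v f s)" if "continuous_on {0..t} f" for C :: "real^'n^'n" and f :: "real \<Rightarrow> real^'n"
    by (rule linear_continuous_on_compose[OF that matrix_vector_mul_linear])
  show ?thesis unfolding cut_integral_def
    using simple_tau_bounds(1)[OF S] by (intro continuous_on_sum mv continuous_on_diff cB) auto
qed

text \<open>On each piece the noise coefficient is frozen, so that \<open>ito_step\<close> applies, and the sum
  over the pieces telescopes.\<close>

lemma ito_formula_simple:
  fixes Z :: "'w \<Rightarrow> real^'n" and \<beta> :: "real \<Rightarrow> 'w \<Rightarrow> real^'n" and \<phi> :: "real^'n \<Rightarrow> real"
  assumes S: "simple_process M F t m \<tau> A" and t: "0 \<le> t" "t \<le> 1"
    and K: "0 \<le> K" "\<And>i w. norm (A i w) \<le> K" and Z: "Z \<in> borel_measurable (F 0)"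
    and \<beta>: "(\<lambda>(s, w). \<beta> s w) \<in> borel_measurable (borel \<Otimes>\<^sub>M M)" "\<And>s w. norm (\<beta> s w) \<le> K'"
    and \<beta>F: "\<And>s. 0 \<le> s \<Longrightarrow> s \<le> t \<Longrightarrow> (\<lambda>w. LBINT r. indicator {0..s} r *\<^sub>R \<beta> r w) \<in> borel_measurable (F s)"
    and \<phi>: "test_function \<phi>"
  defines "Y \<equiv> \<lambda>s w. Z w + (LBINT r. indicator {0..clip t s} r *\<^sub>R \<beta> r w) + cut_integral m \<tau> A (clip t s) w"
  shows "(\<lambda>(s, w). Y s w) \<in> borel_measurable (borel \<Otimes>\<^sub>M M)"
    and "(\<integral>w. \<phi> (Y t w) \<partial>M) - (\<integral>w. \<phi> (Z w) \<partial>M)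
      = (LBINT s. indicator {0..t} s * (\<integral>w. generator \<phi> (Y s w) (\<beta> s w) (simple_value m \<tau> A s w) \<partial>M))"
proof -
  define Y' where "Y' s w = Z w + (LBINT r. indicator {0..s} r *\<^sub>R \<beta> r w) + cut_integral m \<tau> A s w" for s w
  have YY': "Y s = Y' (clip t s)" for s unfolding Y_def Y'_def ..
  have K': "0 \<le> K'" using \<beta>(2) norm_ge_zero order_trans by blast
  have \<beta>s: "(\<lambda>s. \<beta> s w) \<in> borel_measurable borel" if "w \<in> space M" for w
    using measurable_compose[OF measurable_Pair2'[OF that, of borel] \<beta>(1)] by simp
  have Y'F: "Y' s \<in> borel_measurable (F s)" if s: "0 \<le> s" "s \<le> t" for s
  proof -
    have [measurable]: "Z \<in> borel_measurable (F s)" using F_mono[OF Z] s by simp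
    have s1: "s \<le> 1" using s t by simp
    note [measurable] = \<beta>F[OF s] cut_integral_adapted[OF S s(1) s1]
    show ?thesis unfolding Y'_def[abs_def] by measurable
  qed
  have drift: "(LBINT r. indicator {0..v} r *\<^sub>R \<beta> r w) = (LBINT r. indicator {0..u} r *\<^sub>R \<beta> r w) + (LBINT r. indicator {u..v} r *\<^sub>R \<beta> r w)"
    if "w \<in> space M" "0 \<le> u" "u \<le> v" for u v w
    by (rule vector_interval_split[OF \<beta>s[OF that(1)] \<beta>(2) that(2,3)])
  have Y'c: "continuous_on {0..t} (\<lambda>s. Y' s w)" if w: "w \<in> space M" for w
  proof -
    have "K'-lipschitz_on {0..t} (\<lambda>s. LBINT r. indicator {0..s} r *\<^sub>R \<beta> r w)"
    proof (rule lipschitz_on_leI[OF _ K'])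
      fix x y assume xy: "x \<in> {0..t}" "y \<in> {0..t}" "x \<le> y"
      show "dist (LBINT r. indicator {0..x} r *\<^sub>R \<beta> r w) (LBINT r. indicator {0..y} r *\<^sub>R \<beta> r w) \<le> K' * dist x y"
        using vector_interval_integral(2)[OF \<beta>s[OF w] \<beta>(2) xy(3)] drift[OF w _ xy(3)] xy by (simp add: dist_norm)
    qed
    then have "continuous_on {0..t} (\<lambda>s. LBINT r. indicator {0..s} r *\<^sub>R \<beta> r w)" by (rule lipschitz_on_continuous_on)
    then show ?thesis unfolding Y'_def by (intro continuous_on_add continuous_on_const cut_integral_continuous[OF S t(2) w])
  qed
  show Yj: "(\<lambda>(s, w). Y s w) \<in> borel_measurable (borel \<Otimes>\<^sub>M M)"
    unfolding YY' using F_M[OF Y'F] Y'c by (rule continuous_process_measurable[OF t(1)])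
  obtain C where Cg: "\<And>x. norm (grad \<phi> x) \<le> C" and CH: "\<And>x. norm (Hess \<phi> x) \<le> C"
    using test_function_uniform[OF \<phi>] by blast
  define g where "g s = (\<integral>w. generator \<phi> (Y s w) (\<beta> s w) (simple_value m \<tau> A s w) \<partial>M)" for s
  define L where "L = C * (K' + real CARD('n) * real CARD('n) * K\<^sup>2)"
  have gen: "\<bar>generator \<phi> (Y s w) (\<beta> s w) (simple_value m \<tau> A s w)\<bar> \<le> L" for s w
    unfolding L_def using simple_value_bound[OF S K(1), of w s] K(2) by (intro generator_bound Cg CH \<beta>(2)) auto
  have gj: "(\<lambda>(s, w). generator \<phi> (Y s w) (\<beta> s w) (simple_value m \<tau> A s w)) \<in> borel_measurable (borel \<Otimes>\<^sub>M M)"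
    using generator_measurable[OF \<phi> Yj \<beta>(1) simple_value_joint[OF S]] by (simp add: case_prod_beta)
  have gm: "g \<in> borel_measurable borel"
    unfolding g_def using gj by (rule borel_measurable_lebesgue_integral)
  have gb: "\<bar>g s\<bar> \<le> L" for s
  proof -
    have "(\<lambda>w. generator \<phi> (Y s w) (\<beta> s w) (simple_value m \<tau> A s w)) \<in> borel_measurable M"
      using measurable_compose[OF measurable_Pair1' gj, of s] by simp
    then have "integrable M (\<lambda>w. generator \<phi> (Y s w) (\<beta> s w) (simple_value m \<tau> A s w))"
      by (rule bounded_integrable[OF _ gen])
    then have "\<bar>g s\<bar> \<le> (\<integral>w. L \<partial>M)"
      unfolding g_def using gen by (intro order_trans[OF integral_abs_bound] integral_mono integrable_abs) auto
    then show ?thesis by (simp add: prob_space)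
  qed
  have Y0: "Y 0 w = Z w" if "w \<in> space M" for w
  proof -
    have "(LBINT r. indicator {0..0} r *\<^sub>R \<beta> r w) = 0"
      using vector_interval_integral(2)[OF \<beta>s[OF that] \<beta>(2), of 0 0] by simp
    then show ?thesis using t unfolding YY' Y'_def by (simp add: clip_id cut_integral_zero[OF S])
  qed
  have "(\<integral>w. \<phi> (Y (\<tau> k) w) \<partial>M) - (\<integral>w. \<phi> (Y 0 w) \<partial>M) = (LBINT s. indicator {0..\<tau> k} s * g s)" if "k \<le> m" for k
    using that
  proof (induction k)
    case 0
    have "(LBINT s. indicator {0..0} s * g s) = 0"
      using interval_indicator_integral(2)[OF gm gb order_refl, of 0] by simp
    then show ?case using S by (simp add: simple_process_def)
  next
    case (Suc k)
    then have k: "k < m" by simp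
    note tb = simple_tau_bounds[OF S, of k] simple_tau_bounds[OF S, of "Suc k"] simple_tau_mono[OF S, of k "Suc k"]
    have ab: "0 \<le> \<tau> k" "\<tau> k \<le> \<tau> (Suc k)" "\<tau> (Suc k) \<le> 1" "\<tau> (Suc k) \<le> t" using tb k t by auto
    have "(\<integral>w. \<phi> (Y (\<tau> (Suc k)) w) \<partial>M) - (\<integral>w. \<phi> (Y (\<tau> k) w) \<partial>M)
        = (LBINT s. indicator {\<tau> k..\<tau> (Suc k)} s * (\<integral>w. generator \<phi> (Y s w) (\<beta> s w) (A k w) \<partial>M))"
    proof (rule ito_step[OF ab(1-3) simple_measurable(1)[OF S k] K(2) \<beta> Yj _ _ \<phi>])
      show "Y s \<in> borel_measurable (F s)" if "\<tau> k \<le> s" "s \<le> \<tau> (Suc k)" for s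
        using Y'F[of s] that ab unfolding YY' by (simp add: clip_id)
      fix u v w assume w: "w \<in> space M" and uv: "\<tau> k \<le> u" "u \<le> v" "v \<le> \<tau> (Suc k)"
      have u0: "0 \<le> u" using uv ab by simp
      have c: "clip t u = u" "clip t v = v" using uv ab by (auto intro!: clip_id)
      show "Y v w = Y u w + ((LBINT s. indicator {u..v} s *\<^sub>R \<beta> s w) + A k w *v (B v w - B u w))"
        unfolding YY' c Y'_def drift[OF w u0 uv(2)] cut_integral_piece[OF S k uv] by (simp only: ac_simps)
    qed
    also have "\<dots> = (LBINT s. indicator {\<tau> k..\<tau> (Suc k)} s * g s)"
    proof (rule integral_cong_AE)
      have "(\<lambda>s. \<integral>w. generator \<phi> (Y s w) (\<beta> s w) (A k w) \<partial>M) \<in> borel_measurable borel"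
      proof (rule borel_measurable_lebesgue_integral)
        have "(\<lambda>p. A k (snd p)) \<in> borel_measurable (borel \<Otimes>\<^sub>M M)" using simple_measurable(2)[OF S k] by measurable
        from generator_measurable[OF \<phi> Yj \<beta>(1) this]
        show "(\<lambda>(s, w). generator \<phi> (Y s w) (\<beta> s w) (A k w)) \<in> borel_measurable (borel \<Otimes>\<^sub>M M)" by (simp add: case_prod_beta)
      qed
      then show "(\<lambda>s. indicator {\<tau> k..\<tau> (Suc k)} s * (\<integral>w. generator \<phi> (Y s w) (\<beta> s w) (A k w) \<partial>M)) \<in> borel_measurable lborel"
        by measurable
      show "(\<lambda>s. indicator {\<tau> k..\<tau> (Suc k)} s * g s) \<in> borel_measurable lborel" using gm by measurable
      have "indicator {\<tau> k..\<tau> (Suc k)} s * (\<integral>w. generator \<phi> (Y s w) (\<beta> s w) (A k w) \<partial>M) = indicator {\<tau> k..\<tau> (Suc k)} s * g s" if "s \<noteq> \<tau> k" for s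
      proof (cases "s \<in> {\<tau> k..\<tau> (Suc k)}")
        case True
        then have "simple_value m \<tau> A s w = A k w" for w using that by (intro simple_value_piece[OF S k]) auto
        then show ?thesis by (simp add: g_def)
      qed simp
      then show "AE s in lborel. indicator {\<tau> k..\<tau> (Suc k)} s * (\<integral>w. generator \<phi> (Y s w) (\<beta> s w) (A k w) \<partial>M) = indicator {\<tau> k..\<tau> (Suc k)} s * g s"
        by (rule AE_mp[OF AE_lborel_singleton[of "\<tau> k"], OF AE_I2, OF impI])
    qed
    finally show ?case
      using Suc interval_integral_split[OF gm gb ab(1,2)] by simp
  qed
  from this[of m] have "(\<integral>w. \<phi> (Y t w) \<partial>M) - (\<integral>w. \<phi> (Y 0 w) \<partial>M) = (LBINT s. indicator {0..t} s * g s)"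
    using S by (simp add: simple_process_def)
  moreover have "(\<integral>w. \<phi> (Y 0 w) \<partial>M) = (\<integral>w. \<phi> (Z w) \<partial>M)"
    by (rule Bochner_Integration.integral_cong[OF refl]) (simp add: Y0)
  ultimately show "(\<integral>w. \<phi> (Y t w) \<partial>M) - (\<integral>w. \<phi> (Z w) \<partial>M)
      = (LBINT s. indicator {0..t} s * (\<integral>w. generator \<phi> (Y s w) (\<beta> s w) (simple_value m \<tau> A s w) \<partial>M))"
    unfolding g_def by simp
qed

section \<open>Ito's formula for bounded coefficients\<close>

lemma generator_matrix_diff:
  fixes A A' :: "real^'n^'n"
  assumes H: "norm (Hess \<phi> y) \<le> C" and A: "norm A \<le> K" "norm A' \<le> K"
  shows "\<bar>generator \<phi> y b A - generator \<phi> y b A'\<bar> \<le> real CARD('n) * real CARD('n) * (C * K) * norm (A - A')"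
proof -
  have K: "0 \<le> K" using A(1) norm_ge_zero order_trans by blast
  let ?E = "\<lambda>i j. ((A $ i \<bullet> A $ j) - (A' $ i \<bullet> A' $ j)) * Hess \<phi> y $ i $ j"
  have e: "\<bar>?E i j\<bar> \<le> (2 * K * norm (A - A')) * C" for i j
  proof -
    have r: "norm (A $ k) \<le> K" "norm (A' $ k) \<le> K" "norm (A $ k - A' $ k) \<le> norm (A - A')" for k
      using Finite_Cartesian_Product.norm_nth_le[of A k] Finite_Cartesian_Product.norm_nth_le[of A' k] Finite_Cartesian_Product.norm_nth_le[of "A - A'" k] A by auto
    have "(A $ i \<bullet> A $ j) - (A' $ i \<bullet> A' $ j) = (A $ i - A' $ i) \<bullet> A $ j + A' $ i \<bullet> (A $ j - A' $ j)"
      by (simp add: inner_diff_left inner_diff_right)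
    also have "\<bar>\<dots>\<bar> \<le> norm (A - A') * K + K * norm (A - A')"
      by (rule order_trans[OF abs_triangle_ineq]) (intro add_mono order_trans[OF Cauchy_Schwarz_ineq2] mult_mono r; simp add: K)
    finally have d: "\<bar>(A $ i \<bullet> A $ j) - (A' $ i \<bullet> A' $ j)\<bar> \<le> 2 * K * norm (A - A')" by (simp add: algebra_simps)
    show ?thesis unfolding abs_mult
      using d order_trans[OF bounded_matrix_entry H] K by (intro mult_mono) auto
  qed
  have "generator \<phi> y b A - generator \<phi> y b A' = (\<Sum>i\<in>UNIV. \<Sum>j\<in>UNIV. ?E i j) / 2"
    unfolding generator_def matrix_inner matrix_mult_transpose_nth
    by (simp add: inner_vec_def left_diff_distrib sum_subtractf diff_divide_distrib)
  also have "\<bar>\<dots>\<bar> \<le> (\<Sum>i\<in>(UNIV::'n set). \<Sum>j\<in>(UNIV::'n set). (2 * K * norm (A - A')) * C) / 2"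
    by (simp del: sum_constant) (intro order_trans[OF sum_abs] sum_mono e)
  also have "\<dots> = real CARD('n) * real CARD('n) * (C * K) * norm (A - A')" by simp
  finally show ?thesis .
qed

text \<open>The approximations \<open>Y n\<close> keep the drift of the solution and replace the noise coefficient
  by simple processes. For each time \<open>s\<close> they converge to the solution in probability:
  \<open>cut_integral_compare\<close> links the approximations chosen for the time \<open>t\<close> with the integral up
  to \<open>s\<close>. Every difference that occurs is at most a constant times \<open>min 1 (norm (Y n s - X s))\<close>,
  plus the distance of the noise coefficients.\<close>

lemma ito_formula:
  fixes X :: "real \<Rightarrow> 'w \<Rightarrow> real^'n" and b :: "real^'n \<Rightarrow> real^'n" and \<sigma> :: "real^'n \<Rightarrow> real^'n^'n"
  assumes X: "sde_solution M F B b \<sigma> X" and b: "continuous_on UNIV b" "\<And>x. norm (b x) \<le> K'"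
    and \<sigma>: "0 \<le> K" "\<And>x. norm (\<sigma> x) \<le> K" and \<phi>: "test_function \<phi>" and t: "0 \<le> t" "t \<le> 1"
  shows "(\<integral>w. \<phi> (X t w) \<partial>M) - (\<integral>w. \<phi> (X 0 w) \<partial>M)
    = (LBINT s. indicator {0..t} s * (\<integral>w. generator \<phi> (X s w) (b (X s w)) (\<sigma> (X s w)) \<partial>M))"
proof -
  define H where "H s w = \<sigma> (X s w)" for s w
  define Xc where "Xc s = X (clip t s)" for s
  define \<beta> where "\<beta> s w = b (Xc s w)" for s w
  define Hc where "Hc s = H (clip t s)" for s
  have XF: "X s \<in> borel_measurable (F s)" if "0 \<le> s" "s \<le> 1" for s
    using X that unfolding sde_solution_def adapted_def by auto
  have Xc: "continuous_on {0..s} (\<lambda>r. X r w)" if "w \<in> space M" "s \<le> 1" for w s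
  proof (rule continuous_on_subset)
    show "continuous_on {0..1} (\<lambda>r. X r w)" using X that(1) unfolding sde_solution_def continuous_paths_def by blast
  qed (use that in auto)
  have XM: "X s \<in> borel_measurable M" if "0 \<le> s" "s \<le> 1" for s by (rule F_M[OF XF[OF that]])
  have Xj: "(\<lambda>(s, w). Xc s w) \<in> borel_measurable (borel \<Otimes>\<^sub>M M)"
    unfolding Xc_def using t XM Xc by (intro continuous_process_measurable) auto
  have bm: "b \<in> borel_measurable borel" using b(1) by (rule borel_measurable_continuous_onI)
  have \<beta>j: "(\<lambda>(s, w). \<beta> s w) \<in> borel_measurable (borel \<Otimes>\<^sub>M M)"
    using measurable_compose[OF Xj bm] by (simp add: \<beta>_def case_prod_beta)
  have \<beta>b: "norm (\<beta> s w) \<le> K'" for s w unfolding \<beta>_def by (rule b(2))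
  have HK: "norm (H s w) \<le> K" for s w unfolding H_def by (rule \<sigma>(2))
  have int: "\<exists>I. ito_integral M F B s H I \<and> (AE w in M. X s w = X 0 w + (LBINT r:{0..s}. b (X r w)) + I w)"
    if "0 \<le> s" "s \<le> 1" for s
    using X that unfolding sde_solution_def H_def[abs_def] by auto
  obtain I where I: "ito_integral M F B t H I" using int[OF t] by blast
  have Hj: "(\<lambda>(s, w). H (clip t s) w) \<in> borel_measurable (borel \<Otimes>\<^sub>M M)"
    using I t unfolding ito_integral_def by (intro progressive_joint) auto
  obtain m \<tau> A where "\<forall>n::nat. simple_process M F t (m n) (\<tau> n) (A n)" "\<forall>n i w. norm (A n i w) \<le> K"
    and msd: "(\<lambda>n. mean_square_dist t (m n) (\<tau> n) (A n) H) \<longlonglongrightarrow> 0"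
    and "\<forall>\<epsilon>>0. (\<lambda>n. prob {w \<in> space M. \<epsilon> < norm (simple_integral B (m n) (\<tau> n) (A n) w - I w)}) \<longlonglongrightarrow> 0"
    by (rule bounded_approximation[OF I t \<sigma>(1)]) (rule HK)
  then have S: "\<And>n. simple_process M F t (m n) (\<tau> n) (A n)" and AK: "\<And>n i w. norm (A n i w) \<le> K" by auto
  have \<beta>F: "(\<lambda>w. LBINT r. indicator {0..s} r *\<^sub>R \<beta> r w) \<in> borel_measurable (F s)" if s: "0 \<le> s" "s \<le> t" for s
  proof -
    have "(\<lambda>(r, w). X (clip s r) w) \<in> borel_measurable (borel \<Otimes>\<^sub>M F s)"
      using s t Xc by (intro continuous_process_measurable F_mono[OF XF]) (auto simp: space_F)
    from measurable_compose[OF measurable_pair_swap'[of "F s" borel] measurable_compose[OF this bm]]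
    have "(\<lambda>p. b (X (clip s (snd p)) (fst p))) \<in> borel_measurable (F s \<Otimes>\<^sub>M borel)"
      by (simp add: case_prod_beta)
    then have "(\<lambda>p. indicator {0..s} (snd p) *\<^sub>R b (X (clip s (snd p)) (fst p))) \<in> borel_measurable (F s \<Otimes>\<^sub>M borel)"
      by measurable
    then have "(\<lambda>(w, r). indicator {0..s} r *\<^sub>R b (X (clip s r) w)) \<in> borel_measurable (F s \<Otimes>\<^sub>M lborel)"
      by (simp add: case_prod_beta cong: measurable_cong_sets sets_pair_measure_cong)
    from lborel.borel_measurable_lebesgue_integral[OF this]
    have "(\<lambda>w. LBINT r. indicator {0..s} r *\<^sub>R b (X (clip s r) w)) \<in> borel_measurable (F s)" .
    also have "(\<lambda>w. LBINT r. indicator {0..s} r *\<^sub>R b (X (clip s r) w)) = (\<lambda>w. LBINT r. indicator {0..s} r *\<^sub>R \<beta> r w)"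
      by (intro ext Bochner_Integration.integral_cong refl) (use s in \<open>auto simp: indicator_def clip_id \<beta>_def Xc_def\<close>)
    finally show ?thesis .
  qed
  have X0: "X 0 \<in> borel_measurable (F 0)" by (rule XF) auto
  define Y where "Y n s w = X 0 w + (LBINT r. indicator {0..clip t s} r *\<^sub>R \<beta> r w) + cut_integral (m n) (\<tau> n) (A n) (clip t s) w" for n s w
  define sv where "sv n s w = simple_value (m n) (\<tau> n) (A n) s w" for n s w
  have Yj: "(\<lambda>(s, w). Y n s w) \<in> borel_measurable (borel \<Otimes>\<^sub>M M)" for n
    unfolding Y_def by (rule ito_formula_simple(1)[OF S t \<sigma>(1) AK X0 \<beta>j \<beta>b \<beta>F \<phi>])
  have form: "(\<integral>w. \<phi> (Y n t w) \<partial>M) - (\<integral>w. \<phi> (X 0 w) \<partial>M)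
      = (LBINT s. indicator {0..t} s * (\<integral>w. generator \<phi> (Y n s w) (\<beta> s w) (sv n s w) \<partial>M))" for n
    unfolding Y_def sv_def by (rule ito_formula_simple(2)[OF S t \<sigma>(1) AK X0 \<beta>j \<beta>b \<beta>F \<phi>])
  have svj: "(\<lambda>(s, w). sv n s w) \<in> borel_measurable (borel \<Otimes>\<^sub>M M)" for n
    unfolding sv_def by (rule simple_value_joint[OF S])
  have svK: "norm (sv n s w) \<le> K" for n s w
    unfolding sv_def by (rule simple_value_bound[OF S \<sigma>(1) AK])
  have sect: "(\<lambda>w. f s w) \<in> borel_measurable M" if "(\<lambda>(s, w). f s w) \<in> borel_measurable (borel \<Otimes>\<^sub>M M)"
    for f :: "real \<Rightarrow> 'w \<Rightarrow> 'b::topological_space" and s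
    using measurable_compose[OF measurable_Pair1' that, of s] by simp
  have prob_conv: "(\<lambda>n. prob {w \<in> space M. \<epsilon> < norm (Y n s w - Xc s w)}) \<longlonglongrightarrow> 0"
    if s: "0 \<le> s" "s \<le> t" and \<epsilon>: "0 < \<epsilon>" for s \<epsilon>
  proof (rule LIMSEQ_I)
    fix r :: real assume r: "0 < r"
    have s1: "s \<le> 1" using s t by simp
    obtain J where J: "ito_integral M F B s H J" and Xs: "AE w in M. X s w = X 0 w + (LBINT r:{0..s}. b (X r w)) + J w"
      using int[OF s(1) s1] by blast
    have [measurable]: "J \<in> borel_measurable M" using J unfolding ito_integral_def by blast
    obtain m' \<tau>' A' where "\<forall>n::nat. simple_process M F s (m' n) (\<tau>' n) (A' n)" "\<forall>n i w. norm (A' n i w) \<le> K"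
      and msd': "(\<lambda>n. mean_square_dist s (m' n) (\<tau>' n) (A' n) H) \<longlonglongrightarrow> 0"
      and J': "\<forall>\<epsilon>>0. (\<lambda>n. prob {w \<in> space M. \<epsilon> < norm (simple_integral B (m' n) (\<tau>' n) (A' n) w - J w)}) \<longlonglongrightarrow> 0"
      by (rule bounded_approximation[OF J s(1) s1 \<sigma>(1)]) (rule HK)
    then have S': "\<And>n. simple_process M F s (m' n) (\<tau>' n) (A' n)" and AK': "\<And>n i w. norm (A' n i w) \<le> K" by auto
    define \<epsilon>' where "\<epsilon>' = \<epsilon> / 2"
    have \<epsilon>': "0 < \<epsilon>'" using \<epsilon> by (simp add: \<epsilon>'_def)
    \<comment> \<open>two mean square distances below \<open>\<delta>\<close> give a probability of at most \<open>4 * \<delta> / \<epsilon>'\<^sup>2 = 2 * r / 3\<close>\<close>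
    define \<delta> where "\<delta> = r * \<epsilon>'\<^sup>2 / 6"
    have \<delta>: "0 < \<delta>" using r \<epsilon>' by (simp add: \<delta>_def)
    have r3: "0 < r / 3" using r by simp
    obtain k1 where k1: "\<And>k. k1 \<le> k \<Longrightarrow> mean_square_dist s (m' k) (\<tau>' k) (A' k) H < \<delta>"
      using LIMSEQ_D[OF msd' \<delta>] mean_square_dist_nonneg by auto
    obtain k2 where k2: "\<And>k. k2 \<le> k \<Longrightarrow> prob {w \<in> space M. \<epsilon>' < norm (simple_integral B (m' k) (\<tau>' k) (A' k) w - J w)} < r / 3"
      using LIMSEQ_D[OF J'[rule_format, OF \<epsilon>'] r3] by auto
    define k where "k = max k1 k2"
    obtain N where N: "\<And>n. N \<le> n \<Longrightarrow> mean_square_dist t (m n) (\<tau> n) (A n) H < \<delta>"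
      using LIMSEQ_D[OF msd \<delta>] mean_square_dist_nonneg by auto
    let ?J = "simple_integral B (m' k) (\<tau>' k) (A' k)"
    have [measurable]: "?J \<in> borel_measurable M" by (rule simple_integral_measurable[OF S' s1])
    show "\<exists>no. \<forall>n\<ge>no. norm (prob {w \<in> space M. \<epsilon> < norm (Y n s w - Xc s w)} - 0) < r"
    proof (intro exI[of _ N] allI impI)
      fix n assume n: "N \<le> n"
      let ?c = "cut_integral (m n) (\<tau> n) (A n) s"
      have [measurable]: "?c \<in> borel_measurable M" by (rule F_M[OF cut_integral_adapted[OF S s(1) s1]])
      let ?E1 = "{w \<in> space M. \<epsilon>'\<^sup>2 < (norm (?c w - ?J w))\<^sup>2}" and ?E2 = "{w \<in> space M. \<epsilon>' < norm (?J w - J w)}"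
      have "prob {w \<in> space M. \<epsilon> < norm (Y n s w - Xc s w)} \<le> prob (?E1 \<union> ?E2)"
      proof (rule finite_measure_mono_AE)
        show "AE w in M. w \<in> {w \<in> space M. \<epsilon> < norm (Y n s w - Xc s w)} \<longrightarrow> w \<in> ?E1 \<union> ?E2"
        proof (rule AE_mp[OF Xs], rule AE_I2, intro impI, elim CollectE conjE)
          fix w assume w: "w \<in> space M" and x: "X s w = X 0 w + (LBINT r:{0..s}. b (X r w)) + J w"
            and e: "\<epsilon> < norm (Y n s w - Xc s w)"
          have "(LBINT r:{0..s}. b (X r w)) = (LBINT r. indicator {0..s} r *\<^sub>R \<beta> r w)"
            unfolding set_lebesgue_integral_def
            by (intro Bochner_Integration.integral_cong refl) (use s in \<open>auto simp: indicator_def clip_id \<beta>_def Xc_def\<close>)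
          then have "Y n s w - Xc s w = (?c w - ?J w) + (?J w - J w)"
            using s x by (simp add: Y_def Xc_def clip_id)
          then have "\<epsilon> < norm (?c w - ?J w) + norm (?J w - J w)" using e norm_triangle_ineq[of "?c w - ?J w" "?J w - J w"] by simp
          then have "\<epsilon>' < norm (?c w - ?J w) \<or> \<epsilon>' < norm (?J w - J w)" unfolding \<epsilon>'_def by linarith
          then show "w \<in> ?E1 \<union> ?E2" using w \<epsilon>' by (auto intro: power_strict_mono)
        qed
      qed measurable
      also have "\<dots> \<le> prob ?E1 + prob ?E2" by (intro measure_Un_le) measurable
      also have "prob ?E1 < 2 * r / 3"
      proof -
        note cmp = cut_integral_compare[OF S S' s t(2) \<sigma>(1) AK AK' Hj HK, of n k]
        have "prob ?E1 \<le> (\<integral>w. (norm (?c w - ?J w))\<^sup>2 \<partial>M) / \<epsilon>'\<^sup>2"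
          by (rule markov[OF cmp(1)]) (use \<epsilon>' in auto)
        also have "\<dots> \<le> (2 * mean_square_dist t (m n) (\<tau> n) (A n) H + 2 * mean_square_dist s (m' k) (\<tau>' k) (A' k) H) / \<epsilon>'\<^sup>2"
          by (rule divide_right_mono[OF cmp(2)]) simp
        also have "\<dots> < (2 * \<delta> + 2 * \<delta>) / \<epsilon>'\<^sup>2"
          using N[OF n] k1[of k] \<epsilon>' by (intro divide_strict_right_mono add_strict_mono) (auto simp: k_def)
        also have "\<dots> = 2 * r / 3" using \<epsilon>' by (simp add: \<delta>_def)
        finally show ?thesis .
      qed
      finally show "norm (prob {w \<in> space M. \<epsilon> < norm (Y n s w - Xc s w)} - 0) < r"
        using k2[of k] by (simp add: k_def)
    qed
  qed
  \<comment> \<open>truncating the distance at \<open>1\<close> makes its expectation finite and dominates bounded Lipschitz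
    differences\<close>
  define dist' where "dist' n s w = min 1 (norm (Y n s w - Xc s w))" for n s w
  have dj: "(\<lambda>(s, w). dist' n s w) \<in> borel_measurable (borel \<Otimes>\<^sub>M M)" for n
  proof -
    have "(\<lambda>p. min 1 (norm ((case p of (s, w) \<Rightarrow> Y n s w) - (case p of (s, w) \<Rightarrow> Xc s w)))) \<in> borel_measurable (borel \<Otimes>\<^sub>M M)"
      using Yj[of n] Xj by measurable
    then show ?thesis unfolding dist'_def by (simp add: case_prod_beta)
  qed
  have db: "\<bar>dist' n s w\<bar> \<le> 1" "0 \<le> dist' n s w" for n s w by (auto simp: dist'_def)
  have di: "integrable M (dist' n s)" for n s by (rule bounded_integrable[OF sect[OF dj] db(1)])
  define e where "e n s = (\<integral>w. dist' n s w \<partial>M)" for n s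
  have em: "e n \<in> borel_measurable borel" for n
    unfolding e_def using dj by (rule borel_measurable_lebesgue_integral)
  have e0: "0 \<le> e n s" for n s unfolding e_def using db(2) by (rule Bochner_Integration.integral_nonneg)
  have e1: "\<bar>e n s\<bar> \<le> 1" for n s
  proof -
    have "e n s \<le> (\<integral>w. 1 \<partial>M)" unfolding e_def using db(1) by (intro integral_mono di) (auto simp: dist'_def)
    then show ?thesis using e0[of n s] by (simp add: prob_space)
  qed
  have elim: "(\<lambda>n. e n s) \<longlonglongrightarrow> 0" if s: "0 \<le> s" "s \<le> t" for s
  proof (rule LIMSEQ_I)
    fix r :: real assume r: "0 < r"
    then have r2: "0 < r / 2" by simp
    obtain N where N: "\<And>n. N \<le> n \<Longrightarrow> prob {w \<in> space M. r / 2 < norm (Y n s w - Xc s w)} < r / 2"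
      using LIMSEQ_D[OF prob_conv[OF s r2] r2] by auto
    show "\<exists>no. \<forall>n\<ge>no. norm (e n s - 0) < r"
    proof (intro exI[of _ N] allI impI)
      fix n assume n: "N \<le> n"
      let ?E = "{w \<in> space M. r / 2 < norm (Y n s w - Xc s w)}"
      note [measurable] = sect[OF Yj[of n], of s] sect[OF Xj, of s]
      have E: "?E \<in> sets M" by measurable
      have "e n s \<le> (\<integral>w. r / 2 + indicator ?E w \<partial>M)"
        unfolding e_def
      proof (intro integral_mono di)
        show "integrable M (\<lambda>w. r / 2 + indicator ?E w)"
          using E by (intro Bochner_Integration.integrable_add integrable_real_indicator) (auto simp: emeasure_eq_measure)
        show "dist' n s w \<le> r / 2 + indicator ?E w" if "w \<in> space M" for w
          using that r by (auto simp: dist'_def indicator_def min_def)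
      qed
      also have "\<dots> = r / 2 + prob ?E" using E prob_space by (simp add: emeasure_eq_measure)
      also have "\<dots> < r" using N[OF n] by simp
      finally show "norm (e n s - 0) < r" using e0 by simp
    qed
  qed
  have Elim: "(\<lambda>n. LBINT s. indicator {0..t} s * e n s) \<longlonglongrightarrow> 0"
  proof -
    have "(\<lambda>n. LBINT s. indicator {0..t} s * e n s) \<longlonglongrightarrow> (\<integral>s. 0 \<partial>(lborel :: real measure))"
    proof (rule integral_dominated_convergence[where w="indicator {0..t} :: real \<Rightarrow> real"])
      show "AE s in lborel. (\<lambda>n. indicator {0..t} s * e n s) \<longlonglongrightarrow> 0"
      proof (rule AE_I2)
        fix s :: real
        show "(\<lambda>n. indicator {0..t} s * e n s) \<longlonglongrightarrow> 0"
          using elim[of s] by (cases "s \<in> {0..t}") auto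
      qed
      show "AE s in lborel. norm (indicator {0..t} s * e n s) \<le> indicator {0..t} s" for n
        using e1[of n] by (intro AE_I2) (auto simp: indicator_def)
      show "integrable lborel (indicator {0..t} :: real \<Rightarrow> real)" by (rule integrable_real_indicator) (auto simp: emeasure_lborel_Icc_eq)
      show "(\<lambda>s. indicator {0..t} s * e n s) \<in> borel_measurable lborel" for n using em[of n] by measurable
    qed simp
    then show ?thesis by simp
  qed
  obtain C where C0: "C \<ge> 0" and Cb: "\<And>x. \<bar>\<phi> x\<bar> \<le> C" and Cl: "\<And>x y. \<bar>\<phi> y - \<phi> x\<bar> \<le> C * norm (y - x)"
    and Cg: "\<And>x. norm (grad \<phi> x) \<le> C" and Cg': "\<And>x y. norm (grad \<phi> y - grad \<phi> x) \<le> C * norm (y - x)"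
    and CH: "\<And>x. norm (Hess \<phi> x) \<le> C" and CH': "\<And>x y. norm (Hess \<phi> y - Hess \<phi> x) \<le> C * norm (y - x)"
    using test_function_uniform[OF \<phi>] by blast
  have cap: "d \<le> 2 * C * dist' n s w" if "d \<le> C * norm (Y n s w - Xc s w)" "d \<le> C + C" for d n s w
  proof (cases "norm (Y n s w - Xc s w) \<le> 1")
    case True
    have "0 \<le> C * norm (Y n s w - Xc s w)" using C0 by simp
    then show ?thesis using that(1) True by (simp add: dist'_def)
  next
    case False then show ?thesis using that(2) by (simp add: dist'_def)
  qed
  define N where "N = real CARD('n) * real CARD('n)"
  define c1 where "c1 = 2 * C * (K' + N * K\<^sup>2)"
  define c2 where "c2 = N * (C * K)"
  have K': "0 \<le> K'" using b(2) norm_ge_zero order_trans by blast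
  have c: "0 \<le> c1" "0 \<le> c2" using C0 K' \<sigma>(1) by (auto simp: c1_def c2_def N_def)
  have gd: "\<bar>generator \<phi> (Y n s w) (\<beta> s w) (sv n s w) - generator \<phi> (Xc s w) (\<beta> s w) (Hc s w)\<bar> \<le> c1 * dist' n s w + c2 * norm (sv n s w - Hc s w)" for n s w
  proof -
    have "\<bar>generator \<phi> (Y n s w) (\<beta> s w) (sv n s w) - generator \<phi> (Xc s w) (\<beta> s w) (sv n s w)\<bar> \<le> 2 * C * dist' n s w * (K' + real CARD('n) * real CARD('n) * K\<^sup>2)"
    proof (rule generator_diff[OF _ _ \<beta>b svK])
      show "norm (grad \<phi> (Y n s w) - grad \<phi> (Xc s w)) \<le> 2 * C * dist' n s w"
        by (rule cap[OF Cg' order_trans[OF norm_triangle_ineq4 add_mono[OF Cg Cg]]])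
      show "norm (Hess \<phi> (Y n s w) - Hess \<phi> (Xc s w)) \<le> 2 * C * dist' n s w"
        by (rule cap[OF CH' order_trans[OF norm_triangle_ineq4 add_mono[OF CH CH]]])
    qed (use C0 db(2) in simp)
    moreover have "\<bar>generator \<phi> (Xc s w) (\<beta> s w) (sv n s w) - generator \<phi> (Xc s w) (\<beta> s w) (Hc s w)\<bar> \<le> c2 * norm (sv n s w - Hc s w)"
      unfolding c2_def N_def Hc_def by (rule generator_matrix_diff[OF CH svK HK])
    moreover have "2 * C * dist' n s w * (K' + real CARD('n) * real CARD('n) * K\<^sup>2) = c1 * dist' n s w"
      unfolding c1_def N_def by (simp only: ac_simps)
    ultimately show ?thesis by linarith
  qed
  define L where "L = C * (K' + N * K\<^sup>2)"
  have gX: "\<bar>generator \<phi> (Xc s w) (\<beta> s w) (Hc s w)\<bar> \<le> L" "\<bar>generator \<phi> (Y n s w) (\<beta> s w) (sv n s w)\<bar> \<le> L" for n s w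
    unfolding L_def N_def Hc_def by (intro generator_bound Cg CH \<beta>b HK svK)+
  have gXj: "(\<lambda>(s, w). generator \<phi> (Xc s w) (\<beta> s w) (Hc s w)) \<in> borel_measurable (borel \<Otimes>\<^sub>M M)"
    using generator_measurable[OF \<phi> Xj \<beta>j Hj] by (simp add: case_prod_beta Hc_def)
  have gYj: "(\<lambda>(s, w). generator \<phi> (Y n s w) (\<beta> s w) (sv n s w)) \<in> borel_measurable (borel \<Otimes>\<^sub>M M)" for n
    using generator_measurable[OF \<phi> Yj \<beta>j svj, of n n] by (simp add: case_prod_beta)
  define g where "g s = (\<integral>w. generator \<phi> (Xc s w) (\<beta> s w) (Hc s w) \<partial>M)" for s
  define h where "h n s = (\<integral>w. generator \<phi> (Y n s w) (\<beta> s w) (sv n s w) \<partial>M)" for n s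
  have gi: "integrable M (\<lambda>w. generator \<phi> (Xc s w) (\<beta> s w) (Hc s w))" for s by (rule bounded_integrable[OF sect[OF gXj] gX(1)])
  have hi: "integrable M (\<lambda>w. generator \<phi> (Y n s w) (\<beta> s w) (sv n s w))" for n s by (rule bounded_integrable[OF sect[OF gYj] gX(2)])
  have le_L: "\<bar>\<integral>w. f w \<partial>M\<bar> \<le> L" if "integrable M f" "\<And>w. \<bar>f w\<bar> \<le> L" for f :: "'w \<Rightarrow> real"
  proof -
    have "\<bar>\<integral>w. f w \<partial>M\<bar> \<le> (\<integral>w. L \<partial>M)" using that by (intro order_trans[OF integral_abs_bound] integral_mono integrable_abs) auto
    then show ?thesis by (simp add: prob_space)
  qed
  have gm: "g \<in> borel_measurable borel" and hm: "h n \<in> borel_measurable borel" for n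
    unfolding g_def h_def using gXj gYj[of n] by (auto intro!: borel_measurable_lebesgue_integral)
  have gb: "\<bar>g s\<bar> \<le> L" and hb: "\<bar>h n s\<bar> \<le> L" for n s
    unfolding g_def h_def by (rule le_L[OF gi gX(1)], rule le_L[OF hi gX(2)])
  define sq where "sq n s w = (norm (sv n s w - Hc s w))\<^sup>2" for n s w
  have sqj: "(\<lambda>(s, w). sq n s w) \<in> borel_measurable (borel \<Otimes>\<^sub>M M)" for n
  proof -
    have "(\<lambda>p. (norm ((case p of (s, w) \<Rightarrow> sv n s w) - (case p of (s, w) \<Rightarrow> H (clip t s) w)))\<^sup>2) \<in> borel_measurable (borel \<Otimes>\<^sub>M M)"
      using svj[of n] Hj by measurable
    then show ?thesis unfolding sq_def Hc_def by (simp add: case_prod_beta)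
  qed
  have sqb: "\<bar>sq n s w\<bar> \<le> (K + K)\<^sup>2" for n s w
    unfolding sq_def Hc_def abs_power2 by (intro power_mono order_trans[OF norm_triangle_ineq4] add_mono svK HK) simp
  have sqi: "integrable M (sq n s)" for n s by (rule bounded_integrable[OF sect[OF sqj] sqb])
  define q where "q n s = (\<integral>w. sq n s w \<partial>M)" for n s
  have qm: "q n \<in> borel_measurable borel" for n
    unfolding q_def using sqj by (rule borel_measurable_lebesgue_integral)
  have qb: "\<bar>q n s\<bar> \<le> (K + K)\<^sup>2" for n s
  proof -
    have "\<bar>q n s\<bar> \<le> (\<integral>w. (K + K)\<^sup>2 \<partial>M)" unfolding q_def using sqb sqi by (intro order_trans[OF integral_abs_bound] integral_mono integrable_abs) auto
    then show ?thesis by (simp add: prob_space)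
  qed
  define \<mu> where "\<mu> n = mean_square_dist t (m n) (\<tau> n) (A n) H" for n
  have \<mu>0: "0 \<le> \<mu> n" for n unfolding \<mu>_def by (rule mean_square_dist_nonneg)
  have \<mu>q: "\<mu> n = (LBINT s. indicator {0..t} s * q n s)" for n
  proof -
    have "\<mu> n = (\<integral>w. (LBINT s. indicator {0..t} s * sq n s w) \<partial>M)"
      unfolding \<mu>_def mean_square_dist_def
      by (intro Bochner_Integration.integral_cong refl) (auto simp: indicator_def sq_def sv_def Hc_def clip_id)
    then show ?thesis unfolding q_def using integral_time_swap(3)[OF sqj sqb t(1)] by simp
  qed
  \<comment> \<open>the distance \<open>d\<close> of the noise coefficients enters linearly but is controlled in mean square:
    \<open>d \<le> \<eta> + d\<^sup>2 / \<eta>\<close>, where \<open>\<mu> / \<eta> \<le> sqrt \<mu>\<close>; the term \<open>1 / Suc n\<close> keeps \<open>\<eta>\<close> positive\<close>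
  define \<eta> where "\<eta> n = sqrt (\<mu> n) + 1 / real (Suc n)" for n
  have \<eta>: "0 < \<eta> n" for n using \<mu>0 by (simp add: \<eta>_def add_nonneg_pos)
  have hg: "\<bar>h n s - g s\<bar> \<le> c1 * e n s + c2 * (\<eta> n + q n s / \<eta> n)" for n s
  proof -
    have "h n s - g s = (\<integral>w. generator \<phi> (Y n s w) (\<beta> s w) (sv n s w) - generator \<phi> (Xc s w) (\<beta> s w) (Hc s w) \<partial>M)"
      unfolding h_def g_def using hi gi by simp
    also have "\<bar>\<dots>\<bar> \<le> (\<integral>w. c1 * dist' n s w + c2 * (\<eta> n + sq n s w / \<eta> n) \<partial>M)"
    proof (intro order_trans[OF integral_abs_bound] integral_mono integrable_abs Bochner_Integration.integrable_diff hi gi)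
      show "integrable M (\<lambda>w. c1 * dist' n s w + c2 * (\<eta> n + sq n s w / \<eta> n))" using di sqi by simp
      fix w
      let ?d = "norm (sv n s w - Hc s w)"
      have "?d \<le> \<eta> n + sq n s w / \<eta> n"
      proof (cases "?d \<le> \<eta> n")
        case True then show ?thesis using \<eta>[of n] by (simp add: sq_def add_increasing2)
      next
        case False
        then have "?d * \<eta> n \<le> ?d * ?d" by (intro mult_left_mono) auto
        then have "?d \<le> sq n s w / \<eta> n" using \<eta>[of n] by (simp add: sq_def power2_eq_square pos_le_divide_eq)
        then show ?thesis using \<eta>[of n] by simp
      qed
      then have "c2 * ?d \<le> c2 * (\<eta> n + sq n s w / \<eta> n)" using c by (intro mult_left_mono) auto
      then show "\<bar>generator \<phi> (Y n s w) (\<beta> s w) (sv n s w) - generator \<phi> (Xc s w) (\<beta> s w) (Hc s w)\<bar> \<le> c1 * dist' n s w + c2 * (\<eta> n + sq n s w / \<eta> n)"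
        using gd[of n s w] by linarith
    qed
    also have "\<dots> = c1 * e n s + c2 * (\<eta> n + q n s / \<eta> n)"
      unfolding e_def q_def using di sqi by (simp add: prob_space)
    finally show ?thesis .
  qed
  have Gd: "\<bar>(LBINT s. indicator {0..t} s * h n s) - (LBINT s. indicator {0..t} s * g s)\<bar>
      \<le> c1 * (LBINT s. indicator {0..t} s * e n s) + c2 * (\<eta> n * t + sqrt (\<mu> n))" for n
  proof -
    note i = interval_indicator_integral(1)[OF hm hb t(1), of n] interval_indicator_integral(1)[OF gm gb t(1)]
      interval_indicator_integral(1)[OF em e1 t(1), of n] interval_indicator_integral(1)[OF qm qb t(1), of n]
    have ind: "has_bochner_integral lborel (indicator {0..t} :: real \<Rightarrow> real) t"
      using t by (auto simp: has_bochner_integral_iff emeasure_lborel_Icc_eq intro!: integrable_real_indicator)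
    let ?b = "\<lambda>s. c1 * (indicator {0..t} s * e n s) + (c2 * \<eta> n * indicator {0..t} s + c2 / \<eta> n * (indicator {0..t} s * q n s))"
    have bi: "has_bochner_integral lborel ?b (c1 * (LBINT s. indicator {0..t} s * e n s) + (c2 * \<eta> n * t + c2 / \<eta> n * \<mu> n))"
      unfolding \<mu>q using i by (intro has_bochner_integral_add has_bochner_integral_mult_right ind has_bochner_integral_integrable)
    have diff: "(LBINT s. indicator {0..t} s * h n s) - (LBINT s. indicator {0..t} s * g s) = (LBINT s. indicator {0..t} s * h n s - indicator {0..t} s * g s)"
      by (rule Bochner_Integration.integral_diff[OF i(1,2), symmetric])
    have bound: "\<bar>LBINT s. indicator {0..t} s * h n s - indicator {0..t} s * g s\<bar> \<le> (LBINT s. ?b s)"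
    proof (rule order_trans[OF integral_abs_bound], rule integral_mono)
      show "integrable lborel (\<lambda>s. \<bar>indicator {0..t} s * h n s - indicator {0..t} s * g s\<bar>)"
        by (rule integrable_abs, rule Bochner_Integration.integrable_diff[OF i(1,2)])
      show "integrable lborel ?b" by (rule integrable.intros[OF bi])
      show "\<bar>indicator {0..t} s * h n s - indicator {0..t} s * g s\<bar> \<le> ?b s" for s
      proof (cases "s \<in> {0..t}")
        case True
        then have "indicator {0..t} s = (1::real)" by simp
        then show ?thesis using hg[of n s] by (simp only: mult_1 mult_1_right) (simp add: distrib_left mult.assoc)
      qed simp
    qed
    have tot: "(LBINT s. ?b s) = c1 * (LBINT s. indicator {0..t} s * e n s) + (c2 * \<eta> n * t + c2 / \<eta> n * \<mu> n)"
      by (rule has_bochner_integral_integral_eq[OF bi])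
    have "sqrt (\<mu> n) * sqrt (\<mu> n) \<le> sqrt (\<mu> n) * \<eta> n" using \<mu>0[of n] by (intro mult_left_mono) (auto simp: \<eta>_def)
    then have "\<mu> n / \<eta> n \<le> sqrt (\<mu> n)" using \<eta>[of n] \<mu>0[of n] by (simp add: pos_divide_le_eq)
    then have "c2 * (\<mu> n / \<eta> n) \<le> c2 * sqrt (\<mu> n)" by (rule mult_left_mono[OF _ c(2)])
    then have "c2 * \<eta> n * t + c2 / \<eta> n * \<mu> n \<le> c2 * (\<eta> n * t + sqrt (\<mu> n))" by (simp add: distrib_left mult.assoc)
    then show ?thesis unfolding diff using bound unfolding tot by linarith
  qed
  have \<mu>l: "(\<lambda>n. sqrt (\<mu> n)) \<longlonglongrightarrow> 0" using tendsto_real_sqrt[OF msd] unfolding \<mu>_def by simp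
  have \<eta>l: "\<eta> \<longlonglongrightarrow> 0" unfolding \<eta>_def[abs_def] using tendsto_add[OF \<mu>l LIMSEQ_inverse_real_of_nat] by (simp add: inverse_eq_divide)
  have "(\<lambda>n. c1 * (LBINT s. indicator {0..t} s * e n s) + c2 * (\<eta> n * t + sqrt (\<mu> n))) \<longlonglongrightarrow> c1 * 0 + c2 * (0 * t + 0)"
    by (intro tendsto_intros Elim \<eta>l \<mu>l)
  then have majorant: "(\<lambda>n. c1 * (LBINT s. indicator {0..t} s * e n s) + c2 * (\<eta> n * t + sqrt (\<mu> n))) \<longlonglongrightarrow> 0" by simp
  have "(\<lambda>n. (LBINT s. indicator {0..t} s * h n s) - (LBINT s. indicator {0..t} s * g s)) \<longlonglongrightarrow> 0"
    by (rule Lim_null_comparison[OF always_eventually majorant], rule allI) (unfold real_norm_def, rule Gd)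
  then have hl: "(\<lambda>n. LBINT s. indicator {0..t} s * h n s) \<longlonglongrightarrow> (LBINT s. indicator {0..t} s * g s)"
    by (rule LIM_zero_cancel)
  have Xt: "Xc t = X t" using t by (simp add: Xc_def clip_id)
  have \<phi>m: "\<phi> \<in> borel_measurable borel" by (rule test_function_measurable[OF \<phi>])
  have \<phi>i: "integrable M (\<lambda>w. \<phi> (Z w))" if "Z \<in> borel_measurable M" for Z
    by (rule bounded_integrable[OF measurable_compose[OF that \<phi>m] Cb])
  have \<phi>d: "\<bar>(\<integral>w. \<phi> (Y n t w) \<partial>M) - (\<integral>w. \<phi> (X t w) \<partial>M)\<bar> \<le> 2 * C * e n t" for n
  proof -
    note i = \<phi>i[OF sect[OF Yj[of n], of t]] \<phi>i[OF sect[OF Xj, of t]]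
    have "(\<integral>w. \<phi> (Y n t w) \<partial>M) - (\<integral>w. \<phi> (X t w) \<partial>M) = (\<integral>w. \<phi> (Y n t w) - \<phi> (Xc t w) \<partial>M)"
      using i unfolding Xt by simp
    also have "\<bar>\<dots>\<bar> \<le> (\<integral>w. 2 * C * dist' n t w \<partial>M)"
    proof (intro order_trans[OF integral_abs_bound] integral_mono integrable_abs Bochner_Integration.integrable_diff i integrable_mult_right di)
      show "\<bar>\<phi> (Y n t w) - \<phi> (Xc t w)\<bar> \<le> 2 * C * dist' n t w" for w
        by (rule cap[OF Cl order_trans[OF abs_triangle_ineq4 add_mono[OF Cb Cb]]])
    qed
    finally show ?thesis unfolding e_def by simp
  qed
  have "(\<lambda>n. 2 * C * e n t) \<longlonglongrightarrow> 2 * C * 0" by (rule tendsto_mult_left[OF elim[OF t(1) order_refl]])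
  then have majorant': "(\<lambda>n. 2 * C * e n t) \<longlonglongrightarrow> 0" by simp
  have "(\<lambda>n. (\<integral>w. \<phi> (Y n t w) \<partial>M) - (\<integral>w. \<phi> (X t w) \<partial>M)) \<longlonglongrightarrow> 0"
    by (rule Lim_null_comparison[OF always_eventually majorant'], rule allI) (unfold real_norm_def, rule \<phi>d)
  then have "(\<lambda>n. \<integral>w. \<phi> (Y n t w) \<partial>M) \<longlonglongrightarrow> (\<integral>w. \<phi> (X t w) \<partial>M)" by (rule LIM_zero_cancel)
  then have "(\<lambda>n. (\<integral>w. \<phi> (Y n t w) \<partial>M) - (\<integral>w. \<phi> (X 0 w) \<partial>M)) \<longlonglongrightarrow> (\<integral>w. \<phi> (X t w) \<partial>M) - (\<integral>w. \<phi> (X 0 w) \<partial>M)"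
    by (intro tendsto_diff tendsto_const)
  then have "(\<integral>w. \<phi> (X t w) \<partial>M) - (\<integral>w. \<phi> (X 0 w) \<partial>M) = (LBINT s. indicator {0..t} s * g s)"
    unfolding form h_def[symmetric] using hl LIMSEQ_unique by blast
  also have "\<dots> = (LBINT s. indicator {0..t} s * (\<integral>w. generator \<phi> (X s w) (b (X s w)) (\<sigma> (X s w)) \<partial>M))"
    by (intro Bochner_Integration.integral_cong refl) (auto simp: indicator_def g_def Xc_def \<beta>_def Hc_def H_def clip_id)
  finally show ?thesis .
qed

end

section \<open>The Fokker-Planck equation and its weak form\<close>

context landau_potential
begin

abbreviation (input) drift :: "real^'n \<Rightarrow> real^'n" where "drift V \<equiv> 2 *\<^sub>R Lambda \<Phi> R V"

abbreviation (input) noise :: "real^'n \<Rightarrow> real^'n^'n" where "noise V \<equiv> sqrt 2 *\<^sub>R Sigma_coeff \<Phi> R V"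

lemma noise_squared: "noise V ** transpose (noise V) = 2 *\<^sub>R D V"
proof -
  let ?S = "Sigma_coeff \<Phi> R V"
  have "(noise V ** transpose (noise V)) $ i $ j = (2 *\<^sub>R D V) $ i $ j" for i j
  proof -
    have "(noise V ** transpose (noise V)) $ i $ j = (\<Sum>p\<in>UNIV. (sqrt 2 * sqrt 2) * (?S $ i $ p * ?S $ j $ p))"
      unfolding matrix_mult_transpose_nth by (intro sum.cong refl) (simp only: vector_scaleR_component real_scaleR_def ac_simps)
    also have "\<dots> = 2 * (?S ** transpose ?S) $ i $ j"
      unfolding matrix_mult_transpose_nth by (simp add: sum_distrib_left)
    finally show ?thesis by (simp add: Sigma_works)
  qed
  then show ?thesis by (simp add: vec_eq_iff)
qed

text \<open>The drift is twice the divergence of the diffusion matrix, so the coefficients satisfy the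
  fluctuation-dissipation relation on which the reduction to the Landau operator rests.\<close>

lemma drift_divergence: "drift V $ i = 2 * (\<Sum>j\<in>UNIV. partial j (\<lambda>W. D W $ i $ j) V)"
  by (simp add: Lambda_eq divergence_D)

text \<open>Compare the fluxes. As the squared noise is \<open>2 D\<close>, the one on the left is
  \<open>div (D f) - 2 f \<Lambda>\<close>; here \<open>div D = - D(V) V\<close> contributes \<open>- f D(V) V\<close> and the drift
  \<open>2 f D(V) V\<close>.\<close>

lemma fokker_planck_landau:
  assumes f: "C_k 2 f"
  shows "fokker_planck_rhs drift noise f V = landau_rhs (landau_matrix \<Phi>) f V"
proof -
  have fd: "f differentiable (at x)" "partial j f differentiable (at x)" for x j
    using f by (auto simp: numeral_2_eq_2)
  define u where "u i j W = partial j (\<lambda>W. D W $ i $ j) W * f W + D W $ i $ j * partial j f W" for i j W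
  have ud: "u i j differentiable (at x)" for i j x
    unfolding u_def[abs_def] by (intro differentiable_add differentiable_mult D_differentiable fd)
  have u2: "partial j (\<lambda>W. (noise W ** transpose (noise W)) $ i $ j * f W) = (\<lambda>W. 2 * u i j W)" for i j
  proof
    fix W
    have "partial j (\<lambda>W. (noise W ** transpose (noise W)) $ i $ j * f W) W = partial j (\<lambda>W. 2 * (D W $ i $ j * f W)) W"
      unfolding noise_squared by (simp add: mult.assoc)
    also have "\<dots> = 2 * partial j (\<lambda>W. D W $ i $ j * f W) W"
      by (intro partial_cmult differentiable_mult D_differentiable fd)
    also have "partial j (\<lambda>W. D W $ i $ j * f W) W = u i j W"
      unfolding u_def by (intro partial_mult D_differentiable fd)
    finally show "partial j (\<lambda>W. (noise W ** transpose (noise W)) $ i $ j * f W) W = 2 * u i j W" .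
  qed
  define w where "w i W = f W * (2 * (\<Sum>j\<in>UNIV. partial j (\<lambda>W. D W $ i $ j) W))" for i W
  have wd: "w i differentiable (at x)" for i x
    unfolding w_def[abs_def] by (intro differentiable_mult differentiable_const differentiable_sum D_differentiable fd finite ballI)
  have flux: "(landau_matrix \<Phi> W *v (grad f W + f W *\<^sub>R W)) $ i = (\<Sum>j\<in>UNIV. u i j W) - w i W" for i W
  proof -
    have "(landau_matrix \<Phi> W *v (grad f W + f W *\<^sub>R W)) $ i = (\<Sum>j\<in>UNIV. D W $ i $ j * partial j f W) + f W * (D W *v W) $ i"
      unfolding landau_matrix_eq matrix_vector_mult_def
      by (simp add: grad_def distrib_left sum.distrib sum_distrib_left mult_ac)
    moreover have "(\<Sum>j\<in>UNIV. u i j W) = - (f W * (D W *v W) $ i) + (\<Sum>j\<in>UNIV. D W $ i $ j * partial j f W)"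
      unfolding u_def sum.distrib sum_distrib_right[symmetric] divergence_D by simp
    moreover have "w i W = - 2 * (f W * (D W *v W) $ i)" unfolding w_def divergence_D by simp
    ultimately show ?thesis by simp
  qed
  have "landau_rhs (landau_matrix \<Phi>) f V = (\<Sum>i\<in>UNIV. (\<Sum>j\<in>UNIV. partial i (u i j) V) - partial i (w i) V)"
    unfolding landau_rhs_def divergence_def flux
  proof (rule sum.cong[OF refl])
    fix i :: 'n
    show "partial i (\<lambda>W. (\<Sum>j\<in>UNIV. u i j W) - w i W) V = (\<Sum>j\<in>UNIV. partial i (u i j) V) - partial i (w i) V"
      by (subst partial_diff) (auto intro!: differentiable_sum ud wd simp: partial_sum[OF ud])
  qed
  moreover have "fokker_planck_rhs drift noise f V = (\<Sum>i\<in>UNIV. (\<Sum>j\<in>UNIV. partial i (u i j) V) - partial i (w i) V)"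
  proof -
    have "divergence (\<lambda>W. f W *\<^sub>R drift W) V = (\<Sum>i\<in>UNIV. partial i (w i) V)"
    proof -
      have "(f W *\<^sub>R drift W) $ i = w i W" for W i
        unfolding w_def drift_divergence[symmetric] by simp
      then show ?thesis unfolding divergence_def by (simp only:)
    qed
    then show ?thesis
      unfolding fokker_planck_rhs_def u2 partial_cmult[OF ud]
      by (simp add: sum_subtractf sum_distrib_left)
  qed
  ultimately show ?thesis by simp
qed

text \<open>The divergence falls on \<open>D\<close> once, which gives \<open>- (D(V) V) \<bullet> grad \<phi>\<close>; together with the
  explicit term of the adjoint this is the drift \<open>2 \<Lambda>(V) = - 2 D(V) V\<close>.\<close>

lemma landau_adjoint_eq:
  assumes \<phi>: "test_function \<phi>"
  shows "landau_adjoint (landau_matrix \<Phi>) \<phi> V = generator \<phi> V (drift V) (noise V)"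
proof -
  note d = test_function_facts(1)[OF test_function_partial[OF \<phi>]]
  have sym: "D W $ i $ j = D W $ j $ i" for W i j
    using arg_cong[OF transpose_D, of "\<lambda>A. A $ j $ i"] by (simp add: transpose_def)
  have "divergence (\<lambda>W. transpose (landau_matrix \<Phi> W) *v grad \<phi> W) V
      = (\<Sum>i\<in>UNIV. partial i (\<lambda>W. \<Sum>j\<in>UNIV. D W $ i $ j * partial j \<phi> W) V)"
    unfolding divergence_def landau_matrix_eq transpose_D by (simp add: matrix_vector_mult_def grad_def)
  also have "\<dots> = (\<Sum>i\<in>UNIV. \<Sum>j\<in>UNIV. partial i (\<lambda>W. D W $ i $ j) V * partial j \<phi> V + D V $ i $ j * partial i (partial j \<phi>) V)"
  proof (rule sum.cong[OF refl])
    fix i :: 'n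
    show "partial i (\<lambda>W. \<Sum>j\<in>UNIV. D W $ i $ j * partial j \<phi> W) V = (\<Sum>j\<in>UNIV. partial i (\<lambda>W. D W $ i $ j) V * partial j \<phi> V + D V $ i $ j * partial i (partial j \<phi>) V)"
      by (subst partial_sum) (intro differentiable_mult D_differentiable d, simp add: partial_mult D_differentiable d)
  qed
  also have "\<dots> = (\<Sum>i\<in>UNIV. \<Sum>j\<in>UNIV. partial i (\<lambda>W. D W $ i $ j) V * partial j \<phi> V) + D V \<bullet> Hess \<phi> V"
    by (simp add: sum.distrib matrix_inner Hess_def)
  also have "(\<Sum>i\<in>UNIV. \<Sum>j\<in>UNIV. partial i (\<lambda>W. D W $ i $ j) V * partial j \<phi> V) = (\<Sum>j\<in>UNIV. \<Sum>i\<in>UNIV. partial i (\<lambda>W. D W $ j $ i) V * partial j \<phi> V)"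
    by (subst sum.swap) (simp only: sym)
  also have "\<dots> = - ((D V *v V) \<bullet> grad \<phi> V)"
    unfolding sum_distrib_right[symmetric] divergence_D by (simp add: inner_vec_def grad_def sum_negf)
  finally have "landau_adjoint (landau_matrix \<Phi>) \<phi> V = D V \<bullet> Hess \<phi> V - 2 * ((D V *v V) \<bullet> grad \<phi> V)"
    unfolding landau_adjoint_def landau_matrix_eq by simp
  then show ?thesis
    unfolding generator_def noise_squared Lambda_eq by (simp add: inner_commute)
qed

text \<open>The squared Frobenius norm of the noise coefficient is the trace of \<open>2 D\<close>.\<close>

lemma coefficients_bounded: "\<exists>K\<ge>0. \<forall>V. norm (drift V) \<le> K" "\<exists>K\<ge>0. \<forall>V. norm (noise V) \<le> K"
proof -
  obtain K where K: "\<And>i. K i \<ge> 0" "\<And>i V. \<bar>Lambda \<Phi> R V $ i\<bar> \<le> K i" using Lambda_bounded by metis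
  have "norm (drift V) \<le> 2 * (\<Sum>i\<in>UNIV. K i)" for V
    using norm_le_l1_cart[of "Lambda \<Phi> R V"] sum_mono[of UNIV "\<lambda>i. \<bar>Lambda \<Phi> R V $ i\<bar>" K] K(2) by fastforce
  then show "\<exists>K\<ge>0. \<forall>V. norm (drift V) \<le> K" using K(1) by (intro exI[of _ "2 * (\<Sum>i\<in>UNIV. K i)"]) (auto intro!: sum_nonneg)
  have "\<forall>i. \<exists>K\<ge>0. \<forall>V. \<bar>D V $ i $ i\<bar> \<le> K" by (rule allI, rule D_bounded)
  then obtain C where C: "\<And>i. C i \<ge> 0" "\<And>i V. \<bar>D V $ i $ i\<bar> \<le> C i" by metis
  have "norm (noise V) \<le> sqrt (2 * (\<Sum>i\<in>UNIV. C i))" for V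
  proof -
    have "(norm (noise V))\<^sup>2 = (\<Sum>i\<in>UNIV. (noise V ** transpose (noise V)) $ i $ i)"
      unfolding dot_square_norm[symmetric] matrix_inner matrix_mult_transpose_nth ..
    also have "\<dots> = 2 * (\<Sum>i\<in>UNIV. D V $ i $ i)" unfolding noise_squared by (simp add: sum_distrib_left)
    also have "\<dots> \<le> 2 * (\<Sum>i\<in>UNIV. C i)" using C(2) by (intro mult_left_mono sum_mono) (auto simp: abs_le_iff)
    finally show ?thesis by (rule real_le_rsqrt)
  qed
  then show "\<exists>K\<ge>0. \<forall>V. norm (noise V) \<le> K" using C(1) by (intro exI[of _ "sqrt (2 * (\<Sum>i\<in>UNIV. C i))"]) (auto intro!: sum_nonneg)
qed

lemma adjoint_bounded_measurable:
  assumes \<phi>: "test_function \<phi>"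
  shows "landau_adjoint (landau_matrix \<Phi>) \<phi> \<in> borel_measurable borel" "\<exists>C. \<forall>V. \<bar>landau_adjoint (landau_matrix \<Phi>) \<phi> V\<bar> \<le> C"
proof -
  have "continuous_on UNIV D"
  proof -
    have "continuous_on UNIV (\<lambda>V. \<chi> i j. D V $ i $ j)" by (intro continuous_on_vec_lambda continuous_D)
    then show ?thesis by simp
  qed
  then have [measurable]: "D \<in> borel_measurable borel" "Lambda \<Phi> R \<in> borel_measurable borel"
    by (intro borel_measurable_continuous_onI continuous_Lambda; assumption)+
  note [measurable] = test_function_measurable[OF \<phi>]
  show "landau_adjoint (landau_matrix \<Phi>) \<phi> \<in> borel_measurable borel"
    unfolding landau_adjoint_eq[OF \<phi>, abs_def] generator_def noise_squared by measurable
  obtain K K' C where b: "\<And>V. norm (drift V) \<le> K" "\<And>V. norm (noise V) \<le> K'"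
    and g: "\<And>x. norm (grad \<phi> x) \<le> C" "\<And>x. norm (Hess \<phi> x) \<le> C"
    using coefficients_bounded test_function_uniform[OF \<phi>] by metis
  show "\<exists>C. \<forall>V. \<bar>landau_adjoint (landau_matrix \<Phi>) \<phi> V\<bar> \<le> C"
    unfolding landau_adjoint_eq[OF \<phi>] by (rule exI, rule allI, rule generator_bound[OF g b])
qed

end

theorem corollary1p1:
  fixes \<Phi> g\<^sub>0 :: "real ^ 'n \<Rightarrow> real"
    and R :: real
    and M :: "'w measure"
    and F :: "real \<Rightarrow> 'w measure"
    and B \<V> :: "real \<Rightarrow> 'w \<Rightarrow> real ^ 'n"
  assumes "CARD('n) \<ge> 4"
    and "R > 0"
    and "C_k 3 \<Phi>"
    and "closure {x. \<Phi> x \<noteq> 0} \<subseteq> cball 0 R"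
    and "\<And>x. \<Phi> (- x) = \<Phi> x"
    and "\<exists>x. \<Phi> x \<noteq> 0"
    and "C_k 1 g\<^sub>0"
    and "bounded (range g\<^sub>0)"
    and "\<And>i. bounded (range (partial i g\<^sub>0))"
    and "\<And>v. 0 \<le> g\<^sub>0 v * gauss v"
    and "(\<integral>\<^sup>+v. ennreal (g\<^sub>0 v * gauss v) \<partial>lborel) = 1"
    and "prob_space M"
    and "filtration (space M) F"
    and "\<And>t. subalgebra M (F t)"
    and "brownian_motion M F B"
    and "sde_solution M F B (\<lambda>V. 2 *\<^sub>R Lambda \<Phi> R V) (\<lambda>V. sqrt 2 *\<^sub>R Sigma_coeff \<Phi> R V) \<V>"
    and "distributed M lborel (\<V> 0) (\<lambda>v. ennreal (g\<^sub>0 v * gauss v))"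
  shows "(\<forall>f V. C_k 2 f \<longrightarrow>
            fokker_planck_rhs (\<lambda>V. 2 *\<^sub>R Lambda \<Phi> R V) (\<lambda>V. sqrt 2 *\<^sub>R Sigma_coeff \<Phi> R V) f V
            = landau_rhs (landau_matrix \<Phi>) f V)
         \<and> landau_weak_solution (landau_matrix \<Phi>)
             (density lborel (\<lambda>v. ennreal (g\<^sub>0 v * gauss v))) (\<lambda>t. distr M borel (\<V> t))"
proof -
  interpret prob_space M by fact
  interpret landau_potential \<Phi> R by unfold_locales fact+
  interpret brownian M F B by (intro brownian.intro brownian_axioms.intro) fact+
  note sde = assms(16)
  have XF: "\<V> s \<in> borel_measurable (F s)" if "0 \<le> s" "s \<le> 1" for s
    using sde that unfolding sde_solution_def adapted_def by auto
  have XM[measurable]: "\<V> s \<in> borel_measurable M" if "0 \<le> s" "s \<le> 1" for s by (rule F_M[OF XF[OF that]])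
  have path: "continuous_on {0..1} (\<lambda>s. \<V> s w)" if "w \<in> space M" for w
    using sde that unfolding sde_solution_def continuous_paths_def by blast
  have Xj: "(\<lambda>(s, w). \<V> (clip 1 s) w) \<in> borel_measurable (borel \<Otimes>\<^sub>M M)"
    by (rule continuous_process_measurable[OF _ XM path]) auto
  have law0: "distr M borel (\<V> 0) = density lborel (\<lambda>v. ennreal (g\<^sub>0 v * gauss v))"
    using distributed_distr_eq_density[OF assms(17)] distr_cong[of M M borel lborel "\<V> 0" "\<V> 0"] by simp
  obtain K' where K': "\<And>V. norm (drift V) \<le> K'" using coefficients_bounded(1) by blast
  obtain K where K: "0 \<le> K" "\<And>V. norm (noise V) \<le> K" using coefficients_bounded(2) by blast
  have c: "continuous_on UNIV drift" by (intro continuous_on_scaleR continuous_on_const continuous_Lambda)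
  have "landau_weak_solution (landau_matrix \<Phi>) (distr M borel (\<V> 0)) (\<lambda>t. distr M borel (\<V> t))"
    unfolding landau_weak_solution_def
  proof (intro conjI allI impI)
    show "C_k 1 (\<lambda>V. landau_matrix \<Phi> V $ i $ j)" for i j unfolding landau_matrix_eq by (rule C_k_D)
    show "\<forall>t\<in>{0..1}. prob_space (distr M borel (\<V> t)) \<and> sets (distr M borel (\<V> t)) = sets borel"
      using XM by (auto intro: prob_space_distr)
    fix \<phi> :: "real^'n \<Rightarrow> real" assume \<phi>: "test_function \<phi>"
    let ?a = "landau_adjoint (landau_matrix \<Phi>) \<phi>"
    note am[measurable] = adjoint_bounded_measurable(1)[OF \<phi>]
    obtain C where C: "\<And>V. \<bar>?a V\<bar> \<le> C" using adjoint_bounded_measurable(2)[OF \<phi>] by blast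
    have ai: "integrable M (\<lambda>w. ?a (\<V> s w))" if "0 \<le> s" "s \<le> 1" for s
      by (rule bounded_integrable[OF measurable_compose[OF XM[OF that] am] C])
    then show "\<forall>t\<in>{0..1}. integrable (distr M borel (\<V> t)) ?a"
      by (auto simp: integrable_distr_eq)
    have law: "(LINT V|distr M borel (\<V> s). h V) = (\<integral>w. h (\<V> s w) \<partial>M)" if "0 \<le> s" "s \<le> 1" "h \<in> borel_measurable borel"
      for s and h :: "real^'n \<Rightarrow> real"
      by (rule integral_distr[OF XM[OF that(1,2)] that(3)])
    define g where "g s = (\<integral>w. ?a (\<V> (clip 1 s) w) \<partial>M)" for s
    have gm: "g \<in> borel_measurable borel"
      unfolding g_def
      by (rule borel_measurable_lebesgue_integral) (use measurable_compose[OF Xj am] in \<open>simp add: case_prod_beta\<close>)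
    have gb: "\<bar>g s\<bar> \<le> C" for s
    proof -
      have "integrable M (\<lambda>w. ?a (\<V> (clip 1 s) w))" using clip_bounds[of 1 s] by (intro ai) auto
      then have "\<bar>g s\<bar> \<le> (\<integral>w. C \<partial>M)"
        unfolding g_def using C by (intro order_trans[OF integral_abs_bound] integral_mono integrable_abs) auto
      then show ?thesis by (simp add: prob_space)
    qed
    have eg: "indicator {0..t} s *\<^sub>R (LINT V|distr M borel (\<V> s). ?a V) = indicator {0..t} s * g s" if "t \<le> 1" for s t
      using that law[OF _ _ am, of s] by (auto simp: indicator_def g_def clip_id)
    show "set_integrable lborel {0..1} (\<lambda>s. LINT V|distr M borel (\<V> s). ?a V)"
      unfolding set_integrable_def eg[OF order_refl] by (rule interval_indicator_integral(1)[OF gm gb]) simp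
    show "\<forall>t\<in>{0..1}. (LINT V|distr M borel (\<V> t). \<phi> V) = (LINT V|distr M borel (\<V> 0). \<phi> V) + (LBINT s:{0..t}. LINT V|distr M borel (\<V> s). ?a V)"
    proof
      fix t :: real assume "t \<in> {0..1}"
      then have t: "0 \<le> t" "t \<le> 1" by auto
      note \<phi>m = test_function_measurable(1)[OF \<phi>]
      have "(LBINT s:{0..t}. LINT V|distr M borel (\<V> s). ?a V) = (LBINT s. indicator {0..t} s * g s)"
        unfolding set_lebesgue_integral_def eg[OF t(2)] ..
      also have "\<dots> = (LBINT s. indicator {0..t} s * (\<integral>w. generator \<phi> (\<V> s w) (drift (\<V> s w)) (noise (\<V> s w)) \<partial>M))"
        using t by (intro Bochner_Integration.integral_cong refl) (auto simp: indicator_def g_def clip_id landau_adjoint_eq[OF \<phi>])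
      also have "\<dots> = (\<integral>w. \<phi> (\<V> t w) \<partial>M) - (\<integral>w. \<phi> (\<V> 0 w) \<partial>M)"
        by (rule ito_formula[OF sde c K' K \<phi> t, symmetric])
      finally show "(LINT V|distr M borel (\<V> t). \<phi> V) = (LINT V|distr M borel (\<V> 0). \<phi> V) + (LBINT s:{0..t}. LINT V|distr M borel (\<V> s). ?a V)"
        using law[OF t \<phi>m] law[OF order_refl zero_le_one \<phi>m] by simp
    qed
  qed simp
  then show ?thesis using fokker_planck_landau unfolding law0 by blast
qed

end
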